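(* Let $q$ be a prime, let $0\ne c\in\mathbb{Z}_q$, and let $D_q(z)$ be the local Kloosterman series attached to $q$ and $c$. If $e=v_q(c)$ and $x=q^{-z}$, then $$D_q(z)=\frac{(1-x^{e+1})(1-x^{e+2})(1-q^{-1}x)(1-q^{-1}x^2)}{(1-x)(1-x^2)^2(1-x^3)}.$$ In terms of $z$, $$D_q(z)=\frac{(1-q^{-z(e+1)})(1-q^{-z(e+2)})(1-q^{-z-1})(1-q^{-2z-1})}{(1-q^{-z})(1-q^{-2z})^2(1-q^{-3z})}.$$
   Context: Definition of $D_q(z)$. Fix a prime $q$ and $0\neq c\in\mathbb{Z}_q$; $v_q$ is the $q$-adic valuation. An order in an étale cubic $\mathbb{Q}_q$-algebra $E$ is a $\mathbb{Z}_q$-subalgebra free of rank $3$; an overorder of an order is an order of $E$ containing it. For a cubic $\mathbb{Z}_q$-order $R$ in an étale cubic $\mathbb{Q}_q$-algebra put $$C_R(t)=H_R(t)\prod_i(1-t^{f_i})^{-1},$$ the product over the maximal ideals $\mathfrak m_i$ of $R$ with $f_i=[R/\mathfrak m_i:\mathbb{F}_q]$, where $H_R(t)=1$ if $R$ is Gorenstein and $H_R(t)=1+qt$ otherwise. For $v\ge0$ let $\kappa_R(v)=[t^v](1-t)C_R(t)$, the coefficient of $t^v$ in the power series $(1-t)C_R(t)$. For $(a,b)\in\mathbb{Z}_q^2$ let $\Phi_{a,b}(X)=X^3-aX^2+bX-c$ and $R(a,b)=\mathbb{Z}_q[X]/(\Phi_{a,b})$. When $\Phi_{a,b}$ has nonzero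 discriminant, $R(a,b)$ is an order in the étale cubic algebra $\mathbb{Q}_q[X]/(\Phi_{a,b})$, and for $v,r\ge0$ put $$S_q(a,b;v,r)=\sum_{\substack{R\supseteq R(a,b)\\ [R:R(a,b)]=q^r}}\kappa_R(v),$$ the sum over overorders $R$ of $R(a,b)$ of index $q^r$. Every class in $(\mathbb{Z}_q/q^N\mathbb{Z}_q)^2$ has a representative $(a,b)$ with $\Phi_{a,b}$ of nonzero discriminant. It is a known result that $S_q(a,b;v,r)$ takes the same value at any two such pairs that are congruent modulo $q^{v+2r}$. Define $$K_q(q^v,q^r)=\sum_{(a,b)\bmod q^{v+2r}}S_q(a,b;v,r),$$ where each class in $(\mathbb{Z}_q/q^{v+2r}\mathbb{Z}_q)^2$ is evaluated at a representative with nonzero discriminant, and $$D_q(z)=\sum_{v,r\ge0}\frac{K_q(q^v,q^r)}{q^{v(z+2)+r(2z+3)}}.$$ With $x=q^{-z}$ this is regarded as a formal power series in $x$, grouped by the degree $v+2r$: the coefficient of $x^k$ is $\sum_{v+2r=k}q^{-2v-3r}K_q(q^v,q^r)$. *)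

theory Defs
  imports
    "HOL-Analysis.Analysis"
    "HOL-Computational_Algebra.Computational_Algebra"
    "HOL-Algebra.Algebra"
    "HOL-Algebra.Algebraic_Closure_Type"
    "Berlekamp_Zassenhaus.Finite_Field"
begin

section \<open>The ring of \<open>q\<close>-adic integers\<close>

text \<open>
  The prime is \<open>q = CARD('q)\<close> for a type \<open>'q\<close> of prime cardinality, and the ring of \<open>q\<close>-adic
  integers is the inverse limit of the rings of integers modulo \<open>q ^ n\<close>, with \<open>f n\<close> the reduced
  representative modulo \<open>q ^ n\<close>.
\<close>

typedef ('q::prime_card) padic_int =
  "{f :: nat \<Rightarrow> int. \<forall>n. f n = f (Suc n) mod int CARD('q) ^ n}"
  by (rule exI[of _ "\<lambda>_. 0"]) simp

setup_lifting type_definition_padic_int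

lemma padic_coherent:
  fixes f :: "nat \<Rightarrow> int" and q :: int
  assumes "\<forall>n. f n = f (Suc n) mod q ^ n" and "n \<le> m"
  shows "f m mod q ^ n = f n"
  using assms(2)
proof (induction m rule: dec_induct)
  case base
  show ?case using assms(1) by (metis mod_mod_trivial)
next
  case (step m)
  have "f (Suc m) mod q ^ n = f (Suc m) mod q ^ m mod q ^ n"
    using step(1) by (simp add: le_imp_power_dvd mod_mod_cancel)
  also have "\<dots> = f m mod q ^ n" using assms(1) by metis
  finally show ?case using step by simp
qed

lemma mod_power_Suc_mod: "(a::int) mod q ^ Suc n mod q ^ n = a mod q ^ n"
  by (rule mod_mod_cancel) simp

instantiation padic_int :: (prime_card) comm_ring_1
begin

lift_definition zero_padic_int :: "'a padic_int" is "\<lambda>_. 0" by simp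

lift_definition one_padic_int :: "'a padic_int" is "\<lambda>n. 1 mod int CARD('a) ^ n"
  by (simp only: mod_power_Suc_mod)

lift_definition plus_padic_int :: "'a padic_int \<Rightarrow> 'a padic_int \<Rightarrow> 'a padic_int"
  is "\<lambda>f g n. (f n + g n) mod int CARD('a) ^ n"
  by (simp (no_asm) only: mod_power_Suc_mod) (metis mod_add_eq)

lift_definition minus_padic_int :: "'a padic_int \<Rightarrow> 'a padic_int \<Rightarrow> 'a padic_int"
  is "\<lambda>f g n. (f n - g n) mod int CARD('a) ^ n"
  by (simp (no_asm) only: mod_power_Suc_mod) (metis mod_diff_eq)

lift_definition uminus_padic_int :: "'a padic_int \<Rightarrow> 'a padic_int"
  is "\<lambda>f n. (- f n) mod int CARD('a) ^ n"
  by (simp (no_asm) only: mod_power_Suc_mod) (metis mod_minus_eq)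

lift_definition times_padic_int :: "'a padic_int \<Rightarrow> 'a padic_int \<Rightarrow> 'a padic_int"
  is "\<lambda>f g n. (f n * g n) mod int CARD('a) ^ n"
  by (simp (no_asm) only: mod_power_Suc_mod) (metis mod_mult_eq)

instance
proof
  fix a b c :: "'a padic_int"
  show "a * b * c = a * (b * c)"
    by (transfer, rule ext, simp (no_asm) add: mod_simps mult.assoc)
  show "a * b = b * a" by (transfer, rule ext, simp (no_asm) add: mult.commute)
  show "1 * a = a"
    by (transfer, rule ext, simp (no_asm) add: mod_simps) (erule padic_coherent, rule order_refl)
  show "(a + b) * c = a * c + b * c"
    by (transfer, rule ext, simp (no_asm) add: mod_simps distrib_right)
  show "a + b + c = a + (b + c)"
    by (transfer, rule ext, simp (no_asm) add: mod_simps add.assoc)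
  show "a + b = b + a" by (transfer, rule ext, simp (no_asm) add: add.commute)
  show "0 + a = a"
    by (transfer, rule ext, simp (no_asm)) (erule padic_coherent, rule order_refl)
  show "- a + a = 0" by (transfer, rule ext, simp (no_asm) add: mod_simps)
  show "a - b = a + - b" by (transfer, rule ext, simp (no_asm) add: mod_simps)
  show "(0 :: 'a padic_int) \<noteq> 1"
  proof (transfer, rule notI)
    assume "(\<lambda>_. 0) = (\<lambda>n. 1 mod int CARD('a) ^ n)"
    hence "0 = 1 mod int CARD('a) ^ 1" by (rule fun_cong)
    thus False using prime_gt_1_int[OF prime_card_int[where 'a='a]] by simp
  qed
qed

end

lemma padic_int_no_zero_divisors:
  fixes a b :: "'q::prime_card padic_int"
  assumes "a \<noteq> 0" "b \<noteq> 0"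
  shows "a * b \<noteq> 0"
  using assms
proof transfer
  fix f g :: "nat \<Rightarrow> int"
  let ?q = "int CARD('q)"
  have pq: "prime_elem ?q" using prime_card_int[where 'a='q] by blast
  assume f: "\<forall>n. f n = f (Suc n) mod ?q ^ n" and f0: "f \<noteq> (\<lambda>_. 0)"
  assume g: "\<forall>n. g n = g (Suc n) mod ?q ^ n" and g0: "g \<noteq> (\<lambda>_. 0)"
  from f0 g0 obtain m k where mk: "f m \<noteq> 0" "g k \<noteq> 0" by (auto simp: fun_eq_iff)
  have nf: "\<not> ?q ^ m dvd f (m + k)"
    using padic_coherent[OF f, of m "m + k"] mk by (auto simp: dvd_eq_mod_eq_0)
  have ng: "\<not> ?q ^ k dvd g (m + k)"
    using padic_coherent[OF g, of k "m + k"] mk by (auto simp: dvd_eq_mod_eq_0)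
  have nz: "f (m + k) \<noteq> 0" "g (m + k) \<noteq> 0" using nf ng by auto
  have nu: "\<not> is_unit ?q" using pq by (auto simp: prime_elem_def)
  have "multiplicity ?q (f (m + k)) < m" "multiplicity ?q (g (m + k)) < k"
    using nf ng power_dvd_iff_le_multiplicity[OF _ nu] nz by (auto simp: not_le[symmetric])
  hence "multiplicity ?q (f (m + k) * g (m + k)) < m + k"
    using prime_elem_multiplicity_mult_distrib[OF pq nz] by simp
  hence "\<not> ?q ^ (m + k) dvd f (m + k) * g (m + k)"
    using power_dvd_iff_le_multiplicity[OF _ nu, of "f (m + k) * g (m + k)"] nz by auto
  thus "(\<lambda>n. f n * g n mod ?q ^ n) \<noteq> (\<lambda>_. 0)"
    by (metis dvd_eq_mod_eq_0)
qed

instance padic_int :: (prime_card) idom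
  by standard (rule padic_int_no_zero_divisors)

text \<open>Meaningful for \<open>x \<noteq> 0\<close> only.\<close>

definition padic_val :: "'q::prime_card padic_int \<Rightarrow> nat" where
  "padic_val x = (GREATEST n. of_nat CARD('q) ^ n dvd x)"


section \<open>Projective modules\<close>

definition module_homs ::
    "('a, 'm) ring_scheme \<Rightarrow> ('a, 'b) module \<Rightarrow> ('a, 'c) module \<Rightarrow> ('b \<Rightarrow> 'c) set" where
  "module_homs S M N = {h \<in> carrier M \<rightarrow> carrier N.
     (\<forall>x\<in>carrier M. \<forall>y\<in>carrier M. h (x \<oplus>\<^bsub>M\<^esub> y) = h x \<oplus>\<^bsub>N\<^esub> h y) \<and>
     (\<forall>s\<in>carrier S. \<forall>x\<in>carrier M. h (s \<odot>\<^bsub>M\<^esub> x) = s \<odot>\<^bsub>N\<^esub> h x)}"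

definition free_module :: "('a, 'm) ring_scheme \<Rightarrow> nat \<Rightarrow> ('a, nat \<Rightarrow> 'a) module" where
  "free_module S n =
     \<lparr>carrier = {..<n} \<rightarrow>\<^sub>E carrier S, monoid.mult = undefined, one = undefined,
      ring.zero = (\<lambda>i\<in>{..<n}. \<zero>\<^bsub>S\<^esub>), add = (\<lambda>x y. \<lambda>i\<in>{..<n}. x i \<oplus>\<^bsub>S\<^esub> y i),
      smult = (\<lambda>s x. \<lambda>i\<in>{..<n}. s \<otimes>\<^bsub>S\<^esub> x i)\<rparr>"

text \<open>A finitely generated module is projective iff it is a direct summand, that is a
  retract, of a free module of finite rank.\<close>

definition fg_projective :: "('a, 'm) ring_scheme \<Rightarrow> ('a, 'b) module \<Rightarrow> bool" where
  "fg_projective S M \<longleftrightarrow>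
     (\<exists>n. \<exists>i\<in>module_homs S M (free_module S n). \<exists>p\<in>module_homs S (free_module S n) M.
        \<forall>x\<in>carrier M. p (i x) = x)"


section \<open>Cubic orders\<close>

text \<open>
  In this section \<open>E\<close> is an algebra over the \<open>q\<close>-adic integers with structure map \<open>\<iota>\<close>. A subset
  \<open>R\<close> of \<open>E\<close> stands for the ring \<open>E\<lparr>carrier := R\<rparr>\<close>.
\<close>

definition cubic_order ::
    "'e ring \<Rightarrow> ('q::prime_card padic_int \<Rightarrow> 'e) \<Rightarrow> 'e set \<Rightarrow> bool" where
  "cubic_order E \<iota> R \<longleftrightarrow> subring R E \<and> range \<iota> \<subseteq> R \<and>
     (\<exists>b\<^sub>1 \<in> R. \<exists>b\<^sub>2 \<in> R. \<exists>b\<^sub>3 \<in> R.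
        bij_betw (\<lambda>(s\<^sub>1, s\<^sub>2, s\<^sub>3). \<iota> s\<^sub>1 \<otimes>\<^bsub>E\<^esub> b\<^sub>1 \<oplus>\<^bsub>E\<^esub> \<iota> s\<^sub>2 \<otimes>\<^bsub>E\<^esub> b\<^sub>2 \<oplus>\<^bsub>E\<^esub> \<iota> s\<^sub>3 \<otimes>\<^bsub>E\<^esub> b\<^sub>3) UNIV R)"

text \<open>The \<open>R\<close>-module of linear forms on \<open>R\<close> with values in the \<open>q\<close>-adic integers.\<close>

definition dual_module ::
    "'e ring \<Rightarrow> ('q::prime_card padic_int \<Rightarrow> 'e) \<Rightarrow> 'e set \<Rightarrow> ('e, 'e \<Rightarrow> 'q padic_int) module" where
  "dual_module E \<iota> R =
     \<lparr>carrier = {\<phi> \<in> extensional R.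
        (\<forall>x\<in>R. \<forall>y\<in>R. \<phi> (x \<oplus>\<^bsub>E\<^esub> y) = \<phi> x + \<phi> y) \<and> (\<forall>s. \<forall>x\<in>R. \<phi> (\<iota> s \<otimes>\<^bsub>E\<^esub> x) = s * \<phi> x)},
      monoid.mult = undefined, one = undefined,
      ring.zero = (\<lambda>x\<in>R. 0), add = (\<lambda>\<phi> \<psi>. \<lambda>x\<in>R. \<phi> x + \<psi> x),
      smult = (\<lambda>r \<phi>. \<lambda>x\<in>R. \<phi> (r \<otimes>\<^bsub>E\<^esub> x))\<rparr>"

text \<open>An order is Gorenstein if its dual is projective over it. For orders this is the
  usual definition; the dual is the canonical module of \<open>R\<close>.\<close>

definition gorenstein_order ::
    "'e ring \<Rightarrow> ('q::prime_card padic_int \<Rightarrow> 'e) \<Rightarrow> 'e set \<Rightarrow> bool" where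
  "gorenstein_order E \<iota> R \<longleftrightarrow> fg_projective (E\<lparr>carrier := R\<rparr>) (dual_module E \<iota> R)"

text \<open>The prime field of \<open>R / \<mm>\<close> enters as the image of the \<open>q\<close>-adic integers.\<close>

definition residue_degree ::
    "'e ring \<Rightarrow> ('q::prime_card padic_int \<Rightarrow> 'e) \<Rightarrow> 'e set \<Rightarrow> 'e set \<Rightarrow> nat" where
  "residue_degree E \<iota> R \<mm> =
     (let S = E\<lparr>carrier := R\<rparr>; k = S Quot \<mm>
      in ring.dim k (range (\<lambda>s. \<mm> +>\<^bsub>S\<^esub> \<iota> s)) (carrier k))"

definition C_series ::
    "'e ring \<Rightarrow> ('q::prime_card padic_int \<Rightarrow> 'e) \<Rightarrow> 'e set \<Rightarrow> real fps" where
  "C_series E \<iota> R =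
     (if gorenstein_order E \<iota> R then 1 else 1 + of_nat CARD('q) * fps_X) *
     (\<Prod>\<mm> | maximalideal \<mm> (E\<lparr>carrier := R\<rparr>). inverse (1 - fps_X ^ residue_degree E \<iota> R \<mm>))"

definition \<kappa> ::
    "'e ring \<Rightarrow> ('q::prime_card padic_int \<Rightarrow> 'e) \<Rightarrow> 'e set \<Rightarrow> nat \<Rightarrow> real" where
  "\<kappa> E \<iota> R v = fps_nth ((1 - fps_X) * C_series E \<iota> R) v"

text \<open>The group index; it is \<open>0\<close> if infinite.\<close>

definition order_index :: "'e ring \<Rightarrow> 'e set \<Rightarrow> 'e set \<Rightarrow> nat" where
  "order_index E R R' = card (a_rcosets\<^bsub>E\<lparr>carrier := R\<rparr>\<^esub> R')"


section \<open>The algebra attached to a pair\<close>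

definition cubic_poly ::
    "'q::prime_card padic_int \<Rightarrow> 'q padic_int \<times> 'q padic_int \<Rightarrow> 'q padic_int poly" where
  "cubic_poly c = (\<lambda>(a, b). [:- c, b, - a, 1:])"

text \<open>The general discriminant
  \<open>s\<^sup>2 t\<^sup>2 - 4 t\<^sup>3 - 4 s\<^sup>3 u - 27 u\<^sup>2 + 18 s t u\<close> of \<open>X\<^sup>3 + s X\<^sup>2 + t X + u\<close>
  at \<open>s = - a\<close>, \<open>t = b\<close>, \<open>u = - c\<close>.\<close>

definition cubic_disc ::
    "'q::prime_card padic_int \<Rightarrow> 'q padic_int \<times> 'q padic_int \<Rightarrow> 'q padic_int" where
  "cubic_disc c = (\<lambda>(a, b). a\<^sup>2 * b\<^sup>2 - 4 * b ^ 3 - 4 * a ^ 3 * c - 27 * c\<^sup>2 + 18 * a * b * c)"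

abbreviation padic_poly_ring :: "'q::prime_card padic_int fract poly ring" where
  "padic_poly_ring \<equiv> ring_of_type_algebra"

definition cubic_ideal ::
    "'q::prime_card padic_int \<Rightarrow> 'q padic_int \<times> 'q padic_int \<Rightarrow> 'q padic_int fract poly set" where
  "cubic_ideal c ab = PIdl\<^bsub>padic_poly_ring\<^esub> (map_poly to_fract (cubic_poly c ab))"

definition cubic_alg ::
    "'q::prime_card padic_int \<Rightarrow> 'q padic_int \<times> 'q padic_int \<Rightarrow> 'q padic_int fract poly set ring" where
  "cubic_alg c ab = padic_poly_ring Quot cubic_ideal c ab"

definition alg_class ::
    "'q::prime_card padic_int \<Rightarrow> 'q padic_int \<times> 'q padic_int \<Rightarrow>
     'q padic_int poly \<Rightarrow> 'q padic_int fract poly set" where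
  "alg_class c ab f = cubic_ideal c ab +>\<^bsub>padic_poly_ring\<^esub> map_poly to_fract f"

definition alg_scalar ::
    "'q::prime_card padic_int \<Rightarrow> 'q padic_int \<times> 'q padic_int \<Rightarrow>
     'q padic_int \<Rightarrow> 'q padic_int fract poly set" where
  "alg_scalar c ab s = alg_class c ab [:s:]"

text \<open>The quotient of the polynomials over the \<open>q\<close>-adic integers by \<open>cubic_poly c ab\<close>,
  embedded in \<open>cubic_alg c ab\<close>; the embedding is injective because \<open>cubic_poly c ab\<close> is monic.\<close>

definition monogenic_order ::
    "'q::prime_card padic_int \<Rightarrow> 'q padic_int \<times> 'q padic_int \<Rightarrow> 'q padic_int fract poly set set" where
  "monogenic_order c ab = range (alg_class c ab)"


section \<open>The local Kloosterman series\<close>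

definition S_sum ::
    "'q::prime_card padic_int \<Rightarrow> 'q padic_int \<times> 'q padic_int \<Rightarrow> nat \<Rightarrow> nat \<Rightarrow> real" where
  "S_sum c ab v r =
     (\<Sum>R | cubic_order (cubic_alg c ab) (alg_scalar c ab) R \<and> monogenic_order c ab \<subseteq> R \<and>
            order_index (cubic_alg c ab) R (monogenic_order c ab) = CARD('q) ^ r.
        \<kappa> (cubic_alg c ab) (alg_scalar c ab) R v)"

definition pair_cong ::
    "nat \<Rightarrow> (('q::prime_card padic_int \<times> 'q padic_int) \<times> ('q padic_int \<times> 'q padic_int)) set" where
  "pair_cong N = {((a, b), (a', b')).
     of_nat CARD('q) ^ N dvd a - a' \<and> of_nat CARD('q) ^ N dvd b - b'}"

text \<open>The choice of the representative does not matter: \<open>S_sum c ab v r\<close> depends only on the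
  class of \<open>ab\<close> as long as the discriminant is nonzero.\<close>

definition kloosterman_K :: "'q::prime_card padic_int \<Rightarrow> nat \<Rightarrow> nat \<Rightarrow> real" where
  "kloosterman_K c v r =
     (\<Sum>C \<in> UNIV // pair_cong (v + 2 * r).
        S_sum c (SOME ab. ab \<in> C \<and> cubic_disc c ab \<noteq> 0) v r)"

definition kloosterman_D :: "'q::prime_card padic_int \<Rightarrow> real fps" where
  "kloosterman_D c = Abs_fps (\<lambda>k.
     \<Sum>(v, r) | v + 2 * r = k. kloosterman_K c v r / real CARD('q) ^ (2 * v + 3 * r))"

definition kloosterman_D_term ::
    "'q::prime_card padic_int \<Rightarrow> complex \<Rightarrow> nat \<times> nat \<Rightarrow> complex" where
  "kloosterman_D_term c z = (\<lambda>(v, r).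
     of_real (kloosterman_K c v r) /
     of_nat CARD('q) powr (of_nat v * (z + 2) + of_nat r * (2 * z + 3)))"

end

theory Submission
  imports Defs
begin

text \<open>
  The proof replaces orders by binary cubic forms, and sums over residue classes by integrals that
  can be evaluated in closed form.

  \<^emph>\<open>Orders.\<close> A cubic ring with a basis \<open>1, w, \<chi>\<close> such that \<open>w \<chi>\<close> is a scalar is described by the
  coefficients \<open>(A, B, C, D)\<close> of a binary cubic form (Delone and Faddeev; \<open>cmul\<close> below). Every overorder
  of \<open>\<int>\<^sub>q[X] / \<Phi>\<close> of finite index has such a basis with \<open>A = q\<^sup>n\<close> and \<open>w = (X - \<tau>) / q\<^sup>i\<close>
  (\<open>lattice_classification\<close>). Its index is \<open>q\<close> to the power \<open>3 i + n\<close>, the pair \<open>(i, n)\<close> and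
  \<open>\<tau>\<close> modulo \<open>q\<close> to the power \<open>i + n\<close> determine it, and it exists exactly if \<open>\<Phi>''(\<tau>) / 2\<close>, \<open>\<Phi>'(\<tau>)\<close> and
  \<open>\<Phi>(\<tau>)\<close> are divisible by \<open>q\<close> to the powers \<open>i\<close>, \<open>2 i + n\<close> and \<open>3 i + 2 n\<close>. The quotients are
  \<open>B, C, D\<close>. The coefficients \<open>\<kappa>\<close> of an order depend only on its form modulo \<open>q\<close>: homomorphisms to the
  field with \<open>q\<close> elements are counted by points, and the order is Gorenstein exactly if the form
  does not vanish modulo \<open>q\<close> (\<open>\<kappa>_eq\<close>). This gives \<open>S_sum_eq\<close>.

  \<^emph>\<open>Integration.\<close> For fixed \<open>(i, n, \<tau>)\<close> the map from \<open>(a, b)\<close> to \<open>(B, C)\<close> is affine and triangular, so that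
  the average over \<open>(a, b)\<close> is an integral over \<open>(B, C)\<close> of a function of \<open>B\<close>, \<open>C\<close> and
  \<open>\<nu> = \<tau>\<^sup>3 - q\<^sup>i B \<tau>\<^sup>2 + q\<^sup>2\<^sup>i\<^sup>+\<^sup>n C \<tau> - c\<close>, restricted to those \<open>\<nu>\<close> that are divisible by \<open>q\<close> to the
  power \<open>3 i + 2 n\<close>. The powers of \<open>q\<close> in the definition of the series cancel against the Jacobian, and
  what remains is \<open>weight c i n\<close> (\<open>kloosterman_K_weight\<close>). In \<open>\<nu>\<close> the term with \<open>B\<close> dominates the
  one with \<open>C\<close> if \<open>\<tau> \<noteq> 0\<close>; solving for \<open>B\<close> shows that \<open>D\<close> is equidistributed and that \<open>B\<close> is
  congruent to a constant (\<open>frame_weight_nonzero\<close>). For \<open>\<tau> = 0\<close> it is \<open>D\<close> that is constant while \<open>B\<close>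
  and \<open>C\<close> are equidistributed. Hence only means of local Euler factors over the forms with one of
  \<open>B\<close>, \<open>D\<close> fixed are needed, and these are elementary counts of roots over a finite field.

  \<^emph>\<open>Summation.\<close> If \<open>q\<close> divides \<open>c\<close>, the row \<open>i + 1\<close> for \<open>c\<close> is the row \<open>i\<close> for \<open>c / q\<^sup>3\<close>, or zero if
  \<open>q\<^sup>3\<close> does not divide \<open>c\<close> (\<open>weight_rec\<close>), and the row \<open>0\<close> is a finite sum of geometric series. If \<open>c\<close> is
  a unit, the rows telescope, because the density of the solutions of \<open>\<tau>\<^sup>3 = c\<close> modulo \<open>q\<^sup>i\<close> enters the
  row \<open>i\<close> and the row \<open>i - 1\<close> with opposite signs (\<open>unit_row_sums\<close>). The uniform bound
  \<open>norm_weight_le\<close> makes all rearrangements legitimate for \<open>\<bar>x\<bar> < 1\<close>, and the identity of formal power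
  series follows from the identity of values on the disc.
\<close>

section \<open>The q-adic integers and their residue field\<close>

abbreviation unif :: "'q::prime_card padic_int" ("\<varpi>") where "\<varpi> \<equiv> of_nat CARD('q)"

lemma CARD_gt_1: "1 < int CARD('q::prime_card)"
  using prime_gt_1_int[OF prime_card_int[where 'a='q]] .

lemma padic_digits_of_int: "Rep_padic_int (of_int k :: 'q::prime_card padic_int) n = k mod int CARD('q) ^ n"
proof (induction k rule: int_induct[where k=0])
  case base
  show ?case by (simp add: zero_padic_int.rep_eq)
next
  case (step1 i)
  thus ?case by (simp add: plus_padic_int.rep_eq one_padic_int.rep_eq mod_simps)
next
  case (step2 i)
  thus ?case by (simp add: minus_padic_int.rep_eq one_padic_int.rep_eq mod_simps)
qed

lemma padic_digits_of_nat: "Rep_padic_int (of_nat k :: 'q::prime_card padic_int) n = int k mod int CARD('q) ^ n"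
  using padic_digits_of_int[of "int k" n] by simp

lemma padic_digits_bounds:
  "0 \<le> Rep_padic_int (x :: 'q::prime_card padic_int) n" "Rep_padic_int x n < int CARD('q) ^ n"
proof -
  have "Rep_padic_int x n = Rep_padic_int x (Suc n) mod int CARD('q) ^ n"
    using spec[OF Rep_padic_int[of x, unfolded mem_Collect_eq]] .
  thus "0 \<le> Rep_padic_int x n" "Rep_padic_int x n < int CARD('q) ^ n"
    using CARD_gt_1[where 'q='q] by auto
qed

lemma padic_digits_mod:
  "n \<le> m \<Longrightarrow> Rep_padic_int (x :: 'q::prime_card padic_int) m mod int CARD('q) ^ n = Rep_padic_int x n"
  by (rule padic_coherent[OF Rep_padic_int[of x, unfolded mem_Collect_eq]])

lemma unif_power_dvd_iff: "\<varpi> ^ n dvd (x :: 'q::prime_card padic_int) \<longleftrightarrow> Rep_padic_int x n = 0"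
proof
  assume "\<varpi> ^ n dvd x"
  then obtain y where "x = of_nat (CARD('q) ^ n) * y" by (metis dvdE of_nat_power)
  thus "Rep_padic_int x n = 0"
    by (simp only: times_padic_int.rep_eq padic_digits_of_nat) simp
next
  assume x0: "Rep_padic_int x n = 0"
  define f where "f k = Rep_padic_int x (k + n) div int CARD('q) ^ n" for k
  let ?q = "int CARD('q)"
  have q0: "?q ^ k > 0" for k using CARD_gt_1[where 'q='q] by simp
  have dv: "?q ^ n dvd Rep_padic_int x (k + n)" for k
    using padic_digits_mod[of n "k + n" x] x0 by (simp add: dvd_eq_mod_eq_0)
  have coh: "f k = f (Suc k) mod ?q ^ k" for k
  proof -
    have "Rep_padic_int x (k + n) = Rep_padic_int x (Suc k + n) mod ?q ^ (k + n)"
      using padic_digits_mod[of "k + n" "Suc k + n" x] by simp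
    moreover have "Rep_padic_int x (k + n) = ?q ^ n * f k" "Rep_padic_int x (Suc k + n) = ?q ^ n * f (Suc k)"
      unfolding f_def by (rule dvd_mult_div_cancel[OF dv, symmetric])+
    ultimately have "?q ^ n * f k = ?q ^ n * (f (Suc k) mod ?q ^ k)"
      by (simp only: power_add mult.commute[of "?q ^ k"] mod_mult_mult1)
    thus ?thesis using q0[of n] by simp
  qed
  have ff: "Rep_padic_int (Abs_padic_int f :: 'q padic_int) = f"
    by (rule Abs_padic_int_inverse, rule CollectI, rule allI, rule coh)
  have "Rep_padic_int x k = Rep_padic_int (\<varpi> ^ n * Abs_padic_int f :: 'q padic_int) k" for k
  proof -
    have "Rep_padic_int (\<varpi> ^ n * Abs_padic_int f :: 'q padic_int) k
        = (?q ^ n mod ?q ^ k * f k) mod ?q ^ k"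
      by (simp only: of_nat_power[symmetric] times_padic_int.rep_eq padic_digits_of_nat ff)
    also have "\<dots> = (?q ^ n * f k) mod ?q ^ k" by (simp add: mod_simps)
    also have "?q ^ n * f k = Rep_padic_int x (k + n)" unfolding f_def by (rule dvd_mult_div_cancel[OF dv])
    also have "\<dots> mod ?q ^ k = Rep_padic_int x k" by (rule padic_digits_mod) simp
    finally show ?thesis by simp
  qed
  hence "x = \<varpi> ^ n * Abs_padic_int f" by (simp add: Rep_padic_int_inject[symmetric] fun_eq_iff)
  thus "\<varpi> ^ n dvd x" by simp
qed

definition residue :: "nat \<Rightarrow> 'q::prime_card padic_int \<Rightarrow> nat" where
  "residue n x = nat (Rep_padic_int x n)"

lemma residue_less: "residue n (x :: 'q::prime_card padic_int) < CARD('q) ^ n"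
  unfolding residue_def using padic_digits_bounds[of x n]
  by (metis nat_less_iff of_nat_power)

lemma unif_power_dvd_diff_iff:
  "\<varpi> ^ n dvd (x - y :: 'q::prime_card padic_int) \<longleftrightarrow> residue n x = residue n y"
proof -
  have "\<varpi> ^ n dvd (x - y) \<longleftrightarrow> Rep_padic_int x n mod int CARD('q) ^ n = Rep_padic_int y n mod int CARD('q) ^ n"
    unfolding unif_power_dvd_iff minus_padic_int.rep_eq
    by (simp add: mod_eq_dvd_iff dvd_eq_mod_eq_0)
  also have "\<dots> \<longleftrightarrow> Rep_padic_int x n = Rep_padic_int y n" by (simp add: padic_digits_mod)
  also have "\<dots> \<longleftrightarrow> residue n x = residue n y"
    unfolding residue_def using padic_digits_bounds[of _ n] by (metis int_nat_eq)
  finally show ?thesis .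
qed

lemma residue_of_nat: "k < CARD('q) ^ n \<Longrightarrow> residue n (of_nat k :: 'q::prime_card padic_int) = k"
  unfolding residue_def padic_digits_of_nat
  by (metis mod_less nat_int of_nat_mod of_nat_power)

lemma residue_cong: "\<varpi> ^ n dvd (x - of_nat (residue n x) :: 'q::prime_card padic_int)"
  by (simp add: unif_power_dvd_diff_iff residue_of_nat residue_less)

lemma eqI_unif_power_dvd:
  assumes "\<And>n. \<varpi> ^ n dvd (x :: 'q::prime_card padic_int)" shows "x = 0"
proof -
  have "Rep_padic_int x = Rep_padic_int 0"
    using assms by (auto simp: unif_power_dvd_iff zero_padic_int.rep_eq fun_eq_iff)
  thus ?thesis by (rule Rep_padic_int_inject[THEN iffD1])
qed

lemma unif_nonzero [simp]: "\<varpi> \<noteq> (0 :: 'q::prime_card padic_int)"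
proof
  assume "\<varpi> = (0 :: 'q padic_int)"
  hence "Rep_padic_int (of_nat CARD('q) :: 'q padic_int) 2 = 0" by (simp add: zero_padic_int.rep_eq)
  thus False unfolding padic_digits_of_nat using CARD_gt_1[where 'q='q]
    by (simp add: power2_eq_square mod_pos_pos_trivial)
qed

subsection \<open>Reduction\<close>

definition red :: "'q::prime_card padic_int \<Rightarrow> 'q mod_ring" where
  "red x = of_int (Rep_padic_int x 1)"

lemma of_int_mod_CARD: "(of_int (k mod int CARD('q)) :: 'q::prime_card mod_ring) = of_int k"
  unfolding of_int_of_int_mod_ring by transfer simp

lemma of_int_mod_ring_eq_0_iff: "(of_int k :: 'q::prime_card mod_ring) = 0 \<longleftrightarrow> int CARD('q) dvd k"
  unfolding of_int_of_int_mod_ring by transfer (auto simp: dvd_eq_mod_eq_0)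

lemma red_add [simp]: "red (x + y) = red x + red y"
  by (simp add: red_def plus_padic_int.rep_eq of_int_mod_CARD)
lemma red_mult [simp]: "red (x * y) = red x * red y"
  by (simp add: red_def times_padic_int.rep_eq of_int_mod_CARD)
lemma red_diff [simp]: "red (x - y) = red x - red y"
  by (simp add: red_def minus_padic_int.rep_eq of_int_mod_CARD)
lemma red_minus [simp]: "red (- x) = - red x"
  by (simp add: red_def uminus_padic_int.rep_eq of_int_mod_CARD)
lemma red_1 [simp]: "red 1 = 1"
  by (simp add: red_def one_padic_int.rep_eq of_int_mod_CARD)
lemma red_0 [simp]: "red 0 = 0"
  by (simp add: red_def zero_padic_int.rep_eq)
lemma red_of_nat [simp]: "red (of_nat n) = of_nat n"
  by (induction n) simp_all
lemma red_numeral [simp]: "red (numeral n) = numeral n"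
  using red_of_nat[of "numeral n"] by simp
lemma red_power [simp]: "red (x ^ n) = red x ^ n"
  by (induction n) simp_all

lemma red_eq_0_iff: "red x = 0 \<longleftrightarrow> \<varpi> dvd (x :: 'q::prime_card padic_int)"
proof -
  have "red x = 0 \<longleftrightarrow> int CARD('q) dvd Rep_padic_int x 1"
    by (simp add: red_def of_int_mod_ring_eq_0_iff)
  also have "\<dots> \<longleftrightarrow> Rep_padic_int x 1 = 0"
    using padic_digits_bounds[of x 1] zdvd_not_zless[of "Rep_padic_int x 1" "int CARD('q)"] by fastforce
  finally show ?thesis using unif_power_dvd_iff[of 1 x] by simp
qed

lemma red_eq_iff: "red x = red y \<longleftrightarrow> \<varpi> dvd (x - y :: 'q::prime_card padic_int)"
  by (simp flip: red_eq_0_iff)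

lemma red_surj: "\<exists>k<CARD('q). red (of_nat k :: 'q::prime_card padic_int) = s"
proof -
  let ?k = "to_int_mod_ring s"
  have k: "0 \<le> ?k" "?k < int CARD('q)" using range_to_int_mod_ring[where 'a='q] by auto
  have "(of_nat (nat ?k) :: 'q mod_ring) = of_int ?k" by (rule of_nat_nat[OF k(1)])
  also have "\<dots> = s" by (simp add: of_int_of_int_mod_ring)
  finally have "red (of_nat (nat ?k) :: 'q padic_int) = s" by (simp only: red_of_nat)
  moreover have "nat ?k < CARD('q)" using k by (simp add: nat_less_iff)
  ultimately show ?thesis by (intro exI[of _ "nat ?k"] conjI)
qed

lemma padic_unit_iff: "x dvd 1 \<longleftrightarrow> red x \<noteq> (0 :: 'q::prime_card mod_ring)"
proof
  assume "x dvd 1"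
  then obtain y where "x * y = 1" by (metis dvdE)
  hence "red x * red y = 1" by (metis red_mult red_1)
  thus "red x \<noteq> 0" by auto
next
  assume x: "red x \<noteq> 0"
  let ?q = "int CARD('q)"
  have pq: "Factorial_Ring.prime ?q" by (rule prime_card_int)
  have "\<not> ?q dvd Rep_padic_int x 1" using x by (simp add: red_def of_int_mod_ring_eq_0_iff)
  have cop1: "\<not> ?q dvd Rep_padic_int x n" if n: "n > 0" for n
  proof
    assume "?q dvd Rep_padic_int x n"
    hence "?q dvd Rep_padic_int x n mod ?q ^ 1" by (simp add: dvd_mod)
    moreover have "Rep_padic_int x n mod ?q ^ 1 = Rep_padic_int x 1"
      by (rule padic_digits_mod) (use n in simp)
    ultimately have "?q dvd Rep_padic_int x 1" by (simp only:)
    with \<open>\<not> ?q dvd Rep_padic_int x 1\<close> show False by contradiction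
  qed
  have cop: "coprime (Rep_padic_int x n) (?q ^ n)" for n
  proof (cases "n = 0")
    case False
    hence "coprime ?q (Rep_padic_int x n)" using cop1[of n] pq by (intro prime_imp_coprime) simp_all
    thus ?thesis by (simp add: coprime_commute)
  qed simp
  have ex: "\<exists>y. 0 \<le> y \<and> y < ?q ^ n \<and> [Rep_padic_int x n * y = 1] (mod ?q ^ n)" for n
  proof -
    obtain y where "[Rep_padic_int x n * y = 1] (mod ?q ^ n)"
      using cop[of n] cong_solve_coprime_int by blast
    hence "[Rep_padic_int x n * (y mod ?q ^ n) = 1] (mod ?q ^ n)"
      unfolding cong_def mod_mult_right_eq .
    moreover have "0 < ?q ^ n" using CARD_gt_1[where 'q='q] by simp
    ultimately show ?thesis by (intro exI[of _ "y mod ?q ^ n"] conjI pos_mod_sign pos_mod_bound)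
  qed
  define f where "f n = (SOME y. 0 \<le> y \<and> y < ?q ^ n \<and> [Rep_padic_int x n * y = 1] (mod ?q ^ n))" for n
  have f: "0 \<le> f n" "f n < ?q ^ n" "[Rep_padic_int x n * f n = 1] (mod ?q ^ n)" for n
    using someI_ex[OF ex[of n]] unfolding f_def by blast+
  have coh: "f n = f (Suc n) mod ?q ^ n" for n
  proof -
    have "[Rep_padic_int x (Suc n) * f (Suc n) = 1] (mod ?q ^ n)"
      using f(3)[of "Suc n"] by (rule cong_dvd_modulus) simp
    hence "(Rep_padic_int x (Suc n) mod ?q ^ n) * f (Suc n) mod ?q ^ n = 1 mod ?q ^ n"
      unfolding cong_def mod_mult_left_eq .
    moreover have "Rep_padic_int x (Suc n) mod ?q ^ n = Rep_padic_int x n"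
      by (rule padic_digits_mod) simp
    ultimately have "[Rep_padic_int x n * f (Suc n) = Rep_padic_int x n * f n] (mod ?q ^ n)"
      using f(3)[of n] unfolding cong_def by (simp only:)
    hence "[f (Suc n) = f n] (mod ?q ^ n)" by (rule iffD1[OF cong_mult_lcancel[OF cop]])
    hence "f (Suc n) mod ?q ^ n = f n mod ?q ^ n" unfolding cong_def .
    thus ?thesis using mod_pos_pos_trivial[OF f(1,2)] by (simp only:)
  qed
  have ff: "Rep_padic_int (Abs_padic_int f :: 'q padic_int) = f"
    by (rule Abs_padic_int_inverse, rule CollectI, rule allI, rule coh)
  have "x * Abs_padic_int f = 1"
    unfolding Rep_padic_int_inject[symmetric] fun_eq_iff times_padic_int.rep_eq
      ff one_padic_int.rep_eq using f(3) unfolding cong_def by (rule allI)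
  thus "x dvd 1" by (intro dvdI[of _ _ "Abs_padic_int f"]) (rule sym)
qed

lemma unif_power_dvd_mult_unit:
  assumes "\<not> \<varpi> dvd (u :: 'q::prime_card padic_int)"
  shows "\<varpi> ^ n dvd \<varpi> ^ k * u \<longleftrightarrow> n \<le> k"
proof
  assume *: "\<varpi> ^ n dvd \<varpi> ^ k * u"
  show "n \<le> k"
  proof (rule ccontr)
    assume "\<not> n \<le> k"
    then obtain d where d: "n = k + Suc d" using less_imp_Suc_add[of k n] by auto
    have "\<varpi> ^ k * \<varpi> dvd \<varpi> ^ n" unfolding d power_add power_Suc mult.assoc[symmetric] by (rule dvd_triv_left)
    hence "\<varpi> ^ k * \<varpi> dvd \<varpi> ^ k * u" using * by (rule dvd_trans)
    hence "\<varpi> dvd u" using dvd_times_left_cancel_iff[OF power_not_zero[OF unif_nonzero]] by (rule iffD1[rotated])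
    thus False using assms by contradiction
  qed
next
  assume "n \<le> k"
  hence "\<varpi> ^ n dvd (\<varpi> ^ k :: 'q padic_int)" by (rule le_imp_power_dvd)
  thus "\<varpi> ^ n dvd \<varpi> ^ k * u" by (rule dvd_mult2)
qed

lemma padic_val_eq:
  assumes "\<not> \<varpi> dvd u"
  shows "padic_val (\<varpi> ^ k * u :: 'q::prime_card padic_int) = k"
  unfolding padic_val_def unif_power_dvd_mult_unit[OF assms]
  by (rule Greatest_equality) simp_all

lemma padic_factor:
  assumes "x \<noteq> (0 :: 'q::prime_card padic_int)"
  obtains u where "x = \<varpi> ^ padic_val x * u" "\<not> \<varpi> dvd u"
proof -
  obtain N where N: "\<not> \<varpi> ^ N dvd x" using eqI_unif_power_dvd assms by blast
  define k where "k = (LEAST n. \<not> \<varpi> ^ n dvd x)"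
  have k: "\<not> \<varpi> ^ k dvd x" unfolding k_def using N by (rule LeastI)
  have "k \<noteq> 0" using k by (cases "k = 0") simp_all
  then obtain m where m: "k = Suc m" by (cases k) simp_all
  have "m < (LEAST n. \<not> \<varpi> ^ n dvd x)" using m unfolding k_def by simp
  from not_less_Least[OF this] have "\<varpi> ^ m dvd x" by simp
  then obtain u where u: "x = \<varpi> ^ m * u" by (elim dvdE)
  have nu: "\<not> \<varpi> dvd u"
  proof
    assume "\<varpi> dvd u"
    hence "\<varpi> ^ m * \<varpi> dvd x" unfolding u by (rule mult_dvd_mono[OF dvd_refl])
    thus False using k unfolding m power_Suc2 by contradiction
  qed
  have "padic_val x = m" using padic_val_eq[OF nu, of m] u by simp
  thus ?thesis using that u nu by simp
qed

lemma unif_power_dvd_padic_val: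
  assumes "x \<noteq> 0" shows "\<varpi> ^ n dvd (x :: 'q::prime_card padic_int) \<longleftrightarrow> n \<le> padic_val x"
proof -
  obtain u where u: "x = \<varpi> ^ padic_val x * u" "\<not> \<varpi> dvd u" by (rule padic_factor[OF assms])
  have "\<varpi> ^ n dvd \<varpi> ^ padic_val x * u \<longleftrightarrow> n \<le> padic_val x"
    by (rule unif_power_dvd_mult_unit[OF u(2)])
  thus ?thesis unfolding u(1)[symmetric] .
qed

instance padic_int :: (prime_card) ring_char_0
proof
  show "inj (of_nat :: nat \<Rightarrow> 'a padic_int)"
  proof (rule injI)
    fix m n :: nat assume eq: "(of_nat m :: 'a padic_int) = of_nat n"
    have lt: "k < CARD('a) ^ k" for k
      using less_exp[of k] power_mono[of 2 "CARD('a)" k] CARD_gt_1[where 'q='a] by linarith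
    have lt': "k < CARD('a) ^ (k + l)" "k < CARD('a) ^ (l + k)" for k l
      using lt[of "k + l"] lt[of "l + k"] by linarith+
    have "m = residue (m + n) (of_nat m :: 'a padic_int)"
      by (rule residue_of_nat[symmetric]) (rule lt')
    also have "\<dots> = residue (m + n) (of_nat n :: 'a padic_int)" by (simp only: eq)
    also have "\<dots> = n" by (rule residue_of_nat) (rule lt')
    finally show "m = n" .
  qed
qed

section \<open>Cubic algebras over a finite field\<close>

type_synonym 'a triple = "'a \<times> 'a \<times> 'a"

text \<open>The ring of the binary cubic form with coefficients \<open>(A, B, C, D)\<close>, in the basis \<open>1, w, \<chi>\<close>:
  \<open>w\<^sup>2 = - A C - B w + A \<chi>\<close>, \<open>w \<chi> = - A D\<close> and \<open>\<chi>\<^sup>2 = - B D - D w + C \<chi>\<close>. For \<open>A = 1\<close> it is generated by \<open>w\<close>,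
  a root of \<open>X\<^sup>3 + B X\<^sup>2 + C X + D\<close>.\<close>

definition cmul :: "'a::comm_ring_1 \<Rightarrow> 'a \<Rightarrow> 'a \<Rightarrow> 'a \<Rightarrow> 'a triple \<Rightarrow> 'a triple \<Rightarrow> 'a triple" where
  "cmul A B C D = (\<lambda>(s1, s2, s3) (t1, t2, t3).
     (s1 * t1 - A * C * (s2 * t2) - A * D * (s2 * t3 + s3 * t2) - B * D * (s3 * t3),
      s1 * t2 + s2 * t1 - B * (s2 * t2) - D * (s3 * t3),
      s1 * t3 + s3 * t1 + A * (s2 * t2) + C * (s3 * t3)))"

definition tscale :: "'a::comm_ring_1 \<Rightarrow> 'a triple \<Rightarrow> 'a triple" where
  "tscale s = (\<lambda>(t1, t2, t3). (s * t1, s * t2, s * t3))"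

lemma tscale_simps [simp]: "tscale s (t1, t2, t3) = (s * t1, s * t2, s * t3)"
  by (simp add: tscale_def)

lemma cmul_commute: "cmul A B C D s t = cmul A B C D t s"
  by (cases s; cases t) (simp add: cmul_def algebra_simps)

lemma cmul_assoc: "cmul A B C D (cmul A B C D s t) u = cmul A B C D s (cmul A B C D t u)"
proof (cases s; cases t; cases u)
  fix s1 s2 s3 t1 t2 t3 u1 u2 u3 assume [simp]: "s = (s1, s2, s3)" "t = (t1, t2, t3)" "u = (u1, u2, u3)"
  show ?thesis unfolding cmul_def by (simp add: algebra_simps)
qed

lemma cmul_add_right: "cmul A B C D s (t + u) = cmul A B C D s t + cmul A B C D s u"
  by (cases s; cases t; cases u) (simp add: cmul_def algebra_simps)

lemma cmul_add_left: "cmul A B C D (s + t) u = cmul A B C D s u + cmul A B C D t u"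
  by (cases s; cases t; cases u) (simp add: cmul_def algebra_simps)

lemma cmul_scalar: "cmul A B C D (s, 0, 0) t = tscale s t"
  by (cases t) (simp add: cmul_def)

lemma cmul_scale_left: "cmul A B C D (tscale s t) u = tscale s (cmul A B C D t u)"
  by (cases t; cases u) (simp add: cmul_def algebra_simps)

definition ev :: "'a::comm_ring_1 \<times> 'a \<Rightarrow> 'a triple \<Rightarrow> 'a" where
  "ev = (\<lambda>(x, y) (z1, z2, z3). z1 + z2 * x + z3 * y)"

lemma ev_simps [simp]: "ev (x, y) (z1, z2, z3) = z1 + z2 * x + z3 * y"
  by (simp add: ev_def)

text \<open>The ring homomorphisms to the base: \<open>(x, y)\<close> are the images of \<open>w\<close> and \<open>\<chi>\<close>.\<close>

definition points :: "'a::comm_ring_1 \<Rightarrow> 'a \<Rightarrow> 'a \<Rightarrow> 'a \<Rightarrow> ('a \<times> 'a) set" where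
  "points A B C D = {(x, y). x * x = - (A * C) - B * x + A * y \<and> x * y = - (A * D) \<and>
     y * y = - (B * D) - D * x + C * y}"

lemma ev_cmul:
  assumes "h \<in> points A B C D" shows "ev h (cmul A B C D z w) = ev h z * ev h w"
proof (cases h; cases z; cases w)
  fix x y z1 z2 z3 w1 w2 w3
  assume [simp]: "h = (x, y)" "z = (z1, z2, z3)" "w = (w1, w2, w3)"
  have e: "x * x = - (A * C) - B * x + A * y" "x * y = - (A * D)"
    "y * y = - (B * D) - D * x + C * y" using assms by (simp_all add: points_def)
  have "ev h z * ev h w = z1 * w1 + (z1 * w2 + z2 * w1) * x + (z1 * w3 + z3 * w1) * y
    + z2 * w2 * (x * x) + (z2 * w3 + z3 * w2) * (x * y) + z3 * w3 * (y * y)"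
    by (simp add: algebra_simps)
  also have "\<dots> = ev h (cmul A B C D z w)" unfolding e by (simp add: cmul_def algebra_simps)
  finally show ?thesis by simp
qed

lemma pointsI:
  assumes "\<And>z w. ev h (cmul A B C D z w) = ev h z * ev h w" shows "h \<in> points A B C D"
proof (cases h)
  case (Pair x y)
  show ?thesis
    using assms[of "(0, 1, 0)" "(0, 1, 0)"] assms[of "(0, 1, 0)" "(0, 0, 1)"] assms[of "(0, 0, 1)" "(0, 0, 1)"]
    by (simp add: points_def Pair cmul_def)
qed

lemma ev_add: "ev h (z + w) = ev h z + ev h w"
  by (cases h; cases z; cases w) (simp add: algebra_simps)

lemma ev_scale: "ev h (tscale s z) = s * ev h z"
  by (cases h; cases z) (simp add: algebra_simps)

locale cubic_algebra =
  fixes A B C D :: "'k :: {field, finite}"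
begin

abbreviation "mul \<equiv> cmul A B C D"
abbreviation "pts \<equiv> points A B C D"

definition aideal :: "'k triple set \<Rightarrow> bool" where
  "aideal I \<longleftrightarrow> 0 \<in> I \<and> (\<forall>x\<in>I. \<forall>y\<in>I. x + y \<in> I) \<and> (\<forall>z. \<forall>x\<in>I. mul z x \<in> I)"

definition amax :: "'k triple set \<Rightarrow> bool" where
  "amax I \<longleftrightarrow> aideal I \<and> I \<noteq> UNIV \<and> (\<forall>J. aideal J \<and> I \<subseteq> J \<longrightarrow> J = I \<or> J = UNIV)"

definition Ker :: "'k \<times> 'k \<Rightarrow> 'k triple set" where "Ker h = {z. ev h z = 0}"
definition line :: "'k triple \<Rightarrow> 'k triple set" where "line p = range (\<lambda>s. tscale s p)"

definition eigen :: "'k \<times> 'k \<Rightarrow> 'k triple \<Rightarrow> bool" where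
  "eigen h p \<longleftrightarrow> ev h p \<noteq> 0 \<and> (\<forall>z. mul z p = tscale (ev h z) p)"

lemma aideal_scale: "aideal I \<Longrightarrow> x \<in> I \<Longrightarrow> tscale s x \<in> I"
  unfolding aideal_def cmul_scalar[of A B C D, symmetric] by blast

lemma aideal_add: "aideal I \<Longrightarrow> x \<in> I \<Longrightarrow> y \<in> I \<Longrightarrow> x + y \<in> I"
  unfolding aideal_def by blast

lemma aideal_diff: assumes "aideal I" "x \<in> I" "y \<in> I" shows "x - y \<in> I"
proof -
  have "x - y = x + tscale (- 1) y" by (cases x; cases y) simp
  thus ?thesis using aideal_add[OF assms(1,2) aideal_scale[OF assms(1,3)]] by (simp only:)
qed

lemma aideal_mul: "aideal I \<Longrightarrow> x \<in> I \<Longrightarrow> mul z x \<in> I"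
  unfolding aideal_def by blast

lemma aideal_unit: assumes "aideal I" "(s, 0, 0) \<in> I" "s \<noteq> 0" shows "I = UNIV"
proof -
  have "z \<in> I" for z
  proof -
    have "tscale (inverse s) (s, 0, 0) \<in> I" using assms by (intro aideal_scale)
    hence "(1, 0, 0) \<in> I" using assms(3) by simp
    from aideal_mul[OF assms(1) this, of z] show ?thesis
      by (simp add: cmul_commute[of A B C D z] cmul_scalar) (cases z, simp)
  qed
  thus ?thesis by blast
qed

lemma ideal_of_functional:
  assumes I: "aideal I" "I \<noteq> UNIV" and x: "(x, - 1, 0) \<in> I" and y: "(y, 0, - 1) \<in> I"
  shows "(x, y) \<in> pts" "I = Ker (x, y)"
proof -
  let ?h = "(x, y)"
  have res: "z - (ev ?h z, 0, 0) \<in> I" for z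
  proof (cases z)
    case (fields z1 z2 z3)
    have "z - (ev ?h z, 0, 0) = tscale (- z2) (x, - 1, 0) + tscale (- z3) (y, 0, - 1)"
      by (simp add: fields algebra_simps)
    thus ?thesis using aideal_add[OF I(1) aideal_scale[OF I(1) x] aideal_scale[OF I(1) y]] by (simp only:)
  qed
  have const: "s = 0" if "(s, 0, 0) \<in> I" for s using aideal_unit[OF I(1) that] I(2) by blast
  show Ker: "I = Ker ?h"
  proof (intro equalityI subsetI)
    fix z assume "z \<in> I"
    from aideal_diff[OF I(1) this res[of z]] have "(ev ?h z, 0, 0) \<in> I" by simp
    thus "z \<in> Ker ?h" using const by (simp add: Ker_def)
  next
    fix z assume "z \<in> Ker ?h"
    thus "z \<in> I" using res[of z] by (simp add: Ker_def flip: zero_prod_def)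
  qed
  show "(x, y) \<in> pts"
  proof (rule pointsI)
    fix z w
    define z' w' where "z' = z - (ev ?h z, 0, 0)" and "w' = w - (ev ?h w, 0, 0)"
    have z: "z = z' + (ev ?h z, 0, 0)" "w = w' + (ev ?h w, 0, 0)" by (simp_all add: z'_def w'_def)
    have zw: "z' \<in> I" "w' \<in> I" using res by (simp_all add: z'_def w'_def)
    have "mul z w = mul w z'  + tscale (ev ?h z) w' + (ev ?h z * ev ?h w, 0, 0)"
    proof -
      have "mul z w = mul z' w + mul (ev ?h z, 0, 0) w"
        using z(1) cmul_add_left by metis
      also have "mul (ev ?h z, 0, 0) w = tscale (ev ?h z) w" by (simp add: cmul_scalar)
      also have "tscale (ev ?h z) w = tscale (ev ?h z) w' + (ev ?h z * ev ?h w, 0, 0)"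
        by (cases w) (simp add: w'_def algebra_simps)
      finally show ?thesis by (simp add: cmul_commute[of _ _ _ _ z'] add.assoc)
    qed
    moreover have "mul w z'  + tscale (ev ?h z) w' \<in> I"
      using I(1) zw by (intro aideal_add aideal_mul aideal_scale)
    ultimately have "ev ?h (mul z w) = 0 + ev ?h (ev ?h z * ev ?h w, 0, 0)"
      unfolding Ker Ker_def by (simp only: ev_add mem_Collect_eq)
    thus "ev ?h (mul z w) = ev ?h z * ev ?h w" by simp
  qed
qed

text \<open>An ideal is a subspace of a space of dimension three. If it has codimension one, it is the kernel
  of a homomorphism; otherwise its dimension is at most one.\<close>

lemma ideal_dichotomy:
  assumes I: "aideal I" "I \<noteq> UNIV"
  shows "(\<exists>h\<in>pts. I = Ker h) \<or> (\<exists>p\<in>I. I = line p)"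
proof (rule disjCI)
  assume no: "\<not> (\<exists>p\<in>I. I = line p)"
  have const: "s = 0" if "(s, 0, 0) \<in> I" for s using aideal_unit[OF I(1) that] I(2) by blast
  have line_sub: "line p \<subseteq> I" if "p \<in> I" for p
    using aideal_scale[OF I(1) that] by (auto simp: line_def)
  have ex: "\<exists>z\<in>I. z \<notin> line p" if "p \<in> I" for p using no line_sub that by blast
  obtain p where p: "p \<in> I" "p \<notin> line 0" using ex[of 0] I(1) aideal_def by blast
  obtain p' where p': "p' \<in> I" "p' \<notin> line p" using ex[OF p(1)] by blast
  have pnz: "p \<noteq> 0" using p(2) by (auto simp: line_def zero_prod_def)
  define f where "f = (\<lambda>(s, t, u). (s, 0, 0) + tscale t p + tscale u p')"
  have f0: "w = 0" if w0: "f w = 0" for w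
  proof (cases w)
    case (fields s t u)
    have eq: "(s, 0, 0) + (tscale t p + tscale u p') = 0" using w0 by (simp add: f_def fields add.assoc)
    have mem: "tscale t p + tscale u p' \<in> I" using I p p' by (intro aideal_add aideal_scale)
    have "tscale (- 1) (tscale t p + tscale u p') \<in> I" using I(1) mem by (rule aideal_scale)
    also have "tscale (- 1) (tscale t p + tscale u p') = (s, 0, 0)"
      using eq by (cases p; cases p') (auto simp: zero_prod_def add_eq_0_iff2)
    finally have s: "s = 0" by (rule const)
    have eq2: "tscale t p + tscale u p' = 0" using eq s by (simp flip: zero_prod_def)
    have u: "u = 0"
    proof (rule ccontr)
      assume u: "u \<noteq> 0"
      have "p' = tscale (inverse u) (tscale u p')" using u by (cases p') simp
      also have "tscale u p' = tscale (- t) p" using eq2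
        by (cases p; cases p') (auto simp: zero_prod_def add_eq_0_iff2)
      finally have "p' = tscale (inverse u * (- t)) p" by (cases p) simp
      thus False using p'(2) by (auto simp: line_def)
    qed
    have "t = 0" using eq2 u pnz by (cases p; cases p') (auto simp: zero_prod_def)
    thus ?thesis using s u fields by (simp add: zero_prod_def)
  qed
  have "inj f"
  proof (rule injI)
    fix v w assume "f v = f w"
    hence "f (v - w) = 0"
      by (cases v; cases w; cases p; cases p') (auto simp: f_def zero_prod_def algebra_simps)
    from f0[OF this] show "v = w" by simp
  qed
  hence surj: "surj f" by (rule finite_UNIV_inj_surj[OF finite])
  have "\<exists>s. (s, 0, 0) - z \<in> I" for z
  proof -
    obtain s t u where "f (s, t, u) = z" using surj by (metis surjD prod_cases3)
    hence "z = (s, 0, 0) + (tscale t p + tscale u p')" by (simp add: f_def add.assoc)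
    hence "(s, 0, 0) - z = 0 - (tscale t p + tscale u p')" by simp
    hence "\<exists>s. (s, 0, 0) - z = 0 - (tscale t p + tscale u p')" by (rule exI)
    moreover have "0 - (tscale t p + tscale u p') \<in> I"
      using I(1) p p' by (intro aideal_diff aideal_add aideal_scale) (auto simp: aideal_def)
    ultimately show ?thesis by metis
  qed
  from this[of "(0, 1, 0)"] this[of "(0, 0, 1)"] obtain x y where
    "(x, - 1, 0) \<in> I" "(y, 0, - 1) \<in> I" by auto
  from ideal_of_functional[OF I this] show "\<exists>h\<in>pts. I = Ker h" by blast
qed

lemma aideal_Ker: "h \<in> pts \<Longrightarrow> aideal (Ker h)"
  unfolding aideal_def Ker_def by (cases h) (auto simp: ev_add ev_cmul zero_prod_def)

lemma Ker_proper: "Ker h \<noteq> UNIV"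
proof -
  have "(1, 0, 0) \<notin> Ker h" by (cases h) (simp add: Ker_def)
  thus ?thesis by blast
qed

lemma amax_Ker: assumes h: "h \<in> pts" shows "amax (Ker h)"
  unfolding amax_def
proof (intro conjI allI impI)
  fix J assume J: "aideal J \<and> Ker h \<subseteq> J"
  show "J = Ker h \<or> J = UNIV"
  proof (cases "J = Ker h")
    case False
    then obtain z where z: "z \<in> J" "ev h z \<noteq> 0" using J by (auto simp: Ker_def)
    have "z - (ev h z, 0, 0) \<in> Ker h" by (cases h; cases z) (simp add: Ker_def)
    from aideal_diff[OF conjunct1[OF J] z(1) subsetD[OF conjunct2[OF J] this]]
    have "(ev h z, 0, 0) \<in> J" by simp
    thus ?thesis using aideal_unit z(2) J by blast
  qed simp
qed (use aideal_Ker[OF h] Ker_proper in auto)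

lemma inj_Ker: "inj Ker"
proof (rule injI)
  fix h h' :: "'k \<times> 'k" assume eq: "Ker h = Ker h'"
  obtain x y where h: "h = (x, y)" by (cases h)
  have "(- x, 1, 0) \<in> Ker h" "(- y, 0, 1) \<in> Ker h" by (simp_all add: h Ker_def)
  hence "(- x, 1, 0) \<in> Ker h'" "(- y, 0, 1) \<in> Ker h'" by (simp_all add: eq)
  thus "h = h'" by (cases h') (auto simp: h Ker_def add_eq_0_iff)
qed

lemma Ker_not_line: "Ker h \<noteq> line p"
proof
  assume eq: "Ker h = line p"
  obtain x y where h: "h = (x, y)" by (cases h)
  have "(- x, 1, 0) \<in> line p" "(- y, 0, 1) \<in> line p" by (simp_all add: h Ker_def flip: eq)
  thus False by (cases p) (auto simp: line_def)
qed

text \<open>Multiplication acts on a stable line through a character.\<close>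

lemma line_ideal:
  assumes "aideal (line p)" "p \<noteq> 0"
  shows "\<exists>h\<in>pts. \<forall>z. mul z p = tscale (ev h z) p"
proof -
  have "p \<in> line p" unfolding line_def by (rule image_eqI[of _ _ 1]) (cases p, simp_all)
  hence "mul z p \<in> line p" for z using assms(1) by (intro aideal_mul)
  hence "\<exists>s. mul z p = tscale s p" for z unfolding line_def by (rule rangeE) (rule exI)
  then obtain x y where xy: "mul (0, 1, 0) p = tscale x p" "mul (0, 0, 1) p = tscale y p" by metis
  have lin: "mul z p = tscale (ev (x, y) z) p" for z
  proof (cases z)
    case (fields z1 z2 z3)
    have "z = (z1, 0, 0) + tscale z2 (0, 1, 0) + tscale z3 (0, 0, 1)" by (simp add: fields)
    hence "mul z p = mul (z1, 0, 0) p + tscale z2 (mul (0, 1, 0) p) + tscale z3 (mul (0, 0, 1) p)"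
      by (simp only: cmul_add_left cmul_scale_left)
    also have "\<dots> = tscale (ev (x, y) z) p"
      unfolding xy cmul_scalar by (cases p) (simp add: fields algebra_simps)
    finally show ?thesis .
  qed
  have "(x, y) \<in> pts"
  proof (rule pointsI)
    fix z w
    have "tscale (ev (x, y) (mul z w)) p = mul z (mul w p)" by (simp only: lin[symmetric] cmul_assoc)
    also have "\<dots> = mul (tscale (ev (x, y) w) p) z" unfolding lin[of w] by (rule cmul_commute)
    also have "\<dots> = tscale (ev (x, y) w) (tscale (ev (x, y) z) p)"
      unfolding cmul_scale_left cmul_commute[of A B C D p z] lin[of z] ..
    finally show "ev (x, y) (mul z w) = ev (x, y) z * ev (x, y) w"
      using assms(2) by (cases p) (auto simp: zero_prod_def)
  qed
  thus ?thesis using lin by blast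
qed

text \<open>The three cases are residue fields of degree one, three and two over the base. In the last case \<open>p\<close> is a
  multiple of an idempotent, and its line is a direct factor isomorphic to the base field.\<close>

lemma amax_cases:
  assumes I: "amax I"
  obtains (Ker) h where "h \<in> pts" "I = Ker h"
    | (zero) "pts = {}" "I = {0}"
    | (line) h p where "pts = {h}" "eigen h p" "I = line p"
proof -
  have I': "aideal I" "I \<noteq> UNIV" using I by (auto simp: amax_def)
  have mx: "J = I" if "aideal J" "I \<subseteq> J" "J \<noteq> UNIV" for J using I that by (auto simp: amax_def)
  from ideal_dichotomy[OF I'] show ?thesis
  proof (elim disjE bexE)
    fix h assume "h \<in> pts" "I = Ker h" thus ?thesis by (rule Ker)
  next
    fix p assume p: "p \<in> I" "I = line p"
    have notin: "\<not> I \<subseteq> Ker h" if "h \<in> pts" for h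
      using mx[OF aideal_Ker[OF that] _ Ker_proper] Ker_not_line p(2) by blast
    show ?thesis
    proof (cases "p = 0")
      case True
      hence I0: "I = {0}" using p by (auto simp: line_def zero_prod_def)
      have "pts = {}" using notin aideal_Ker I0 by (auto simp: aideal_def)
      thus ?thesis using I0 by (rule zero)
    next
      case False
      obtain h where h: "h \<in> pts" "\<And>z. mul z p = tscale (ev h z) p"
        using line_ideal[of p] I' p False by blast
      have nz: "ev h' p \<noteq> 0" if "h' \<in> pts" for h'
        using notin[OF that] unfolding p(2) line_def Ker_def by (auto simp: ev_scale)
      have "h' = h" if h': "h' \<in> pts" for h'
      proof -
        have "ev h' z = ev h z" for z
        proof -
          have "ev h' z * ev h' p = ev h z * ev h' p"
            using ev_cmul[OF h', of z p, unfolded h(2) ev_scale] by (rule sym)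
          thus ?thesis using nz[OF h'] by (simp only: mult_cancel_right) simp
        qed
        from this[of "(0, 1, 0)"] this[of "(0, 0, 1)"] show ?thesis by (cases h; cases h') simp
      qed
      hence "pts = {h}" using h(1) by blast
      moreover have "eigen h p" unfolding eigen_def using nz[OF h(1)] h(2) by blast
      ultimately show ?thesis using p(2) by (rule line)
    qed
  qed
qed

lemma maximal_ideals_no_point: assumes "pts = {}" shows "{I. amax I} = {{0}}"
proof -
  have "aideal {0}" by (auto simp: aideal_def cmul_def zero_prod_def split: prod.splits)
  moreover have "J = {0} \<or> J = UNIV" if J: "aideal J" for J
  proof (cases "J = UNIV")
    case False
    from ideal_dichotomy[OF J False] assms obtain p where p: "p \<in> J" "J = line p" by blast
    have "p = 0" using line_ideal[of p] J p assms by blast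
    thus ?thesis using p by (auto simp: line_def zero_prod_def)
  qed simp
  moreover have "{0} \<noteq> (UNIV :: 'k triple set)"
  proof
    assume "{0} = (UNIV :: 'k triple set)"
    hence "(1, 0, 0) \<in> {0 :: 'k triple}" by simp
    thus False by (simp add: zero_prod_def)
  qed
  ultimately have "amax {0}" by (auto simp: amax_def)
  moreover have "I = {0}" if "amax I" for I using that by (cases rule: amax_cases) (use assms in auto)
  ultimately show ?thesis by blast
qed

lemma maximal_ideals_eigen:
  assumes pts: "pts = {h}" and e: "eigen h p"
  shows "{I. amax I} = {Ker h, line p}"
proof -
  have ep: "ev h p \<noteq> 0" "\<And>z. mul z p = tscale (ev h z) p" using e by (auto simp: eigen_def)
  have sc: "line (tscale s p) = line p" if "s \<noteq> 0" for s p
  proof -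
    have 1: "tscale t p = tscale (t * inverse s) (tscale s p)" for t using that by (cases p) simp
    have 2: "tscale t (tscale s p) = tscale (t * s) p" for t by (cases p) simp
    show ?thesis unfolding line_def
    proof (intro equalityI subsetI; elim rangeE)
      fix x t assume "x = tscale t (tscale s p)"
      thus "x \<in> range (\<lambda>s. tscale s p)" unfolding 2 by (rule range_eqI)
    next
      fix x t assume "x = tscale t p"
      thus "x \<in> range (\<lambda>t. tscale t (tscale s p))" unfolding 1[of t] by (rule range_eqI)
    qed
  qed
  have same: "line p' = line p" if "eigen h p'" for p'
  proof -
    have "tscale (ev h p) p' = mul p p'" using that unfolding eigen_def by metis
    also have "\<dots> = tscale (ev h p') p" unfolding ep(2)[symmetric] by (rule cmul_commute)
    finally have "tscale (ev h p) p' = tscale (ev h p') p" .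
    thus ?thesis using sc[of "ev h p" p'] sc[of "ev h p'" p] ep(1) that by (simp add: eigen_def)
  qed
  have al: "aideal (line p)"
    unfolding aideal_def
  proof (intro conjI ballI allI)
    show "0 \<in> line p" unfolding line_def by (rule image_eqI[of _ _ 0]) (cases p, simp_all add: zero_prod_def)
    fix x y assume "x \<in> line p" "y \<in> line p"
    then obtain s t where "x = tscale s p" "y = tscale t p" by (auto simp: line_def)
    hence "x + y = tscale (s + t) p" by (cases p) (simp add: algebra_simps)
    thus "x + y \<in> line p" by (simp add: line_def)
  next
    fix z x assume "x \<in> line p"
    then obtain s where "x = tscale s p" by (auto simp: line_def)
    hence "mul z x = tscale s (mul z p)" by (simp add: cmul_commute[of A B C D z] cmul_scale_left)
    also have "\<dots> = tscale (s * ev h z) p" unfolding ep(2) by (cases p) simp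
    finally show "mul z x \<in> line p" by (simp add: line_def)
  qed
  have pl: "p \<in> line p" unfolding line_def by (rule image_eqI[of _ _ 1]) (cases p, simp_all)
  have lp: "line p \<noteq> UNIV"
  proof
    assume "line p = UNIV"
    hence "(1, 0, 0) \<in> line p" "(0, 1, 0) \<in> line p" by simp_all
    thus False by (cases p) (auto simp: line_def)
  qed
  have "amax (line p)" unfolding amax_def
  proof (intro conjI allI impI al lp)
    fix J assume J: "aideal J \<and> line p \<subseteq> J"
    show "J = line p \<or> J = UNIV"
    proof (rule disjCI)
      assume "J \<noteq> UNIV"
      from ideal_dichotomy[OF conjunct1[OF J] this] show "J = line p"
      proof (elim disjE bexE)
        fix h' assume "h' \<in> pts" "J = Ker h'"
        thus ?thesis using pts J pl ep(1) by (auto simp: Ker_def)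
      next
        fix p' assume p': "p' \<in> J" "J = line p'"
        obtain s where s: "p = tscale s p'" using p'(2) J pl by (auto simp: line_def)
        have "s \<noteq> 0" using ep(1) unfolding s by (auto simp: ev_scale)
        thus ?thesis using sc[of s p'] s p'(2) by simp
      qed
    qed
  qed
  moreover have "amax (Ker h)" using amax_Ker pts by simp
  moreover have "I = Ker h \<or> I = line p" if "amax I" for I
    using that by (cases rule: amax_cases) (use pts same in auto)
  ultimately show ?thesis by blast
qed

lemma maximal_ideals_points:
  assumes "pts \<noteq> {}" and "\<And>h p. pts = {h} \<Longrightarrow> \<not> eigen h p"
  shows "{I. amax I} = Ker ` pts"
proof (intro equalityI subsetI)
  fix I assume "I \<in> {I. amax I}"
  hence "amax I" by simp
  thus "I \<in> Ker ` pts" by (cases rule: amax_cases) (use assms in auto)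
qed (use amax_Ker in auto)

text \<open>The projection along the line of \<open>p\<close> onto the kernel of \<open>h\<close>, followed by the second and
  third coordinate. On that kernel the first coordinate is determined by the other two.\<close>

definition line_residue :: "'k \<times> 'k \<Rightarrow> 'k triple \<Rightarrow> 'k triple \<Rightarrow> 'k \<times> 'k" where
  "line_residue h p z = snd (z - tscale (ev h z / ev h p) p)"

lemma line_residue:
  assumes "eigen h p"
  shows "line_residue h p (z + w) = line_residue h p z + line_residue h p w"
    "{z. line_residue h p z = 0} = line p" "surj (line_residue h p)"
proof -
  have ep: "ev h p \<noteq> 0" using assms by (simp add: eigen_def)
  show "line_residue h p (z + w) = line_residue h p z + line_residue h p w"
  proof -
    have "(ev h z + ev h w) / ev h p = ev h z / ev h p + ev h w / ev h p" by (rule add_divide_distrib)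
    thus ?thesis unfolding line_residue_def ev_add
      by (cases z; cases w; cases p) (simp add: algebra_simps del: ev_simps)
  qed
  show "{z. line_residue h p z = 0} = line p"
  proof (intro equalityI subsetI)
    fix z assume z: "z \<in> {z. line_residue h p z = 0}"
    define d where "d = z - tscale (ev h z / ev h p) p"
    have "snd d = 0" using z by (simp add: line_residue_def d_def)
    have "ev h (d + tscale (ev h z / ev h p) p) = ev h d + ev h z"
      using ep by (simp only: ev_add ev_scale) simp
    hence "ev h d = 0" by (simp add: d_def)
    hence "d = 0" using \<open>snd d = 0\<close> by (cases d; cases h) (auto simp: zero_prod_def)
    hence "z = tscale (ev h z / ev h p) p" by (simp add: d_def)
    thus "z \<in> line p" by (auto simp: line_def)
  next
    fix z assume "z \<in> line p"
    then obtain s where s: "z = tscale s p" by (auto simp: line_def)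
    have "z - tscale (ev h z / ev h p) p = 0" unfolding s ev_scale using ep by (cases p) (simp add: zero_prod_def)
    thus "z \<in> {z. line_residue h p z = 0}" by (simp add: line_residue_def)
  qed
  show "surj (line_residue h p)"
  proof (rule surjI)
    fix w :: "'k \<times> 'k"
    show "line_residue h p (- fst w * fst h - snd w * snd h, fst w, snd w) = w"
      by (cases h; cases p; cases w) (simp add: line_residue_def)
  qed
qed

end

section \<open>Orders attached to a binary cubic form\<close>

declare split_paired_All [simp del] split_paired_Ex [simp del]

lemma (in ring) card_of_dimension:
  assumes K: "subfield K R" "finite K" and d: "dimension n K V"
  shows "card V = card K ^ n"
proof -
  obtain Vs where Vs: "set Vs \<subseteq> carrier R" "independent K Vs" "length Vs = n" "Span K Vs = V"
    using exists_base[OF K(1) d] by blast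
  let ?L = "{Ks. set Ks \<subseteq> K \<and> length Ks = n}"
  have "bij_betw (\<lambda>Ks. combine Ks Vs) ?L V"
    unfolding bij_betw_def
  proof
    show "(\<lambda>Ks. combine Ks Vs) ` ?L = V"
      using Span_eq_combine_set_length_version[OF K(1) Vs(1)] Vs(3,4) by auto
    show "inj_on (\<lambda>Ks. combine Ks Vs) ?L"
    proof (rule inj_onI)
      fix x y assume xy: "x \<in> ?L" "y \<in> ?L" "combine x Vs = combine y Vs"
      have "combine x Vs \<in> Span K Vs"
        using Span_eq_combine_set[OF K(1) Vs(1)] xy by auto
      from unique_decomposition[OF K(1) Vs(2) this] show "x = y" using xy Vs(3) by auto
    qed
  qed
  hence "card V = card ?L" by (simp add: bij_betw_same_card)
  thus ?thesis using card_lists_length_eq[OF K(2)] by simp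
qed

text \<open>Counting elements replaces the construction of bases for residue fields.\<close>

lemma (in ring) dim_of_card:
  assumes K: "subfield K R" "finite K" and fin: "finite (carrier R)" and c: "card (carrier R) = card K ^ n"
  shows "dim K (carrier R) = n"
proof -
  interpret K: subfield K R by fact
  obtain xs where xs: "set xs = carrier R" using finite_list[OF fin] by blast
  have "Span K xs = carrier R"
    using Span_in_carrier[of K xs] Span_base_incl[OF K(1), of xs] xs K.subset by auto
  hence "finite_dimension K (carrier R)" using Span_finite_dimension[OF K(1), of xs] xs by auto
  then obtain m where m: "dimension m K (carrier R)" by (rule finite_dimensionE')
  have "card K ^ m = card K ^ n" using card_of_dimension[OF K m] c by simp
  moreover have "1 < card K"
  proof -
    have "\<zero> \<in> K" "\<one> \<in> K" "\<one> \<noteq> \<zero>"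
      using subfieldE(6)[OF K(1)] subringE(2,3)[OF subfieldE(1)[OF K(1)]] by auto
    hence "card {\<zero>, \<one>} \<le> card K" using K(2) by (intro card_mono) auto
    thus ?thesis using \<open>\<one> \<noteq> \<zero>\<close> by simp
  qed
  ultimately have "m = n" by simp
  thus ?thesis using dimI[OF K(1) m] by (simp add: over_def)
qed

lemma cramer_exists:
  fixes m11 :: "'a::comm_ring_1"
  assumes "m11 * (m22 * m33 - m23 * m32) - m12 * (m21 * m33 - m23 * m31) + m13 * (m21 * m32 - m22 * m31) dvd 1"
  shows "\<exists>x1 x2 x3. m11 * x1 + m12 * x2 + m13 * x3 = u1 \<and> m21 * x1 + m22 * x2 + m23 * x3 = u2
     \<and> m31 * x1 + m32 * x2 + m33 * x3 = u3"
proof -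
  let ?det = "m11 * (m22 * m33 - m23 * m32) - m12 * (m21 * m33 - m23 * m31) + m13 * (m21 * m32 - m22 * m31)"
  obtain d where d: "1 = ?det * d" using assms by (elim dvdE)
  have "u = (?det * d) * u" for u by (simp flip: d)
  note u = this[of u1] this[of u2] this[of u3]
  show ?thesis
    by (subst u(1), subst u(2), subst u(3),
      rule exI[of _ "d * ((m22 * m33 - m23 * m32) * u1 - (m12 * m33 - m13 * m32) * u2 + (m12 * m23 - m13 * m22) * u3)"],
      rule exI[of _ "d * (- (m21 * m33 - m23 * m31) * u1 + (m11 * m33 - m13 * m31) * u2 - (m11 * m23 - m13 * m21) * u3)"],
      rule exI[of _ "d * ((m21 * m32 - m22 * m31) * u1 - (m11 * m32 - m12 * m31) * u2 + (m11 * m22 - m12 * m21) * u3)"])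
     (simp add: algebra_simps)
qed

lemma cramer_unique:
  fixes m11 :: "'a::comm_ring_1"
  assumes det: "m11 * (m22 * m33 - m23 * m32) - m12 * (m21 * m33 - m23 * m31) + m13 * (m21 * m32 - m22 * m31) dvd 1"
    and e1: "m11 * x1 + m12 * x2 + m13 * x3 = 0" and e2: "m21 * x1 + m22 * x2 + m23 * x3 = 0"
    and e3: "m31 * x1 + m32 * x2 + m33 * x3 = 0"
  shows "x1 = 0 \<and> x2 = 0 \<and> x3 = 0"
proof -
  let ?det = "m11 * (m22 * m33 - m23 * m32) - m12 * (m21 * m33 - m23 * m31) + m13 * (m21 * m32 - m22 * m31)"
  obtain d where d: "1 = ?det * d" using det by (elim dvdE)
  have "?det * x1 = (m22 * m33 - m23 * m32) * (m11 * x1 + m12 * x2 + m13 * x3)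
     - (m12 * m33 - m13 * m32) * (m21 * x1 + m22 * x2 + m23 * x3)
     + (m12 * m23 - m13 * m22) * (m31 * x1 + m32 * x2 + m33 * x3)" by (simp add: algebra_simps)
  hence 1: "?det * x1 = 0" unfolding e1 e2 e3 by simp
  have "?det * x2 = - (m21 * m33 - m23 * m31) * (m11 * x1 + m12 * x2 + m13 * x3)
     + (m11 * m33 - m13 * m31) * (m21 * x1 + m22 * x2 + m23 * x3)
     - (m11 * m23 - m13 * m21) * (m31 * x1 + m32 * x2 + m33 * x3)" by (simp add: algebra_simps)
  hence 2: "?det * x2 = 0" unfolding e1 e2 e3 by simp
  have "?det * x3 = (m21 * m32 - m22 * m31) * (m11 * x1 + m12 * x2 + m13 * x3)
     - (m11 * m32 - m12 * m31) * (m21 * x1 + m22 * x2 + m23 * x3)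
     + (m11 * m22 - m12 * m21) * (m31 * x1 + m32 * x2 + m33 * x3)" by (simp add: algebra_simps)
  hence 3: "?det * x3 = 0" unfolding e1 e2 e3 by simp
  have "x = 0" if "?det * x = 0" for x
  proof -
    have "x = (?det * d) * x" by (simp flip: d)
    also have "\<dots> = d * (?det * x)" by (simp only: ac_simps)
    finally show ?thesis using that by simp
  qed
  thus ?thesis using 1 2 3 by blast
qed

definition red3 :: "'q::prime_card padic_int triple \<Rightarrow> 'q mod_ring triple" where
  "red3 = (\<lambda>(x, y, z). (red x, red y, red z))"

lemma red3_simps [simp]: "red3 (x, y, z) = (red x, red y, red z)" by (simp add: red3_def)
lemma red3_add: "red3 (s + t) = red3 s + red3 t" by (cases s; cases t) simp
lemma red3_cmul: "red3 (cmul A B C D s t) = cmul (red A) (red B) (red C) (red D) (red3 s) (red3 t)"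
  by (cases s; cases t) (simp add: cmul_def)
lemma red3_0 [simp]: "red3 0 = 0" by (simp add: zero_prod_def)
lemma surj_red: "surj (red :: 'q::prime_card padic_int \<Rightarrow> 'q mod_ring)"
  unfolding surj_def using red_surj by metis

lemma surj_red3: "surj (red3 :: 'q::prime_card padic_int triple \<Rightarrow> _)"
proof (rule surjI[where f = "\<lambda>(x, y, z). (inv_into UNIV red x, inv_into UNIV red y, inv_into UNIV red z)"])
  show "red3 (case t of (x, y, z) \<Rightarrow> (inv_into UNIV red x, inv_into UNIV red y, inv_into UNIV red z)) = t"
    for t :: "'q::prime_card mod_ring triple"
    by (cases t) (simp add: surj_f_inv_f[OF surj_red])
qed
lemma red3_eq_0: "red3 s = 0 \<Longrightarrow> \<exists>t. s = tscale \<varpi> t"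
proof (cases s)
  fix x y z assume s: "red3 s = 0" "s = (x, y, z)"
  then obtain x' y' z' where "x = \<varpi> * x'" "y = \<varpi> * y'" "z = \<varpi> * z'"
    by (auto simp: zero_prod_def red_eq_0_iff elim!: dvdE)
  thus ?thesis using s(2) by (intro exI[of _ "(x', y', z')"]) simp
qed

text \<open>The ring of a form over the \<open>q\<close>-adic integers, embedded by \<open>\<psi>\<close> in an ambient commutative ring.\<close>

locale form_order = E: cring E for E :: "'e ring" (structure) +
  fixes \<psi> :: "'q::prime_card padic_int triple \<Rightarrow> 'e" and A B C D :: "'q padic_int"
  assumes inj: "inj \<psi>" and in_carrier: "\<psi> s \<in> carrier E" and \<psi>_add: "\<psi> (s + t) = \<psi> s \<oplus> \<psi> t"
    and \<psi>_mult: "\<psi> (cmul A B C D s t) = \<psi> s \<otimes> \<psi> t" and \<psi>_one: "\<psi> (1, 0, 0) = \<one>"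
begin

abbreviation "\<iota> \<equiv> (\<lambda>s. \<psi> (s, 0, 0))"
abbreviation "R \<equiv> range \<psi>"
abbreviation "S \<equiv> E\<lparr>carrier := R\<rparr>"
abbreviation "pmul \<equiv> cmul A B C D"

sublocale fib: cubic_algebra "red A" "red B" "red C" "red D" .

lemma \<psi>_zero: "\<psi> 0 = \<zero>"
  using \<psi>_add[of 0 0] in_carrier[of 0] E.add.r_cancel_one by simp

lemma \<psi>_uminus: "\<psi> (- s) = \<ominus> \<psi> s"
  using \<psi>_add[of "- s" s] in_carrier by (intro E.minus_equality[symmetric]) (simp_all add: \<psi>_zero)

lemma \<psi>_eq_iff: "\<psi> s = \<psi> t \<longleftrightarrow> s = t" using inj by (simp add: inj_eq)

lemma subring_R: "subring R E"
proof (rule E.subringI)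
  show "R \<subseteq> carrier E" using in_carrier by auto
  show "\<one> \<in> R" by (rule range_eqI[where x="(1, 0, 0)"], rule \<psi>_one[symmetric])
qed (auto simp flip: \<psi>_uminus \<psi>_mult \<psi>_add)

lemma cring_S: "cring S"
  using E.subcringI'[OF subring_R] E.subcring_iff[of R] subringE(1)[OF subring_R] by blast

lemma S_uminus: "\<ominus>\<^bsub>S\<^esub> \<psi> t = \<psi> (- t)"
proof -
  interpret S: cring S by (rule cring_S)
  show ?thesis using \<psi>_add[of "- t" t] by (intro S.minus_equality) (auto simp: \<psi>_zero)
qed

lemma cubic_order_R: "cubic_order E \<iota> R"
  unfolding cubic_order_def
proof (intro conjI subring_R)
  have eq: "\<iota> s1 \<otimes> \<psi> (1, 0, 0) \<oplus> \<iota> s2 \<otimes> \<psi> (0, 1, 0) \<oplus> \<iota> s3 \<otimes> \<psi> (0, 0, 1) = \<psi> (s1, s2, s3)" for s1 s2 s3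
    by (simp flip: \<psi>_mult \<psi>_add add: cmul_scalar)
  show "\<exists>b1\<in>R. \<exists>b2\<in>R. \<exists>b3\<in>R. bij_betw (\<lambda>(s1, s2, s3). \<iota> s1 \<otimes> b1 \<oplus> \<iota> s2 \<otimes> b2 \<oplus> \<iota> s3 \<otimes> b3) UNIV R"
    by (intro bexI[of _ "\<psi> (1, 0, 0)"] bexI[of _ "\<psi> (0, 1, 0)"] bexI[of _ "\<psi> (0, 0, 1)"])
      (auto simp: eq bij_betw_def inj case_prod_beta' intro: inj)
qed auto

subsection \<open>Ideals\<close>

definition pideal :: "'q padic_int triple set \<Rightarrow> bool" where
  "pideal Z \<longleftrightarrow> 0 \<in> Z \<and> (\<forall>x\<in>Z. \<forall>y\<in>Z. x + y \<in> Z) \<and> (\<forall>z. \<forall>x\<in>Z. pmul z x \<in> Z)"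

lemma pideal_uminus: assumes "pideal Z" "x \<in> Z" shows "- x \<in> Z"
proof -
  have "- x = pmul (- 1, 0, 0) x" by (cases x) (simp add: cmul_scalar)
  thus ?thesis using assms unfolding pideal_def by metis
qed

lemma pideal_unit: assumes "pideal Z" "(1, 0, 0) \<in> Z" shows "Z = UNIV"
proof -
  have "z \<in> Z" for z
  proof -
    have "pmul z (1, 0, 0) \<in> Z" using assms unfolding pideal_def by blast
    moreover have "pmul z (1, 0, 0) = z" by (subst cmul_commute) (cases z, simp add: cmul_scalar)
    ultimately show ?thesis by simp
  qed
  thus ?thesis by blast
qed

lemma ideal_image: assumes Z: "pideal Z" shows "ideal (\<psi> ` Z) S"
proof (rule idealI)
  interpret S: cring S by (rule cring_S)
  show "ring S" by (rule S.ring_axioms)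
  show "subgroup (\<psi> ` Z) (add_monoid S)"
  proof (rule S.add.subgroupI)
    show "\<psi> ` Z \<subseteq> carrier S" by auto
    show "\<psi> ` Z \<noteq> {}" using Z by (auto simp: pideal_def)
    fix a assume "a \<in> \<psi> ` Z"
    then obtain x where x: "x \<in> Z" "a = \<psi> x" by blast
    have "\<ominus>\<^bsub>S\<^esub> a = \<psi> (- x)" by (simp add: x S_uminus)
    thus "\<ominus>\<^bsub>S\<^esub> a \<in> \<psi> ` Z" using pideal_uminus[OF Z x(1)] by blast
  next
    fix a b assume "a \<in> \<psi> ` Z" "b \<in> \<psi> ` Z"
    then obtain x y where "x \<in> Z" "a = \<psi> x" "y \<in> Z" "b = \<psi> y" by blast
    thus "a \<oplus>\<^bsub>S\<^esub> b \<in> \<psi> ` Z" using Z by (auto simp: pideal_def simp flip: \<psi>_add)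
  qed
  fix a x assume "a \<in> \<psi> ` Z" "x \<in> carrier S"
  then obtain s t where st: "s \<in> Z" "a = \<psi> s" "x = \<psi> t" by auto
  hence "pmul t s \<in> Z" using Z unfolding pideal_def by blast
  thus "x \<otimes>\<^bsub>S\<^esub> a \<in> \<psi> ` Z" "a \<otimes>\<^bsub>S\<^esub> x \<in> \<psi> ` Z"
    using st by (auto simp flip: \<psi>_mult simp: cmul_commute[of _ _ _ _ s])
qed

lemma ideal_vimage:
  assumes "ideal m S" shows "pideal (\<psi> -` m)" "m = \<psi> ` (\<psi> -` m)"
proof -
  interpret m: ideal m S by fact
  show "m = \<psi> ` (\<psi> -` m)" using m.Icarr by auto
  have "pmul z x \<in> \<psi> -` m" if "x \<in> \<psi> -` m" for z x
    using m.I_l_closed[of "\<psi> x" "\<psi> z"] that by (simp add: \<psi>_mult)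
  moreover have "x + y \<in> \<psi> -` m" if "x \<in> \<psi> -` m" "y \<in> \<psi> -` m" for x y
    using additive_subgroup.a_closed[OF m.is_additive_subgroup, of "\<psi> x" "\<psi> y"] that by (simp add: \<psi>_add)
  moreover have "0 \<in> \<psi> -` m" using additive_subgroup.zero_closed[OF m.is_additive_subgroup] by (simp add: \<psi>_zero)
  ultimately show "pideal (\<psi> -` m)" by (simp add: pideal_def)
qed

definition pmax :: "'q padic_int triple set \<Rightarrow> bool" where
  "pmax Z \<longleftrightarrow> pideal Z \<and> Z \<noteq> UNIV \<and> (\<forall>Y. pideal Y \<and> Z \<subseteq> Y \<longrightarrow> Y = Z \<or> Y = UNIV)"

lemma maximalideal_image_iff: "maximalideal (\<psi> ` Z) S \<longleftrightarrow> pmax Z"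
proof
  have vi: "\<psi> -` \<psi> ` Y = Y" for Y using inj by (rule inj_vimage_image_eq)
  {
    assume "maximalideal (\<psi> ` Z) S"
    then interpret m: maximalideal "\<psi> ` Z" S .
    have "pideal Z" using ideal_vimage(1)[OF m.ideal_axioms] by (simp add: vi)
    moreover have "Z \<noteq> UNIV" using m.I_notcarr by auto
    moreover have "Y = Z \<or> Y = UNIV" if Y: "pideal Y" "Z \<subseteq> Y" for Y
    proof -
      have "\<psi> ` Y = \<psi> ` Z \<or> \<psi> ` Y = carrier S"
        by (rule m.I_maximal[OF ideal_image[OF Y(1)]]) (use Y in auto)
      thus ?thesis using inj inj_image_eq_iff[OF inj] by auto
    qed
    ultimately show "pmax Z" by (auto simp: pmax_def)
  next
    assume Z: "pmax Z"
    show "maximalideal (\<psi> ` Z) S"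
    proof (rule maximalidealI)
      show "ideal (\<psi> ` Z) S" using Z by (intro ideal_image) (simp add: pmax_def)
      show "carrier S \<noteq> \<psi> ` Z" using Z inj_image_eq_iff[OF inj, of UNIV Z] by (auto simp: pmax_def)
      fix J assume J: "ideal J S" "\<psi> ` Z \<subseteq> J" "J \<subseteq> carrier S"
      have "Z \<subseteq> \<psi> -` J" using J(2) by auto
      hence "\<psi> -` J = Z \<or> \<psi> -` J = UNIV"
        using Z ideal_vimage(1)[OF J(1)] by (simp add: pmax_def)
      hence "\<psi> ` (\<psi> -` J) = \<psi> ` Z \<or> \<psi> ` (\<psi> -` J) = R" by (elim disjE) simp_all
      thus "J = \<psi> ` Z \<or> J = carrier S" unfolding ideal_vimage(2)[OF J(1), symmetric] by simp
    qed
  }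
qed

text \<open>The determinant of multiplication by \<open>s\<close> is congruent to \<open>1\<close>, hence a unit, and Cramer's rule
  gives an inverse. In effect, the uniformizer lies in the radical.\<close>

lemma unit_one_mod_unif:
  assumes "red3 s = (1, 0, 0)" shows "\<exists>z. pmul s z = (1, 0, 0)"
proof (cases s)
  case (fields s1 s2 s3)
  have r: "red s1 = 1" "red s2 = 0" "red s3 = 0" using assms by (simp_all add: fields)
  let ?m12 = "- (A * C * s2) - A * D * s3" and ?m13 = "- (A * D * s2) - B * D * s3"
    and ?m22 = "s1 - B * s2" and ?m23 = "- (D * s3)" and ?m32 = "A * s2" and ?m33 = "s1 + C * s3"
  have "s1 * (?m22 * ?m33 - ?m23 * ?m32) - ?m12 * (s2 * ?m33 - ?m23 * s3)
      + ?m13 * (s2 * ?m32 - ?m22 * s3) dvd 1"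
    unfolding padic_unit_iff by (simp add: r)
  from cramer_exists[OF this, of 1 0 0] obtain z1 z2 z3 where z:
    "s1 * z1 + ?m12 * z2 + ?m13 * z3 = 1" "s2 * z1 + ?m22 * z2 + ?m23 * z3 = 0"
    "s3 * z1 + ?m32 * z2 + ?m33 * z3 = 0" by blast
  have "pmul s (z1, z2, z3) = (s1 * z1 + ?m12 * z2 + ?m13 * z3, s2 * z1 + ?m22 * z2 + ?m23 * z3,
      s3 * z1 + ?m32 * z2 + ?m33 * z3)"
    by (simp add: fields cmul_def algebra_simps)
  thus ?thesis unfolding z by blast
qed

lemma pmax_contains_unif: assumes Z: "pmax Z" shows "tscale \<varpi> t \<in> Z"
proof -
  define Y where "Y = {x + tscale \<varpi> u | x u. x \<in> Z}"
  have Xi: "pideal Z" using Z by (simp add: pmax_def)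
  have sc: "tscale \<varpi> u = pmul (\<varpi>, 0, 0) u" for u by (simp add: cmul_scalar)
  have "pideal Y" unfolding pideal_def
  proof (intro conjI ballI allI)
    have "0 + tscale \<varpi> 0 \<in> Y" unfolding Y_def using Xi unfolding pideal_def by blast
    thus "0 \<in> Y" by (simp add: zero_prod_def)
    fix x y assume "x \<in> Y" "y \<in> Y"
    then obtain x' u y' v where xy: "x = x' + tscale \<varpi> u" "x' \<in> Z" "y = y' + tscale \<varpi> v" "y' \<in> Z"
      by (auto simp: Y_def)
    have "x + y = (x' + y') + tscale \<varpi> (u + v)" unfolding xy sc cmul_add_right by simp
    moreover have "x' + y' \<in> Z" using Xi xy by (auto simp: pideal_def)
    ultimately show "x + y \<in> Y" unfolding Y_def by blast
  next
    fix z x assume "x \<in> Y"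
    then obtain x' u where x: "x = x' + tscale \<varpi> u" "x' \<in> Z" by (auto simp: Y_def)
    have "pmul z x = pmul z x' + tscale \<varpi> (pmul z u)"
      unfolding x sc cmul_add_right cmul_commute[of A B C D z] by (simp add: cmul_assoc)
    moreover have "pmul z x' \<in> Z" using Xi x unfolding pideal_def by blast
    ultimately show "pmul z x \<in> Y" unfolding Y_def by blast
  qed
  moreover have XY: "Z \<subseteq> Y"
  proof
    fix x assume "x \<in> Z"
    moreover have "x = x + tscale \<varpi> 0" by (simp add: zero_prod_def)
    ultimately show "x \<in> Y" unfolding Y_def by blast
  qed
  moreover have "Y \<noteq> UNIV"
  proof
    assume "Y = UNIV"
    hence "(1, 0, 0) \<in> Y" by simp
    then obtain x u where xu: "(1, 0, 0) = x + tscale \<varpi> u" "x \<in> Z" unfolding Y_def by blast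
    obtain u1 u2 u3 where u: "u = (u1, u2, u3)" by (cases u)
    have "x = (1, 0, 0) - tscale \<varpi> u" using xu(1) by simp
    hence "red3 x = (1, 0, 0)" by (simp add: u)
    from unit_one_mod_unif[OF this] obtain z where "pmul x z = (1, 0, 0)" by blast
    hence "pmul z x = (1, 0, 0)" by (simp add: cmul_commute)
    moreover have "pmul z x \<in> Z" using Xi xu(2) unfolding pideal_def by blast
    ultimately have "Z = UNIV" using pideal_unit[OF Xi] by simp
    thus False using Z by (simp add: pmax_def)
  qed
  ultimately have "Y = Z" using Z by (auto simp: pmax_def)
  moreover have "0 + tscale \<varpi> t \<in> Y" unfolding Y_def using Xi unfolding pideal_def by blast
  ultimately show ?thesis by simp
qed

lemma pideal_vimage: assumes "fib.aideal I" shows "pideal (red3 -` I)"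
proof -
  have "red3 (pmul z x) \<in> I" if "red3 x \<in> I" for z x
    unfolding red3_cmul using fib.aideal_mul[OF assms that] .
  moreover have "red3 (x + y) \<in> I" if "red3 x \<in> I" "red3 y \<in> I" for x y
    unfolding red3_add using fib.aideal_add[OF assms that] .
  moreover have "red3 0 \<in> I" using assms by (simp add: fib.aideal_def)
  ultimately show ?thesis by (simp add: pideal_def)
qed

lemma aideal_image:
  fixes Z :: "'q padic_int triple set"
  assumes Z: "pideal Z" shows "fib.aideal (red3 ` Z)"
  unfolding fib.aideal_def
proof (intro conjI ballI allI)
  have "red3 0 \<in> red3 ` Z" using Z by (intro imageI) (simp add: pideal_def)
  thus "0 \<in> red3 ` Z" by simp
  fix x y assume "x \<in> red3 ` Z" "y \<in> red3 ` Z"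
  then obtain x' y' where xy: "x = red3 x'" "y = red3 y'" "x' \<in> Z" "y' \<in> Z" by blast
  have "red3 (x' + y') \<in> red3 ` Z" using Z xy by (intro imageI) (simp add: pideal_def)
  thus "x + y \<in> red3 ` Z" by (simp add: red3_add xy)
next
  fix z :: "'q mod_ring triple" and x assume "x \<in> red3 ` Z"
  then obtain x' where x: "x = red3 x'" "x' \<in> Z" by blast
  obtain z' where z: "z = red3 z'" using surjD[OF surj_red3] by blast
  have "pmul z' x' \<in> Z" using Z x(2) unfolding pideal_def by blast
  hence "red3 (pmul z' x') \<in> red3 ` Z" by (rule imageI)
  thus "fib.mul z x \<in> red3 ` Z" by (simp add: red3_cmul x z)
qed

lemma pmax_saturated: assumes "pideal Z" "\<And>t. tscale \<varpi> t \<in> Z" shows "red3 -` red3 ` Z = Z"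
proof (intro equalityI subsetI)
  fix s assume "s \<in> red3 -` red3 ` Z"
  then obtain x where x: "x \<in> Z" "red3 s = red3 x" by auto
  have "red3 (s + (- x)) = red3 s - red3 x" by (cases s; cases x) simp
  hence "red3 (s + (- x)) = 0" using x by simp
  then obtain t where t: "s + (- x) = tscale \<varpi> t" using red3_eq_0 by blast
  have "s = tscale \<varpi> t + x" using t[symmetric] by simp
  thus "s \<in> Z" using assms(1) assms(2)[of t] x(1) unfolding pideal_def by metis
qed auto

text \<open>Maximal ideals contain the uniformizer, and so correspond to those of the algebra over the
  residue field.\<close>

lemma maximalideals:
  "{m. maximalideal m S} = (\<lambda>I. \<psi> ` (red3 -` I)) ` {I. fib.amax I}"
proof (intro equalityI subsetI)
  fix m assume "m \<in> {m. maximalideal m S}"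
  hence m: "maximalideal m S" by simp
  then interpret m: maximalideal m S .
  define Z where V_def: "Z = \<psi> -` m"
  have mX: "m = \<psi> ` Z" using ideal_vimage(2)[OF m.ideal_axioms] by (simp add: V_def)
  have Z: "pmax Z" using m maximalideal_image_iff mX by simp
  have Xi: "pideal Z" using Z by (simp add: pmax_def)
  have sat: "red3 -` red3 ` Z = Z" by (rule pmax_saturated[OF Xi pmax_contains_unif[OF Z]])
  have "fib.amax (red3 ` Z)" unfolding fib.amax_def
  proof (intro conjI allI impI aideal_image[OF Xi])
    show "red3 ` Z \<noteq> UNIV"
    proof
      assume "red3 ` Z = UNIV"
      hence "Z = UNIV" using sat by simp
      thus False using Z by (simp add: pmax_def)
    qed
    fix J assume J: "fib.aideal J \<and> red3 ` Z \<subseteq> J"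
    hence "Z \<subseteq> red3 -` J" by auto
    hence "red3 -` J = Z \<or> red3 -` J = UNIV"
      using Z pideal_vimage[of J] J by (simp add: pmax_def)
    hence "red3 ` red3 -` J = red3 ` Z \<or> red3 ` red3 -` J = UNIV"
      by (elim disjE) (simp_all add: surj_red3)
    thus "J = red3 ` Z \<or> J = UNIV" by (simp only: surj_image_vimage_eq[OF surj_red3])
  qed
  thus "m \<in> (\<lambda>I. \<psi> ` (red3 -` I)) ` {I. fib.amax I}" using mX sat by (intro image_eqI[of _ _ "red3 ` Z"]) auto
next
  fix m assume "m \<in> (\<lambda>I. \<psi> ` (red3 -` I)) ` {I. fib.amax I}"
  then obtain I where I: "fib.amax I" "m = \<psi> ` (red3 -` I)" by blast
  have "pmax (red3 -` I)" unfolding pmax_def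
  proof (intro conjI allI impI)
    show "pideal (red3 -` I)" using I by (intro pideal_vimage) (simp add: fib.amax_def)
    show "red3 -` I \<noteq> UNIV"
    proof
      assume "red3 -` I = UNIV"
      hence "red3 ` red3 -` I = UNIV" by (simp add: surj_red3)
      thus False using I(1) unfolding surj_image_vimage_eq[OF surj_red3] by (simp add: fib.amax_def)
    qed
    fix Y assume Y: "pideal Y \<and> red3 -` I \<subseteq> Y"
    have "tscale \<varpi> t \<in> Y" for t
    proof -
      have "red3 (tscale \<varpi> t) = 0" by (cases t) (simp add: zero_prod_def)
      hence "tscale \<varpi> t \<in> red3 -` I" using I(1) by (simp add: fib.amax_def fib.aideal_def)
      thus ?thesis using Y by blast
    qed
    with conjunct1[OF Y] have sat: "red3 -` red3 ` Y = Y" by (rule pmax_saturated)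
    have "red3 ` red3 -` I \<subseteq> red3 ` Y" using Y by (intro image_mono) simp
    hence "I \<subseteq> red3 ` Y" by (simp only: surj_image_vimage_eq[OF surj_red3])
    hence "red3 ` Y = I \<or> red3 ` Y = UNIV" using I(1) aideal_image[OF conjunct1[OF Y]]
      by (simp add: fib.amax_def)
    hence "red3 -` red3 ` Y = red3 -` I \<or> red3 -` red3 ` Y = UNIV" by (elim disjE) simp_all
    thus "Y = red3 -` I \<or> Y = UNIV" unfolding sat .
  qed
  thus "m \<in> {m. maximalideal m S}" using maximalideal_image_iff I(2) by simp
qed

lemma inj_image_vimage: "inj (\<lambda>I. \<psi> ` (red3 -` I))"
proof (rule injI)
  fix I J assume "\<psi> ` (red3 -` I) = \<psi> ` (red3 -` J)"
  hence "red3 -` I = red3 -` J" by (rule iffD1[OF inj_image_eq_iff[OF inj]])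
  hence "red3 ` red3 -` I = red3 ` red3 -` J" by simp
  thus "I = J" by (simp only: surj_image_vimage_eq[OF surj_red3])
qed

lemma residue_degree_eq:
  fixes \<phi> :: "'q mod_ring triple \<Rightarrow> 't::{ab_group_add, finite}"
  assumes I: "fib.amax I" and add: "\<And>z w. \<phi> (z + w) = \<phi> z + \<phi> w" and ker: "{z. \<phi> z = 0} = I"
    and surj: "surj \<phi>" and card: "CARD('t) = CARD('q) ^ d"
  shows "residue_degree E \<iota> R (\<psi> ` (red3 -` I)) = d"
proof -
  let ?m = "\<psi> ` (red3 -` I)"
  define k where "k = S Quot ?m"
  have mx: "maximalideal ?m S" using maximalideals I by blast
  then interpret m: maximalideal ?m S .
  have fk: "field k" unfolding k_def by (rule m.quotient_is_field[OF cring_S])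
  interpret k: field k by (rule fk)
  have diff: "\<phi> (z - w) = \<phi> z - \<phi> w" for z w
    using add[of "z - w" w] by (simp add: eq_diff_eq)
  have coset_eq: "?m +>\<^bsub>S\<^esub> \<psi> s = ?m +>\<^bsub>S\<^esub> \<psi> t \<longleftrightarrow> \<phi> (red3 s) = \<phi> (red3 t)" for s t
  proof -
    have "?m +>\<^bsub>S\<^esub> \<psi> s = ?m +>\<^bsub>S\<^esub> \<psi> t \<longleftrightarrow> \<psi> s \<ominus>\<^bsub>S\<^esub> \<psi> t \<in> ?m"
      using ring.quotient_eq_iff_same_a_r_cos[OF cring.axioms(1)[OF cring_S] m.ideal_axioms, of "\<psi> s" "\<psi> t"] by simp
    also have "\<psi> s \<ominus>\<^bsub>S\<^esub> \<psi> t = \<psi> (s - t)"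
      by (simp add: a_minus_def S_uminus flip: \<psi>_add)
    also have "\<psi> (s - t) \<in> ?m \<longleftrightarrow> red3 (s - t) \<in> I" by (auto simp: \<psi>_eq_iff)
    also have "red3 (s - t) = red3 s - red3 t" by (cases s; cases t) simp
    also have "red3 s - red3 t \<in> I \<longleftrightarrow> \<phi> (red3 s) = \<phi> (red3 t)"
      using ker[symmetric] by (simp add: diff)
    finally show ?thesis .
  qed
  have ck: "carrier k = range (\<lambda>s. ?m +>\<^bsub>S\<^esub> \<psi> s)"
    unfolding k_def FactRing_def A_RCOSETS_def' by auto
  have bij: "bij_betw (\<lambda>x. ?m +>\<^bsub>S\<^esub> \<psi> (inv_into UNIV (\<phi> \<circ> red3) x)) UNIV (carrier k)"
  proof -
    have s: "surj (\<phi> \<circ> red3)" by (rule comp_surj[OF surj_red3 surj])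
    have e: "\<phi> (red3 (inv_into UNIV (\<phi> \<circ> red3) x)) = x" for x using surj_f_inv_f[OF s, of x] by simp
    show ?thesis unfolding bij_betw_def
    proof
      show "inj (\<lambda>x. ?m +>\<^bsub>S\<^esub> \<psi> (inv_into UNIV (\<phi> \<circ> red3) x))" by (rule injI) (simp only: coset_eq e)
      show "range (\<lambda>x. ?m +>\<^bsub>S\<^esub> \<psi> (inv_into UNIV (\<phi> \<circ> red3) x)) = carrier k" unfolding ck
      proof (intro equalityI subsetI; elim rangeE)
        fix y s assume y: "y = ?m +>\<^bsub>S\<^esub> \<psi> s"
        have "y = ?m +>\<^bsub>S\<^esub> \<psi> (inv_into UNIV (\<phi> \<circ> red3) (\<phi> (red3 s)))" unfolding y coset_eq e ..
        thus "y \<in> range (\<lambda>x. ?m +>\<^bsub>S\<^esub> \<psi> (inv_into UNIV (\<phi> \<circ> red3) x))" by (rule range_eqI)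
      qed auto
    qed
  qed
  have ccard: "card (carrier k) = CARD('t)" using bij_betw_same_card[OF bij] by simp
  have fin: "finite (carrier k)" using bij_betw_finite[OF bij] by simp
  define h :: "'q mod_ring \<Rightarrow> 'e set" where "h x = ?m +>\<^bsub>S\<^esub> \<iota> (inv_into UNIV red x)" for x
  note sr = surj_red[where 'q='q]
  have hred: "h (red s) = ?m +>\<^bsub>S\<^esub> \<iota> s" for s
    unfolding h_def coset_eq by (simp add: surj_f_inv_f[OF sr])
  have hom: "(\<lambda>x. ?m +>\<^bsub>S\<^esub> x) \<in> Ring.ring_hom S k" unfolding k_def by (rule m.rcos_ring_hom)
  let ?F = "ring_of_type_algebra :: 'q mod_ring ring"
  have F: "field ?F" by (rule field_from_type_algebra)
  interpret F: field ?F by (rule F)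
  have hh: "ring_hom_ring ?F k h"
  proof (rule ring_hom_ringI[OF F.ring_axioms k.ring_axioms])
    fix x y :: "'q mod_ring"
    obtain s t where st: "x = red s" "y = red t" using sr by (metis surjD)
    show "h x \<in> carrier k" unfolding h_def ck by blast
    have "h (x * y) = ?m +>\<^bsub>S\<^esub> \<iota> (s * t)" unfolding st by (simp only: red_mult[symmetric] hred)
    also have "\<iota> (s * t) = \<iota> s \<otimes>\<^bsub>S\<^esub> \<iota> t" by (simp flip: \<psi>_mult add: cmul_scalar)
    also have "?m +>\<^bsub>S\<^esub> \<dots> = h x \<otimes>\<^bsub>k\<^esub> h y" unfolding st hred by (rule ring_hom_mult[OF hom]) auto
    finally show "h (x \<otimes>\<^bsub>?F\<^esub> y) = h x \<otimes>\<^bsub>k\<^esub> h y" by (simp add: ring_of_type_algebra_def)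
    have "h (x + y) = ?m +>\<^bsub>S\<^esub> \<iota> (s + t)" unfolding st by (simp only: red_add[symmetric] hred)
    also have "\<iota> (s + t) = \<iota> s \<oplus>\<^bsub>S\<^esub> \<iota> t" by (simp flip: \<psi>_add)
    also have "?m +>\<^bsub>S\<^esub> \<dots> = h x \<oplus>\<^bsub>k\<^esub> h y" unfolding st hred by (rule ring_hom_add[OF hom]) auto
    finally show "h (x \<oplus>\<^bsub>?F\<^esub> y) = h x \<oplus>\<^bsub>k\<^esub> h y" by (simp add: ring_of_type_algebra_def)
  next
    have "h 1 = ?m +>\<^bsub>S\<^esub> \<iota> 1" using hred[of 1] by simp
    also have "\<dots> = \<one>\<^bsub>k\<^esub>" using ring_hom_one[OF hom] by (simp add: \<psi>_one)
    finally show "h \<one>\<^bsub>?F\<^esub> = \<one>\<^bsub>k\<^esub>" by (simp add: ring_of_type_algebra_def)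
  qed
  interpret hh: ring_hom_ring ?F k h by (rule hh)
  have K: "inj_on h (carrier ?F)" "subfield (h ` carrier ?F) k"
    using hh.img_is_subfield[OF F.carrier_is_subfield] k.one_not_zero by auto
  have hK: "h ` carrier ?F = range (\<lambda>s. ?m +>\<^bsub>S\<^esub> \<iota> s)"
  proof (intro equalityI subsetI)
    fix y assume "y \<in> range (\<lambda>s. ?m +>\<^bsub>S\<^esub> \<iota> s)"
    thus "y \<in> h ` carrier ?F" by (auto simp: ring_of_type_algebra_def simp flip: hred)
  qed (auto simp: h_def)
  have "card (h ` carrier ?F) = CARD('q)"
    using card_image[OF K(1)] by (simp add: ring_of_type_algebra_def)
  hence "k.dim (h ` carrier ?F) (carrier k) = d"
    by (intro k.dim_of_card[OF K(2) _ fin]) (simp_all add: ccard card ring_of_type_algebra_def)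
  thus ?thesis unfolding residue_degree_def Let_def k_def[symmetric] hK by (simp add: k_def)
qed

end

section \<open>Gorenstein orders and the local Euler factor\<close>

definition pair3 :: "'a::comm_ring_1 triple \<Rightarrow> 'a triple \<Rightarrow> 'a" where
  "pair3 = (\<lambda>(u1, u2, u3) (t1, t2, t3). u1 * t1 + u2 * t2 + u3 * t3)"

lemma pair3_simps [simp]: "pair3 (u1, u2, u3) (t1, t2, t3) = u1 * t1 + u2 * t2 + u3 * t3"
  by (simp add: pair3_def)

lemma pair3_add_left: "pair3 (u + u') t = pair3 u t + pair3 u' t"
  by (cases u; cases u'; cases t) (simp add: algebra_simps)

lemma pair3_add_right: "pair3 u (t + t') = pair3 u t + pair3 u t'"
  by (cases u; cases t'; cases t) (simp add: algebra_simps)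

lemma pair3_tscale: "pair3 u (tscale s t) = s * pair3 u t"
  by (cases u; cases t) (simp add: algebra_simps)

lemma pair3_ext: assumes "\<And>t. pair3 u t = pair3 u' t" shows "u = u'"
  using assms[of "(1, 0, 0)"] assms[of "(0, 1, 0)"] assms[of "(0, 0, 1)"] by (cases u; cases u') simp

text \<open>The transpose of the multiplication by \<open>z\<close>: the action of the ring on its dual in coordinates.\<close>

definition dact :: "'a::comm_ring_1 \<Rightarrow> 'a \<Rightarrow> 'a \<Rightarrow> 'a \<Rightarrow> 'a triple \<Rightarrow> 'a triple \<Rightarrow> 'a triple" where
  "dact A B C D z u = (pair3 u (cmul A B C D z (1, 0, 0)), pair3 u (cmul A B C D z (0, 1, 0)),
     pair3 u (cmul A B C D z (0, 0, 1)))"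

lemma pair3_dact: "pair3 (dact A B C D z u) t = pair3 u (cmul A B C D z t)"
  by (cases z; cases u; cases t) (simp add: dact_def cmul_def algebra_simps)

context form_order
begin

abbreviation "act \<equiv> dact A B C D"
abbreviation "dual \<equiv> dual_module E \<iota> R"

definition form :: "'q padic_int triple \<Rightarrow> 'e \<Rightarrow> 'q padic_int" where
  "form u = (\<lambda>x\<in>R. pair3 u (inv_into UNIV \<psi> x))"

lemma form_\<psi> [simp]: "form u (\<psi> t) = pair3 u t"
  by (simp add: form_def inv_f_f[OF inj])

lemma form_inj: "form u = form u' \<longleftrightarrow> u = u'"
proof
  assume "form u = form u'"
  hence "pair3 u t = pair3 u' t" for t using form_\<psi> by metis
  thus "u = u'" by (rule pair3_ext)
qed simp

lemma form_ext: "(\<lambda>x\<in>R. f x) = form u \<longleftrightarrow> (\<forall>t. f (\<psi> t) = pair3 u t)"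
proof
  assume eq: "(\<lambda>x\<in>R. f x) = form u"
  show "\<forall>t. f (\<psi> t) = pair3 u t"
  proof
    fix t
    have "f (\<psi> t) = (\<lambda>x\<in>R. f x) (\<psi> t)" by simp
    also have "\<dots> = pair3 u t" unfolding eq by simp
    finally show "f (\<psi> t) = pair3 u t" .
  qed
next
  assume eq: "\<forall>t. f (\<psi> t) = pair3 u t"
  show "(\<lambda>x\<in>R. f x) = form u"
    unfolding form_def by (rule restrict_ext) (use eq in \<open>auto simp: inv_f_f[OF inj]\<close>)
qed

lemma dual_carrier: "carrier dual = range form"
proof (intro equalityI subsetI)
  fix \<phi> assume "\<phi> \<in> carrier dual"
  hence \<phi>: "\<phi> \<in> extensional R" "\<And>s t. \<phi> (\<psi> s \<oplus> \<psi> t) = \<phi> (\<psi> s) + \<phi> (\<psi> t)"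
    "\<And>s t. \<phi> (\<iota> s \<otimes> \<psi> t) = s * \<phi> (\<psi> t)" by (auto simp: dual_module_def)
  let ?u = "(\<phi> (\<psi> (1, 0, 0)), \<phi> (\<psi> (0, 1, 0)), \<phi> (\<psi> (0, 0, 1)))"
  have u: "\<phi> (\<psi> t) = pair3 ?u t" for t
  proof (cases t)
    case (fields t1 t2 t3)
    have "t = pmul (t1, 0, 0) (1, 0, 0) + pmul (t2, 0, 0) (0, 1, 0) + pmul (t3, 0, 0) (0, 0, 1)"
      by (simp add: fields cmul_scalar)
    hence "\<phi> (\<psi> t) = t1 * \<phi> (\<psi> (1, 0, 0)) + t2 * \<phi> (\<psi> (0, 1, 0)) + t3 * \<phi> (\<psi> (0, 0, 1))"
      by (simp only: \<phi>(2)[folded \<psi>_add] \<phi>(3)[folded \<psi>_mult])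
    thus ?thesis by (simp add: fields mult.commute)
  qed
  have "restrict \<phi> R = form ?u" unfolding form_ext by (rule allI) (rule u)
  hence "\<phi> = form ?u" unfolding extensional_restrict[OF \<phi>(1)] .
  thus "\<phi> \<in> range form" by (rule range_eqI)
next
  fix \<phi> assume "\<phi> \<in> range form"
  then obtain u where u: "\<phi> = form u" by blast
  have "form u \<in> extensional R" by (simp add: form_def)
  moreover have "form u (\<psi> s \<oplus> \<psi> t) = form u (\<psi> s) + form u (\<psi> t)" for s t
    by (simp only: \<psi>_add[symmetric] form_\<psi> pair3_add_right)
  moreover have "form u (\<iota> s \<otimes> \<psi> t) = s * form u (\<psi> t)" for s t
    by (simp only: \<psi>_mult[symmetric] form_\<psi> cmul_scalar pair3_tscale)
  ultimately show "\<phi> \<in> carrier dual" by (auto simp: dual_module_def u)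
qed

lemma dual_add: "form u \<oplus>\<^bsub>dual\<^esub> form u' = form (u + u')"
proof -
  have "form u \<oplus>\<^bsub>dual\<^esub> form u' = (\<lambda>x\<in>R. form u x + form u' x)" by (simp add: dual_module_def)
  also have "\<dots> = form (u + u')" unfolding form_ext by (simp add: pair3_add_left)
  finally show ?thesis .
qed

lemma dual_smult: "\<psi> z \<odot>\<^bsub>dual\<^esub> form u = form (act z u)"
proof -
  have "\<psi> z \<odot>\<^bsub>dual\<^esub> form u = (\<lambda>x\<in>R. form u (\<psi> z \<otimes> x))" by (simp add: dual_module_def)
  also have "\<dots> = form (act z u)" unfolding form_ext by (simp add: pair3_dact flip: \<psi>_mult)
  finally show ?thesis .
qed

lemma act_mul: "act (pmul z s) u = act z (act s u)"
  by (rule pair3_ext) (simp only: pair3_dact, simp only: cmul_commute[of A B C D z s] cmul_assoc)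

lemma act_add: "act (z + z') u = act z u + act z' u"
  by (rule pair3_ext) (simp only: pair3_dact pair3_add_left cmul_add_left pair3_add_right)

text \<open>A generator with trivial annihilator makes the dual free of rank one.\<close>

lemma gorenstein_of_generator:
  assumes "\<And>u. \<exists>z. act z v = u" and inj_act: "\<And>z. act z v = 0 \<Longrightarrow> z = 0"
  shows "gorenstein_order E \<iota> R"
proof -
  define sol where "sol u = (SOME z. act z v = u)" for u
  have sol: "act (sol u) v = u" for u unfolding sol_def using someI_ex[OF assms(1)] .
  have uniq: "z = sol u" if z: "act z v = u" for z u
  proof -
    have "u = act (z - sol u) v + act (sol u) v" by (simp add: z flip: act_add)
    hence "act (z - sol u) v = 0" unfolding sol by simp
    from inj_act[OF this] show ?thesis by simp
  qed
  define unform where "unform = inv_into UNIV form"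
  have uf: "unform (form u) = u" for u unfolding unform_def
    by (rule inv_f_f) (simp add: inj_on_def form_inj)
  define i where "i \<phi> = (\<lambda>j\<in>{..<1::nat}. \<psi> (sol (unform \<phi>)))" for \<phi>
  define p where "p f = f 0 \<odot>\<^bsub>dual\<^esub> form v" for f :: "nat \<Rightarrow> 'e"
  let ?M = "free_module S 1"
  have cM: "carrier ?M = {..<1} \<rightarrow>\<^sub>E R" by (simp add: free_module_def)
  have "i \<in> module_homs S dual ?M" unfolding module_homs_def
  proof (intro CollectI conjI ballI)
    show "i \<in> carrier dual \<rightarrow> carrier ?M" unfolding cM i_def by auto
    fix x y assume "x \<in> carrier dual" "y \<in> carrier dual"
    then obtain u u' where uu: "x = form u" "y = form u'" unfolding dual_carrier by blast
    have "sol (u + u') = sol u + sol u'" by (rule uniq[symmetric]) (simp add: act_add sol)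
    thus "i (x \<oplus>\<^bsub>dual\<^esub> y) = i x \<oplus>\<^bsub>?M\<^esub> i y" unfolding uu dual_add
      by (simp add: i_def uf free_module_def \<psi>_add restrict_def fun_eq_iff)
  next
    fix s x assume "s \<in> carrier S" "x \<in> carrier dual"
    then obtain z u where zu: "s = \<psi> z" "x = form u" unfolding dual_carrier by auto
    have "sol (act z u) = pmul z (sol u)" by (rule uniq[symmetric]) (simp add: act_mul sol)
    thus "i (s \<odot>\<^bsub>dual\<^esub> x) = s \<odot>\<^bsub>?M\<^esub> i x" unfolding zu dual_smult
      by (simp add: i_def uf free_module_def \<psi>_mult restrict_def fun_eq_iff)
  qed
  moreover have "p \<in> module_homs S ?M dual" unfolding module_homs_def
  proof (intro CollectI conjI ballI)
    show "p \<in> carrier ?M \<rightarrow> carrier dual"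
    proof
      fix f assume "f \<in> carrier ?M"
      hence "f 0 \<in> R" unfolding cM by (simp add: PiE_iff)
      then obtain z where "f 0 = \<psi> z" by blast
      thus "p f \<in> carrier dual" unfolding p_def dual_carrier by (simp add: dual_smult)
    qed
    fix f g assume "f \<in> carrier ?M" "g \<in> carrier ?M"
    hence "f 0 \<in> R" "g 0 \<in> R" unfolding cM by (simp_all add: PiE_iff)
    then obtain z w where zw: "f 0 = \<psi> z" "g 0 = \<psi> w" by blast
    have "(f \<oplus>\<^bsub>?M\<^esub> g) 0 = \<psi> (z + w)" by (simp add: free_module_def zw \<psi>_add)
    thus "p (f \<oplus>\<^bsub>?M\<^esub> g) = p f \<oplus>\<^bsub>dual\<^esub> p g"
      unfolding p_def zw dual_smult dual_add by (simp only: dual_smult act_add)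
  next
    fix s f assume "s \<in> carrier S" "f \<in> carrier ?M"
    hence "s \<in> R" "f 0 \<in> R" unfolding cM by (simp_all add: PiE_iff)
    then obtain z w where zw: "s = \<psi> z" "f 0 = \<psi> w" by blast
    have "(s \<odot>\<^bsub>?M\<^esub> f) 0 = \<psi> (pmul z w)" by (simp add: free_module_def zw \<psi>_mult)
    thus "p (s \<odot>\<^bsub>?M\<^esub> f) = s \<odot>\<^bsub>dual\<^esub> p f"
      unfolding p_def zw dual_smult by (simp only: zw dual_smult act_mul)
  qed
  moreover have "p (i x) = x" if x: "x \<in> carrier dual" for x
  proof -
    obtain u where u: "x = form u" using x unfolding dual_carrier by blast
    show ?thesis unfolding p_def i_def u uf by (simp add: dual_smult sol)
  qed
  ultimately show ?thesis unfolding gorenstein_order_def fg_projective_def by blast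
qed

text \<open>The assumption says that the Gram matrix of the bilinear form \<open>(s, t) \<mapsto> v (s t)\<close> is invertible, so that
  the linear form \<open>v\<close> generates the dual. \<open>P\<close>, \<open>Q\<close> and \<open>T\<close> are the values of \<open>v\<close> at \<open>w\<^sup>2\<close>, \<open>w \<chi>\<close> and \<open>\<chi>\<^sup>2\<close>.\<close>

lemma gorenstein_of_unit_gram:
  fixes v1 v2 v3
  defines "P \<equiv> - (A * C * v1) - B * v2 + A * v3" and "Q \<equiv> - (A * D * v1)"
    and "T \<equiv> - (B * D * v1) - D * v2 + C * v3"
  assumes det: "v1 * (P * T - Q * Q) - v2 * (v2 * T - Q * v3) + v3 * (v2 * Q - P * v3) dvd 1"
  shows "gorenstein_order E \<iota> R"
proof (rule gorenstein_of_generator[of "(v1, v2, v3)"])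
  have act: "act (z1, z2, z3) (v1, v2, v3) =
      (v1 * z1 + v2 * z2 + v3 * z3, v2 * z1 + P * z2 + Q * z3, v3 * z1 + Q * z2 + T * z3)" for z1 z2 z3
    by (simp add: dact_def cmul_def P_def Q_def T_def algebra_simps)
  show "\<exists>z. act z (v1, v2, v3) = u" for u
    using cramer_exists[OF det, of "fst u" "fst (snd u)" "snd (snd u)"] act by (metis prod.collapse)
  show "z = 0" if "act z (v1, v2, v3) = 0" for z
  proof (cases z)
    case (fields z1 z2 z3)
    have "v1 * z1 + v2 * z2 + v3 * z3 = 0" "v2 * z1 + P * z2 + Q * z3 = 0" "v3 * z1 + Q * z2 + T * z3 = 0"
      using that unfolding fields act by (simp_all add: zero_prod_def)
    from cramer_unique[OF det this] show ?thesis by (simp add: fields zero_prod_def)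
  qed
qed

text \<open>In each case one of the linear forms \<open>\<chi>\<^sup>*\<close>, \<open>w\<^sup>*\<close>, \<open>w\<^sup>* + \<chi>\<^sup>*\<close> and \<open>1\<^sup>* + w\<^sup>* + \<chi>\<^sup>*\<close> has a Gram
  determinant that is a unit.\<close>

lemma gorenstein_if_primitive:
  assumes "A = 1 \<or> red A = 0 \<and> (red B \<noteq> 0 \<or> red C \<noteq> 0 \<or> red D \<noteq> 0)"
  shows "gorenstein_order E \<iota> R"
proof -
  note gram = gorenstein_of_unit_gram[unfolded padic_unit_iff]
  show ?thesis
  proof (cases "A = 1")
    case True
    show ?thesis by (rule gram[of 0 0 1]) (simp add: True)
  next
    case False
    hence A: "red A = 0" and BCD: "red B \<noteq> 0 \<or> red C \<noteq> 0 \<or> red D \<noteq> 0" using assms by auto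
    show ?thesis
    proof (cases "red D = 0")
      case D: False
      show ?thesis by (rule gram[of 0 1 0]) (simp add: A D)
    next
      case D: True
      show ?thesis
      proof (cases "red B = red C")
        case False
        show ?thesis by (rule gram[of 0 1 1]) (use False in \<open>simp add: A D\<close>)
      next
        case True
        show ?thesis by (rule gram[of 1 1 1]) (use BCD True D in \<open>simp add: A D\<close>)
      qed
    qed
  qed
qed

text \<open>If the form vanishes modulo \<open>q\<close>, every homomorphism from the dual to the ring sends the linear form
  \<open>1\<^sup>*\<close> to a multiple of \<open>q\<close>, because \<open>1\<^sup>* = w w\<^sup>* + B w\<^sup>*\<close> and the image of \<open>w\<^sup>*\<close> has a first coordinate
  divisible by \<open>q\<close>. If the dual were projective, \<open>1\<^sup>*\<close> itself would be a multiple of \<open>q\<close>, which it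
  is not.\<close>

lemma not_gorenstein:
  assumes r: "red A = 0" "red B = 0" "red C = 0" "red D = 0"
  shows "\<not> gorenstein_order E \<iota> R"
proof
  assume "gorenstein_order E \<iota> R"
  then obtain n i p where i: "i \<in> module_homs S dual (free_module S n)"
    and p: "p \<in> module_homs S (free_module S n) dual" and pi: "\<And>x. x \<in> carrier dual \<Longrightarrow> p (i x) = x"
    unfolding gorenstein_order_def fg_projective_def by blast
  let ?M = "free_module S n"
  have cM: "carrier ?M = {..<n} \<rightarrow>\<^sub>E R" by (simp add: free_module_def)
  have ic: "i (form u) \<in> {..<n} \<rightarrow>\<^sub>E R" for u
    using i unfolding module_homs_def cM dual_carrier by auto
  have iadd: "i (form (u + u')) = i (form u) \<oplus>\<^bsub>?M\<^esub> i (form u')" for u u'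
    using i unfolding module_homs_def dual_carrier by (auto simp flip: dual_add)
  have ismult: "i (form (act z u)) = \<psi> z \<odot>\<^bsub>?M\<^esub> i (form u)" for z u
    using i unfolding module_homs_def dual_carrier by (auto simp flip: dual_smult)
  define w where "w j u = inv_into UNIV \<psi> (i (form u) j)" for j u
  have w: "i (form u) j = \<psi> (w j u)" if "j < n" for j u
    using ic[of u] that unfolding w_def by (auto simp: PiE_iff f_inv_into_f)
  have wadd: "w j (u + u') = w j u + w j u'" if j: "j < n" for j u u'
  proof -
    have "\<psi> (w j (u + u')) = \<psi> (w j u + w j u')"
      using j by (simp only: w[OF j, symmetric] iadd) (simp add: free_module_def w \<psi>_add)
    thus ?thesis by (simp add: \<psi>_eq_iff)
  qed
  have wact: "w j (act z u) = pmul z (w j u)" if j: "j < n" for j z u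
  proof -
    have "\<psi> (w j (act z u)) = \<psi> (pmul z (w j u))"
      using j by (simp only: w[OF j, symmetric] ismult) (simp add: free_module_def w \<psi>_mult)
    thus ?thesis by (simp add: \<psi>_eq_iff)
  qed
  have div: "red3 (w j (1, 0, 0)) = 0" if j: "j < n" for j
  proof -
    obtain x1 x2 x3 where x: "w j (0, 1, 0) = (x1, x2, x3)" by (cases "w j (0, 1, 0)")
    have "act (0, 0, 1) (0, 1, 0) = act (- D, 0, 0) (0, 0, 1)"
      by (simp add: dact_def cmul_def)
    hence "pmul (0, 0, 1) (x1, x2, x3) = pmul (- D, 0, 0) (w j (0, 0, 1))"
      using wact[OF j] x by metis
    hence "red3 (pmul (0, 0, 1) (x1, x2, x3)) = red3 (pmul (- D, 0, 0) (w j (0, 0, 1)))" by (rule arg_cong)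
    hence x1: "red x1 = 0" unfolding red3_cmul by (cases "w j (0, 0, 1)") (simp add: r cmul_def)
    have "act (0, 1, 0) (0, 1, 0) + act (B, 0, 0) (0, 1, 0) = (1, 0, 0)"
      by (simp add: dact_def cmul_def)
    hence "w j (1, 0, 0) = pmul (0, 1, 0) (x1, x2, x3) + pmul (B, 0, 0) (x1, x2, x3)"
      using wact[OF j] wadd[OF j] x by metis
    thus ?thesis unfolding red3_add red3_cmul by (simp add: r cmul_def x1 red3_add red3_cmul zero_prod_def)
  qed
  have "\<exists>t. w j (1, 0, 0) = tscale \<varpi> t" if "j < n" for j using red3_eq_0[OF div[OF that]] .
  then obtain t where t: "\<And>j. j < n \<Longrightarrow> w j (1, 0, 0) = tscale \<varpi> (t j)" by metis
  define f where "f = (\<lambda>j\<in>{..<n}. \<psi> (t j))"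
  have fM: "f \<in> carrier ?M" unfolding cM f_def by auto
  have "i (form (1, 0, 0)) = \<psi> (\<varpi>, 0, 0) \<odot>\<^bsub>?M\<^esub> f"
  proof (rule PiE_ext[OF ic])
    show "\<psi> (\<varpi>, 0, 0) \<odot>\<^bsub>?M\<^esub> f \<in> {..<n} \<rightarrow>\<^sub>E R"
      by (auto simp: free_module_def f_def simp flip: \<psi>_mult)
    fix j assume "j \<in> {..<n}"
    thus "i (form (1, 0, 0)) j = (\<psi> (\<varpi>, 0, 0) \<odot>\<^bsub>?M\<^esub> f) j"
      by (simp add: w t free_module_def f_def cmul_scalar flip: \<psi>_mult)
  qed
  moreover have "p (i (form (1, 0, 0))) = form (1, 0, 0)" by (rule pi) (simp add: dual_carrier)
  moreover have "p (\<psi> (\<varpi>, 0, 0) \<odot>\<^bsub>?M\<^esub> f) = \<psi> (\<varpi>, 0, 0) \<odot>\<^bsub>dual\<^esub> p f"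
    using p fM unfolding module_homs_def by auto
  moreover obtain u where "p f = form u"
    using p fM unfolding module_homs_def dual_carrier by blast
  ultimately have "form (1, 0, 0) = form (act (\<varpi>, 0, 0) u)" by (simp add: dual_smult)
  hence "pair3 (1, 0, 0) (1, 0, 0) = pair3 (act (\<varpi>, 0, 0) u) (1, 0, 0)" unfolding form_inj by simp
  hence "1 = \<varpi> * pair3 u (1, 0, 0)" by (simp add: pair3_dact cmul_scalar pair3_tscale del: tscale_simps)
  hence "\<varpi> dvd (1 :: 'q padic_int)" by (rule dvdI)
  thus False unfolding red_eq_0_iff[symmetric] by simp
qed

end

text \<open>The product of \<open>1 / (1 - X\<^sup>f)\<close> over the residue degrees \<open>f\<close> of the maximal ideals. The middle case is a
  product of the base field and its quadratic extension.\<close>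

definition cubic_euler :: "'k::{field, finite} \<Rightarrow> 'k \<Rightarrow> 'k \<Rightarrow> 'k \<Rightarrow> real fps" where
  "cubic_euler A B C D =
    (if points A B C D = {} then inverse (1 - fps_X ^ 3)
     else if \<exists>h p. points A B C D = {h} \<and> cubic_algebra.eigen A B C D h p
       then inverse (1 - fps_X) * inverse (1 - fps_X ^ 2)
     else inverse (1 - fps_X) ^ card (points A B C D))"

definition local_factor :: "'k::{field, finite} \<Rightarrow> 'k \<Rightarrow> 'k \<Rightarrow> 'k \<Rightarrow> real fps" where
  "local_factor A B C D = (1 - fps_X) * ((if A = 0 \<and> B = 0 \<and> C = 0 \<and> D = 0
     then 1 + of_nat CARD('k) * fps_X else 1) * cubic_euler A B C D)"

context form_order
begin

lemma residue_degree_Ker: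
  assumes "h \<in> fib.pts" shows "residue_degree E \<iota> R (\<psi> ` (red3 -` fib.Ker h)) = 1"
proof (rule residue_degree_eq[of _ "ev h"])
  show "fib.amax (fib.Ker h)" by (rule fib.amax_Ker[OF assms])
  show "surj (ev h)" by (rule surjI[where f = "\<lambda>s. (s, 0, 0)"]) (cases h, simp)
qed (simp_all add: ev_add fib.Ker_def)

lemma euler_product:
  "(\<Prod>\<mm> | maximalideal \<mm> S. inverse (1 - fps_X ^ residue_degree E \<iota> R \<mm>)) =
    cubic_euler (red A) (red B) (red C) (red D)"
proof -
  let ?J = "\<lambda>I. \<psi> ` (red3 -` I)"
  have eq: "(\<Prod>\<mm> | maximalideal \<mm> S. inverse (1 - fps_X ^ residue_degree E \<iota> R \<mm>)) =
      (\<Prod>I | fib.amax I. inverse (1 - fps_X ^ residue_degree E \<iota> R (?J I) :: real fps))"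
    unfolding maximalideals
    by (rule prod.reindex_cong[OF inj_on_subset[OF inj_image_vimage]]) auto
  consider (none) "fib.pts = {}" | (eigen) h p where "fib.pts = {h}" "fib.eigen h p"
    | (many) "fib.pts \<noteq> {}" "\<And>h p. fib.pts = {h} \<Longrightarrow> \<not> fib.eigen h p" by blast
  thus ?thesis
  proof cases
    case none
    note mx = fib.maximal_ideals_no_point[OF none]
    have "residue_degree E \<iota> R (?J {0}) = 3"
    proof (rule residue_degree_eq[of _ "\<lambda>z. z"])
      show "fib.amax {0}" using mx by blast
      show "CARD('q mod_ring triple) = CARD('q) ^ 3" by (simp add: power3_eq_cube)
    qed auto
    thus ?thesis unfolding eq mx by (simp add: cubic_euler_def none)
  next
    case eigen
    note mx = fib.maximal_ideals_eigen[OF eigen]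
    have "residue_degree E \<iota> R (?J (fib.line p)) = 2"
    proof (rule residue_degree_eq[of _ "fib.line_residue h p"])
      show "fib.amax (fib.line p)" using mx by blast
      show "CARD('q mod_ring \<times> 'q mod_ring) = CARD('q) ^ 2" by (simp add: power2_eq_square)
    qed (rule fib.line_residue[OF eigen(2)])+
    moreover have "residue_degree E \<iota> R (?J (fib.Ker h)) = 1" using eigen by (intro residue_degree_Ker) simp
    moreover have "\<exists>h' p'. fib.pts = {h'} \<and> fib.eigen h' p'" using eigen by blast
    ultimately show ?thesis unfolding eq mx using fib.Ker_not_line[of h p] eigen(1)
      by (simp add: cubic_euler_def)
  next
    case many
    have mx: "{I. fib.amax I} = fib.Ker ` fib.pts"
      by (rule fib.maximal_ideals_points[OF many(1)]) (rule many(2))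
    have "(\<Prod>I\<in>fib.Ker ` fib.pts. inverse (1 - fps_X ^ residue_degree E \<iota> R (?J I) :: real fps)) =
       (\<Prod>h\<in>fib.pts. inverse (1 - fps_X ^ residue_degree E \<iota> R (?J (fib.Ker h))))"
      by (rule prod.reindex_cong[OF inj_on_subset[OF fib.inj_Ker]]) auto
    also have "\<dots> = (\<Prod>h\<in>fib.pts. inverse (1 - fps_X))"
      by (rule prod.cong) (simp_all add: residue_degree_Ker)
    also have "\<dots> = cubic_euler (red A) (red B) (red C) (red D)"
      using many by (auto simp: cubic_euler_def)
    finally show ?thesis unfolding eq mx .
  qed
qed

lemma \<kappa>_eq:
  assumes "A = 1 \<or> red A = 0"
  shows "\<kappa> E \<iota> R v = fps_nth (local_factor (red A) (red B) (red C) (red D)) v"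
proof -
  have "gorenstein_order E \<iota> R \<longleftrightarrow> \<not> (red A = 0 \<and> red B = 0 \<and> red C = 0 \<and> red D = 0)"
    using gorenstein_if_primitive not_gorenstein assms by auto
  thus ?thesis unfolding \<kappa>_def C_series_def euler_product local_factor_def by simp
qed

end

section \<open>Coordinates on the cubic algebra\<close>

text \<open>Elements of the algebra are written in the basis \<open>1, X, X\<^sup>2 - a X + b\<close>, in which the multiplication
  is that of the form \<open>(1, - a, b, - c)\<close>.\<close>

abbreviation (input) j :: "'q::prime_card padic_int \<Rightarrow> 'q padic_int fract" where "j \<equiv> to_fract"

abbreviation j3 :: "'q::prime_card padic_int triple \<Rightarrow> 'q padic_int fract triple" where
  "j3 \<equiv> (\<lambda>(x, y, z). (j x, j y, j z))"

abbreviation kmul ::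
    "'q::prime_card padic_int \<Rightarrow> 'q padic_int \<times> 'q padic_int \<Rightarrow> 'q padic_int fract triple \<Rightarrow>
     'q padic_int fract triple \<Rightarrow> 'q padic_int fract triple" where
  "kmul c ab \<equiv> cmul 1 (- j (fst ab)) (j (snd ab)) (- j c)"

lemma map_poly_to_fract_pCons:
  "map_poly to_fract (pCons s p) = pCons (to_fract s) (map_poly to_fract p)"
  by (rule poly_eqI) (simp add: coeff_map_poly coeff_pCons split: nat.splits)

definition coset :: "'q::prime_card padic_int \<Rightarrow> 'q padic_int \<times> 'q padic_int \<Rightarrow>
    'q padic_int fract poly \<Rightarrow> 'q padic_int fract poly set" where
  "coset c ab p = cubic_ideal c ab +>\<^bsub>padic_poly_ring\<^esub> p"

definition coord :: "'q::prime_card padic_int \<Rightarrow> 'q padic_int \<times> 'q padic_int \<Rightarrow>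
    'q padic_int fract triple \<Rightarrow> 'q padic_int fract poly set" where
  "coord c ab = (\<lambda>(k1, k2, k3). coset c ab [:k1 + j (snd ab) * k3, k2 - j (fst ab) * k3, k3:])"

context
  fixes c :: "'q::prime_card padic_int" and ab :: "'q padic_int \<times> 'q padic_int"
begin

private abbreviation "\<Phi> \<equiv> map_poly to_fract (cubic_poly c ab)"

lemma cubic_poly_fract: "\<Phi> = [:- j c, j (snd ab), - j (fst ab), 1:]"
  by (cases ab) (simp add: cubic_poly_def map_poly_to_fract_pCons)

lemma padic_poly_cring: "cring (padic_poly_ring :: 'q padic_int fract poly ring)"
  by (rule cring_from_type_algebra)

lemma cubic_ideal_eq: "cubic_ideal c ab = range (\<lambda>p. p * \<Phi>)"
  by (auto simp: cubic_ideal_def cgenideal_def ring_of_type_algebra_def)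

lemma ideal_cubic: "ideal (cubic_ideal c ab) (padic_poly_ring :: 'q padic_int fract poly ring)"
  unfolding cubic_ideal_def by (rule cring.cgenideal_ideal[OF padic_poly_cring])
     (simp add: ring_of_type_algebra_def)

lemma coset_hom: "coset c ab \<in> Ring.ring_hom padic_poly_ring (cubic_alg c ab)"
  using ideal.rcos_ring_hom[OF ideal_cubic] by (simp add: coset_def[abs_def] cubic_alg_def)

lemma coset_add: "coset c ab (p + p') = coset c ab p \<oplus>\<^bsub>cubic_alg c ab\<^esub> coset c ab p'"
  using ring_hom_add[OF coset_hom, of p p'] by (simp add: ring_of_type_algebra_def)
lemma coset_mult: "coset c ab (p * p') = coset c ab p \<otimes>\<^bsub>cubic_alg c ab\<^esub> coset c ab p'"
  using ring_hom_mult[OF coset_hom, of p p'] by (simp add: ring_of_type_algebra_def)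
lemma coset_one: "coset c ab 1 = \<one>\<^bsub>cubic_alg c ab\<^esub>"
  using ring_hom_one[OF coset_hom] by (simp add: ring_of_type_algebra_def)

lemma coset_eq_iff: "coset c ab p = coset c ab p' \<longleftrightarrow> \<Phi> dvd p - p'"
proof -
  let ?P = "padic_poly_ring :: 'q padic_int fract poly ring"
  interpret P: cring ?P by (rule padic_poly_cring)
  have "p' \<oplus>\<^bsub>?P\<^esub> (- p') = \<zero>\<^bsub>?P\<^esub>" by (simp add: ring_of_type_algebra_def)
  hence "\<ominus>\<^bsub>?P\<^esub> p' = - p'"
    by (intro P.minus_equality) (simp_all add: ring_of_type_algebra_def)
  hence m: "p \<ominus>\<^bsub>?P\<^esub> p' = p - p'" by (simp add: a_minus_def) (simp add: ring_of_type_algebra_def)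
  have "coset c ab p = coset c ab p' \<longleftrightarrow> p \<ominus>\<^bsub>?P\<^esub> p' \<in> cubic_ideal c ab"
    unfolding coset_def by (rule P.quotient_eq_iff_same_a_r_cos[OF ideal_cubic, symmetric])
      (simp_all add: ring_of_type_algebra_def)
  also have "\<dots> \<longleftrightarrow> \<Phi> dvd p - p'" unfolding m cubic_ideal_eq by (auto simp: dvd_def mult.commute)
  finally show ?thesis .
qed

lemma carrier_cubic_alg: "carrier (cubic_alg c ab) = range (coset c ab)"
  unfolding cubic_alg_def FactRing_def A_RCOSETS_def' coset_def
  by (auto simp: ring_of_type_algebra_def)

lemma cring_cubic_alg: "cring (cubic_alg c ab)"
  unfolding cubic_alg_def by (rule ideal.quotient_is_cring[OF ideal_cubic padic_poly_cring])

lemma degree_\<Phi>: "Polynomial.degree \<Phi> = 3" unfolding cubic_poly_fract by simp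

lemma coord_add: "coord c ab (k + l) = coord c ab k \<oplus>\<^bsub>cubic_alg c ab\<^esub> coord c ab l"
  by (cases k; cases l) (simp add: coord_def algebra_simps flip: coset_add)

lemma coord_mult: "coord c ab (kmul c ab k l) = coord c ab k \<otimes>\<^bsub>cubic_alg c ab\<^esub> coord c ab l"
proof (cases k; cases l)
  fix k1 k2 k3 l1 l2 l3 assume [simp]: "k = (k1, k2, k3)" "l = (l1, l2, l3)"
  obtain a b where [simp]: "ab = (a, b)" by (cases ab)
  let ?p = "[:k1 + j b * k3, k2 - j a * k3, k3:]" and ?r = "[:l1 + j b * l3, l2 - j a * l3, l3:]"
  obtain m1 m2 m3 where m: "kmul c ab k l = (m1, m2, m3)" by (cases "kmul c ab k l")
  have "?p * ?r - [:m1 + j b * m3, m2 - j a * m3, m3:] =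
      \<Phi> * [:k3 * l2 + k2 * l3 - j a * k3 * l3, k3 * l3:]"
    using m unfolding cubic_poly_fract by (simp add: cmul_def) (auto simp: algebra_simps)
  hence "\<Phi> dvd ?p * ?r - [:m1 + j b * m3, m2 - j a * m3, m3:]" by (rule dvdI)
  hence "coset c ab (?p * ?r) = coset c ab [:m1 + j b * m3, m2 - j a * m3, m3:]"
    by (simp only: coset_eq_iff)
  thus ?thesis unfolding m by (simp only: coord_def coset_mult prod.case) (simp add: coset_mult)
qed

lemma coord_one: "coord c ab (1, 0, 0) = \<one>\<^bsub>cubic_alg c ab\<^esub>"
  by (simp add: coord_def coset_one[symmetric] one_pCons)

lemma coord_inj: "inj (coord c ab)"
proof (rule injI)
  fix k l assume eq: "coord c ab k = coord c ab l"
  obtain k1 k2 k3 l1 l2 l3 where kl: "k = (k1, k2, k3)" "l = (l1, l2, l3)" by (cases k; cases l)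
  let ?d = "[:k1 + j (snd ab) * k3, k2 - j (fst ab) * k3, k3:] - [:l1 + j (snd ab) * l3, l2 - j (fst ab) * l3, l3:]"
  have "\<Phi> dvd ?d" using eq by (simp only: kl coord_def prod.case coset_eq_iff)
  moreover have "Polynomial.degree ?d < 3" by (rule degree_lessI) (auto simp: coeff_pCons split: nat.splits)
  ultimately have "?d = 0" using degree_\<Phi> dvd_imp_degree_le[of \<Phi> ?d] by auto
  thus "k = l" by (auto simp: kl)
qed

lemma range_coord: "range (coord c ab) = carrier (cubic_alg c ab)"
proof (intro equalityI subsetI)
  fix y assume "y \<in> carrier (cubic_alg c ab)"
  then obtain p where p: "y = coset c ab p" unfolding carrier_cubic_alg by blast
  define r where "r = p mod \<Phi>"
  have "\<Phi> \<noteq> 0" using degree_\<Phi> by auto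
  hence "Polynomial.degree r < 3" using degree_mod_less[of \<Phi> p] degree_\<Phi> by (auto simp: r_def)
  hence r: "r = [:Polynomial.coeff r 0, Polynomial.coeff r 1, Polynomial.coeff r 2:]"
    by (intro poly_eqI) (auto simp: coeff_pCons coeff_eq_0 numeral_2_eq_2 split: nat.splits)
  have "\<Phi> dvd p - r" by (simp add: r_def minus_mod_eq_mult_div)
  hence "y = coset c ab r" unfolding p by (simp only: coset_eq_iff)
  also have "\<dots> = coord c ab (Polynomial.coeff r 0 - j (snd ab) * Polynomial.coeff r 2, Polynomial.coeff r 1 + j (fst ab) * Polynomial.coeff r 2, Polynomial.coeff r 2)"
    by (subst r) (simp add: coord_def)
  finally show "y \<in> range (coord c ab)" by (rule range_eqI)
qed (auto simp: coord_def carrier_cubic_alg)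

lemma alg_class_coset: "alg_class c ab f = coset c ab (map_poly to_fract f)"
  by (simp add: alg_class_def coset_def)

lemma alg_scalar_coord: "alg_scalar c ab s = coord c ab (j s, 0, 0)"
  by (simp add: alg_scalar_def alg_class_coset coord_def map_poly_to_fract_pCons)

lemma monogenic_coord: "monogenic_order c ab = coord c ab ` range j3"
proof (intro equalityI subsetI)
  fix y assume "y \<in> monogenic_order c ab"
  then obtain f where f: "y = alg_class c ab f" unfolding monogenic_order_def by blast
  define g where "g = cubic_poly c ab"
  have g: "Polynomial.degree g = 3" "Polynomial.lead_coeff g = 1" by (cases ab, simp add: g_def cubic_poly_def)+
  have g0: "g \<noteq> 0" using g by auto
  obtain h r where hr: "pseudo_divmod f g = (h, r)" by (cases "pseudo_divmod f g")
  from pseudo_divmod[OF g0 hr] have fr: "f = g * h + r" and dr: "r = 0 \<or> Polynomial.degree r < 3"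
    using g by simp_all
  have r: "r = [:Polynomial.coeff r 0, Polynomial.coeff r 1, Polynomial.coeff r 2:]"
    using dr by (intro poly_eqI) (auto simp: coeff_pCons coeff_eq_0 numeral_2_eq_2 split: nat.splits)
  have "map_poly to_fract f - map_poly to_fract r = \<Phi> * map_poly to_fract h"
    unfolding fr g_def by (simp add: hom_distribs)
  hence "y = coset c ab (map_poly to_fract r)" unfolding f alg_class_coset coset_eq_iff by simp
  also have "\<dots> = coord c ab (j3 (Polynomial.coeff r 0 - snd ab * Polynomial.coeff r 2, Polynomial.coeff r 1 + fst ab * Polynomial.coeff r 2, Polynomial.coeff r 2))"
    by (subst r) (simp add: coord_def map_poly_to_fract_pCons)
  finally show "y \<in> coord c ab ` range j3" by blast
next
  fix y assume "y \<in> coord c ab ` range j3"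
  then obtain s1 s2 s3 where "y = coord c ab (j s1, j s2, j s3)" by auto
  also have "\<dots> = alg_class c ab [:s1 + snd ab * s3, s2 - fst ab * s3, s3:]"
    by (simp add: alg_class_coset coord_def map_poly_to_fract_pCons)
  finally show "y \<in> monogenic_order c ab" by (simp add: monogenic_order_def)
qed

end

section \<open>Orders in normalised position\<close>

lemma j_eq_iff: "to_fract x = to_fract y \<longleftrightarrow> x = y" by (metis to_fract_eq_iff)

lemma j_power: "j (x ^ k) = j x ^ k" by (induction k) simp_all
lemma j_of_nat: "j (of_nat k) = of_nat k" by (induction k) simp_all
lemma j_numeral: "j (numeral k) = numeral k" using j_of_nat[of "numeral k"] by simp
lemmas j_hom = to_fract_add to_fract_mult to_fract_diff to_fract_uminus to_fract_0 to_fract_1 j_power j_numeral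

lemma unif_power_j_nonzero [simp]: "to_fract (of_nat CARD('q)) \<noteq> (0 :: 'q::prime_card padic_int fract)"
  by simp

lemma fract_cases:
  obtains (int) x where "v = j (x :: 'q::prime_card padic_int)"
    | (frac) u k where "v = j u / j (\<varpi> ^ k)" "\<not> \<varpi> dvd (u :: 'q padic_int)"
proof (cases "v = 0")
  case True
  thus ?thesis using int[of 0] by simp
next
  case False
  obtain x y where xy: "v = j x / j y" "y \<noteq> 0" by (metis Fract_cases Fract_conv_to_fract)
  have "x \<noteq> 0" using False xy by auto
  obtain u where u: "x = \<varpi> ^ padic_val x * u" "\<not> \<varpi> dvd u" by (rule padic_factor[OF \<open>x \<noteq> 0\<close>])
  obtain w where w: "y = \<varpi> ^ padic_val y * w" "\<not> \<varpi> dvd w" by (rule padic_factor[OF xy(2)])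
  let ?k = "padic_val x" and ?l = "padic_val y"
  have "w dvd 1" using w(2) by (simp add: padic_unit_iff red_eq_0_iff)
  then obtain w' where w': "1 = w * w'" by (elim dvdE)
  have jw: "j w * j w' = 1" by (metis w' to_fract_mult to_fract_1)
  hence jw0: "j w \<noteq> 0" by auto
  have inv: "1 / j w = j w'" using jw jw0 by (simp add: field_simps)
  have nd: "\<not> \<varpi> dvd u * w'"
    using u(2) w' unfolding red_eq_0_iff[symmetric] by (metis mult_eq_0_iff red_1 red_mult zero_neq_one)
  have "v = (j (\<varpi> ^ ?k) * j u) / (j (\<varpi> ^ ?l) * j w)"
    by (subst xy(1), subst u(1), subst w(1)) (simp only: to_fract_mult)
  also have "\<dots> = j (\<varpi> ^ ?k) / j (\<varpi> ^ ?l) * (j u * (1 / j w))" by simp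
  finally have v: "v = j (\<varpi> ^ ?k) / j (\<varpi> ^ ?l) * j (u * w')" by (simp only: inv to_fract_mult)
  show ?thesis
  proof (cases "?l \<le> ?k")
    case True
    then obtain m where m: "?k = ?l + m" using le_Suc_ex by blast
    have "v = j (\<varpi> ^ m * (u * w'))" unfolding v m power_add to_fract_mult by simp
    thus ?thesis by (rule int)
  next
    case False
    then obtain m where m: "?l = ?k + m" using le_Suc_ex nat_le_linear by blast
    have "v = j (u * w') / j (\<varpi> ^ m)" unfolding v m power_add to_fract_mult by simp
    thus ?thesis using nd by (rule frac)
  qed
qed

text \<open>The \<open>q\<close>-adic integers are a discrete valuation ring, so that a fractional ideal with bounded
  denominators that contains \<open>1\<close> is generated by a power of \<open>1 / q\<close>.\<close>

lemma fract_submodule: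
  fixes V :: "'q::prime_card padic_int fract set"
  assumes scal: "\<And>s v. v \<in> V \<Longrightarrow> j s * v \<in> V" and one: "1 \<in> V"
    and bd: "\<And>v. v \<in> V \<Longrightarrow> j d * v \<in> range j" and d: "d \<noteq> 0"
  obtains i where "V = {v. j (\<varpi> ^ i) * v \<in> range j}" "1 / j (\<varpi> ^ i) \<in> V"
proof -
  let ?P = "\<lambda>i. 1 / j (\<varpi> ^ i) \<in> V"
  have "i \<le> padic_val d" if P: "?P i" for i
  proof -
    obtain s where "j d * (1 / j (\<varpi> ^ i)) = j s" using bd[OF P] by blast
    hence "j d = j (\<varpi> ^ i * s)" by (simp add: field_simps)
    hence "d = \<varpi> ^ i * s" by (simp only: j_eq_iff)
    hence "\<varpi> ^ i dvd d" by simp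
    thus ?thesis by (simp only: unif_power_dvd_padic_val[OF d])
  qed
  moreover have "?P 0" using one by simp
  ultimately obtain i where i: "?P i" "\<And>k. ?P k \<Longrightarrow> k \<le> i"
    using Nat.ex_has_greatest_nat[of ?P 0 "padic_val d"] by metis
  have "v \<in> V \<longleftrightarrow> j (\<varpi> ^ i) * v \<in> range j" for v
  proof
    assume v: "v \<in> V"
    show "j (\<varpi> ^ i) * v \<in> range j"
    proof (cases v rule: fract_cases)
      case (int x) thus ?thesis by (auto simp flip: to_fract_mult)
    next
      case (frac u k)
      have "u dvd 1" using frac(2) by (simp add: padic_unit_iff red_eq_0_iff)
      then obtain u' where "1 = u' * u" by (auto elim!: dvdE simp: mult.commute)
      hence u': "j u' * j u = 1" by (metis to_fract_1 to_fract_mult)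
      have "j u' * v = 1 / j (\<varpi> ^ k)" unfolding frac(1) using u' by simp
      hence "k \<le> i" using scal[OF v, of u'] i(2) by simp
      then obtain m where m: "i = k + m" using le_Suc_ex by blast
      have "j (\<varpi> ^ i) * v = j (\<varpi> ^ m * u)" unfolding frac(1) m power_add to_fract_mult by simp
      thus ?thesis by (rule range_eqI)
    qed
  next
    assume "j (\<varpi> ^ i) * v \<in> range j"
    then obtain s where s: "j (\<varpi> ^ i) * v = j s" by blast
    have "j (\<varpi> ^ i) \<noteq> 0" by simp
    hence "v = j s * (1 / j (\<varpi> ^ i))" using s by (simp add: field_simps)
    thus "v \<in> V" using scal[OF i(1)] by simp
  qed
  hence "V = {v. j (\<varpi> ^ i) * v \<in> range j}" by blast
  thus ?thesis using i(1) by (rule that)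
qed

subsection \<open>The family of orders\<close>

text \<open>The three left hand sides are \<open>\<Phi>''(\<tau>) / 2\<close>, \<open>\<Phi>'(\<tau>)\<close> and \<open>\<Phi>(\<tau>)\<close>. The form \<open>(q\<^sup>n, B, C, D)\<close> arises from
  \<open>\<Phi>(\<tau> + q\<^sup>i Z)\<close> by dividing out powers of \<open>q\<close>.\<close>

definition admissible :: "'q::prime_card padic_int \<Rightarrow> 'q padic_int \<times> 'q padic_int \<Rightarrow> nat \<Rightarrow> nat \<Rightarrow>
    'q padic_int \<Rightarrow> 'q padic_int \<Rightarrow> 'q padic_int \<Rightarrow> 'q padic_int \<Rightarrow> bool" where
  "admissible c ab i n \<tau> B C D \<longleftrightarrow>
     3 * \<tau> - fst ab = \<varpi> ^ i * B \<and>
     3 * \<tau>\<^sup>2 - 2 * fst ab * \<tau> + snd ab = \<varpi> ^ (2 * i + n) * C \<and>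
     \<tau> ^ 3 - fst ab * \<tau>\<^sup>2 + snd ab * \<tau> - c = \<varpi> ^ (3 * i + 2 * n) * D"

text \<open>Coordinates of \<open>s1 + s2 w + s3 \<chi>\<close> in the basis \<open>1, X, X\<^sup>2 - a X + b\<close>, where \<open>w = (X - \<tau>) / q\<^sup>i\<close>
  and \<open>q\<^sup>n \<chi> = w\<^sup>2 + B w + q\<^sup>n C\<close>.\<close>

definition frame :: "nat \<Rightarrow> nat \<Rightarrow> 'q::prime_card padic_int \<Rightarrow> 'q padic_int \<Rightarrow>
    'q padic_int triple \<Rightarrow> 'q padic_int fract triple" where
  "frame i n \<tau> B = (\<lambda>(s1, s2, s3).
     let u = j s2 / j (\<varpi> ^ i); w = j s3 / j (\<varpi> ^ (2 * i + n)) in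
     (j s1 - j \<tau> * u + (j (\<varpi> ^ i) * j B * j \<tau> - 2 * (j \<tau>)\<^sup>2) * w, u + j \<tau> * w, w))"

lemma frame_add: "frame i n \<tau> B (s + t) = frame i n \<tau> B s + frame i n \<tau> B t"
  by (cases s; cases t) (simp add: frame_def Let_def add_divide_distrib algebra_simps)

lemma frame_one: "frame i n \<tau> B (1, 0, 0) = (1, 0, 0)"
  by (simp add: frame_def)

lemma frame_inj: "inj (frame i n \<tau> B)"
  by (rule injI) (auto simp: frame_def Let_def j_eq_iff split: prod.splits)

lemma frame_mult_aux:
  fixes e g \<tau> B C D :: "'a::comm_ring_1"
  assumes a: "a = 3 * \<tau> - e * B" and b: "b = e\<^sup>2 * g * C - 3 * \<tau>\<^sup>2 + 2 * a * \<tau>"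
    and c: "c = \<tau> ^ 3 - a * \<tau>\<^sup>2 + b * \<tau> - e ^ 3 * g\<^sup>2 * D"
    and F: "F = (\<lambda>(s1, u, w). (s1 - \<tau> * u + (e * B * \<tau> - 2 * \<tau>\<^sup>2) * w, u + \<tau> * w, w))"
  shows "cmul 1 (- a) b (- c) (F (s1, u2, u3)) (F (t1, w2, w3)) =
    F (s1 * t1 - e\<^sup>2 * g * C * (u2 * w2) - e ^ 3 * g\<^sup>2 * D * (u2 * w3 + u3 * w2) - e ^ 4 * g\<^sup>2 * B * D * (u3 * w3),
       s1 * w2 + u2 * t1 - e * B * (u2 * w2) - e ^ 3 * g\<^sup>2 * D * (u3 * w3),
       s1 * w3 + u3 * t1 + u2 * w2 + e\<^sup>2 * g * C * (u3 * w3))"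
  unfolding F c b a by (simp add: cmul_def algebra_simps power2_eq_square power3_eq_cube power4_eq_xxxx)

lemma admissible_fract:
  assumes "admissible c ab i n \<tau> B C D"
  defines "e \<equiv> j (\<varpi> ^ i)" and "g \<equiv> j (\<varpi> ^ n)"
  shows "j (fst ab) = 3 * j \<tau> - e * j B"
    "j (snd ab) = e\<^sup>2 * g * j C - 3 * (j \<tau>)\<^sup>2 + 2 * j (fst ab) * j \<tau>"
    "j c = j \<tau> ^ 3 - j (fst ab) * (j \<tau>)\<^sup>2 + j (snd ab) * j \<tau> - e ^ 3 * g\<^sup>2 * j D"
proof -
  have "fst ab = 3 * \<tau> - \<varpi> ^ i * B"
    "snd ab = (\<varpi> ^ i)\<^sup>2 * \<varpi> ^ n * C - 3 * \<tau>\<^sup>2 + 2 * fst ab * \<tau>"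
    "c = \<tau> ^ 3 - fst ab * \<tau>\<^sup>2 + snd ab * \<tau> - (\<varpi> ^ i) ^ 3 * (\<varpi> ^ n)\<^sup>2 * D"
    using assms(1) unfolding admissible_def
    by (simp_all add: power_add power_mult[symmetric] mult.commute algebra_simps)
  from this[THEN arg_cong[where f = j]] show "j (fst ab) = 3 * j \<tau> - e * j B"
    "j (snd ab) = e\<^sup>2 * g * j C - 3 * (j \<tau>)\<^sup>2 + 2 * j (fst ab) * j \<tau>"
    "j c = j \<tau> ^ 3 - j (fst ab) * (j \<tau>)\<^sup>2 + j (snd ab) * j \<tau> - e ^ 3 * g\<^sup>2 * j D"
    unfolding e_def g_def by (simp_all only: j_hom)
qed

lemma frame_mult:
  assumes "admissible c ab i n \<tau> B C D"
  shows "frame i n \<tau> B (cmul (\<varpi> ^ n) B C D s t) = kmul c ab (frame i n \<tau> B s) (frame i n \<tau> B t)"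
proof (cases s; cases t)
  fix s1 s2 s3 t1 t2 t3 assume st: "s = (s1, s2, s3)" "t = (t1, t2, t3)"
  define e g where "e = j (\<varpi> ^ i :: 'a padic_int)" and "g = j (\<varpi> ^ n :: 'a padic_int)"
  have e0: "e \<noteq> 0" "g \<noteq> 0" by (simp_all add: e_def g_def)
  have eg: "j (\<varpi> ^ (2 * i + n)) = e\<^sup>2 * g"
    by (simp add: e_def g_def power_add power_mult[symmetric] mult.commute[of _ 2] j_hom)
  note adm = admissible_fract[OF assms, folded e_def g_def]
  define F where "F = (\<lambda>(s1, u, w). (s1 - j \<tau> * u + (e * j B * j \<tau> - 2 * (j \<tau>)\<^sup>2) * w, u + j \<tau> * w, w))"
  have fr: "frame i n \<tau> B (s1, s2, s3) = F (j s1, j s2 / e, j s3 / (e\<^sup>2 * g))" for s1 s2 s3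
    unfolding frame_def F_def eg by (simp add: Let_def e_def)
  show ?thesis
    unfolding st fr frame_mult_aux[OF adm F_def]
    unfolding cmul_def prod.case fr
    by (rule arg_cong[where f = F]) (use e0 in \<open>simp add: to_fract_add to_fract_mult to_fract_diff g_def[symmetric] field_simps power2_eq_square power3_eq_cube power4_eq_xxxx\<close>)
qed

lemma form_order_frame:
  assumes "admissible c ab i n \<tau> B C D"
  shows "form_order (cubic_alg c ab) (coord c ab \<circ> frame i n \<tau> B) (\<varpi> ^ n) B C D"
proof (intro form_order.intro form_order_axioms.intro)
  show "cring (cubic_alg c ab)" by (rule cring_cubic_alg)
  show "inj (coord c ab \<circ> frame i n \<tau> B)" by (rule inj_compose[OF coord_inj frame_inj])
  show "(coord c ab \<circ> frame i n \<tau> B) s \<in> carrier (cubic_alg c ab)" for s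
    using range_coord[of c ab] by auto
qed (simp_all add: frame_add frame_mult[OF assms] frame_one coord_add coord_mult coord_one)

definition frame_order :: "'q::prime_card padic_int \<Rightarrow> 'q padic_int \<times> 'q padic_int \<Rightarrow> nat \<Rightarrow> nat \<Rightarrow>
    'q padic_int \<Rightarrow> 'q padic_int \<Rightarrow> 'q padic_int fract poly set set" where
  "frame_order c ab i n \<tau> B = coord c ab ` range (frame i n \<tau> B)"

lemma alg_scalar_frame: "alg_scalar c ab = (\<lambda>s. (coord c ab \<circ> frame i n \<tau> B) (s, 0, 0))"
  by (rule ext) (simp add: alg_scalar_coord frame_def Let_def)

lemma frame_order_cubic:
  assumes "admissible c ab i n \<tau> B C D"
  shows "cubic_order (cubic_alg c ab) (alg_scalar c ab) (frame_order c ab i n \<tau> B)"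
proof -
  interpret form_order "cubic_alg c ab" "coord c ab \<circ> frame i n \<tau> B" "\<varpi> ^ n" B C D
    by (rule form_order_frame[OF assms])
  show ?thesis using cubic_order_R unfolding frame_order_def alg_scalar_frame[of c ab i n \<tau> B]
    by (simp add: image_comp)
qed

lemma frame_order_\<kappa>:
  assumes "admissible c ab i n \<tau> B C D"
  shows "\<kappa> (cubic_alg c ab) (alg_scalar c ab) (frame_order c ab i n \<tau> B) v =
    fps_nth (local_factor (red (\<varpi> ^ n)) (red B) (red C) (red D)) v"
proof -
  interpret form_order "cubic_alg c ab" "coord c ab \<circ> frame i n \<tau> B" "\<varpi> ^ n" B C D
    by (rule form_order_frame[OF assms])
  have "\<varpi> ^ n = (1 :: 'a padic_int) \<or> red (\<varpi> ^ n :: 'a padic_int) = 0"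
    by (cases n) simp_all
  from \<kappa>_eq[OF this, of v] show ?thesis
    unfolding frame_order_def alg_scalar_frame[of c ab i n \<tau> B] by (simp add: image_comp)
qed

lemma frame_in_lattice_iff:
  "frame i n \<tau> B (s1, s2, s3) \<in> range j3 \<longleftrightarrow> \<varpi> ^ i dvd s2 \<and> \<varpi> ^ (2 * i + n) dvd s3"
proof -
  define u where "u = j s2 / j (\<varpi> ^ i)"
  define w where "w = j s3 / j (\<varpi> ^ (2 * i + n))"
  have fr: "frame i n \<tau> B (s1, s2, s3) =
     (j s1 - j \<tau> * u + (j (\<varpi> ^ i) * j B * j \<tau> - 2 * (j \<tau>)\<^sup>2) * w, u + j \<tau> * w, w)"
    by (simp add: frame_def Let_def u_def w_def)
  have div: "j s / j (\<varpi> ^ k) \<in> range j \<longleftrightarrow> \<varpi> ^ k dvd s" for s :: "'a padic_int" and k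
  proof
    assume "j s / j (\<varpi> ^ k) \<in> range j"
    then obtain t where "j s / j (\<varpi> ^ k) = j t" by blast
    hence "j s = j (\<varpi> ^ k * t)" by (simp add: field_simps)
    thus "\<varpi> ^ k dvd s" by (simp only: j_eq_iff) simp
  next
    assume "\<varpi> ^ k dvd s"
    then obtain t where "s = \<varpi> ^ k * t" by (elim dvdE)
    hence "j s / j (\<varpi> ^ k) = j t" by simp
    thus "j s / j (\<varpi> ^ k) \<in> range j" by (rule range_eqI)
  qed
  have "frame i n \<tau> B (s1, s2, s3) \<in> range j3 \<longleftrightarrow> u \<in> range j \<and> w \<in> range j"
  proof
    assume "frame i n \<tau> B (s1, s2, s3) \<in> range j3"
    then obtain x y z where "u + j \<tau> * w = j y" "w = j z" unfolding fr by auto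
    hence "u = j (y - \<tau> * z)" by (simp add: algebra_simps)
    thus "u \<in> range j \<and> w \<in> range j" using \<open>w = j z\<close> by blast
  next
    assume "u \<in> range j \<and> w \<in> range j"
    then obtain y z where "u = j y" "w = j z" by blast
    hence "frame i n \<tau> B (s1, s2, s3) =
       j3 (s1 - \<tau> * y + (\<varpi> ^ i * B * \<tau> - 2 * \<tau>\<^sup>2) * z, y + \<tau> * z, z)"
      unfolding fr by (simp add: j_hom)
    thus "frame i n \<tau> B (s1, s2, s3) \<in> range j3" by (rule range_eqI)
  qed
  thus ?thesis unfolding u_def w_def div .
qed

lemma monogenic_subset_frame_order: "monogenic_order c ab \<subseteq> frame_order c ab i n \<tau> B"
proof -
  have "j3 (x, y, z) \<in> range (frame i n \<tau> B)" for x y z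
  proof (rule range_eqI)
      show "j3 (x, y, z) = frame i n \<tau> B
        (x + \<tau> * (y - \<tau> * z) - (\<varpi> ^ i * B * \<tau> - 2 * \<tau>\<^sup>2) * z, \<varpi> ^ i * (y - \<tau> * z), \<varpi> ^ (2 * i + n) * z)"
      by (simp add: frame_def Let_def) (simp add: j_hom algebra_simps)
  qed
  thus ?thesis unfolding monogenic_coord frame_order_def by (intro image_mono) auto
qed

lemma coset_coord:
  "monogenic_order c ab +>\<^bsub>cubic_alg c ab\<lparr>carrier := R\<rparr>\<^esub> coord c ab k = coord c ab ` ((\<lambda>l. l + k) ` range j3)"
proof -
  have "monogenic_order c ab +>\<^bsub>cubic_alg c ab\<lparr>carrier := R\<rparr>\<^esub> coord c ab k
      = (\<lambda>l. coord c ab l \<oplus>\<^bsub>cubic_alg c ab\<^esub> coord c ab k) ` range j3"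
    unfolding a_r_coset_def' monogenic_coord by (simp add: image_def) blast
  thus ?thesis by (simp add: image_image coord_add)
qed

lemma shifts_eq_iff: "(\<lambda>l. l + k) ` range j3 = (\<lambda>l. l + k') ` range (j3 :: 'q::prime_card padic_int triple \<Rightarrow> _) \<longleftrightarrow> k - k' \<in> range j3"
proof -
  have add: "x + y \<in> range j3" if "x \<in> range j3" "y \<in> range j3" for x y :: "'q padic_int fract triple"
  proof -
    obtain s t where "x = j3 s" "y = j3 t" using \<open>x \<in> range j3\<close> \<open>y \<in> range j3\<close> by blast
    hence "x + y = j3 (s + t)" by (cases s; cases t) simp
    thus ?thesis by (rule range_eqI)
  qed
  have neg: "- x \<in> range j3" if "x \<in> range j3" for x :: "'q padic_int fract triple"
  proof -
    obtain s where "x = j3 s" using \<open>x \<in> range j3\<close> by blast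
    hence "- x = j3 (- s)" by (cases s) simp
    thus ?thesis by (rule range_eqI)
  qed
  have zero: "(0 :: 'q padic_int fract triple) \<in> range j3"
    by (rule range_eqI[of _ _ "(0, 0, 0)"]) (simp add: zero_prod_def)
  show ?thesis
  proof
    assume "(\<lambda>l. l + k) ` range j3 = (\<lambda>l. l + k') ` range (j3 :: 'q padic_int triple \<Rightarrow> _)"
    moreover have "0 + k \<in> (\<lambda>l. l + k) ` range j3" using zero by (rule imageI)
    ultimately have "0 + k \<in> (\<lambda>l. l + k') ` range j3" by simp
    then obtain l where "l \<in> range j3" "0 + k = l + k'" by blast
    thus "k - k' \<in> range j3" by (simp add: algebra_simps)
  next
    assume d: "k - k' \<in> range j3"
    have sub: "(\<lambda>l. l + k) ` range j3 \<subseteq> (\<lambda>l. l + k') ` range j3" if "k - k' \<in> range j3"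
      for k k' :: "'q padic_int fract triple"
    proof
      fix x assume "x \<in> (\<lambda>l. l + k) ` range j3"
      then obtain l where l: "l \<in> range j3" "x = l + k" by blast
      have "x = (l + (k - k')) + k'" by (simp add: l(2))
      thus "x \<in> (\<lambda>l. l + k') ` range j3" using add[OF l(1) that] by (rule image_eqI)
    qed
    have "k' - k \<in> range j3" using neg[OF d] by simp
    thus "(\<lambda>l. l + k) ` range j3 = (\<lambda>l. l + k') ` range j3" using sub[OF d] sub by blast
  qed
qed

text \<open>In the frame, the monogenic order consists of the triples with second and third coordinate
  divisible by \<open>q\<close> to the powers \<open>i\<close> and \<open>2 i + n\<close>.\<close>

lemma order_index_frame:
  "order_index (cubic_alg c ab) (frame_order c ab i n \<tau> B) (monogenic_order c ab) = CARD('q) ^ (3 * i + n)"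
  for c :: "'q::prime_card padic_int"
proof -
  let ?R = "frame_order c ab i n \<tau> B" and ?L = "range (j3 :: 'q padic_int triple \<Rightarrow> _)"
  let ?f = "frame i n \<tau> B"
  let ?G = "\<lambda>(k, l). coord c ab ` ((\<lambda>x. x + ?f (0, of_nat k, of_nat l)) ` ?L)"
  let ?I = "{..<CARD('q) ^ i} \<times> {..<CARD('q) ^ (2 * i + n)}"
  have fd: "?f s - ?f t = ?f (s - t)" for s t using frame_add[of i n \<tau> B "s - t" t] by simp
  have same: "coord c ab ` ((\<lambda>x. x + ?f s) ` ?L) = coord c ab ` ((\<lambda>x. x + ?f t) ` ?L) \<longleftrightarrow>
     residue i (fst (snd s)) = residue i (fst (snd t)) \<and>
     residue (2 * i + n) (snd (snd s)) = residue (2 * i + n) (snd (snd t))" for s t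
  proof -
    have "coord c ab ` ((\<lambda>x. x + ?f s) ` ?L) = coord c ab ` ((\<lambda>x. x + ?f t) ` ?L) \<longleftrightarrow> ?f (s - t) \<in> ?L"
      unfolding inj_image_eq_iff[OF coord_inj] shifts_eq_iff fd ..
    thus ?thesis by (cases s; cases t) (simp only: diff_Pair frame_in_lattice_iff unif_power_dvd_diff_iff fst_conv snd_conv)
  qed
  have "a_rcosets\<^bsub>cubic_alg c ab\<lparr>carrier := ?R\<rparr>\<^esub> monogenic_order c ab
      = (\<lambda>s. coord c ab ` ((\<lambda>x. x + ?f s) ` ?L)) ` UNIV"
    unfolding A_RCOSETS_def' frame_order_def by (auto simp: coset_coord[unfolded image_comp] image_comp)
  also have "\<dots> = ?G ` ?I"
  proof (intro equalityI subsetI)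
    fix y assume "y \<in> (\<lambda>s. coord c ab ` ((\<lambda>x. x + ?f s) ` ?L)) ` UNIV"
    then obtain s where y: "y = coord c ab ` ((\<lambda>x. x + ?f s) ` ?L)" by blast
    have "y = ?G (residue i (fst (snd s)), residue (2 * i + n) (snd (snd s)))"
      unfolding y prod.case same by (simp add: residue_of_nat residue_less)
    thus "y \<in> ?G ` ?I" by (rule image_eqI) (simp add: residue_less)
  qed auto
  also have "card \<dots> = card ?I"
  proof (rule card_image, rule inj_onI)
    fix x y assume "x \<in> ?I" "y \<in> ?I" "?G x = ?G y"
    thus "x = y" by (cases x; cases y) (auto simp only: prod.case same fst_conv snd_conv residue_of_nat mem_Times_iff lessThan_iff)
  qed
  also have "card ?I = CARD('q) ^ (3 * i + n)" by (simp add: power_add[symmetric])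
  finally show ?thesis unfolding order_index_def .
qed

section \<open>Classification of overorders\<close>

lemma shift_aux:
  fixes f h :: "'a::field"
  assumes nz: "f \<noteq> 0" "h \<noteq> 0" and x2: "x2 = h * ((a - 2 * \<sigma>) * f\<^sup>2 + p * f)"
    and x1: "x1 = h * ((\<sigma>\<^sup>2 - b) * f\<^sup>2 - p * \<sigma> * f + p0)"
    and E3: "- \<sigma> * f * (f\<^sup>2 * h) + f * x2 = s3 * (f\<^sup>2 * h)"
    and E2: "- \<sigma> * f * x2 + f * x1 + a * f * x2 = s2 * f + s3 * x2"
    and E1: "- \<sigma> * f * x1 - b * f * x2 + c * f * (f\<^sup>2 * h) = s1 - s2 * \<sigma> * f + s3 * x1"
  shows "s3 = p - (3 * \<sigma> - a) * f"
    "s2 = h * (p0 - (3 * \<sigma>\<^sup>2 - 2 * a * \<sigma> + b) * f\<^sup>2 - s3 * p)"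
    "s1 = h * (- (\<sigma> ^ 3 - a * \<sigma>\<^sup>2 + b * \<sigma> - c) * f ^ 3 - s3 * p0)"
proof -
  have "s3 * (f\<^sup>2 * h) = (p - (3 * \<sigma> - a) * f) * (f\<^sup>2 * h)"
    unfolding E3[symmetric] x2 by (simp add: algebra_simps power2_eq_square)
  thus s3: "s3 = p - (3 * \<sigma> - a) * f" using nz by simp
  have "s2 * f = - \<sigma> * f * x2 + f * x1 + a * f * x2 - s3 * x2" using E2 by simp
  also have "\<dots> = (h * (p0 - (3 * \<sigma>\<^sup>2 - 2 * a * \<sigma> + b) * f\<^sup>2 - s3 * p)) * f"
    unfolding s3 x1 x2 by (simp add: algebra_simps power2_eq_square)
  finally show s2: "s2 = h * (p0 - (3 * \<sigma>\<^sup>2 - 2 * a * \<sigma> + b) * f\<^sup>2 - s3 * p)" using nz by simp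
  have "s1 = - \<sigma> * f * x1 - b * f * x2 + c * f * (f\<^sup>2 * h) + s2 * \<sigma> * f - s3 * x1" using E1 by simp
  also have "\<dots> = h * (- (\<sigma> ^ 3 - a * \<sigma>\<^sup>2 + b * \<sigma> - c) * f ^ 3 - s3 * p0)"
    unfolding s2 s3 x1 x2 by (simp add: algebra_simps power2_eq_square power3_eq_cube)
  finally show "s1 = h * (- (\<sigma> ^ 3 - a * \<sigma>\<^sup>2 + b * \<sigma> - c) * f ^ 3 - s3 * p0)" .
qed

lemma square_aux:
  fixes f h :: "'a::field"
  assumes nz: "f \<noteq> 0" "h \<noteq> 0" and w: "w = f\<^sup>2 * h"
    and E3: "2 * ((\<tau>\<^sup>2 - a * \<tau>) * w) * w + (\<tau> * w)\<^sup>2 + b * w\<^sup>2 = s3 * w"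
    and E2: "2 * ((\<tau>\<^sup>2 - a * \<tau>) * w) * (\<tau> * w) + a * (\<tau> * w)\<^sup>2 + c * w\<^sup>2 = s2 * f + s3 * (\<tau> * w)"
  shows "s3 = (3 * \<tau>\<^sup>2 - 2 * a * \<tau> + b) * w" "s2 = - (\<tau> ^ 3 - a * \<tau>\<^sup>2 + b * \<tau> - c) * f ^ 3 * h\<^sup>2"
proof -
  have "s3 * w = ((3 * \<tau>\<^sup>2 - 2 * a * \<tau> + b) * w) * w"
    unfolding E3[symmetric] by (simp add: algebra_simps power2_eq_square)
  thus s3: "s3 = (3 * \<tau>\<^sup>2 - 2 * a * \<tau> + b) * w" using nz w by simp
  have "s2 * f = 2 * ((\<tau>\<^sup>2 - a * \<tau>) * w) * (\<tau> * w) + a * (\<tau> * w)\<^sup>2 + c * w\<^sup>2 - s3 * (\<tau> * w)" using E2 by simp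
  also have "\<dots> = (- (\<tau> ^ 3 - a * \<tau>\<^sup>2 + b * \<tau> - c) * f ^ 3 * h\<^sup>2) * f"
    unfolding s3 w by (simp add: algebra_simps power2_eq_square power3_eq_cube)
  finally show "s2 = - (\<tau> ^ 3 - a * \<tau>\<^sup>2 + b * \<tau> - c) * f ^ 3 * h\<^sup>2" using nz by simp
qed

lemma unif_power_dvd_unif_power: "\<varpi> ^ i dvd (\<varpi> ^ k :: 'q::prime_card padic_int) \<longleftrightarrow> i \<le> k"
proof -
  have "\<not> \<varpi> dvd (1 :: 'q padic_int)" unfolding red_eq_0_iff[symmetric] by simp
  from unif_power_dvd_mult_unit[OF this, of i k] show ?thesis by simp
qed

text \<open>A ring between \<open>\<int>\<^sub>q[X] / \<Phi>\<close> and a lattice has a triangular basis \<open>1, w\<^sub>0, \<chi>\<^sub>0\<close>, where \<open>w\<^sub>0\<close> is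
  linear in \<open>X\<close> with leading coefficient \<open>1 / q\<^sup>i\<close>, and the leading coefficient of \<open>\<chi>\<^sub>0\<close> divides that of
  \<open>w\<^sub>0\<^sup>2\<close>, say \<open>q\<^sup>n \<chi>\<^sub>0 = w\<^sub>0\<^sup>2 + p w\<^sub>0 + p\<^sub>0\<close>. Expanding \<open>w\<^sub>0 \<chi>\<^sub>0\<close> in the basis shows that the difference \<open>t\<close> of \<open>p\<close>
  and the trace part at the root of \<open>w\<^sub>0\<close> is integral; moving that root by \<open>q\<^sup>i t\<close> makes the product
  of the linear and the quadratic generator a scalar. The squares of the generators then give the
  remaining divisibilities.\<close>

lemma lattice_classification:
  fixes L :: "'q::prime_card padic_int fract triple set" and ab :: "'q padic_int \<times> 'q padic_int"
  assumes add: "\<And>k l. k \<in> L \<Longrightarrow> l \<in> L \<Longrightarrow> k + l \<in> L"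
    and mult: "\<And>k l. k \<in> L \<Longrightarrow> l \<in> L \<Longrightarrow> kmul c ab k l \<in> L"
    and base: "range j3 \<subseteq> L" and bd: "\<And>k. k \<in> L \<Longrightarrow> tscale (j d) k \<in> range j3" and d: "d \<noteq> 0"
  obtains i n \<tau> B C D where "admissible c ab i n \<tau> B C D" "L = range (frame i n \<tau> B)"
proof -
  define a b cc where "a = j (fst ab)" and "b = j (snd ab)" and "cc = j c"
  have j3L: "(j x, j y, j z) \<in> L" for x y z
    using subsetD[OF base rangeI[of j3 "(x, y, z)"]] by simp
  have c1: "(j x, 0, 0) \<in> L" for x using j3L[of x 0 0] by simp
  have scal: "tscale (j s) k \<in> L" if "k \<in> L" for s k
    using mult[OF c1[of s] that] by (simp add: cmul_scalar)
  have diff: "k - l \<in> L" if "k \<in> L" "l \<in> L" for k l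
  proof -
    have "k - l = k + tscale (j (- 1)) l" by (cases k; cases l) simp
    thus ?thesis using add[OF that(1) scal[OF that(2)]] by (simp only:)
  qed
  have bds: "j d * x \<in> range j \<and> j d * y \<in> range j \<and> j d * z \<in> range j" if "(x, y, z) \<in> L" for x y z
    using bd[OF that] by auto
  \<comment> \<open>The constants in \<open>L\<close> form a ring with bounded denominators, so they are integral.\<close>
  define V0 where "V0 = {x. (x, 0, 0) \<in> L}"
  have "j s * v \<in> V0" if "v \<in> V0" for s v using that scal[of "(v, 0, 0)" s] by (simp add: V0_def)
  moreover have "1 \<in> V0" using c1[of 1] by (simp add: V0_def)
  moreover have "j d * v \<in> range j" if "v \<in> V0" for v using that bds by (simp add: V0_def)
  ultimately obtain m where m: "V0 = {v. j (\<varpi> ^ m) * v \<in> range j}" "1 / j (\<varpi> ^ m) \<in> V0"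
    using fract_submodule[of V0 d] d by metis
  have "m = 0"
  proof -
    let ?v = "1 / j (\<varpi> ^ m) :: 'q padic_int fract"
    have "(?v, 0, 0) \<in> L" using m(2) by (simp only: V0_def mem_Collect_eq)
    from mult[OF this this] have "?v * ?v \<in> V0" by (simp add: cmul_scalar V0_def)
    hence "j (\<varpi> ^ m) * (?v * ?v) \<in> range j" unfolding m(1) mem_Collect_eq .
    then obtain s where "j (\<varpi> ^ m) * (?v * ?v) = j s" by blast
    hence "j 1 = j (\<varpi> ^ m * s)" by (simp add: field_simps)
    hence "1 = \<varpi> ^ m * s" by (simp only: j_eq_iff)
    hence "\<varpi> ^ m dvd (1 :: 'q padic_int)" by (rule dvdI)
    hence "\<varpi> ^ m dvd (\<varpi> ^ 0 :: 'q padic_int)" by (simp only: power_0)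
    thus ?thesis unfolding unif_power_dvd_unif_power by simp
  qed
  hence const: "x \<in> range j" if "(x, 0, 0) \<in> L" for x using m(1) that by (auto simp: V0_def)
  \<comment> \<open>The leading coefficients of the linear elements form a fractional ideal; this defines \<open>i\<close>.\<close>
  define V1 where "V1 = {y. \<exists>x. (x, y, 0) \<in> L}"
  have "j s * v \<in> V1" if v: "v \<in> V1" for s v
  proof -
    obtain x where "(x, v, 0) \<in> L" using v by (auto simp: V1_def)
    from scal[OF this, of s] show ?thesis by (auto simp: V1_def)
  qed
  moreover have "1 \<in> V1" using j3L[of 0 1 0] by (auto simp: V1_def)
  moreover have "j d * v \<in> range j" if "v \<in> V1" for v using that bds by (auto simp: V1_def)
  ultimately obtain i where i: "V1 = {v. j (\<varpi> ^ i) * v \<in> range j}" "1 / j (\<varpi> ^ i) \<in> V1"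
    using fract_submodule[of V1 d] d by metis
  define e where "e = j (\<varpi> ^ i :: 'q padic_int)"
  define f where "f = 1 / e"
  have e0: "e \<noteq> 0" by (simp add: e_def)
  have ef: "e * f = 1" "f \<noteq> 0" using e0 by (simp_all add: f_def)
  obtain w0 where w0: "(w0, f, 0) \<in> L" using i(2) by (auto simp: V1_def e_def f_def)
  have "tscale e (w0, f, 0) - (j 0, j 1, j 0) \<in> L"
    unfolding e_def by (rule diff[OF scal[OF w0] j3L])
  hence "(e * w0, 0, 0) \<in> L" by (simp add: ef zero_prod_def)
  then obtain s' where s': "e * w0 = j s'" using const by blast
  define \<sigma>0 where "\<sigma>0 = - s'"
  have w0_eq: "w0 = - j \<sigma>0 * f" using s' ef e0 by (simp add: \<sigma>0_def f_def field_simps)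
  have lin: "\<exists>s1 s2. (x, y, 0) = (j s1, 0, 0) + tscale (j s2) (w0, f, 0)" if xy: "(x, y, 0) \<in> L" for x y
  proof -
    have "y \<in> V1" using xy by (auto simp: V1_def)
    hence "e * y \<in> range j" unfolding i(1) e_def by simp
    then obtain s2 where s2: "e * y = j s2" by blast
    hence y: "y = j s2 * f" using ef e0 by (simp add: f_def field_simps)
    have "(x, y, 0) - tscale (j s2) (w0, f, 0) \<in> L" by (rule diff[OF xy scal[OF w0]])
    hence "(x - j s2 * w0, 0, 0) \<in> L" by (simp add: y zero_prod_def)
    then obtain s1 where "x - j s2 * w0 = j s1" using const by blast
    hence "(x, y, 0) = (j s1, 0, 0) + tscale (j s2) (w0, f, 0)" by (simp add: y algebra_simps)
    thus ?thesis by blast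
  qed
  \<comment> \<open>Likewise for the quadratic elements. The square of the linear generator shows \<open>l \<ge> 2 i\<close>.\<close>
  define V2 where "V2 = {z. \<exists>x y. (x, y, z) \<in> L}"
  have "j s * v \<in> V2" if v: "v \<in> V2" for s v
  proof -
    obtain x y where "(x, y, v) \<in> L" using v by (auto simp: V2_def)
    from scal[OF this, of s] show ?thesis by (auto simp: V2_def)
  qed
  moreover have "1 \<in> V2" using j3L[of 0 0 1] by (auto simp: V2_def)
  moreover have "j d * v \<in> range j" if "v \<in> V2" for v using that bds by (auto simp: V2_def)
  ultimately obtain l where l: "V2 = {v. j (\<varpi> ^ l) * v \<in> range j}" "1 / j (\<varpi> ^ l) \<in> V2"
    using fract_submodule[of V2 d] d by metis
  have sq: "kmul c ab (x, y, 0) (x, y, 0) = (x\<^sup>2 - b * y\<^sup>2, 2 * x * y + a * y\<^sup>2, y\<^sup>2)" for x y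
    by (simp add: cmul_def a_def b_def power2_eq_square algebra_simps)
  have "f\<^sup>2 \<in> V2" using mult[OF w0 w0] unfolding sq V2_def by blast
  hence "j (\<varpi> ^ l) * f\<^sup>2 \<in> range j" unfolding l(1) by simp
  then obtain s where "j (\<varpi> ^ l) * f\<^sup>2 = j s" by blast
  hence "j (\<varpi> ^ l) = e\<^sup>2 * j s" using e0 by (simp add: f_def field_simps)
  also have "\<dots> = j (\<varpi> ^ (2 * i) * s)" by (simp add: e_def j_hom power_mult[symmetric] mult.commute[of 2])
  finally have "\<varpi> ^ l = \<varpi> ^ (2 * i) * s" by (simp only: j_eq_iff)
  hence "\<varpi> ^ (2 * i) dvd (\<varpi> ^ l :: 'q padic_int)" by simp
  hence "2 * i \<le> l" unfolding unif_power_dvd_unif_power .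
  then obtain n where n: "l = 2 * i + n" using le_Suc_ex by blast
  define g where "g = j (\<varpi> ^ n :: 'q padic_int)"
  define h where "h = 1 / g"
  have g0: "g \<noteq> 0" by (simp add: g_def)
  have gh: "g * h = 1" "h \<noteq> 0" using g0 by (simp_all add: h_def)
  have jl: "j (\<varpi> ^ l :: 'q padic_int) = e\<^sup>2 * g"
    by (simp add: n e_def g_def j_hom power_add power_mult[symmetric] mult.commute[of 2])
  have "f\<^sup>2 * h \<in> V2" using l(2) unfolding jl by (simp add: f_def h_def power2_eq_square)
  then obtain x1 x2 where \<chi>0: "(x1, x2, f\<^sup>2 * h) \<in> L" by (auto simp: V2_def)
  have quad: "\<exists>s1 s2 s3. k = (j s1, 0, 0) + tscale (j s2) (w0, f, 0) + tscale (j s3) (x1, x2, f\<^sup>2 * h)"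
    if k: "k \<in> L" for k
  proof -
    obtain x y z where kk: "k = (x, y, z)" by (cases k)
    have "z \<in> V2" using k by (auto simp: V2_def kk)
    hence "e\<^sup>2 * g * z \<in> range j" unfolding l(1) jl by simp
    then obtain s3 where "e\<^sup>2 * g * z = j s3" by blast
    hence z: "z = j s3 * (f\<^sup>2 * h)" using e0 g0 by (simp add: f_def h_def field_simps)
    have "k - tscale (j s3) (x1, x2, f\<^sup>2 * h) \<in> L" by (rule diff[OF k scal[OF \<chi>0]])
    hence "(x - j s3 * x1, y - j s3 * x2, 0) \<in> L" by (simp add: kk z)
    from lin[OF this] obtain s1 s2 where
      "(x - j s3 * x1, y - j s3 * x2, 0) = (j s1, 0, 0) + tscale (j s2) (w0, f, 0)" by blast
    hence "k = (j s1, 0, 0) + tscale (j s2) (w0, f, 0) + tscale (j s3) (x1, x2, f\<^sup>2 * h)"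
      by (simp add: kk z) (simp add: algebra_simps)
    thus ?thesis by blast
  qed
  \<comment> \<open>For any linear generator, the product of the two generators shows how far the trace part is from \<open>p\<close>;
    this is used before and after the generator is moved.\<close>
  have step: "\<exists>t z1. j t = j p - (3 * j \<sigma> - a) * f \<and>
      g * j z1 = j p0 - (3 * (j \<sigma>)\<^sup>2 - 2 * a * j \<sigma> + b) * f\<^sup>2 - j t * j p"
    if X2: "x2 = h * ((a - 2 * j \<sigma>) * f\<^sup>2 + j p * f)"
      and X1: "x1 = h * (((j \<sigma>)\<^sup>2 - b) * f\<^sup>2 - j p * j \<sigma> * f + j p0)"
      and \<omega>: "(- j \<sigma> * f, f, 0) \<in> L"
      and gen: "\<And>k. k \<in> L \<Longrightarrow> \<exists>s1 s2 s3. k = (j s1, 0, 0) + tscale (j s2) (- j \<sigma> * f, f, 0) + tscale (j s3) (x1, x2, f\<^sup>2 * h)"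
    for \<sigma> p p0
  proof -
    obtain s1 s2 s3 where s: "kmul c ab (- j \<sigma> * f, f, 0) (x1, x2, f\<^sup>2 * h) =
       (j s1, 0, 0) + tscale (j s2) (- j \<sigma> * f, f, 0) + tscale (j s3) (x1, x2, f\<^sup>2 * h)"
      using gen[OF mult[OF \<omega> \<chi>0]] by blast
    have prod: "kmul c ab (y1, y2, 0) (u1, u2, u3) =
        (y1 * u1 - b * y2 * u2 + cc * y2 * u3, y1 * u2 + y2 * u1 + a * y2 * u2, y1 * u3 + y2 * u2)"
      for y1 y2 u1 u2 u3 by (simp add: cmul_def a_def b_def cc_def algebra_simps)
    have E3: "- j \<sigma> * f * (f\<^sup>2 * h) + f * x2 = j s3 * (f\<^sup>2 * h)"
      and E2: "- j \<sigma> * f * x2 + f * x1 + a * f * x2 = j s2 * f + j s3 * x2"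
      and E1: "- j \<sigma> * f * x1 - b * f * x2 + cc * f * (f\<^sup>2 * h) = j s1 - j s2 * j \<sigma> * f + j s3 * x1"
      using s unfolding prod tscale_simps add_Pair prod.inject by simp_all
    note r = shift_aux[OF ef(2) gh(2) X2 X1 E3 E2 E1]
    have "g * j s2 = (g * h) * (j p0 - (3 * (j \<sigma>)\<^sup>2 - 2 * a * j \<sigma> + b) * f\<^sup>2 - j s3 * j p)"
      by (subst r(2)) (simp only: mult.assoc)
    hence "g * j s2 = j p0 - (3 * (j \<sigma>)\<^sup>2 - 2 * a * j \<sigma> + b) * f\<^sup>2 - j s3 * j p" by (simp only: gh mult_1_left)
    thus ?thesis using r(1) by blast
  qed
  have "tscale g (x1, x2, f\<^sup>2 * h) - kmul c ab (w0, f, 0) (w0, f, 0) \<in> L"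
    unfolding g_def[symmetric] by (intro diff mult w0) (use scal[OF \<chi>0] in \<open>simp only: g_def\<close>)
  moreover have "g * (f\<^sup>2 * h) = f\<^sup>2" using gh(1) by (simp add: ac_simps)
  ultimately have "(g * x1 - (w0\<^sup>2 - b * f\<^sup>2), g * x2 - (2 * w0 * f + a * f\<^sup>2), 0) \<in> L"
    unfolding sq by simp
  from lin[OF this] obtain p0 p where pp: "g * x1 - (w0\<^sup>2 - b * f\<^sup>2) = j p0 + j p * w0"
     "g * x2 - (2 * w0 * f + a * f\<^sup>2) = j p * f" by auto
  have hg: "x = h * y" if "g * x = y" for x y using that g0 by (auto simp: h_def)
  have X2: "x2 = h * ((a - 2 * j \<sigma>0) * f\<^sup>2 + j p * f)"
    by (rule hg) (use pp(2) in \<open>simp add: w0_eq algebra_simps power2_eq_square\<close>)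
  have X1: "x1 = h * (((j \<sigma>0)\<^sup>2 - b) * f\<^sup>2 - j p * j \<sigma>0 * f + j p0)"
    by (rule hg) (use pp(1) in \<open>simp add: w0_eq algebra_simps power2_eq_square\<close>)
  have "\<exists>t z1. j t = j p - (3 * j \<sigma>0 - a) * f \<and>
      g * j z1 = j p0 - (3 * (j \<sigma>0)\<^sup>2 - 2 * a * j \<sigma>0 + b) * f\<^sup>2 - j t * j p"
    by (rule step[OF X2 X1 w0[unfolded w0_eq]], erule quad[unfolded w0_eq])
  then obtain t where t: "j t = j p - (3 * j \<sigma>0 - a) * f" by blast
  define \<tau> where "\<tau> = \<sigma>0 + \<varpi> ^ i * t"
  define p' where "p' = p + 2 * t"
  define p0' where "p0' = p0 + p * t + t * t"
  have j\<tau>: "j \<tau> = j \<sigma>0 + e * j t" by (simp add: \<tau>_def e_def)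
  have jp: "j p' = j p + 2 * j t" "j p0' = j p0 + j p * j t + j t * j t"
    by (simp_all add: p'_def p0'_def j_hom)
  have j\<tau>f: "j \<tau> * f = j \<sigma>0 * f + j t" using ef(1) by (simp add: j\<tau> algebra_simps)
  have \<omega>eq: "(- j \<tau> * f, f, 0 :: 'q padic_int fract) = (w0, f, 0) - (j t, 0, 0)"
    using j\<tau>f by (simp add: w0_eq)
  have \<omega>: "(- j \<tau> * f, f, 0) \<in> L" unfolding \<omega>eq by (rule diff[OF w0 c1])
  have gen: "\<exists>s1 s2 s3. k = (j s1, 0, 0) + tscale (j s2) (- j \<tau> * f, f, 0) + tscale (j s3) (x1, x2, f\<^sup>2 * h)"
    if k: "k \<in> L" for k
  proof -
    obtain s1 s2 s3 where "k = (j s1, 0, 0) + tscale (j s2) (w0, f, 0) + tscale (j s3) (x1, x2, f\<^sup>2 * h)"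
      using quad[OF k] by blast
    moreover have "tscale (j s2) (w0, f, 0) = (j (s2 * t), 0, 0) + tscale (j s2) (- j \<tau> * f, f, 0)"
      unfolding \<omega>eq by (simp add: algebra_simps)
    ultimately have "k = (j (s1 + s2 * t), 0, 0) + tscale (j s2) (- j \<tau> * f, f, 0) + tscale (j s3) (x1, x2, f\<^sup>2 * h)"
      by (simp add: algebra_simps)
    thus ?thesis by blast
  qed
  have X2': "x2 = h * ((a - 2 * j \<tau>) * f\<^sup>2 + j p' * f)"
  proof -
    have "(a - 2 * j \<tau>) * f\<^sup>2 + j p' * f = a * f * f - 2 * (j \<tau> * f) * f + j p' * f"
      by (simp add: algebra_simps power2_eq_square)
    also have "\<dots> = (a - 2 * j \<sigma>0) * f\<^sup>2 + j p * f"
      unfolding j\<tau>f jp by (simp add: algebra_simps power2_eq_square)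
    finally show ?thesis using X2 by (simp only:)
  qed
  have X1': "x1 = h * (((j \<tau>)\<^sup>2 - b) * f\<^sup>2 - j p' * j \<tau> * f + j p0')"
  proof -
    have "((j \<tau>)\<^sup>2 - b) * f\<^sup>2 - j p' * j \<tau> * f + j p0' = (j \<tau> * f)\<^sup>2 - b * f\<^sup>2 - j p' * (j \<tau> * f) + j p0'"
      by (simp add: algebra_simps power2_eq_square)
    also have "\<dots> = ((j \<sigma>0)\<^sup>2 - b) * f\<^sup>2 - j p * j \<sigma>0 * f + j p0"
      unfolding j\<tau>f jp by (simp add: algebra_simps power2_eq_square)
    finally show ?thesis using X1 by (simp only:)
  qed
  have p'B: "j p' = (3 * j \<tau> - a) * f"
  proof -
    have "(3 * j \<tau> - a) * f = 3 * (j \<tau> * f) - a * f" by (simp add: algebra_simps)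
    also have "\<dots> = 3 * (j \<sigma>0 * f) + 3 * j t - a * f" unfolding j\<tau>f by (simp add: algebra_simps)
    also have "\<dots> = j p'" unfolding jp t by (simp add: algebra_simps)
    finally show ?thesis by simp
  qed
  have "\<exists>t' z1. j t' = j p' - (3 * j \<tau> - a) * f \<and>
      g * j z1 = j p0' - (3 * (j \<tau>)\<^sup>2 - 2 * a * j \<tau> + b) * f\<^sup>2 - j t' * j p'"
    by (rule step[OF X2' X1' \<omega>], erule gen)
  then obtain t' z1 where t': "j t' = j p' - (3 * j \<tau> - a) * f"
    and z1: "g * j z1 = j p0' - (3 * (j \<tau>)\<^sup>2 - 2 * a * j \<tau> + b) * f\<^sup>2 - j t' * j p'"
    by blast
  have "j t' = 0" using t' p'B by simp
  hence z1': "j p0' = g * j z1 + (3 * (j \<tau>)\<^sup>2 - 2 * a * j \<tau> + b) * f\<^sup>2" using z1 by simp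
  define w where "w = f\<^sup>2 * h"
  have x2w: "x2 = j \<tau> * w" unfolding X2' p'B w_def by (simp add: algebra_simps power2_eq_square)
  have x1w: "x1 - j z1 = ((j \<tau>)\<^sup>2 - a * j \<tau>) * w"
  proof -
    have "x1 = (g * h) * j z1 + h * ((((j \<tau>)\<^sup>2 - b) * f\<^sup>2 - j p' * j \<tau> * f) + (3 * (j \<tau>)\<^sup>2 - 2 * a * j \<tau> + b) * f\<^sup>2)"
      unfolding X1' z1' by (simp add: algebra_simps)
    thus ?thesis unfolding p'B w_def gh(1) by (simp add: algebra_simps power2_eq_square)
  qed
  let ?\<chi> = "(((j \<tau>)\<^sup>2 - a * j \<tau>) * w, j \<tau> * w, w)"
  have \<chi>eq: "?\<chi> = (x1, x2, f\<^sup>2 * h) - (j z1, 0, 0)" using x1w x2w by (simp add: w_def)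
  have \<chi>: "?\<chi> \<in> L" unfolding \<chi>eq by (rule diff[OF \<chi>0 c1])
  have gen': "\<exists>s1 s2 s3. k = (j s1, 0, 0) + tscale (j s2) (- j \<tau> * f, f, 0) + tscale (j s3) ?\<chi>"
    if k: "k \<in> L" for k
  proof -
    obtain s1 s2 s3 where "k = (j s1, 0, 0) + tscale (j s2) (- j \<tau> * f, f, 0) + tscale (j s3) (x1, x2, f\<^sup>2 * h)"
      using gen[OF k] by blast
    moreover have "tscale (j s3) (x1, x2, f\<^sup>2 * h) = (j (s3 * z1), 0, 0) + tscale (j s3) ?\<chi>"
      unfolding \<chi>eq by (simp add: algebra_simps)
    ultimately have "k = (j (s1 + s3 * z1), 0, 0) + tscale (j s2) (- j \<tau> * f, f, 0) + tscale (j s3) ?\<chi>"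
      by (simp add: algebra_simps)
    thus ?thesis by blast
  qed
  \<comment> \<open>The square of the quadratic generator makes the last two quotients integral.\<close>
  obtain s1 s2 s3 where s: "kmul c ab ?\<chi> ?\<chi> =
      (j s1, 0, 0) + tscale (j s2) (- j \<tau> * f, f, 0) + tscale (j s3) ?\<chi>"
    using gen'[OF mult[OF \<chi> \<chi>]] by blast
  have sq3: "kmul c ab (y1, y2, y3) (y1, y2, y3) = (y1 * y1 - b * (y2 * y2) + cc * (y2 * y3 + y3 * y2) - a * cc * (y3 * y3),
     2 * y1 * y2 + a * y2\<^sup>2 + cc * y3\<^sup>2, 2 * y1 * y3 + y2\<^sup>2 + b * y3\<^sup>2)" for y1 y2 y3
    by (simp add: cmul_def a_def b_def cc_def power2_eq_square algebra_simps)
  have E3: "2 * (((j \<tau>)\<^sup>2 - a * j \<tau>) * w) * w + (j \<tau> * w)\<^sup>2 + b * w\<^sup>2 = j s3 * w"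
    and E2: "2 * (((j \<tau>)\<^sup>2 - a * j \<tau>) * w) * (j \<tau> * w) + a * (j \<tau> * w)\<^sup>2 + cc * w\<^sup>2 = j s2 * f + j s3 * (j \<tau> * w)"
    using s unfolding sq3 by simp_all
  note r = square_aux[OF ef(2) gh(2) w_def E3 E2]
  have "admissible c ab i n \<tau> p' s3 (- s2)"
    unfolding admissible_def
  proof (intro conjI)
    have "j (\<varpi> ^ i * p') = (e * f) * (3 * j \<tau> - a)" using p'B by (simp add: e_def)
    hence "j (3 * \<tau> - fst ab) = j (\<varpi> ^ i * p')" unfolding ef(1) by (simp add: j_hom a_def)
    thus "3 * \<tau> - fst ab = \<varpi> ^ i * p'" by (simp only: j_eq_iff)
    have "j (\<varpi> ^ (2 * i + n) * s3) = (e * f)\<^sup>2 * (g * h) * (3 * (j \<tau>)\<^sup>2 - 2 * a * j \<tau> + b)"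
      using jl unfolding n to_fract_mult r(1) w_def by (simp add: power_mult_distrib)
    hence "j (3 * \<tau>\<^sup>2 - 2 * fst ab * \<tau> + snd ab) = j (\<varpi> ^ (2 * i + n) * s3)"
      unfolding ef(1) gh(1) by (simp add: j_hom a_def b_def)
    thus "3 * \<tau>\<^sup>2 - 2 * fst ab * \<tau> + snd ab = \<varpi> ^ (2 * i + n) * s3" by (simp only: j_eq_iff)
    have pw: "j (\<varpi> ^ (3 * i + 2 * n) :: 'q padic_int) = e ^ 3 * g\<^sup>2"
      by (simp add: e_def g_def j_hom power_add power_mult[symmetric] mult.commute[of 2] mult.commute[of 3])
    have "j (\<varpi> ^ (3 * i + 2 * n) * (- s2)) = - (e ^ 3 * g\<^sup>2 * j s2)"
      by (simp only: to_fract_mult to_fract_uminus pw mult_minus_right)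
    also have "\<dots> = (e * f) ^ 3 * (g * h)\<^sup>2 * ((j \<tau>) ^ 3 - a * (j \<tau>)\<^sup>2 + b * j \<tau> - cc)"
      unfolding r(2) by (simp add: power_mult_distrib algebra_simps)
    finally have "j (\<tau> ^ 3 - fst ab * \<tau>\<^sup>2 + snd ab * \<tau> - c) = j (\<varpi> ^ (3 * i + 2 * n) * (- s2))"
      unfolding ef(1) gh(1) by (simp add: j_hom a_def b_def cc_def)
    thus "\<tau> ^ 3 - fst ab * \<tau>\<^sup>2 + snd ab * \<tau> - c = \<varpi> ^ (3 * i + 2 * n) * (- s2)" by (simp only: j_eq_iff)
  qed
  moreover have "L = range (frame i n \<tau> p')"
  proof -
    have "e * j p' = (e * f) * (3 * j \<tau> - a)" unfolding p'B by simp
    hence ep: "e * j p' = 3 * j \<tau> - a" by (simp add: ef)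
    have fr: "frame i n \<tau> p' (s1, s2, s3) = (j s1, 0, 0) + tscale (j s2) (- j \<tau> * f, f, 0) + tscale (j s3) ?\<chi>"
      for s1 s2 s3
    proof -
      have "frame i n \<tau> p' (s1, s2, s3) = (j s1 - j \<tau> * (j s2 * f) + (e * j p' * j \<tau> - 2 * (j \<tau>)\<^sup>2) * (j s3 * w), j s2 * f + j \<tau> * (j s3 * w), j s3 * w)"
        unfolding frame_def prod.case Let_def n[symmetric] jl by (simp add: e_def[symmetric] w_def f_def h_def power2_eq_square)
      thus ?thesis unfolding ep by (simp add: algebra_simps power2_eq_square)
    qed
    show ?thesis
    proof (intro equalityI subsetI)
      fix k assume "k \<in> L"
      from gen'[OF this] obtain s1 s2 s3 where "k = frame i n \<tau> p' (s1, s2, s3)" unfolding fr by blast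
      thus "k \<in> range (frame i n \<tau> p')" by (rule range_eqI)
    next
      fix k assume "k \<in> range (frame i n \<tau> p')"
      then obtain s1 s2 s3 where k: "k = frame i n \<tau> p' (s1, s2, s3)" by auto
      show "k \<in> L" unfolding k fr by (intro add scal c1 \<omega> \<chi>)
    qed
  qed
  ultimately show ?thesis by (rule that)
qed

text \<open>The levels \<open>i\<close> and \<open>2 i + n\<close> are read off from the denominators. At equal levels, \<open>\<tau>\<close> is unique up to the
  translations that preserve the normalisation.\<close>

lemma frame_range_subset:
  assumes "range (frame i n \<tau> B) \<subseteq> range (frame i' n' \<tau>' B')"
  shows "i \<le> i'" "2 * i + n \<le> 2 * i' + n'"
    "i = i' \<Longrightarrow> n = n' \<Longrightarrow> \<varpi> ^ (i + n) dvd \<tau> - (\<tau>' :: 'q::prime_card padic_int)"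
proof -
  have mem: "frame i n \<tau> B s \<in> range (frame i' n' \<tau>' B')" for s using assms by blast
  obtain s1 s2 s3 where s: "frame i n \<tau> B (0, 1, 0) = frame i' n' \<tau>' B' (s1, s2, s3)"
    using mem[of "(0, 1, 0)"] by auto
  have "s3 = 0" using s by (simp add: frame_def Let_def)
  hence "1 / j (\<varpi> ^ i :: 'q padic_int) = j s2 / j (\<varpi> ^ i')" using s by (simp add: frame_def Let_def)
  hence "j (\<varpi> ^ i' :: 'q padic_int) = j (\<varpi> ^ i * s2)" by (simp add: field_simps)
  hence "\<varpi> ^ i' = \<varpi> ^ i * s2" by (simp only: j_eq_iff)
  hence "\<varpi> ^ i dvd (\<varpi> ^ i' :: 'q padic_int)" by (rule dvdI)
  thus "i \<le> i'" unfolding unif_power_dvd_unif_power .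
  obtain t1 t2 t3 where t: "frame i n \<tau> B (0, 0, 1) = frame i' n' \<tau>' B' (t1, t2, t3)"
    using mem[of "(0, 0, 1)"] by auto
  have third: "1 / j (\<varpi> ^ (2 * i + n) :: 'q padic_int) = j t3 / j (\<varpi> ^ (2 * i' + n'))"
    using t by (simp add: frame_def Let_def)
  hence "j (\<varpi> ^ (2 * i' + n') :: 'q padic_int) = j (\<varpi> ^ (2 * i + n) * t3)" by (simp add: field_simps)
  hence "\<varpi> ^ (2 * i' + n') = \<varpi> ^ (2 * i + n) * t3" by (simp only: j_eq_iff)
  hence "\<varpi> ^ (2 * i + n) dvd (\<varpi> ^ (2 * i' + n') :: 'q padic_int)" by (rule dvdI)
  thus "2 * i + n \<le> 2 * i' + n'" unfolding unif_power_dvd_unif_power .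
  show "\<varpi> ^ (i + n) dvd \<tau> - \<tau>'" if eq: "i = i'" "n = n'"
  proof -
    have "j t3 = 1" using third unfolding eq by simp
    define e g where "e = j (\<varpi> ^ i :: 'q padic_int)" and "g = j (\<varpi> ^ n :: 'q padic_int)"
    have nz: "e \<noteq> 0" "g \<noteq> 0" by (simp_all add: e_def g_def)
    have eg: "j (\<varpi> ^ (2 * i + n) :: 'q padic_int) = e * e * g"
      by (simp add: e_def g_def power_add mult_2)
    have "j \<tau> / (e * e * g) = j t2 / e + j \<tau>' / (e * e * g)"
      using t \<open>j t3 = 1\<close> unfolding eq[symmetric] frame_def Let_def prod.case eg e_def[symmetric] by simp
    hence "j \<tau> - j \<tau>' = e * g * j t2" using nz by (simp add: field_simps)
    hence "j (\<tau> - \<tau>') = j (\<varpi> ^ (i + n) * t2)" by (simp add: e_def g_def power_add)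
    hence "\<tau> - \<tau>' = \<varpi> ^ (i + n) * t2" by (simp only: j_eq_iff)
    thus ?thesis by (rule dvdI)
  qed
qed

lemma admissible_shift:
  assumes "admissible c ab i n \<tau> B C D" and \<tau>': "\<tau>' = \<tau> + \<varpi> ^ (i + n) * \<delta>"
  shows "\<exists>C' D'. admissible c ab i n \<tau>' (B + 3 * \<varpi> ^ n * \<delta>) C' D'"
proof -
  define e g where "e = (\<varpi> ^ i :: 'a padic_int)" and "g = (\<varpi> ^ n :: 'a padic_int)"
  have p: "\<varpi> ^ (2 * i + n) = e\<^sup>2 * g" "\<varpi> ^ (3 * i + 2 * n) = e ^ 3 * g\<^sup>2"
    unfolding e_def g_def by (simp_all add: power_add power_mult[symmetric] mult.commute)
  have a: "3 * \<tau> - fst ab = e * B" and b: "3 * \<tau>\<^sup>2 - 2 * fst ab * \<tau> + snd ab = e\<^sup>2 * g * C"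
    and c: "\<tau> ^ 3 - fst ab * \<tau>\<^sup>2 + snd ab * \<tau> - c = e ^ 3 * g\<^sup>2 * D"
    using assms(1) unfolding admissible_def p by (simp_all add: e_def)
  define d where "d = e * g * \<delta>"
  have \<tau>d: "\<tau>' = \<tau> + d" unfolding \<tau>' d_def e_def g_def power_add ..
  have "3 * \<tau>' - fst ab = (3 * \<tau> - fst ab) + 3 * d" unfolding \<tau>d by (simp add: algebra_simps)
  also have "\<dots> = e * (B + 3 * g * \<delta>)" unfolding a d_def by (simp add: algebra_simps)
  finally have 1: "3 * \<tau>' - fst ab = e * (B + 3 * g * \<delta>)" .
  have "3 * \<tau>'\<^sup>2 - 2 * fst ab * \<tau>' + snd ab
      = (3 * \<tau>\<^sup>2 - 2 * fst ab * \<tau> + snd ab) + 2 * (3 * \<tau> - fst ab) * d + 3 * d\<^sup>2"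
    unfolding \<tau>d by (simp add: algebra_simps power2_eq_square)
  also have "\<dots> = e\<^sup>2 * g * (C + 2 * B * \<delta> + 3 * g * \<delta>\<^sup>2)"
    unfolding a b d_def by (simp add: algebra_simps power2_eq_square)
  finally have 2: "3 * \<tau>'\<^sup>2 - 2 * fst ab * \<tau>' + snd ab = e\<^sup>2 * g * (C + 2 * B * \<delta> + 3 * g * \<delta>\<^sup>2)" .
  have "\<tau>' ^ 3 - fst ab * \<tau>'\<^sup>2 + snd ab * \<tau>' - c
      = (\<tau> ^ 3 - fst ab * \<tau>\<^sup>2 + snd ab * \<tau> - c) + (3 * \<tau>\<^sup>2 - 2 * fst ab * \<tau> + snd ab) * d
        + (3 * \<tau> - fst ab) * d\<^sup>2 + d ^ 3"
    unfolding \<tau>d by (simp add: algebra_simps power2_eq_square power3_eq_cube)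
  also have "\<dots> = e ^ 3 * g\<^sup>2 * (D + C * \<delta> + B * \<delta>\<^sup>2 + g * \<delta> ^ 3)"
    unfolding a b c d_def by (simp add: algebra_simps power2_eq_square power3_eq_cube)
  finally have 3: "\<tau>' ^ 3 - fst ab * \<tau>'\<^sup>2 + snd ab * \<tau>' - c = e ^ 3 * g\<^sup>2 * (D + C * \<delta> + B * \<delta>\<^sup>2 + g * \<delta> ^ 3)" .
  show ?thesis unfolding admissible_def p using 1 2 3 by (auto simp: e_def g_def)
qed

lemma frame_shift_subset:
  assumes \<tau>': "\<tau>' = \<tau> + \<varpi> ^ (i + n) * \<delta>" and B': "B' = B + 3 * \<varpi> ^ n * \<delta>"
  shows "range (frame i n \<tau>' B') \<subseteq> range (frame i n \<tau> B)"
proof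
  fix k assume "k \<in> range (frame i n \<tau>' B')"
  then obtain s1 s2 s3 where k: "k = frame i n \<tau>' B' (s1, s2, s3)" by auto
  define e g where "e = j (\<varpi> ^ i :: 'a padic_int)" and "g = j (\<varpi> ^ n :: 'a padic_int)"
  have nz: "e \<noteq> 0" "g \<noteq> 0" by (simp_all add: e_def g_def)
  have eg: "j (\<varpi> ^ (2 * i + n) :: 'a padic_int) = e * e * g"
    by (simp add: e_def g_def power_add mult_2)
  have j: "j \<tau>' = j \<tau> + e * g * j \<delta>" "j B' = j B + 3 * g * j \<delta>" "j (\<varpi> ^ n) = g"
    by (simp_all add: \<tau>' B' e_def g_def power_add j_numeral)
  have "k = frame i n \<tau> B (s1 - \<varpi> ^ n * \<delta> * s2 + (B * \<delta> + \<varpi> ^ n * (\<delta> * \<delta>)) * s3, s2 + \<delta> * s3, s3)"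
    unfolding k frame_def Let_def prod.case eg e_def[symmetric] to_fract_add to_fract_diff to_fract_mult j
    using nz by (simp add: field_simps power2_eq_square)
  thus "k \<in> range (frame i n \<tau> B)" by (rule range_eqI)
qed

text \<open>Translating \<open>w\<close> by \<open>- q\<^sup>n \<delta>\<close> changes \<open>\<chi>\<close> by \<open>\<delta> w\<close> up to scalars, so the change of basis is unipotent.\<close>

lemma frame_shift:
  assumes \<tau>': "\<tau>' = \<tau> + \<varpi> ^ (i + n) * \<delta>" and B': "B' = B + 3 * \<varpi> ^ n * \<delta>"
  shows "range (frame i n \<tau>' B') = range (frame i n \<tau> B)"
  by (intro equalityI frame_shift_subset[OF assms] frame_shift_subset[of \<tau> \<tau>' i n "- \<delta>"])
    (simp_all add: \<tau>' B')

section \<open>The sum over overorders\<close>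

text \<open>Among \<open>N + 1\<close> multiples of \<open>k\<close> two lie in the same coset, where \<open>N\<close> is the index.\<close>

lemma bounded_denominators:
  fixes c :: "'q::prime_card padic_int"
  assumes fin: "finite (a_rcosets\<^bsub>cubic_alg c ab\<lparr>carrier := R\<rparr>\<^esub> monogenic_order c ab)"
    and closed: "\<And>m. coord c ab (tscale (of_nat m) k) \<in> R"
    and N: "N = card (a_rcosets\<^bsub>cubic_alg c ab\<lparr>carrier := R\<rparr>\<^esub> monogenic_order c ab)"
  shows "tscale (j (of_nat (fact N))) k \<in> range j3"
proof -
  let ?C = "\<lambda>m. coord c ab ` ((\<lambda>l. l + tscale (of_nat m) k) ` range (j3 :: 'q padic_int triple \<Rightarrow> _))"
  have "?C ` {..N} \<subseteq> a_rcosets\<^bsub>cubic_alg c ab\<lparr>carrier := R\<rparr>\<^esub> monogenic_order c ab"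
  proof
    fix y assume "y \<in> ?C ` {..N}"
    then obtain m where "y = ?C m" by blast
    thus "y \<in> a_rcosets\<^bsub>cubic_alg c ab\<lparr>carrier := R\<rparr>\<^esub> monogenic_order c ab"
      unfolding A_RCOSETS_def' coset_coord[symmetric, of c ab _ R] using closed[of m] by auto
  qed
  hence "card (?C ` {..N}) \<le> N" unfolding N by (rule card_mono[OF fin])
  have noninj: "\<not> inj_on ?C {..N}"
  proof
    assume "inj_on ?C {..N}"
    from card_image[OF this] \<open>card (?C ` {..N}) \<le> N\<close> show False by simp
  qed
  have "\<exists>m m'. m \<le> N \<and> m' \<le> N \<and> m < m' \<and> ?C m' = ?C m"
  proof (rule ccontr)
    assume no: "\<not> (\<exists>m m'. m \<le> N \<and> m' \<le> N \<and> m < m' \<and> ?C m' = ?C m)"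
    have "inj_on ?C {..N}"
    proof (rule linorder_inj_onI')
      fix m m' assume "m \<in> {..N}" "m' \<in> {..N}" "m < m'"
      thus "?C m \<noteq> ?C m'" using no by (metis atMost_iff)
    qed
    thus False using noninj by contradiction
  qed
  then obtain m m' where mm: "m \<le> N" "m' \<le> N" "m < m'" "?C m' = ?C m" by (elim exE conjE)
  have "tscale (of_nat m') k - tscale (of_nat m) k \<in> range j3"
    using mm(4) unfolding inj_image_eq_iff[OF coord_inj] shifts_eq_iff .
  moreover have "tscale (of_nat m') k - tscale (of_nat m) k = tscale (of_nat (m' - m)) k"
    using mm(3) by (cases k) (simp add: of_nat_diff algebra_simps)
  ultimately have "tscale (of_nat (m' - m)) k \<in> range j3" by (simp only:)
  then obtain s where s: "tscale (of_nat (m' - m)) k = j3 s" by (rule rangeE)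
  have "m' - m dvd fact N" by (rule dvd_fact) (use mm in auto)
  then obtain l where l: "fact N = (m' - m) * l" by (elim dvdE)
  have jl: "j (of_nat (fact N)) = of_nat l * of_nat (m' - m)" for x :: "'q padic_int"
    unfolding j_of_nat l by (simp add: mult.commute)
  have "tscale (j (of_nat (fact N))) k = tscale (of_nat l) (tscale (of_nat (m' - m)) k)"
    unfolding jl by (cases k) (simp add: mult.assoc)
  also have "\<dots> = j3 (tscale (of_nat l) s)" unfolding s by (cases s) (simp add: j_of_nat)
  finally show ?thesis by (rule range_eqI)
qed

lemma overorder_classification:
  fixes c :: "'q::prime_card padic_int"
  assumes R: "subring R (cubic_alg c ab)" and sub: "monogenic_order c ab \<subseteq> R"
    and idx: "order_index (cubic_alg c ab) R (monogenic_order c ab) \<noteq> 0"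
  obtains i n \<tau> B C D where "admissible c ab i n \<tau> B C D" "R = frame_order c ab i n \<tau> B"
proof -
  define L where "L = coord c ab -` R"
  have RL: "R = coord c ab ` L"
    unfolding L_def image_vimage_eq range_coord using subringE(1)[OF R] by blast
  have add: "k + l \<in> L" if "k \<in> L" "l \<in> L" for k l
    using subringE(7)[OF R that[unfolded L_def vimage_eq]] unfolding L_def vimage_eq coord_add .
  have mult: "kmul c ab k l \<in> L" if "k \<in> L" "l \<in> L" for k l
    using subringE(6)[OF R that[unfolded L_def vimage_eq]] unfolding L_def vimage_eq coord_mult .
  have base: "range j3 \<subseteq> L"
    unfolding L_def by (rule iffD1[OF image_subset_iff_subset_vimage sub[unfolded monogenic_coord]])
  let ?N = "order_index (cubic_alg c ab) R (monogenic_order c ab)"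
  have "tscale (j (of_nat (fact ?N))) k \<in> range j3" if k: "k \<in> L" for k
  proof (rule bounded_denominators)
    show "finite (a_rcosets\<^bsub>cubic_alg c ab\<lparr>carrier := R\<rparr>\<^esub> monogenic_order c ab)"
      using idx unfolding order_index_def by (rule card_ge_0_finite[OF neq0_conv[THEN iffD1]])
    have "tscale (of_nat m) k \<in> L" for m
    proof -
      have "(j (of_nat m), 0, 0) \<in> L" using subsetD[OF base rangeI[of j3 "(of_nat m, 0, 0)"]] by simp
      from mult[OF this k] show ?thesis by (simp add: cmul_scalar j_of_nat)
    qed
    thus "coord c ab (tscale (of_nat m) k) \<in> R" for m by (simp add: L_def)
  qed (simp add: order_index_def)
  note bd = this
  have d: "of_nat (fact ?N) \<noteq> (0 :: 'q padic_int)" unfolding of_nat_eq_0_iff by simp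
  show ?thesis
  proof (rule lattice_classification[where L = L and c = c and ab = ab and d = "of_nat (fact ?N)", OF add mult base bd d])
    fix i n \<tau> B C D assume "admissible c ab i n \<tau> B C D" "L = range (frame i n \<tau> B)"
    thus ?thesis using that[of i n \<tau> B C D] RL unfolding frame_order_def by simp
  qed
qed

definition shiftr :: "nat \<Rightarrow> 'q::prime_card padic_int \<Rightarrow> 'q padic_int" where
  "shiftr m x = (THE y. x = \<varpi> ^ m * y)"

lemma shiftr_mult [simp]: "shiftr m (\<varpi> ^ m * y) = y"
  unfolding shiftr_def by (rule the_equality) simp_all

lemma shiftr_dvd: "\<varpi> ^ m dvd x \<Longrightarrow> \<varpi> ^ m * shiftr m x = x"
  by (elim dvdE) simp

definition trace_part :: "'q::prime_card padic_int \<times> 'q padic_int \<Rightarrow> 'q padic_int \<Rightarrow> 'q padic_int" where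
  "trace_part ab \<tau> = 3 * \<tau> - fst ab"
definition deriv_part :: "'q::prime_card padic_int \<times> 'q padic_int \<Rightarrow> 'q padic_int \<Rightarrow> 'q padic_int" where
  "deriv_part ab \<tau> = 3 * \<tau>\<^sup>2 - 2 * fst ab * \<tau> + snd ab"
definition value_part :: "'q::prime_card padic_int \<Rightarrow> 'q padic_int \<times> 'q padic_int \<Rightarrow> 'q padic_int \<Rightarrow> 'q padic_int" where
  "value_part c ab \<tau> = \<tau> ^ 3 - fst ab * \<tau>\<^sup>2 + snd ab * \<tau> - c"

definition overorder_at :: "'q::prime_card padic_int \<Rightarrow> 'q padic_int \<times> 'q padic_int \<Rightarrow> nat \<Rightarrow> nat \<Rightarrow> 'q padic_int \<Rightarrow> bool" where
  "overorder_at c ab i n \<tau> \<longleftrightarrow> \<varpi> ^ i dvd trace_part ab \<tau> \<and> \<varpi> ^ (2 * i + n) dvd deriv_part ab \<tau> \<and>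
     \<varpi> ^ (3 * i + 2 * n) dvd value_part c ab \<tau>"

lemma admissible_imp:
  assumes "admissible c ab i n \<tau> B C D"
  shows "overorder_at c ab i n \<tau>" "B = shiftr i (trace_part ab \<tau>)"
    "C = shiftr (2 * i + n) (deriv_part ab \<tau>)" "D = shiftr (3 * i + 2 * n) (value_part c ab \<tau>)"
  using assms unfolding admissible_def overorder_at_def trace_part_def deriv_part_def value_part_def by simp_all

lemma overorder_at_admissible:
  assumes "overorder_at c ab i n \<tau>"
  shows "admissible c ab i n \<tau> (shiftr i (trace_part ab \<tau>)) (shiftr (2 * i + n) (deriv_part ab \<tau>))
    (shiftr (3 * i + 2 * n) (value_part c ab \<tau>))"
  using assms unfolding admissible_def overorder_at_def
  by (simp add: shiftr_dvd) (simp add: trace_part_def deriv_part_def value_part_def)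

definition order_coeff :: "'q::prime_card padic_int \<Rightarrow> 'q padic_int \<times> 'q padic_int \<Rightarrow> nat \<Rightarrow> nat \<Rightarrow> 'q padic_int \<Rightarrow> nat \<Rightarrow> real" where
  "order_coeff c ab i n \<tau> v = fps_nth (local_factor (red (\<varpi> ^ n)) (red (shiftr i (trace_part ab \<tau>)))
     (red (shiftr (2 * i + n) (deriv_part ab \<tau>))) (red (shiftr (3 * i + 2 * n) (value_part c ab \<tau>)))) v"

text \<open>The overorders of index \<open>q\<^sup>r\<close> correspond to the triples \<open>(i, n, \<tau>)\<close>, with \<open>\<tau>\<close> running through
  representatives modulo \<open>q\<close> to the power \<open>i + n\<close>.\<close>

lemma S_sum_eq:
  fixes c :: "'q::prime_card padic_int"
  shows "S_sum c ab v r = (\<Sum>(i, n) | 3 * i + n = r.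
    \<Sum>k | k < CARD('q) ^ (i + n) \<and> overorder_at c ab i n (of_nat k). order_coeff c ab i n (of_nat k) v)"
proof -
  let ?O = "{R. cubic_order (cubic_alg c ab) (alg_scalar c ab) R \<and> monogenic_order c ab \<subseteq> R \<and>
            order_index (cubic_alg c ab) R (monogenic_order c ab) = CARD('q) ^ r}"
  let ?K = "\<lambda>(i, n). {k. k < CARD('q) ^ (i + n) \<and> overorder_at c ab i n (of_nat k)}"
  let ?I = "Sigma {(i, n). 3 * i + n = r} ?K"
  define B where "B i k = shiftr i (trace_part ab (of_nat k))" for i k
  let ?F = "\<lambda>((i, n), k). frame_order c ab i n (of_nat k) (B i k)"
  have q1: "1 < CARD('q)" using CARD_gt_1[where 'q='q] by simp
  have "bij_betw ?F ?I ?O" unfolding bij_betw_def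
  proof
    show "inj_on ?F ?I"
    proof (rule inj_onI)
      fix x y assume xy: "x \<in> ?I" "y \<in> ?I" "?F x = ?F y"
      obtain i n k i' n' k' where e: "x = ((i, n), k)" "y = ((i', n'), k')" by (metis prod.exhaust)
      have r: "range (frame i n (of_nat k) (B i k)) = range (frame i' n' (of_nat k') (B i' k'))"
        using xy(3) unfolding e frame_order_def prod.case inj_image_eq_iff[OF coord_inj] .
      note s = equalityD1[OF r] equalityD2[OF r]
      have "i = i'" "n = n'" using frame_range_subset(1,2)[OF s(1)] frame_range_subset(1,2)[OF s(2)] by simp_all
      hence "\<varpi> ^ (i + n) dvd (of_nat k - of_nat k' :: 'q padic_int)" using frame_range_subset(3)[OF s(1)] by simp
      hence "residue (i + n) (of_nat k :: 'q padic_int) = residue (i + n) (of_nat k' :: 'q padic_int)"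
        unfolding unif_power_dvd_diff_iff .
      hence "k = k'" using xy(1,2) \<open>i = i'\<close> \<open>n = n'\<close> by (simp add: e residue_of_nat)
      thus "x = y" using \<open>i = i'\<close> \<open>n = n'\<close> by (simp add: e)
    qed
    show "?F ` ?I = ?O"
    proof (intro equalityI subsetI)
      fix R assume "R \<in> ?F ` ?I"
      then obtain i n k where k: "3 * i + n = r" "overorder_at c ab i n (of_nat k)"
        "R = frame_order c ab i n (of_nat k) (B i k)" by auto
      from frame_order_cubic[OF overorder_at_admissible[OF k(2)]] monogenic_subset_frame_order order_index_frame
      show "R \<in> ?O" unfolding k(3) B_def using k(1) by blast
    next
      fix R assume R: "R \<in> ?O"
      hence idx: "order_index (cubic_alg c ab) R (monogenic_order c ab) \<noteq> 0" using q1 by simp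
      have Rp: "subring R (cubic_alg c ab)" "monogenic_order c ab \<subseteq> R"
        using R by (simp_all add: cubic_order_def)
      obtain i n \<tau> B0 C D where adm: "admissible c ab i n \<tau> B0 C D" and RF: "R = frame_order c ab i n \<tau> B0"
        by (rule overorder_classification[OF Rp idx])
      have "CARD('q) ^ (3 * i + n) = CARD('q) ^ r" using R unfolding RF by (simp add: order_index_frame)
      hence r: "3 * i + n = r" using q1 by simp
      let ?k = "residue (i + n) \<tau>"
      obtain \<delta> where \<delta>: "of_nat ?k - \<tau> = \<varpi> ^ (i + n) * \<delta>"
        using residue_cong[of "i + n" \<tau>] by (metis dvdE dvd_minus_iff minus_diff_eq)
      hence k: "of_nat ?k = \<tau> + \<varpi> ^ (i + n) * \<delta>" by (simp add: algebra_simps)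
      obtain C' D' where adm': "admissible c ab i n (of_nat ?k) (B0 + 3 * \<varpi> ^ n * \<delta>) C' D'"
        using admissible_shift[OF adm k] by blast
      have "R = frame_order c ab i n (of_nat ?k) (B0 + 3 * \<varpi> ^ n * \<delta>)"
        unfolding RF frame_order_def frame_shift[OF k refl] ..
      hence "R = ?F ((i, n), ?k)" using admissible_imp(2)[OF adm'] by (simp add: B_def)
      moreover have "((i, n), ?k) \<in> ?I" using r admissible_imp(1)[OF adm'] residue_less by simp
      ultimately show "R \<in> ?F ` ?I" by (rule image_eqI)
    qed
  qed
  hence "S_sum c ab v r = (\<Sum>x\<in>?I. \<kappa> (cubic_alg c ab) (alg_scalar c ab) (?F x) v)"
    unfolding S_sum_def by (rule sum.reindex_bij_betw[symmetric])
  also have "\<dots> = (\<Sum>x\<in>?I. case x of ((i, n), k) \<Rightarrow> order_coeff c ab i n (of_nat k) v)"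
  proof (rule sum.cong[OF refl])
    fix x assume x: "x \<in> ?I"
    obtain i n k where e: "x = ((i, n), k)" by (metis prod.exhaust)
    have "overorder_at c ab i n (of_nat k)" using x by (simp add: e)
    from frame_order_\<kappa>[OF overorder_at_admissible[OF this], of v]
    show "\<kappa> (cubic_alg c ab) (alg_scalar c ab) (?F x) v = (case x of ((i, n), k) \<Rightarrow> order_coeff c ab i n (of_nat k) v)"
      unfolding e prod.case B_def order_coeff_def .
  qed
  also have "\<dots> = (\<Sum>p\<in>{(i, n). 3 * i + n = r}. \<Sum>k\<in>?K p. order_coeff c ab (fst p) (snd p) (of_nat k) v)"
  proof -
    have "{(i, n). 3 * i + n = r} \<subseteq> {..r} \<times> {..r}" by auto
    hence "finite {(i, n). 3 * i + n = r}" by (rule finite_subset) simp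
    moreover have "\<forall>p\<in>{(i, n). 3 * i + n = r}. finite (?K p)" by auto
    ultimately show ?thesis by (subst sum.Sigma) (simp_all add: case_prod_beta')
  qed
  finally show ?thesis by (simp add: case_prod_beta')
qed

section \<open>Euler factors of forms over a finite field\<close>

text \<open>The value of \<open>local_factor\<close> at \<open>x\<close> as a rational function.\<close>

definition lval :: "complex \<Rightarrow> 'k::{field, finite} \<Rightarrow> 'k \<Rightarrow> 'k \<Rightarrow> 'k \<Rightarrow> complex" where
  "lval x A B C D = (1 - x) * ((if A = 0 \<and> B = 0 \<and> C = 0 \<and> D = 0 then 1 + of_nat CARD('k) * x else 1) *
    (if points A B C D = {} then 1 / (1 - x ^ 3)
     else if \<exists>h p. points A B C D = {h} \<and> cubic_algebra.eigen A B C D h p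
       then 1 / (1 - x) * (1 / (1 - x\<^sup>2))
     else (1 / (1 - x)) ^ card (points A B C D)))"

subsection \<open>Forms with vanishing leading coefficient\<close>

text \<open>For \<open>A = 0\<close> the points lie on \<open>x = 0\<close>, where \<open>y\<close> is a root of a quadratic polynomial, with one
  more point if \<open>B \<noteq> 0\<close>. Counting double roots separately avoids completing the square, which fails
  for \<open>q = 2\<close>.\<close>

definition qroots :: "'k::{field, finite} \<Rightarrow> 'k \<Rightarrow> 'k set" where
  "qroots s p = {y. y * y - s * y + p = 0}"

definition qdouble :: "'k::{field, finite} \<Rightarrow> 'k \<Rightarrow> 'k set" where
  "qdouble s p = {y. y * y - s * y + p = 0 \<and> y + y = s}"

lemma qroots_cases:
  obtains "card (qroots s p) = 0" "card (qdouble s p) = 0"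
    | "card (qroots s p) = 2" "card (qdouble s p) = 0"
    | "card (qroots s p) = 1" "card (qdouble s p) = 1"
proof (cases "qroots s p = {}")
  case True
  moreover have "qdouble s p \<subseteq> qroots s p" by (auto simp: qroots_def qdouble_def)
  ultimately show ?thesis using that(1) by auto
next
  case False
  then obtain y where y: "y * y - s * y + p = 0" by (auto simp: qroots_def)
  have p: "p = y * (s - y)" using y by (simp add: algebra_simps add_eq_0_iff eq_neg_iff_add_eq_0)
  have r: "z * z - s * z + p = (z - y) * (z - (s - y))" for z unfolding p by (simp add: algebra_simps)
  have R: "qroots s p = {y, s - y}" unfolding qroots_def r by auto
  show ?thesis
  proof (cases "y = s - y")
    case True
    have "y + y = s" by (subst (2) True) simp
    hence "qdouble s p = {y}" unfolding qdouble_def r using True by auto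
    thus ?thesis using that(3) R True by simp
  next
    case False
    have "qdouble s p = {}"
    proof -
      have "z + z \<noteq> s" if "z = y \<or> z = s - y" for z
        using that False by (auto simp: eq_diff_eq)
      thus ?thesis unfolding qdouble_def r by auto
    qed
    thus ?thesis using that(2) R False by simp
  qed
qed

lemma points_degenerate:
  "points 0 B C (D :: 'k::{field, finite}) = (\<lambda>y. (0, y)) ` qroots C (B * D) \<union> (if B = 0 then {} else {(- B, 0)})"
proof -
  have "(x, y) \<in> points 0 B C D \<longleftrightarrow> (x = 0 \<and> y \<in> qroots C (B * D)) \<or> (B \<noteq> 0 \<and> x = - B \<and> y = 0)" for x y
  proof (cases "x = 0")
    case True
    have "y * y = - (B * D) + C * y \<longleftrightarrow> y * y - C * y + B * D = 0"
      by (simp add: algebra_simps add_eq_0_iff eq_neg_iff_add_eq_0)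
    thus ?thesis using True by (auto simp: points_def qroots_def)
  next
    case False
    have "x * x = - (B * x) \<longleftrightarrow> x * x = (- B) * x" by simp
    also have "\<dots> \<longleftrightarrow> x = - B" using False by (simp only: mult_cancel_right) simp
    finally have "x * x = - (B * x) \<longleftrightarrow> x = - B" .
    thus ?thesis using False by (auto simp: points_def)
  qed
  thus ?thesis by auto
qed

text \<open>The combination of the numbers of roots and of double roots interpolates the three splitting types.\<close>

lemma lval_degenerate:
  fixes B C D :: "'k::{field, finite}"
  assumes x: "x \<noteq> 1" "x\<^sup>2 \<noteq> 1"
  shows "B \<noteq> 0 \<Longrightarrow> lval x 0 B C D = 1 / (1 - x\<^sup>2) + x / ((1 - x) * (1 - x\<^sup>2)) * of_nat (card (qroots C (B * D)))
        - x\<^sup>2 / ((1 - x) * (1 - x\<^sup>2)) * of_nat (card (qdouble C (B * D)))"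
    and "B = 0 \<Longrightarrow> C \<noteq> 0 \<Longrightarrow> lval x 0 B C D = 1 / (1 - x)"
    and "B = 0 \<Longrightarrow> C = 0 \<Longrightarrow> D \<noteq> 0 \<Longrightarrow> lval x 0 B C D = 1"
    and "B = 0 \<Longrightarrow> C = 0 \<Longrightarrow> D = 0 \<Longrightarrow> lval x 0 B C D = 1 + of_nat CARD('k) * x"
proof -
  have nz: "1 - x \<noteq> 0" "1 - x\<^sup>2 \<noteq> 0" using x by auto
  have f: "1 - x\<^sup>2 = (1 - x) * (1 + x)" by (simp add: power2_eq_square algebra_simps)
  have nz': "1 + x \<noteq> 0" using nz(2) unfolding f by auto
  {
    assume B: "B \<noteq> 0"
    have P: "points 0 B C D = insert (- B, 0) ((\<lambda>y. (0, y)) ` qroots C (B * D))"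
      using B unfolding points_degenerate by auto
    have c: "card (points 0 B C D) = Suc (card (qroots C (B * D)))" unfolding P
      by (subst card_insert_disjoint) (use B in \<open>auto simp: card_image inj_on_def\<close>)
    have ne: "points 0 B C D \<noteq> {}" unfolding P by simp
    show "lval x 0 B C D = 1 / (1 - x\<^sup>2) + x / ((1 - x) * (1 - x\<^sup>2)) * of_nat (card (qroots C (B * D)))
        - x\<^sup>2 / ((1 - x) * (1 - x\<^sup>2)) * of_nat (card (qdouble C (B * D)))"
    proof (cases rule: qroots_cases[of C "B * D"])
      case 1
      hence "qroots C (B * D) = {}" by simp
      hence "points 0 B C D = {(- B, 0)}" unfolding P by simp
      moreover have "cubic_algebra.eigen 0 B C D (- B, 0) (0, 1, 0)"
        unfolding cubic_algebra.eigen_def using B by (auto simp: cmul_def algebra_simps)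
      ultimately have e: "\<exists>h p. points 0 B C D = {h} \<and> cubic_algebra.eigen 0 B C D h p" by blast
      show ?thesis unfolding lval_def if_not_P[OF ne] if_P[OF e] using B 1 nz by simp
    next
      case 2
      have ns: "\<not> (\<exists>h p. points 0 B C D = {h} \<and> cubic_algebra.eigen 0 B C D h p)"
        using c 2 by auto
      show ?thesis unfolding lval_def if_not_P[OF ne] if_not_P[OF ns] c 2 using B nz nz' unfolding f
        by (simp add: divide_simps) (simp add: algebra_simps power2_eq_square power3_eq_cube)
    next
      case 3
      have ns: "\<not> (\<exists>h p. points 0 B C D = {h} \<and> cubic_algebra.eigen 0 B C D h p)"
        using c 3 by auto
      show ?thesis unfolding lval_def if_not_P[OF ne] if_not_P[OF ns] c 3 using B nz nz' unfolding f
        by (simp add: divide_simps) (simp add: algebra_simps power2_eq_square power3_eq_cube)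
    qed
  next
    assume B: "B = 0" and C: "C \<noteq> 0"
    have q: "qroots C 0 = {0, C}" by (auto simp: qroots_def)
    have "points 0 B C D = {(0, 0), (0, C)}" unfolding points_degenerate by (simp add: B q)
    hence *: "card (points 0 B C D) = 2" "points 0 B C D \<noteq> {}"
       "\<not> (\<exists>h p. points 0 B C D = {h} \<and> cubic_algebra.eigen 0 B C D h p)" using C by auto
    show "lval x 0 B C D = 1 / (1 - x)" unfolding lval_def if_not_P[OF *(2)] if_not_P[OF *(3)] *(1)
      using nz B C by (simp add: power2_eq_square)
  next
    have *: "points 0 B C D \<noteq> {}" "card (points 0 B C D) = 1"
      "\<not> (\<exists>h p. points 0 B C D = {h} \<and> cubic_algebra.eigen 0 B C D h p)" if BC: "B = 0" "C = 0"
    proof -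
      have q: "qroots 0 0 = {0 :: 'k}" by (auto simp: qroots_def)
      have P: "points 0 B C D = {(0, 0)}" unfolding points_degenerate by (simp add: BC q)
      thus "points 0 B C D \<noteq> {}" "card (points 0 B C D) = 1" by auto
      have "\<not> cubic_algebra.eigen 0 B C D (0, 0) p" for p
      proof
        assume e: "cubic_algebra.eigen 0 B C D (0, 0) p"
        obtain p1 p2 p3 where p: "p = (p1, p2, p3)" by (cases p)
        have "p1 \<noteq> 0" using e by (simp add: cubic_algebra.eigen_def p)
        moreover have "cmul 0 B C D (0, 1, 0) p = tscale (ev (0, 0) (0, 1, 0)) p"
          using e by (simp only: cubic_algebra.eigen_def)
        ultimately show False by (simp add: p cmul_def BC)
      qed
      thus "\<not> (\<exists>h p. points 0 B C D = {h} \<and> cubic_algebra.eigen 0 B C D h p)" unfolding P by auto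
    qed
    show "lval x 0 B C D = 1" if "B = 0" "C = 0" "D \<noteq> 0"
      unfolding lval_def if_not_P[OF *(1)[OF that(1,2)]] if_not_P[OF *(3)[OF that(1,2)]] *(2)[OF that(1,2)]
      using that nz by simp
    show "lval x 0 B C D = 1 + of_nat CARD('k) * x" if "B = 0" "C = 0" "D = 0"
      unfolding lval_def if_not_P[OF *(1)[OF that(1,2)]] if_not_P[OF *(3)[OF that(1,2)]] *(2)[OF that(1,2)]
      using that nz by simp
  }
qed

text \<open>Double counting: all counts below are sums over a coefficient that is determined by a root.\<close>

lemma sum_card_unique:
  fixes P :: "'a::finite \<Rightarrow> 'b::finite \<Rightarrow> bool"
  assumes "\<And>y. y \<in> Y \<Longrightarrow> \<exists>!d. P y d" and "\<And>y d. P y d \<Longrightarrow> y \<in> Y"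
  shows "(\<Sum>d\<in>UNIV. card {y. P y d}) = card Y"
proof -
  have "(\<Sum>d\<in>UNIV. card {y. P y d}) = card (SIGMA d:UNIV. {y. P y d})" by simp
  also have "\<dots> = card Y"
  proof (rule bij_betw_same_card[of snd])
    show "bij_betw snd (SIGMA d:UNIV. {y. P y d}) Y"
      unfolding bij_betw_def
    proof
      show "inj_on snd (SIGMA d:UNIV. {y. P y d})"
        using assms by (auto simp: inj_on_def)
      show "snd ` (SIGMA d:UNIV. {y. P y d}) = Y" using assms by force
    qed
  qed
  finally show ?thesis .
qed

lemma card_UNIV_minus_0: "card (UNIV - {0 :: 'k::{field, finite}}) = CARD('k) - 1"
  by (simp add: card_Diff_singleton)

lemma sum_UNIV_0: "(\<Sum>s\<in>UNIV. f s) = f 0 + (\<Sum>s\<in>UNIV - {0 :: 'k::{field, finite}}. (f s :: complex))"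
  by (subst sum.remove[of UNIV 0]) simp_all

lemma of_nat_CARD_minus_1: "of_nat (CARD('k::{field, finite}) - 1) = (of_nat CARD('k) - 1 :: complex)"
  by (simp add: of_nat_diff Suc_leI)

lemma degenerate_mean_unit:
  fixes B :: "'k::{field, finite}"
  assumes x: "x \<noteq> 1" "x\<^sup>2 \<noteq> 1" and B: "B \<noteq> 0"
  defines "Q \<equiv> of_nat CARD('k) :: complex"
  shows "(\<Sum>C\<in>UNIV. \<Sum>D\<in>UNIV. lval x 0 B C D) = Q\<^sup>2 * (1 - x\<^sup>2 / Q) / ((1 - x) * (1 - x\<^sup>2))"
proof -
  have Q0: "Q \<noteq> 0" by (simp add: Q_def)
  have nz: "1 - x \<noteq> 0" "1 - x\<^sup>2 \<noteq> 0" using x by auto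
  have r: "(\<Sum>D\<in>UNIV. card (qroots C (B * D))) = CARD('k)" for C
    unfolding qroots_def
  proof (rule sum_card_unique)
    fix y show "\<exists>!D. y * y - C * y + B * D = 0"
      by (rule ex1I[of _ "(C * y - y * y) / B"]) (use B in \<open>auto simp: field_simps add_eq_0_iff eq_neg_iff_add_eq_0\<close>)
  qed simp
  have "(\<Sum>D\<in>UNIV. card (qdouble C (B * D))) = card {y. y + y = C}" for C
    unfolding qdouble_def
  proof (rule sum_card_unique)
    fix y assume "y \<in> {y. y + y = C}"
    thus "\<exists>!D. y * y - C * y + B * D = 0 \<and> y + y = C"
      by (intro ex1I[of _ "(C * y - y * y) / B"]) (use B in \<open>auto simp: field_simps add_eq_0_iff eq_neg_iff_add_eq_0\<close>)
  qed simp
  hence d: "(\<Sum>C\<in>UNIV. \<Sum>D\<in>UNIV. card (qdouble C (B * D))) = CARD('k)"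
    by (simp only:) (rule sum_card_unique, auto)
  have "(\<Sum>C\<in>UNIV. \<Sum>D\<in>UNIV. lval x 0 B C D) =
     Q\<^sup>2 / (1 - x\<^sup>2) + x / ((1 - x) * (1 - x\<^sup>2)) * of_nat (\<Sum>C\<in>(UNIV :: 'k set). \<Sum>D\<in>UNIV. card (qroots C (B * D)))
     - x\<^sup>2 / ((1 - x) * (1 - x\<^sup>2)) * of_nat (\<Sum>C\<in>(UNIV :: 'k set). \<Sum>D\<in>UNIV. card (qdouble C (B * D)))"
    by (simp add: lval_degenerate(1)[OF x B] sum.distrib sum_subtractf sum_distrib_left Q_def power2_eq_square)
  also have "\<dots> = Q\<^sup>2 / (1 - x\<^sup>2) + x / ((1 - x) * (1 - x\<^sup>2)) * Q\<^sup>2 - x\<^sup>2 / ((1 - x) * (1 - x\<^sup>2)) * Q"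
    unfolding d r by (simp add: Q_def power2_eq_square)
  also have "\<dots> = Q\<^sup>2 * (1 - x\<^sup>2 / Q) / ((1 - x) * (1 - x\<^sup>2))"
    using nz Q0 by (simp add: divide_simps) (simp add: algebra_simps power2_eq_square)
  finally show ?thesis .
qed

lemma degenerate_mean_zero:
  assumes x: "x \<noteq> 1" "x\<^sup>2 \<noteq> 1"
  defines "Q \<equiv> of_nat CARD('k::{field, finite}) :: complex"
  shows "(\<Sum>C\<in>UNIV. \<Sum>D\<in>UNIV. lval x 0 0 C (D :: 'k)) = Q\<^sup>2 * (1 - x\<^sup>2 / Q) / (1 - x)"
proof -
  have Q0: "Q \<noteq> 0" by (simp add: Q_def)
  have nz: "1 - x \<noteq> 0" using x by auto
  note L = lval_degenerate(2-4)[OF x]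
  have "(\<Sum>C\<in>UNIV. \<Sum>D\<in>UNIV. lval x 0 0 C (D :: 'k)) = (1 + Q * x) + (Q - 1) + (Q - 1) * (Q / (1 - x))"
    unfolding sum_UNIV_0[of "\<lambda>C. \<Sum>D\<in>UNIV. lval x 0 0 C (D :: 'k)"] sum_UNIV_0[of "\<lambda>D. lval x 0 0 0 (D :: 'k)"]
    by (simp add: L card_UNIV_minus_0 of_nat_CARD_minus_1 Q_def)
  also have "\<dots> = Q\<^sup>2 * (1 - x\<^sup>2 / Q) / (1 - x)"
  proof -
    have "((1 + Q * x) + (Q - 1) + (Q - 1) * (Q / (1 - x))) * (1 - x) = ((1 + Q * x) + (Q - 1)) * (1 - x) + (Q - 1) * Q"
      using nz by (simp add: distrib_right)
    also have "\<dots> = Q * (Q - x\<^sup>2)" by (simp add: algebra_simps power2_eq_square)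
    also have "\<dots> = Q\<^sup>2 * (1 - x\<^sup>2 / Q)" using Q0 by (simp add: power2_eq_square right_diff_distrib)
    finally show ?thesis using nz by (simp add: eq_divide_eq)
  qed
  finally show ?thesis .
qed

lemma degenerate_sum_zero:
  assumes x: "x \<noteq> 1" "x\<^sup>2 \<noteq> 1"
  defines "Q \<equiv> of_nat CARD('k::{field, finite}) :: complex"
  shows "(\<Sum>B\<in>UNIV. \<Sum>C\<in>UNIV. lval x 0 B C (0 :: 'k)) =
    (Q - 1)\<^sup>2 / (1 - x)\<^sup>2 + 2 * (Q - 1) / (1 - x) + 1 + Q * x"
proof -
  have nz: "1 - x \<noteq> 0" "1 - x\<^sup>2 \<noteq> 0" using x by auto
  have f: "1 - x\<^sup>2 = (1 - x) * (1 + x)" by (simp add: power2_eq_square algebra_simps)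
  have nz': "1 + x \<noteq> 0" using nz(2) unfolding f by auto
  note L = lval_degenerate(2-4)[OF x]
  have "y * y - C * y + 0 = 0 \<longleftrightarrow> y = 0 \<or> y = C" for y C :: 'k
    by (auto simp flip: left_diff_distrib)
  moreover have "(2 :: 'k) \<noteq> 1"
  proof
    assume "(2 :: 'k) = 1"
    hence "(1 :: 'k) + 1 = 1 + 0" by (simp only: one_add_one add_0_right)
    thus False by (simp only: add_left_cancel one_neq_zero)
  qed
  ultimately have q: "qroots C 0 = {0, C}" "qdouble C 0 = (if C = 0 then {0} else {})" for C :: 'k
    unfolding qroots_def qdouble_def by (auto simp del: add_0_right)
  have B: "lval x 0 B C (0 :: 'k) = (if C = 0 then 1 / (1 - x) else 1 / (1 - x)\<^sup>2)" if "B \<noteq> 0" for B C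
    unfolding lval_degenerate(1)[OF x that] using nz nz' unfolding f
    by (simp add: q divide_simps) (simp add: algebra_simps power2_eq_square power3_eq_cube)
  have "(\<Sum>B\<in>UNIV. \<Sum>C\<in>UNIV. lval x 0 B C (0 :: 'k)) =
     ((1 + Q * x) + (Q - 1) / (1 - x)) + (Q - 1) * (1 / (1 - x) + (Q - 1) / (1 - x)\<^sup>2)"
    unfolding sum_UNIV_0[of "\<lambda>B. \<Sum>C\<in>UNIV. lval x 0 B C (0 :: 'k)"] sum_UNIV_0[of "\<lambda>C. lval x 0 0 C (0 :: 'k)"]
    unfolding sum_UNIV_0[of "\<lambda>C. lval x 0 _ C (0 :: 'k)"]
    by (simp add: L B card_UNIV_minus_0 of_nat_CARD_minus_1 Q_def)
  also have "\<dots> = (1 + Q * x) + (Q - 1) / (1 - x) + (Q - 1) / (1 - x) + (Q - 1)\<^sup>2 / (1 - x)\<^sup>2"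
    by (simp add: distrib_left power2_eq_square)
  finally show ?thesis by simp
qed

lemma degenerate_sum_unit:
  fixes D :: "'k::{field, finite}"
  assumes x: "x \<noteq> 1" "x\<^sup>2 \<noteq> 1" and D: "D \<noteq> 0"
  defines "Q \<equiv> of_nat CARD('k) :: complex"
  shows "(\<Sum>B\<in>UNIV. \<Sum>C\<in>UNIV. lval x 0 B C D) = 1 + (Q - 1) / (1 - x) +
    (Q - 1) * (Q / (1 - x\<^sup>2) + x / ((1 - x) * (1 - x\<^sup>2)) * (Q - 1) - x\<^sup>2 / ((1 - x) * (1 - x\<^sup>2)))"
proof -
  note L = lval_degenerate(2-4)[OF x]
  have r: "(\<Sum>C\<in>UNIV. card (qroots C (B * D))) = CARD('k) - 1" if B: "B \<noteq> 0" for B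
    unfolding qroots_def card_UNIV_minus_0[symmetric]
  proof (rule sum_card_unique)
    fix y assume "y \<in> UNIV - {0 :: 'k}"
    thus "\<exists>!C. y * y - C * y + B * D = 0"
      by (intro ex1I[of _ "(B * D + y * y) / y"]) (auto simp: field_simps add_eq_0_iff eq_neg_iff_add_eq_0)
  next
    fix y C assume "y * y - C * y + B * D = 0"
    thus "y \<in> UNIV - {0}" using B D by auto
  qed
  have "(\<Sum>C\<in>UNIV. card (qdouble C (B * D))) = card {y. y * y = B * D}" for B
    unfolding qdouble_def
  proof (rule sum_card_unique)
    fix y assume "y \<in> {y. y * y = B * D}"
    thus "\<exists>!C. y * y - C * y + B * D = 0 \<and> y + y = C"
      by (intro ex1I[of _ "y + y"]) (auto simp: algebra_simps)
  next
    fix y C assume "y * y - C * y + B * D = 0 \<and> y + y = C"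
    thus "y \<in> {y. y * y = B * D}" by (auto simp: algebra_simps)
  qed
  hence "(\<Sum>B\<in>UNIV - {0}. \<Sum>C\<in>UNIV. card (qdouble C (B * D))) = (\<Sum>B\<in>UNIV - {0}. card {y. y * y = B * D})" by simp
  also have "\<dots> = (\<Sum>B\<in>UNIV. card {y. y * y = B * D \<and> y \<noteq> 0})"
    using D by (intro sum.mono_neutral_cong_left) (auto intro!: arg_cong[where f = card])
  also have "\<dots> = card (UNIV - {0 :: 'k})"
  proof (rule sum_card_unique)
    fix y assume "y \<in> UNIV - {0 :: 'k}"
    thus "\<exists>!B. y * y = B * D \<and> y \<noteq> 0" using D by (intro ex1I[of _ "y * y / D"]) auto
  qed simp
  finally have d: "(\<Sum>B\<in>UNIV - {0}. \<Sum>C\<in>UNIV. card (qdouble C (B * D))) = CARD('k) - 1"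
    by (simp only: card_UNIV_minus_0)
  have "(\<Sum>B\<in>UNIV - {0}. \<Sum>C\<in>UNIV. lval x 0 B C D) = (\<Sum>B\<in>UNIV - {0 :: 'k}. \<Sum>C\<in>(UNIV :: 'k set). 1 / (1 - x\<^sup>2) +
        x / ((1 - x) * (1 - x\<^sup>2)) * of_nat (card (qroots C (B * D)))
        - x\<^sup>2 / ((1 - x) * (1 - x\<^sup>2)) * of_nat (card (qdouble C (B * D))))"
    by (rule sum.cong[OF refl], rule sum.cong[OF refl]) (simp add: lval_degenerate(1)[OF x])
  also have "\<dots> = (Q - 1) * (Q / (1 - x\<^sup>2)) + x / ((1 - x) * (1 - x\<^sup>2)) * of_nat (\<Sum>B\<in>UNIV - {0}. \<Sum>C\<in>(UNIV :: 'k set). card (qroots C (B * D)))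
        - x\<^sup>2 / ((1 - x) * (1 - x\<^sup>2)) * of_nat (\<Sum>B\<in>UNIV - {0}. \<Sum>C\<in>(UNIV :: 'k set). card (qdouble C (B * D)))"
    by (simp add: sum.distrib sum_subtractf sum_distrib_left Q_def card_UNIV_minus_0 of_nat_CARD_minus_1)
  also have "of_nat (\<Sum>B\<in>UNIV - {0}. \<Sum>C\<in>(UNIV :: 'k set). card (qroots C (B * D))) = (Q - 1) * (Q - 1)"
    by (simp add: r card_UNIV_minus_0 of_nat_CARD_minus_1 Q_def)
  finally have "(\<Sum>B\<in>UNIV - {0}. \<Sum>C\<in>UNIV. lval x 0 B C D) =
    (Q - 1) * (Q / (1 - x\<^sup>2)) + x / ((1 - x) * (1 - x\<^sup>2)) * ((Q - 1) * (Q - 1)) - x\<^sup>2 / ((1 - x) * (1 - x\<^sup>2)) * (Q - 1)"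
    unfolding d by (simp add: of_nat_CARD_minus_1 Q_def)
  moreover have "(\<Sum>C\<in>UNIV. lval x 0 0 C D) = 1 + (Q - 1) / (1 - x)"
    unfolding sum_UNIV_0[of "\<lambda>C. lval x 0 0 C D"]
    by (simp add: L D card_UNIV_minus_0 of_nat_CARD_minus_1 Q_def)
  ultimately show ?thesis unfolding sum_UNIV_0[of "\<lambda>B. \<Sum>C\<in>UNIV. lval x 0 B C D"]
    by (simp add: algebra_simps)
qed

subsection \<open>Monic forms\<close>

definition croots :: "'k::{field, finite} \<Rightarrow> 'k \<Rightarrow> 'k \<Rightarrow> 'k set" where
  "croots B C D = {s. s * s * s + B * (s * s) + C * s + D = 0}"
definition cdouble :: "'k::{field, finite} \<Rightarrow> 'k \<Rightarrow> 'k \<Rightarrow> 'k set" where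
  "cdouble B C D = {s \<in> croots B C D. 3 * (s * s) + 2 * (B * s) + C = 0}"
definition ctriple :: "'k::{field, finite} \<Rightarrow> 'k \<Rightarrow> 'k \<Rightarrow> 'k set" where
  "ctriple B C D = {s \<in> cdouble B C D. 3 * s + B = 0}"

lemma points_monic: "points 1 B C (D :: 'k::{field, finite}) = (\<lambda>s. (s, s * s + B * s + C)) ` croots B C D"
proof (intro equalityI subsetI)
  fix h assume "h \<in> points 1 B C D"
  then obtain x y where h: "h = (x, y)" "x * x = - C - B * x + y" "x * y = - D" by (auto simp: points_def)
  have y: "y = x * x + B * x + C" using h(2) by (simp add: algebra_simps)
  have "x * x * x + B * (x * x) + C * x + D = x * y + D" unfolding y by (simp add: algebra_simps)
  hence "x \<in> croots B C D" using h(3) by (simp add: croots_def)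
  thus "h \<in> (\<lambda>s. (s, s * s + B * s + C)) ` croots B C D" using h(1) y by blast
next
  fix h assume "h \<in> (\<lambda>s. (s, s * s + B * s + C)) ` croots B C D"
  then obtain s where h: "h = (s, s * s + B * s + C)" and s: "s * s * s + B * (s * s) + C * s + D = 0"
    by (auto simp: croots_def)
  have D: "D = - (s * s * s + B * (s * s) + C * s)" by (rule minus_unique[OF s, symmetric])
  show "h \<in> points 1 B C D" unfolding points_def h D by (simp add: algebra_simps)
qed

lemma card_points_monic: "card (points 1 B C (D :: 'k::{field, finite})) = card (croots B C D)"
  unfolding points_monic by (rule card_image) (auto simp: inj_on_def)

lemma eigen_monic:
  fixes s :: "'k::{field, finite}"
  assumes s: "s \<in> croots B C D"
  shows "(\<exists>p. cubic_algebra.eigen 1 B C D (s, s * s + B * s + C) p) \<longleftrightarrow> s \<notin> cdouble B C D"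
proof -
  let ?h = "(s, s * s + B * s + C)" and ?p = "(s * s + B * s, s, 1)"
  have D: "D = - (s * s * s + B * (s * s) + C * s)"
    by (rule minus_unique[symmetric]) (use s in \<open>simp add: croots_def\<close>)
  have act: "cmul 1 B C D z ?p = tscale (ev ?h z) ?p" for z
    unfolding D by (cases z) (simp add: cmul_def algebra_simps)
  have ev: "ev ?h ?p = 3 * (s * s) + 2 * (B * s) + C" by (simp add: algebra_simps)
  have pt: "?h \<in> points 1 B C D" using s unfolding points_monic by blast
  show ?thesis
  proof (cases "3 * (s * s) + 2 * (B * s) + C = 0")
    case True
    have "\<not> cubic_algebra.eigen 1 B C D ?h p" for p
    proof
      assume e: "cubic_algebra.eigen 1 B C D ?h p"
      have "tscale (ev ?h p) ?p = cmul 1 B C D p ?p" by (simp only: act)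
      also have "\<dots> = cmul 1 B C D ?p p" by (rule cmul_commute)
      also have "\<dots> = tscale (ev ?h ?p) p" using e by (simp only: cubic_algebra.eigen_def)
      finally have "ev ?h p = 0" unfolding ev True by (cases p) simp
      thus False using e by (simp add: cubic_algebra.eigen_def)
    qed
    thus ?thesis using True s by (simp add: cdouble_def)
  next
    case False
    hence "cubic_algebra.eigen 1 B C D ?h ?p" unfolding cubic_algebra.eigen_def ev
      by (rule conjI[OF _ allI[OF act]])
    thus ?thesis using False by (auto simp: cdouble_def)
  qed
qed

lemma croots_cases:
  fixes B C D :: "'k::{field, finite}"
  obtains (none) "card (croots B C D) = 0" "card (cdouble B C D) = 0" "card (ctriple B C D) = 0"
    | (one) "card (croots B C D) = 1" "card (cdouble B C D) = 0" "card (ctriple B C D) = 0"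
    | (three) "card (croots B C D) = 3" "card (cdouble B C D) = 0" "card (ctriple B C D) = 0"
    | (two) "card (croots B C D) = 2" "card (cdouble B C D) = 1" "card (ctriple B C D) = 0"
    | (triple) "card (croots B C D) = 1" "card (cdouble B C D) = 1" "card (ctriple B C D) = 1"
proof (cases "croots B C D = {}")
  case True
  hence "cdouble B C D = {}" "ctriple B C D = {}" by (auto simp: cdouble_def ctriple_def)
  thus ?thesis using none True by simp
next
  case False
  then obtain s where s: "s * s * s + B * (s * s) + C * s + D = 0" by (auto simp: croots_def)
  have D: "D = - (s * s * s + B * (s * s) + C * s)"
    by (rule minus_unique[OF s, symmetric])
  have fac: "z * z * z + B * (z * z) + C * z + D = (z - s) * (z * z - (- (B + s)) * z + (C + B * s + s * s))" for z
    unfolding D by (simp add: algebra_simps)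
  define p r where "p = C + B * s + s * s" and "r = - (B + s)"
  have R: "croots B C D = insert s (qroots r p)" unfolding croots_def fac qroots_def p_def r_def by auto
  show ?thesis
  proof (cases "qroots r p = {}")
    case True
    have "3 * (s * s) + 2 * (B * s) + C \<noteq> 0"
    proof
      assume "3 * (s * s) + 2 * (B * s) + C = 0"
      hence "s \<in> qroots r p" unfolding qroots_def p_def r_def by (simp add: algebra_simps)
      thus False using True by simp
    qed
    hence "cdouble B C D = {}" unfolding cdouble_def R True by auto
    hence "ctriple B C D = {}" by (simp add: ctriple_def)
    show ?thesis by (rule one) (simp_all add: R True \<open>cdouble B C D = {}\<close> \<open>ctriple B C D = {}\<close>)
  next
    case False
    then obtain t where t: "t * t - r * t + p = 0" by (auto simp: qroots_def)
    define u where "u = r - t"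
    have p: "p = t * u" using t unfolding u_def by (simp add: algebra_simps add_eq_0_iff eq_neg_iff_add_eq_0)
    have r: "r = t + u" by (simp add: u_def)
    have Q: "qroots r p = {t, u}"
    proof -
      have "z * z - r * z + p = (z - t) * (z - u)" for z unfolding p r by (simp add: algebra_simps)
      thus ?thesis unfolding qroots_def by auto
    qed
    have B: "B = - (s + t + u)" using r_def r by (simp add: algebra_simps)
    have C: "C = s * t + s * u + t * u"
    proof -
      have "C = p - B * s - s * s" unfolding p_def by simp
      thus ?thesis unfolding p B by (simp add: algebra_simps)
    qed
    have RR: "croots B C D = {s, t, u}" unfolding R Q ..
    have der: "3 * (s * s) + 2 * (B * s) + C = (s - t) * (s - u)" "3 * (t * t) + 2 * (B * t) + C = (t - s) * (t - u)"
      "3 * (u * u) + 2 * (B * u) + C = (u - s) * (u - t)" unfolding B C by (simp_all add: algebra_simps)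
    have sec: "3 * s + B = (s - t) + (s - u)" "3 * t + B = (t - s) + (t - u)" "3 * u + B = (u - s) + (u - t)"
      unfolding B by (simp_all add: algebra_simps)
    have dd: "cdouble B C D = {z \<in> {s, t, u}. 3 * (z * z) + 2 * (B * z) + C = 0}" unfolding cdouble_def RR ..
    consider "s = t" "t = u" | "s = t" "t \<noteq> u" | "s = u" "t \<noteq> u" | "t = u" "s \<noteq> t" | "s \<noteq> t" "t \<noteq> u" "s \<noteq> u" by blast
    thus ?thesis
    proof cases
      case 1
      have "cdouble B C D = {s}" "ctriple B C D = {s}" unfolding ctriple_def dd using 1 der sec by auto
      thus ?thesis using triple RR 1 by simp
    next
      case 2
      have "3 * s + B \<noteq> 0" unfolding sec using 2 by simp
      hence "cdouble B C D = {s}" "ctriple B C D = {}" unfolding ctriple_def dd using 2 der by auto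
      thus ?thesis using two RR 2 by simp
    next
      case 3
      have "3 * s + B \<noteq> 0" unfolding sec using 3 by simp
      hence "cdouble B C D = {s}" "ctriple B C D = {}" unfolding ctriple_def dd using 3 der by auto
      thus ?thesis using two RR 3 by (simp add: insert_commute)
    next
      case 4
      have "3 * t + B \<noteq> 0" unfolding sec using 4 by simp
      hence "cdouble B C D = {t}" "ctriple B C D = {}" unfolding ctriple_def dd using 4 der by auto
      thus ?thesis using two RR 4 by simp
    next
      case 5
      have "cdouble B C D = {}" "ctriple B C D = {}" unfolding ctriple_def dd using 5 der by auto
      thus ?thesis using three RR 5 by simp
    qed
  qed
qed

text \<open>For \<open>A = 1\<close> the numbers of roots, of pairs of distinct roots, of double roots and of triple roots
  separate the five splitting types; the coefficients solve the resulting linear system.\<close>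

lemma lval_monic:
  fixes B C D :: "'k::{field, finite}"
  assumes x: "x \<noteq> 1" "x\<^sup>2 \<noteq> 1" "x ^ 3 \<noteq> 1"
  defines "\<Delta> \<equiv> (1 - x\<^sup>2) * (1 - x ^ 3)"
  shows "lval x 1 B C D = (1 - x) / (1 - x ^ 3) +
    (x + 2 * x\<^sup>2) * (1 - x) / \<Delta> * of_nat (card (croots B C D)) +
    x ^ 3 / \<Delta> * (of_nat (card (croots B C D)) * (of_nat (card (croots B C D)) - 1)) -
    (x\<^sup>2 + x ^ 4) / \<Delta> * of_nat (card (cdouble B C D)) +
    x ^ 4 * (1 + x) / \<Delta> * of_nat (card (ctriple B C D))"
proof -
  define t where "t = 1 + x + x\<^sup>2"
  have f: "1 - x\<^sup>2 = (1 - x) * (1 + x)" "1 - x ^ 3 = (1 - x) * t"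
    by (simp_all add: t_def power2_eq_square power3_eq_cube algebra_simps)
  have nz: "1 - x \<noteq> 0" "1 + x \<noteq> 0" "t \<noteq> 0" using x f by auto
  have ne: "points 1 B C D = {} \<longleftrightarrow> card (croots B C D) = 0" unfolding points_monic by simp
  have lv: "lval x 1 B C D = (1 - x) * (if card (croots B C D) = 0 then 1 / (1 - x ^ 3)
     else if card (croots B C D) = 1 \<and> card (cdouble B C D) = 0 then 1 / (1 - x) * (1 / (1 - x\<^sup>2))
     else (1 / (1 - x)) ^ card (croots B C D))"
  proof -
    have "(\<exists>h p. points 1 B C D = {h} \<and> cubic_algebra.eigen 1 B C D h p) \<longleftrightarrow>
      card (croots B C D) = 1 \<and> card (cdouble B C D) = 0"
    proof
      assume "\<exists>h p. points 1 B C D = {h} \<and> cubic_algebra.eigen 1 B C D h p"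
      then obtain h p where h: "points 1 B C D = {h}" "cubic_algebra.eigen 1 B C D h p" by blast
      have c1: "card (croots B C D) = 1" using h(1) card_points_monic[of B C D] by simp
      then obtain s where s: "croots B C D = {s}" by (rule card_1_singletonE)
      have "h = (s, s * s + B * s + C)" using h(1) unfolding points_monic s by simp
      hence "s \<notin> cdouble B C D" using eigen_monic[of s B C D] h(2) s by blast
      hence "cdouble B C D = {}" using s by (auto simp: cdouble_def)
      thus "card (croots B C D) = 1 \<and> card (cdouble B C D) = 0" using c1 by simp
    next
      assume c: "card (croots B C D) = 1 \<and> card (cdouble B C D) = 0"
      then obtain s where s: "croots B C D = {s}" by (meson card_1_singletonE)
      have "s \<notin> cdouble B C D" using c by auto
      then obtain p where "cubic_algebra.eigen 1 B C D (s, s * s + B * s + C) p"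
        using eigen_monic[of s B C D] s by blast
      moreover have "points 1 B C D = {(s, s * s + B * s + C)}" unfolding points_monic s by simp
      ultimately show "\<exists>h p. points 1 B C D = {h} \<and> cubic_algebra.eigen 1 B C D h p" by blast
    qed
    thus ?thesis unfolding lval_def ne card_points_monic by simp
  qed
  have X: "x ^ 3 = x * x * x" "x ^ 4 = x * x * x * x" "x\<^sup>2 = x * x"
    by (simp_all add: power2_eq_square power3_eq_cube power4_eq_xxxx)
  have D: "\<Delta> = (1 - x) * (1 - x) * (1 + x) * t" unfolding \<Delta>_def f by (simp only: ac_simps)
  have D0: "\<Delta> \<noteq> 0" unfolding D using nz by simp
  have a: "(1 - x) / (1 - x ^ 3) = (1 - x) * (1 - x\<^sup>2) / \<Delta>" "1 / (1 - x\<^sup>2) = (1 - x ^ 3) / \<Delta>"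
    using nz unfolding \<Delta>_def f by simp_all
  have b: "1 / (1 - x) = (1 - x) * (1 + x) * t / \<Delta>" "1 / (1 - x) * (1 / (1 - x)) = (1 + x) * t / \<Delta>"
    using nz unfolding D by simp_all
  define n where "n r d e = ((1 - x) * (1 - x\<^sup>2) + (x + 2 * x\<^sup>2) * (1 - x) * r + x ^ 3 * (r * (r - 1))
      - (x\<^sup>2 + x ^ 4) * d + x ^ 4 * (1 + x) * e)" for r d e :: complex
  have N: "(1 - x) / (1 - x ^ 3) + (x + 2 * x\<^sup>2) * (1 - x) / \<Delta> * r + x ^ 3 / \<Delta> * (r * (r - 1)) -
    (x\<^sup>2 + x ^ 4) / \<Delta> * d + x ^ 4 * (1 + x) / \<Delta> * e = n r d e / \<Delta>" for r d e
    unfolding a n_def by (simp only: add_divide_distrib[symmetric] diff_divide_distrib[symmetric] times_divide_eq_left)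
  show ?thesis unfolding N
  proof (cases rule: croots_cases[of B C D])
    case none
    thus "lval x 1 B C D = n (of_nat (card (croots B C D))) (of_nat (card (cdouble B C D))) (of_nat (card (ctriple B C D))) / \<Delta>"
      unfolding lv n_def using a(1) by simp
  next
    case one
    have "n 1 0 0 = 1 - x ^ 3" unfolding n_def X by (simp add: algebra_simps)
    thus "lval x 1 B C D = n (of_nat (card (croots B C D))) (of_nat (card (cdouble B C D))) (of_nat (card (ctriple B C D))) / \<Delta>"
      unfolding lv using one nz a(2) by simp
  next
    case two
    have "n 2 1 0 = (1 - x) * (1 + x) * t" unfolding n_def t_def X by (simp add: algebra_simps)
    moreover have "lval x 1 B C D = 1 / (1 - x)" unfolding lv using two nz by (simp add: power2_eq_square)
    ultimately show "lval x 1 B C D = n (of_nat (card (croots B C D))) (of_nat (card (cdouble B C D))) (of_nat (card (ctriple B C D))) / \<Delta>"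
      using two by (simp only: b(1)) simp
  next
    case three
    have "n 3 0 0 = (1 + x) * t" unfolding n_def t_def X by (simp add: algebra_simps)
    moreover have "lval x 1 B C D = 1 / (1 - x) * (1 / (1 - x))" unfolding lv using three nz by (simp add: power3_eq_cube)
    ultimately show "lval x 1 B C D = n (of_nat (card (croots B C D))) (of_nat (card (cdouble B C D))) (of_nat (card (ctriple B C D))) / \<Delta>"
      using three by (simp only: b(2)) simp
  next
    case triple
    have "n 1 1 1 = \<Delta>" unfolding n_def D t_def X by (simp add: algebra_simps)
    moreover have "lval x 1 B C D = 1" unfolding lv using triple nz by simp
    ultimately show "lval x 1 B C D = n (of_nat (card (croots B C D))) (of_nat (card (cdouble B C D))) (of_nat (card (ctriple B C D))) / \<Delta>"
      using triple D0 by simp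
  qed
qed

text \<open>With \<open>C\<close> and \<open>D\<close> free, roots, pairs of roots and double roots occur with the expected frequency.
  Only the triple roots retain a dependence on \<open>B\<close>.\<close>

lemma monic_mean:
  fixes B :: "'k::{field, finite}"
  assumes x: "x \<noteq> 1" "x\<^sup>2 \<noteq> 1" "x ^ 3 \<noteq> 1"
  defines "\<Delta> \<equiv> (1 - x\<^sup>2) * (1 - x ^ 3)" and "Q \<equiv> of_nat CARD('k) :: complex"
  shows "(\<Sum>C\<in>UNIV. \<Sum>D\<in>UNIV. lval x 1 B C D) =
    Q\<^sup>2 * (1 - x\<^sup>2 * (1 + x + x\<^sup>2) / Q) / \<Delta> + x ^ 4 * (1 + x) / \<Delta> * of_nat (card {s :: 'k. 3 * s + B = 0})"
proof -
  have Q0: "Q \<noteq> 0" by (simp add: Q_def)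
  have D0: "\<Delta> \<noteq> 0" using x by (simp add: \<Delta>_def)
  have solve: "s * s * s + B * (s * s) + C * s + D = 0 \<longleftrightarrow> D = - (s * s * s + B * (s * s) + C * s)" for s C D :: 'k
    by (rule add_eq_0_iff)
  have solve': "3 * (s * s) + 2 * (B * s) + C = 0 \<longleftrightarrow> C = - (3 * (s * s) + 2 * (B * s))" for s C :: 'k
    by (rule add_eq_0_iff)
  have r: "(\<Sum>D\<in>UNIV. card (croots B C D)) = CARD('k)" for C
    unfolding croots_def solve by (rule sum_card_unique) auto
  have pairs: "(\<Sum>C\<in>UNIV. \<Sum>D\<in>UNIV. card {(s, t). s \<noteq> t \<and> s \<in> croots B C D \<and> t \<in> croots B C D}) = CARD('k) * (CARD('k) - 1)"
  proof -
    have "(\<Sum>D\<in>UNIV. card {(s, t). s \<noteq> t \<and> s \<in> croots B C D \<and> t \<in> croots B C D}) =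
       card {(s, t). s \<noteq> t \<and> C = - (s * s + s * t + t * t + B * (s + t))}" for C
    proof (rule sum_card_unique)
      have key: "s * s * s + B * (s * s) + C * s = t * t * t + B * (t * t) + C * t \<longleftrightarrow>
         C = - (s * s + s * t + t * t + B * (s + t))" if "s \<noteq> t" for s t
      proof -
        have "s * s * s + B * (s * s) + C * s - (t * t * t + B * (t * t) + C * t) =
           (s - t) * (C + (s * s + s * t + t * t + B * (s + t)))" by (simp add: algebra_simps)
        thus ?thesis using that by (metis add_eq_0_iff2 eq_iff_diff_eq_0 mult_eq_0_iff)
      qed
      {
        fix p :: "'k \<times> 'k" assume "p \<in> {(s, t). s \<noteq> t \<and> C = - (s * s + s * t + t * t + B * (s + t))}"
        then obtain s t where p: "p = (s, t)" "s \<noteq> t" "C = - (s * s + s * t + t * t + B * (s + t))" by auto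
        have "s * s * s + B * (s * s) + C * s = t * t * t + B * (t * t) + C * t" using key[OF p(2)] p(3) by blast
        thus "\<exists>!D. case p of (s, t) \<Rightarrow> s \<noteq> t \<and> s \<in> croots B C D \<and> t \<in> croots B C D"
          unfolding p(1) croots_def mem_Collect_eq solve prod.case using p(2) by metis
      next
        fix p :: "'k \<times> 'k" and D
        assume "case p of (s, t) \<Rightarrow> s \<noteq> t \<and> s \<in> croots B C D \<and> t \<in> croots B C D"
        then obtain s t where p: "p = (s, t)" "s \<noteq> t" "D = - (s * s * s + B * (s * s) + C * s)" "D = - (t * t * t + B * (t * t) + C * t)"
          unfolding croots_def mem_Collect_eq solve by (cases p) auto
        hence "s * s * s + B * (s * s) + C * s = t * t * t + B * (t * t) + C * t" by (metis neg_equal_iff_equal)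
        thus "p \<in> {(s, t). s \<noteq> t \<and> C = - (s * s + s * t + t * t + B * (s + t))}" using key[OF p(2)] p(1,2) by simp
      }
    qed
    hence "(\<Sum>C\<in>UNIV. \<Sum>D\<in>UNIV. card {(s, t). s \<noteq> t \<and> s \<in> croots B C D \<and> t \<in> croots B C D}) =
      (\<Sum>C\<in>UNIV. card {p. (case p of (s, t) \<Rightarrow> s \<noteq> t \<and> C = - (s * s + s * t + t * t + B * (s + t)))})" by simp
    also have "\<dots> = card {p :: 'k \<times> 'k. fst p \<noteq> snd p}"
      by (rule sum_card_unique) auto
    also have "{p :: 'k \<times> 'k. fst p \<noteq> snd p} = (SIGMA s:UNIV. UNIV - {s})" by auto
    also have "card \<dots> = CARD('k) * (CARD('k) - 1)" by (simp add: card_Diff_singleton)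
    finally show ?thesis .
  qed
  have pc: "of_nat (card {(s, t). s \<noteq> t \<and> s \<in> S \<and> t \<in> S}) = (of_nat (card S) * (of_nat (card S) - 1) :: complex)" for S :: "'k set"
  proof -
    have "{(s, t). s \<noteq> t \<and> s \<in> S \<and> t \<in> S} = (SIGMA s:S. S - {s})" by auto
    hence "card {(s, t). s \<noteq> t \<and> s \<in> S \<and> t \<in> S} = (\<Sum>s\<in>S. card (S - {s}))" by simp
    also have "\<dots> = card S * (card S - 1)" by (simp add: card_Diff_singleton)
    finally show ?thesis by (cases "card S") (simp_all add: algebra_simps)
  qed
  have "(\<Sum>D\<in>UNIV. card (cdouble B C D)) = card {s. 3 * (s * s) + 2 * (B * s) + C = 0}" for C
    unfolding cdouble_def croots_def mem_Collect_eq solve by (rule sum_card_unique) auto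
  hence d: "(\<Sum>C\<in>UNIV. \<Sum>D\<in>UNIV. card (cdouble B C D)) = CARD('k)"
    unfolding solve' by (simp only:) (rule sum_card_unique, auto)
  have "(\<Sum>D\<in>UNIV. card (ctriple B C D)) = card {s. 3 * s + B = 0 \<and> 3 * (s * s) + 2 * (B * s) + C = 0}" for C
    unfolding ctriple_def cdouble_def croots_def mem_Collect_eq solve by (rule sum_card_unique) auto
  hence e: "(\<Sum>C\<in>UNIV. \<Sum>D\<in>UNIV. card (ctriple B C D)) = card {s. 3 * s + B = 0}"
    unfolding solve' by (simp only:) (rule sum_card_unique, auto)
  have "(\<Sum>C\<in>UNIV. \<Sum>D\<in>UNIV. lval x 1 B C D) = Q\<^sup>2 * ((1 - x) / (1 - x ^ 3)) +
    (x + 2 * x\<^sup>2) * (1 - x) / \<Delta> * of_nat (\<Sum>C\<in>(UNIV :: 'k set). \<Sum>D\<in>UNIV. card (croots B C D)) +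
    x ^ 3 / \<Delta> * of_nat (\<Sum>C\<in>(UNIV :: 'k set). \<Sum>D\<in>UNIV. card {(s, t). s \<noteq> t \<and> s \<in> croots B C D \<and> t \<in> croots B C D}) -
    (x\<^sup>2 + x ^ 4) / \<Delta> * of_nat (\<Sum>C\<in>(UNIV :: 'k set). \<Sum>D\<in>UNIV. card (cdouble B C D)) +
    x ^ 4 * (1 + x) / \<Delta> * of_nat (\<Sum>C\<in>(UNIV :: 'k set). \<Sum>D\<in>UNIV. card (ctriple B C D))"
    unfolding lval_monic[OF x, folded \<Delta>_def] of_nat_sum pc
    by (simp add: sum.distrib sum_subtractf sum_distrib_left Q_def power2_eq_square)
  also have "\<dots> = Q\<^sup>2 * ((1 - x) / (1 - x ^ 3)) + (x + 2 * x\<^sup>2) * (1 - x) / \<Delta> * Q\<^sup>2 + x ^ 3 / \<Delta> * (Q * (Q - 1)) -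
    (x\<^sup>2 + x ^ 4) / \<Delta> * Q + x ^ 4 * (1 + x) / \<Delta> * of_nat (card {s. 3 * s + B = 0})"
    unfolding pairs d e r by (simp add: Q_def power2_eq_square of_nat_CARD_minus_1)
  also have "(1 - x) / (1 - x ^ 3) = (1 - x) * (1 - x\<^sup>2) / \<Delta>" using x by (simp add: \<Delta>_def)
  also have "Q\<^sup>2 * ((1 - x) * (1 - x\<^sup>2) / \<Delta>) + (x + 2 * x\<^sup>2) * (1 - x) / \<Delta> * Q\<^sup>2 + x ^ 3 / \<Delta> * (Q * (Q - 1)) -
      (x\<^sup>2 + x ^ 4) / \<Delta> * Q = (Q\<^sup>2 * ((1 - x) * (1 - x\<^sup>2)) + (x + 2 * x\<^sup>2) * (1 - x) * Q\<^sup>2 + x ^ 3 * (Q * (Q - 1)) -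
      (x\<^sup>2 + x ^ 4) * Q) / \<Delta>"
    by (simp only: add_divide_distrib[symmetric] diff_divide_distrib[symmetric] times_divide_eq_left times_divide_eq_right)
  also have "Q\<^sup>2 * ((1 - x) * (1 - x\<^sup>2)) + (x + 2 * x\<^sup>2) * (1 - x) * Q\<^sup>2 + x ^ 3 * (Q * (Q - 1)) - (x\<^sup>2 + x ^ 4) * Q
     = Q\<^sup>2 * (1 - x\<^sup>2 * (1 + x + x\<^sup>2) / Q)"
    using Q0 by (simp add: right_diff_distrib power2_eq_square) (simp add: algebra_simps power3_eq_cube power4_eq_xxxx)
  finally show ?thesis .
qed

text \<open>With \<open>D\<close> fixed, nonzero roots have the expected frequency, and \<open>0\<close> is a root exactly if \<open>D = 0\<close>; the
  terms with \<open>z\<close> are the contribution of the root \<open>0\<close>.\<close>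

lemma monic_sum:
  fixes D :: "'k::{field, finite}"
  assumes x: "x \<noteq> 1" "x\<^sup>2 \<noteq> 1" "x ^ 3 \<noteq> 1"
  defines "\<Delta> \<equiv> (1 - x\<^sup>2) * (1 - x ^ 3)" and "Q \<equiv> of_nat CARD('k) :: complex"
    and "z \<equiv> (if D = 0 then 1 else 0) :: complex"
  shows "(\<Sum>B\<in>UNIV. \<Sum>C\<in>UNIV. lval x 1 B C D) =
    Q\<^sup>2 * ((1 - x) / (1 - x ^ 3)) + (x + 2 * x\<^sup>2) * (1 - x) / \<Delta> * (Q * (Q - 1) + z * Q\<^sup>2) +
    x ^ 3 / \<Delta> * ((Q - 1) * (Q - 2) + z * (2 * Q * (Q - 1))) -
    (x\<^sup>2 + x ^ 4) / \<Delta> * ((Q - 1) + z * Q) + x ^ 4 * (1 + x) / \<Delta> * of_nat (card {s. s * s * s = - D})"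
proof -
  have solve: "s * s * s + B * (s * s) + C * s + D = 0 \<longleftrightarrow> C * s = - (s * s * s + B * (s * s) + D)" for s B C :: 'k
  proof -
    have "s * s * s + B * (s * s) + C * s + D = (s * s * s + B * (s * s) + D) + C * s" by simp
    thus ?thesis by (simp only: add_eq_0_iff)
  qed
  have solve_nz: "s * s * s + B * (s * s) + C * s + D = 0 \<longleftrightarrow> C = - (s * s * s + B * (s * s) + D) / s"
    if "s \<noteq> 0" for s B C :: 'k unfolding solve using that by (simp add: eq_divide_eq)
  have solve': "3 * (s * s) + 2 * (B * s) + C = 0 \<longleftrightarrow> C = - (3 * (s * s) + 2 * (B * s))" for s B C :: 'k
    by (rule add_eq_0_iff)
  have zD: "of_nat (if D = 0 then m else 0) = z * of_nat m" for m by (simp add: z_def)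
  have cc: "card {s. P s} = card {s :: 'k. s \<noteq> 0 \<and> P s} + (if P 0 then 1 else 0)" for P
  proof -
    have "{s. P s} = {s. s \<noteq> 0 \<and> P s} \<union> (if P 0 then {0} else {})" by auto
    thus ?thesis by (simp add: card_insert_if)
  qed
  have nz: "{s :: 'k. s \<noteq> 0} = UNIV - {0}" by auto
  have r: "(\<Sum>C\<in>UNIV. card (croots B C D)) = CARD('k) - 1 + (if D = 0 then CARD('k) else 0)" for B
  proof -
    have "(\<Sum>C\<in>UNIV. card {s. s \<noteq> 0 \<and> s * s * s + B * (s * s) + C * s + D = 0}) = card {s :: 'k. s \<noteq> 0}"
      by (rule sum_card_unique) (auto simp: solve_nz)
    thus ?thesis unfolding croots_def cc[of "\<lambda>s. s * s * s + B * (s * s) + _ * s + D = 0"] sum.distrib nz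
      by (simp add: card_UNIV_minus_0)
  qed
  define PP where "PP B C = {(s, t). s \<noteq> t \<and> s \<in> croots B C D \<and> t \<in> croots B C D}" for B C
  have pairs: "of_nat (\<Sum>B\<in>UNIV. \<Sum>C\<in>UNIV. card (PP B C)) = (Q - 1) * (Q - 2) + z * (2 * Q * (Q - 1))"
  proof -
    \<comment> \<open>Two distinct nonzero roots determine \<open>C\<close> and then \<open>B\<close>. The root \<open>0\<close> occurs only for \<open>D = 0\<close>, where the
      other root in the pair is a root of a quadratic polynomial.\<close>
    let ?N = "\<lambda>B C. {p \<in> PP B C. fst p \<noteq> 0 \<and> snd p \<noteq> 0}"
    let ?Z = "\<lambda>B C. (\<lambda>s. (s, 0)) ` (if D = 0 then croots B C D - {0} else {}) \<union> (\<lambda>s. (0, s)) ` (if D = 0 then croots B C D - {0} else {})"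
    have split: "card (PP B C) = card (?N B C) + (if D = 0 then 2 * card {s. s \<noteq> 0 \<and> s * s + B * s + C = 0} else 0)" for B C
    proof -
      have 0: "0 \<in> croots B C D \<longleftrightarrow> D = 0" by (simp add: croots_def)
      have e: "PP B C = ?N B C \<union> ?Z B C" using 0 by (auto simp: PP_def split: if_splits)
      have d: "?N B C \<inter> ?Z B C = {}" by auto
      have "card (PP B C) = card (?N B C \<union> ?Z B C)" by (rule arg_cong[OF e])
      also have "\<dots> = card (?N B C) + card (?Z B C)" by (rule card_Un_disjoint[OF finite finite d])
      also have "card (?Z B C) = card ((\<lambda>s. (s, 0 :: 'k)) ` (if D = 0 then croots B C D - {0} else {})) + card ((\<lambda>s. (0 :: 'k, s)) ` (if D = 0 then croots B C D - {0} else {}))"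
        by (rule card_Un_disjoint) auto
      also have "\<dots> = 2 * card (if D = 0 then croots B C D - {0} else {})"
        by (simp add: card_image inj_on_def)
      also have "\<dots> = (if D = 0 then 2 * card {s. s \<noteq> 0 \<and> s * s + B * s + C = 0} else 0)"
      proof -
        have "croots B C D - {0} = {s. s \<noteq> 0 \<and> s * s + B * s + C = 0}" if "D = 0"
        proof -
          have "s * s * s + B * (s * s) + C * s + D = s * (s * s + B * s + C)" for s
            using that by (simp add: algebra_simps)
          thus ?thesis by (auto simp: croots_def)
        qed
        thus ?thesis by simp
      qed
      finally show ?thesis .
    qed
    have z1: "(\<Sum>C\<in>UNIV. card {s. s \<noteq> 0 \<and> s * s + B * s + C = 0}) = CARD('k) - 1" for B :: 'k
      unfolding card_UNIV_minus_0[symmetric] nz[symmetric]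
    proof (rule sum_card_unique)
      fix s assume "s \<in> {s :: 'k. s \<noteq> 0}"
      thus "\<exists>!C. s \<noteq> 0 \<and> s * s + B * s + C = 0" unfolding add_eq_0_iff by auto
    qed simp
    have n1: "(\<Sum>C\<in>UNIV. card (?N B C)) = card {(s, t). s \<noteq> t \<and> s \<noteq> 0 \<and> t \<noteq> 0 \<and> B * (s * t) = D - s * t * (s + t)}" for B
    proof (rule sum_card_unique)
      have key: "- (s * s * s + B * (s * s) + D) / s = - (t * t * t + B * (t * t) + D) / t \<longleftrightarrow> B * (s * t) = D - s * t * (s + t)"
        if "s \<noteq> t" "s \<noteq> 0" "t \<noteq> 0" for s t
      proof -
        have "- (s * s * s + B * (s * s) + D) / s = - (t * t * t + B * (t * t) + D) / t \<longleftrightarrow>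
          - (s * s * s + B * (s * s) + D) * t = - (t * t * t + B * (t * t) + D) * s"
          using that by (rule_tac frac_eq_eq)
        also have "\<dots> \<longleftrightarrow> (s - t) * (D - s * t * (s + t) - B * (s * t)) = 0"
        proof -
          have "- (s * s * s + B * (s * s) + D) * t - (- (t * t * t + B * (t * t) + D) * s) = (s - t) * (D - s * t * (s + t) - B * (s * t))"
            by (simp add: algebra_simps)
          thus ?thesis by (metis eq_iff_diff_eq_0)
        qed
        also have "\<dots> \<longleftrightarrow> B * (s * t) = D - s * t * (s + t)" using that(1) by auto
        finally show ?thesis .
      qed
      {
        fix p :: "'k \<times> 'k" assume "p \<in> {(s, t). s \<noteq> t \<and> s \<noteq> 0 \<and> t \<noteq> 0 \<and> B * (s * t) = D - s * t * (s + t)}"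
        then obtain s t where p: "p = (s, t)" "s \<noteq> t" "s \<noteq> 0" "t \<noteq> 0" "B * (s * t) = D - s * t * (s + t)" by auto
        have "- (s * s * s + B * (s * s) + D) / s = - (t * t * t + B * (t * t) + D) / t" using key[OF p(2-4)] p(5) by blast
        thus "\<exists>!C. p \<in> PP B C \<and> fst p \<noteq> 0 \<and> snd p \<noteq> 0"
          unfolding p(1) PP_def croots_def mem_Collect_eq prod.case using p(2-4) solve_nz[OF p(3)] solve_nz[OF p(4)] by simp
      next
        fix p :: "'k \<times> 'k" and C
        assume "p \<in> PP B C \<and> fst p \<noteq> 0 \<and> snd p \<noteq> 0"
        then obtain s t where p: "p = (s, t)" "s \<noteq> t" "s \<noteq> 0" "t \<noteq> 0" "s \<in> croots B C D" "t \<in> croots B C D"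
          unfolding PP_def by (cases p) auto
        have "- (s * s * s + B * (s * s) + D) / s = - (t * t * t + B * (t * t) + D) / t"
          using p(5,6) unfolding croots_def mem_Collect_eq solve_nz[OF p(3)] solve_nz[OF p(4)] by simp
        thus "p \<in> {(s, t). s \<noteq> t \<and> s \<noteq> 0 \<and> t \<noteq> 0 \<and> B * (s * t) = D - s * t * (s + t)}"
          using key[OF p(2-4)] p by simp
      }
    qed
    have n2: "(\<Sum>B\<in>UNIV. card {(s, t). s \<noteq> t \<and> s \<noteq> 0 \<and> t \<noteq> 0 \<and> B * (s * t) = D - s * t * (s + t)}) = card (SIGMA s:UNIV - {0 :: 'k}. UNIV - {0, s})"
    proof (rule sum_card_unique)
      fix p assume "p \<in> (SIGMA s:UNIV - {0 :: 'k}. UNIV - {0, s})"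
      then obtain s t where p: "p = (s, t)" "s \<noteq> t" "s \<noteq> 0" "t \<noteq> 0" by auto
      show "\<exists>!B. case p of (s, t) \<Rightarrow> s \<noteq> t \<and> s \<noteq> 0 \<and> t \<noteq> 0 \<and> B * (s * t) = D - s * t * (s + t)"
        unfolding p(1) prod.case using p(2-4) by (intro ex1I[of _ "(D - s * t * (s + t)) / (s * t)"]) (auto simp: eq_divide_eq)
    qed auto
    have "card (SIGMA s:UNIV - {0 :: 'k}. UNIV - {0, s}) = (\<Sum>s\<in>UNIV - {0 :: 'k}. CARD('k) - 2)"
      by (subst card_SigmaI) (auto intro!: sum.cong simp: card_Diff_subset)
    hence n3: "of_nat (card (SIGMA s:UNIV - {0 :: 'k}. UNIV - {0, s})) = (Q - 1) * (Q - 2)"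
    proof -
      assume a: "card (SIGMA s:UNIV - {0 :: 'k}. UNIV - {0, s}) = (\<Sum>s\<in>UNIV - {0 :: 'k}. CARD('k) - 2)"
      have "card {0, 1 :: 'k} \<le> CARD('k)" by (rule card_mono) simp_all
      hence "2 \<le> CARD('k)" by simp
      thus ?thesis unfolding a by (simp add: card_UNIV_minus_0 of_nat_CARD_minus_1 of_nat_diff Q_def)
    qed
    have n4: "(\<Sum>B\<in>UNIV. \<Sum>C\<in>UNIV. card (PP B C)) =
        card (SIGMA s:UNIV - {0 :: 'k}. UNIV - {0, s}) + (if D = 0 then 2 * (CARD('k) * (CARD('k) - 1)) else 0)"
    proof -
      have "(\<Sum>B\<in>UNIV. \<Sum>C\<in>UNIV. if D = 0 then 2 * card {s. s \<noteq> 0 \<and> s * s + B * s + C = (0 :: 'k)} else 0) =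
          (if D = 0 then 2 * (CARD('k) * (CARD('k) - 1)) else 0)"
        by (cases "D = 0") (simp_all only: if_True if_False sum_distrib_left[symmetric] z1 sum_constant of_nat_id mult_0_right simp_thms sum.neutral_const mult.left_commute)
      thus ?thesis unfolding split sum.distrib n1 n2 by (simp only:)
    qed
    show ?thesis unfolding n4 of_nat_add n3
      by (cases "D = 0") (simp_all only: if_True if_False of_nat_mult of_nat_CARD_minus_1 z_def of_nat_numeral Q_def
        mult_1_left mult_zero_left of_nat_0 mult.assoc simp_thms)
  qed
  have pc: "of_nat (card (PP B C)) = (of_nat (card (croots B C D)) * (of_nat (card (croots B C D)) - 1) :: complex)" for B C
  proof -
    have "PP B C = (SIGMA s:croots B C D. croots B C D - {s})" by (auto simp: PP_def)
    hence "card (PP B C) = (\<Sum>s\<in>croots B C D. card (croots B C D - {s}))" by simp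
    also have "\<dots> = card (croots B C D) * (card (croots B C D) - 1)" by (simp add: card_Diff_singleton)
    finally show ?thesis by (cases "card (croots B C D)") (simp_all add: algebra_simps)
  qed
  have dd: "s * s * s + B * (s * s) + C * s + D = 0 \<and> 3 * (s * s) + 2 * (B * s) + C = 0 \<longleftrightarrow>
     C = - (3 * (s * s) + 2 * (B * s)) \<and> B * (s * s) = D - 2 * (s * s * s)" for s B C :: 'k
  proof -
    have "s * s * s + B * (s * s) + (- (3 * (s * s) + 2 * (B * s))) * s + D = (D - 2 * (s * s * s)) - B * (s * s)"
      by (simp add: algebra_simps)
    thus ?thesis unfolding solve' by (metis (no_types, lifting) right_minus_eq)
  qed
  have "(\<Sum>C\<in>UNIV. card (cdouble B C D)) = card {s. B * (s * s) = D - 2 * (s * s * s)}" for B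
    unfolding cdouble_def croots_def mem_Collect_eq dd by (rule sum_card_unique) auto
  hence "(\<Sum>B\<in>UNIV. \<Sum>C\<in>UNIV. card (cdouble B C D)) = (\<Sum>B\<in>UNIV. card {s. s \<noteq> 0 \<and> B * (s * s) = D - 2 * (s * s * s)}) + (if D = 0 then CARD('k) else 0)"
    unfolding cc[of "\<lambda>s. _ * (s * s) = D - 2 * (s * s * s)"] by (simp add: sum.distrib eq_commute[of 0 D])
  also have "(\<Sum>B\<in>UNIV. card {s. s \<noteq> 0 \<and> B * (s * s) = D - 2 * (s * s * s)}) = card {s :: 'k. s \<noteq> 0}"
  proof (rule sum_card_unique)
    fix s assume "s \<in> {s :: 'k. s \<noteq> 0}"
    thus "\<exists>!B. s \<noteq> 0 \<and> B * (s * s) = D - 2 * (s * s * s)"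
      by (intro ex1I[of _ "(D - 2 * (s * s * s)) / (s * s)"]) (auto simp: eq_divide_eq)
  qed simp
  finally have d: "(\<Sum>B\<in>UNIV. \<Sum>C\<in>UNIV. card (cdouble B C D)) = CARD('k) - 1 + (if D = 0 then CARD('k) else 0)"
    unfolding nz card_UNIV_minus_0 .
  have tt: "(C = - (3 * (s * s) + 2 * (B * s)) \<and> B * (s * s) = D - 2 * (s * s * s)) \<and> 3 * s + B = 0 \<longleftrightarrow>
     B = - (3 * s) \<and> C = - (3 * (s * s) + 2 * (B * s)) \<and> s * s * s = - D" for s B C :: 'k
  proof -
    have "(- (3 * s)) * (s * s) = D - 2 * (s * s * s) \<longleftrightarrow> s * s * s = - D"
    proof -
      have "(- (3 * s)) * (s * s) - (D - 2 * (s * s * s)) = - (D + s * s * s)" by (simp add: algebra_simps)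
      hence "(- (3 * s)) * (s * s) = D - 2 * (s * s * s) \<longleftrightarrow> D + s * s * s = 0"
        by (metis eq_iff_diff_eq_0 neg_equal_0_iff_equal)
      thus ?thesis unfolding add_eq_0_iff .
    qed
    thus ?thesis unfolding add_eq_0_iff[of "3 * s"] by blast
  qed
  have "(\<Sum>C\<in>UNIV. card (ctriple B C D)) = card {s. B = - (3 * s) \<and> s * s * s = - D}" for B
    unfolding ctriple_def cdouble_def croots_def mem_Collect_eq dd tt by (rule sum_card_unique) auto
  hence e: "(\<Sum>B\<in>UNIV. \<Sum>C\<in>UNIV. card (ctriple B C D)) = card {s. s * s * s = - D}"
    by (simp only:) (rule sum_card_unique, auto)
  have "(\<Sum>B\<in>UNIV. \<Sum>C\<in>UNIV. lval x 1 B C D) = Q\<^sup>2 * ((1 - x) / (1 - x ^ 3)) +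
    (x + 2 * x\<^sup>2) * (1 - x) / \<Delta> * of_nat (\<Sum>B\<in>(UNIV :: 'k set). \<Sum>C\<in>UNIV. card (croots B C D)) +
    x ^ 3 / \<Delta> * of_nat (\<Sum>B\<in>(UNIV :: 'k set). \<Sum>C\<in>UNIV. card (PP B C)) -
    (x\<^sup>2 + x ^ 4) / \<Delta> * of_nat (\<Sum>B\<in>(UNIV :: 'k set). \<Sum>C\<in>UNIV. card (cdouble B C D)) +
    x ^ 4 * (1 + x) / \<Delta> * of_nat (\<Sum>B\<in>(UNIV :: 'k set). \<Sum>C\<in>UNIV. card (ctriple B C D))"
    unfolding lval_monic[OF x, folded \<Delta>_def] of_nat_sum pc
    by (simp add: sum.distrib sum_subtractf sum_distrib_left Q_def power2_eq_square)
  also have "of_nat (\<Sum>B\<in>(UNIV :: 'k set). \<Sum>C\<in>UNIV. card (croots B C D)) = Q * (Q - 1) + z * Q\<^sup>2"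
    unfolding r sum_constant of_nat_mult of_nat_add of_nat_CARD_minus_1
    by (cases "D = 0") (simp_all add: z_def Q_def power2_eq_square algebra_simps)
  also note pairs
  also have "of_nat (\<Sum>B\<in>(UNIV :: 'k set). \<Sum>C\<in>UNIV. card (cdouble B C D)) = (Q - 1) + z * Q"
    unfolding d of_nat_add of_nat_CARD_minus_1 by (simp add: z_def Q_def)
  finally show ?thesis unfolding e .
qed

text \<open>The numerator of the result up to the two factors that depend on \<open>c\<close>.\<close>

definition numer :: "complex \<Rightarrow> complex \<Rightarrow> complex" where
  "numer Q x = (1 - x / Q) * (1 - x\<^sup>2 / Q)"

lemma monic_sum_unit:
  fixes D :: "'k::{field, finite}"
  assumes x: "x \<noteq> 1" "x\<^sup>2 \<noteq> 1" "x ^ 3 \<noteq> 1" and D: "D \<noteq> 0"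
  defines "\<Delta> \<equiv> (1 - x\<^sup>2) * (1 - x ^ 3)" and "Q \<equiv> of_nat CARD('k) :: complex"
  shows "(\<Sum>B\<in>UNIV. \<Sum>C\<in>UNIV. lval x 1 B C D) =
    Q\<^sup>2 * (numer Q x - (1 - 1 / Q) * (x\<^sup>2 / Q) * (1 + x + x\<^sup>2)) / \<Delta>
    + x ^ 4 * (1 + x) / \<Delta> * of_nat (card {s. s * s * s = - D})"
proof -
  have Q0: "Q \<noteq> 0" by (simp add: Q_def)
  have a: "(1 - x) / (1 - x ^ 3) = (1 - x) * (1 - x\<^sup>2) / \<Delta>" using x by (simp add: \<Delta>_def)
  have "Q\<^sup>2 * (numer Q x - (1 - 1 / Q) * (x\<^sup>2 / Q) * (1 + x + x\<^sup>2)) =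
      (Q - x) * (Q - x\<^sup>2) - (Q - 1) * x\<^sup>2 * (1 + x + x\<^sup>2)"
    using Q0 unfolding numer_def by (simp add: field_simps power2_eq_square)
  also have "\<dots> = Q\<^sup>2 * ((1 - x) * (1 - x\<^sup>2)) + (x + 2 * x\<^sup>2) * (1 - x) * (Q * (Q - 1)) + x ^ 3 * ((Q - 1) * (Q - 2)) -
      (x\<^sup>2 + x ^ 4) * (Q - 1)" by (simp add: algebra_simps power2_eq_square power3_eq_cube power4_eq_xxxx)
  finally have F: "Q\<^sup>2 * (numer Q x - (1 - 1 / Q) * (x\<^sup>2 / Q) * (1 + x + x\<^sup>2)) = \<dots>" .
  have "Q\<^sup>2 * (numer Q x - (1 - 1 / Q) * (x\<^sup>2 / Q) * (1 + x + x\<^sup>2)) / \<Delta> =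
      Q\<^sup>2 * ((1 - x) / (1 - x ^ 3)) + (x + 2 * x\<^sup>2) * (1 - x) / \<Delta> * (Q * (Q - 1)) +
      x ^ 3 / \<Delta> * ((Q - 1) * (Q - 2)) - (x\<^sup>2 + x ^ 4) / \<Delta> * (Q - 1)"
    unfolding F unfolding a times_divide_eq_left times_divide_eq_right by (simp only: add_divide_distrib diff_divide_distrib)
  thus ?thesis using monic_sum[OF x, of D] D by (simp add: \<Delta>_def Q_def)
qed

lemma monic_sum_zero:
  assumes x: "x \<noteq> 1" "x\<^sup>2 \<noteq> 1" "x ^ 3 \<noteq> 1"
  defines "Q \<equiv> of_nat CARD('k::{field, finite}) :: complex"
  shows "(\<Sum>B\<in>UNIV. \<Sum>C\<in>UNIV. lval x 1 B C (0 :: 'k)) =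
    Q\<^sup>2 * (numer Q x - (1 - 1 / Q) * (x\<^sup>2 / Q)) / ((1 - x) * (1 - x\<^sup>2))"
proof -
  define \<Delta> where "\<Delta> = (1 - x\<^sup>2) * (1 - x ^ 3)"
  define t where "t = 1 + x + x\<^sup>2"
  have Q0: "Q \<noteq> 0" by (simp add: Q_def)
  have f: "1 - x ^ 3 = (1 - x) * t" by (simp add: t_def power2_eq_square power3_eq_cube algebra_simps)
  have nz: "1 - x \<noteq> 0" "1 - x\<^sup>2 \<noteq> 0" "t \<noteq> 0" using x f by auto
  have a: "(1 - x) / (1 - x ^ 3) = (1 - x) * (1 - x\<^sup>2) / \<Delta>" using x by (simp add: \<Delta>_def)
  have b: "u / ((1 - x) * (1 - x\<^sup>2)) = u * t / \<Delta>" for u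
  proof -
    have "\<Delta> = ((1 - x) * (1 - x\<^sup>2)) * t" unfolding \<Delta>_def f by (simp only: mult_ac)
    thus ?thesis by (simp only: mult_divide_mult_cancel_right[OF nz(3)])
  qed
  have s: "s * s * s = - 0 \<longleftrightarrow> s = 0" for s :: 'k by auto
  have "Q\<^sup>2 * (numer Q x - (1 - 1 / Q) * (x\<^sup>2 / Q)) = (Q - x) * (Q - x\<^sup>2) - (Q - 1) * x\<^sup>2"
    using Q0 unfolding numer_def by (simp add: field_simps power2_eq_square)
  hence "Q\<^sup>2 * (numer Q x - (1 - 1 / Q) * (x\<^sup>2 / Q)) * t = ((Q - x) * (Q - x\<^sup>2) - (Q - 1) * x\<^sup>2) * t" by (rule arg_cong)
  also have "\<dots> = Q\<^sup>2 * ((1 - x) * (1 - x\<^sup>2)) + (x + 2 * x\<^sup>2) * (1 - x) * (Q * (Q - 1) + Q\<^sup>2) +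
      x ^ 3 * ((Q - 1) * (Q - 2) + 2 * Q * (Q - 1)) - (x\<^sup>2 + x ^ 4) * ((Q - 1) + Q) + x ^ 4 * (1 + x)"
    unfolding t_def by (simp add: algebra_simps power2_eq_square power3_eq_cube power4_eq_xxxx)
  finally have F: "Q\<^sup>2 * (numer Q x - (1 - 1 / Q) * (x\<^sup>2 / Q)) * t = \<dots>" .
  have "Q\<^sup>2 * (numer Q x - (1 - 1 / Q) * (x\<^sup>2 / Q)) / ((1 - x) * (1 - x\<^sup>2)) =
      Q\<^sup>2 * ((1 - x) / (1 - x ^ 3)) + (x + 2 * x\<^sup>2) * (1 - x) / \<Delta> * (Q * (Q - 1) + Q\<^sup>2) +
      x ^ 3 / \<Delta> * ((Q - 1) * (Q - 2) + 2 * Q * (Q - 1)) - (x\<^sup>2 + x ^ 4) / \<Delta> * ((Q - 1) + Q) + x ^ 4 * (1 + x) / \<Delta>"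
    unfolding b unfolding F unfolding a times_divide_eq_left times_divide_eq_right by (simp only: add_divide_distrib diff_divide_distrib)
  thus ?thesis using monic_sum[OF x, of "0 :: 'k"] unfolding s by (simp add: \<Delta>_def Q_def)
qed

lemma degenerate_sum_zero':
  assumes x: "x \<noteq> 1" "x\<^sup>2 \<noteq> 1"
  defines "Q \<equiv> of_nat CARD('k::{field, finite}) :: complex"
  shows "(\<Sum>B\<in>UNIV. \<Sum>C\<in>UNIV. lval x 0 B C (0 :: 'k)) =
    Q\<^sup>2 * (numer Q x / (1 - x)\<^sup>2 - (1 - 1 / Q) * (x\<^sup>2 / Q) / (1 - x))"
proof -
  have Q0: "Q \<noteq> 0" by (simp add: Q_def)
  have nz: "1 - x \<noteq> 0" using x by simp
  have n: "Q\<^sup>2 * numer Q x = (Q - x) * (Q - x\<^sup>2)" "Q\<^sup>2 * ((1 - 1 / Q) * (x\<^sup>2 / Q)) = (Q - 1) * x\<^sup>2"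
    using Q0 unfolding numer_def by (simp_all add: field_simps power2_eq_square)
  have "(Q - 1)\<^sup>2 / (1 - x)\<^sup>2 + 2 * (Q - 1) / (1 - x) + 1 + Q * x
     = ((Q - 1)\<^sup>2 + 2 * (Q - 1) * (1 - x) + (1 + Q * x) * (1 - x)\<^sup>2) / (1 - x)\<^sup>2"
    using nz by (simp add: add_divide_distrib power2_eq_square)
  also have "(Q - 1)\<^sup>2 + 2 * (Q - 1) * (1 - x) + (1 + Q * x) * (1 - x)\<^sup>2 = (Q - x) * (Q - x\<^sup>2) - (Q - 1) * x\<^sup>2 * (1 - x)"
    by (simp add: algebra_simps power2_eq_square)
  also have "\<dots> / (1 - x)\<^sup>2 = (Q - x) * (Q - x\<^sup>2) / (1 - x)\<^sup>2 - (Q - 1) * x\<^sup>2 / (1 - x)"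
    using nz by (simp add: diff_divide_distrib power2_eq_square)
  also have "\<dots> = Q\<^sup>2 * numer Q x / (1 - x)\<^sup>2 - Q\<^sup>2 * ((1 - 1 / Q) * (x\<^sup>2 / Q)) / (1 - x)" by (simp only: n)
  also have "\<dots> = Q\<^sup>2 * (numer Q x / (1 - x)\<^sup>2 - (1 - 1 / Q) * (x\<^sup>2 / Q) / (1 - x))"
    by (simp only: right_diff_distrib times_divide_eq_right)
  finally show ?thesis unfolding degenerate_sum_zero[OF x] Q_def[symmetric] .
qed

lemma degenerate_sum_unit':
  fixes D :: "'k::{field, finite}"
  assumes x: "x \<noteq> 1" "x\<^sup>2 \<noteq> 1" and D: "D \<noteq> 0"
  defines "Q \<equiv> of_nat CARD('k) :: complex"
  shows "(\<Sum>B\<in>UNIV. \<Sum>C\<in>UNIV. lval x 0 B C D) =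
    Q\<^sup>2 * (numer Q x - (1 - 1 / Q) * (x\<^sup>2 / Q)) / ((1 - x) * (1 - x\<^sup>2))"
proof -
  have Q0: "Q \<noteq> 0" by (simp add: Q_def)
  have nz: "1 - x \<noteq> 0" "1 - x\<^sup>2 \<noteq> 0" using x by simp_all
  define E where "E = (1 - x) * (1 - x\<^sup>2)"
  have E0: "E \<noteq> 0" using nz by (simp add: E_def)
  have h: "1 / (1 - x) = (1 - x\<^sup>2) / E" "Q / (1 - x\<^sup>2) = Q * (1 - x) / E" "1 = E / E"
    "(Q - 1) / (1 - x) = (Q - 1) * (1 - x\<^sup>2) / E"
    using nz E0 by (simp_all add: E_def)
  have n: "Q\<^sup>2 * (numer Q x - (1 - 1 / Q) * (x\<^sup>2 / Q)) = (Q - x) * (Q - x\<^sup>2) - (Q - 1) * x\<^sup>2"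
    using Q0 unfolding numer_def by (simp add: field_simps power2_eq_square)
  have "1 + (Q - 1) / (1 - x) + (Q - 1) * (Q / (1 - x\<^sup>2) + x / E * (Q - 1) - x\<^sup>2 / E)
     = E / E + (Q - 1) * (1 - x\<^sup>2) / E + (Q - 1) * (Q * (1 - x) / E + x / E * (Q - 1) - x\<^sup>2 / E)"
    using h(2,4) E0 by simp
  also have "\<dots> = (E + (Q - 1) * (1 - x\<^sup>2) + (Q - 1) * (Q * (1 - x) + x * (Q - 1) - x\<^sup>2)) / E"
    by (simp only: add_divide_distrib[symmetric] diff_divide_distrib[symmetric] times_divide_eq_left times_divide_eq_right)
  also have "E + (Q - 1) * (1 - x\<^sup>2) + (Q - 1) * (Q * (1 - x) + x * (Q - 1) - x\<^sup>2) = (Q - x) * (Q - x\<^sup>2) - (Q - 1) * x\<^sup>2"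
    unfolding E_def by (simp add: algebra_simps power2_eq_square)
  finally show ?thesis unfolding degenerate_sum_unit[OF x D] n Q_def[symmetric] E_def[symmetric] .
qed

section \<open>Integration of locally constant functions\<close>

definition locconst :: "nat \<Rightarrow> ('q::prime_card padic_int \<Rightarrow> 'a) \<Rightarrow> bool" where
  "locconst N f \<longleftrightarrow> (\<forall>x y. f (x + \<varpi> ^ N * y) = f x)"

definition psum :: "nat \<Rightarrow> ('q::prime_card padic_int \<Rightarrow> complex) \<Rightarrow> complex" where
  "psum N f = (\<Sum>k<CARD('q) ^ N. f (of_nat k))"

text \<open>The Haar integral of a locally constant function, as the mean over the residues at the coarsest
  level at which the function is constant; any finer level gives the same value (\<open>haar_eq\<close>).\<close>

definition haar :: "('q::prime_card padic_int \<Rightarrow> complex) \<Rightarrow> complex" where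
  "haar f = psum (LEAST N. locconst N f) f / of_nat CARD('q) ^ (LEAST N. locconst N f)"

lemma locconstI: "(\<And>x y. f (x + \<varpi> ^ N * y) = f x) \<Longrightarrow> locconst N f"
  by (simp add: locconst_def)

lemma locconstD: "locconst N f \<Longrightarrow> f (x + \<varpi> ^ N * y) = f x"
  by (simp add: locconst_def)

lemma locconst_cong: "locconst N f \<Longrightarrow> \<varpi> ^ N dvd x - y \<Longrightarrow> f x = f y"
  by (elim dvdE) (metis add_diff_cancel_left' diff_add_cancel add.commute locconstD)

lemma locconst_residue: "locconst N f \<Longrightarrow> f (of_nat (residue N x)) = f x"
  using locconst_cong[OF _ residue_cong] by metis

lemma residue_of_nat_inj:
  assumes "\<varpi> ^ N dvd (of_nat k - of_nat l :: 'q::prime_card padic_int)" "k < CARD('q) ^ N" "l < CARD('q) ^ N"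
  shows "k = l"
  using assms by (metis unif_power_dvd_diff_iff residue_of_nat)

lemma psum_reindex:
  fixes f :: "'q::prime_card padic_int \<Rightarrow> complex" and \<phi> :: "'q padic_int \<Rightarrow> 'q padic_int"
  assumes f: "locconst N f" and inj: "\<And>x y. \<varpi> ^ N dvd \<phi> x - \<phi> y \<Longrightarrow> \<varpi> ^ N dvd x - y"
  shows "psum N (\<lambda>x. f (\<phi> x)) = psum N f"
proof -
  define h where "h k = residue N (\<phi> (of_nat k))" for k
  have sub: "h ` {..<CARD('q) ^ N} \<subseteq> {..<CARD('q) ^ N}" by (auto simp: h_def residue_less)
  have "inj_on h {..<CARD('q) ^ N}"
  proof (rule inj_onI)
    fix k l assume a: "k \<in> {..<CARD('q) ^ N}" "l \<in> {..<CARD('q) ^ N}" "h k = h l"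
    hence "\<varpi> ^ N dvd of_nat k - (of_nat l :: 'q padic_int)"
      by (rule_tac inj) (simp add: h_def unif_power_dvd_diff_iff)
    thus "k = l" using a by (intro residue_of_nat_inj[where 'q='q]) auto
  qed
  hence bij: "bij_betw h {..<CARD('q) ^ N} {..<CARD('q) ^ N}"
    using endo_inj_surj[OF _ sub] by (simp add: bij_betw_def)
  have "psum N (\<lambda>x. f (\<phi> x)) = (\<Sum>k<CARD('q) ^ N. f (of_nat (h k)))"
    unfolding psum_def h_def locconst_residue[OF f] ..
  also have "\<dots> = psum N f" unfolding psum_def by (rule sum.reindex_bij_betw[OF bij])
  finally show ?thesis .
qed

lemma psum_split:
  fixes f :: "'q::prime_card padic_int \<Rightarrow> complex"
  shows "psum (N + M) f = psum N (\<lambda>s. psum M (\<lambda>y. f (s + \<varpi> ^ N * y)))"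
proof -
  let ?k = "CARD('q) ^ N" and ?g = "\<lambda>j. f (of_nat j)"
  have "psum (N + M) f = sum ?g {..<CARD('q) ^ M * ?k}"
    by (simp add: psum_def power_add mult.commute)
  also have "\<dots> = (\<Sum>l<CARD('q) ^ M. sum ?g {l * ?k..<l * ?k + ?k})" by (rule sum.nat_group[symmetric])
  also have "\<dots> = (\<Sum>l<CARD('q) ^ M. \<Sum>s<?k. ?g (s + l * ?k))"
  proof (rule sum.cong[OF refl])
    fix l
    show "sum ?g {l * ?k..<l * ?k + ?k} = (\<Sum>s<?k. ?g (s + l * ?k))"
      using sum.shift_bounds_nat_ivl[of ?g 0 "l * ?k" ?k] by (simp only: add_0 add.commute lessThan_atLeast0)
  qed
  also have "\<dots> = (\<Sum>s<?k. \<Sum>l<CARD('q) ^ M. ?g (s + l * ?k))" by (rule sum.swap)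
  also have "\<dots> = psum N (\<lambda>s. psum M (\<lambda>y. f (s + \<varpi> ^ N * y)))"
    by (simp add: psum_def mult.commute)
  finally show ?thesis .
qed

lemma psum_refine:
  fixes f :: "'q::prime_card padic_int \<Rightarrow> complex"
  assumes "locconst N f"
  shows "psum (N + M) f = of_nat CARD('q) ^ M * psum N f"
  unfolding psum_split locconstD[OF assms] by (simp add: psum_def sum_distrib_left)

lemma haar_eq:
  fixes f :: "'q::prime_card padic_int \<Rightarrow> complex"
  assumes f: "locconst N f"
  shows "haar f = psum N f / of_nat CARD('q) ^ N"
proof -
  define L where "L = (LEAST N. locconst N f)"
  have L: "locconst L f" "L \<le> N" unfolding L_def by (rule LeastI[of _ N], rule f, rule Least_le, rule f)
  have "psum N f = of_nat CARD('q) ^ (N - L) * psum L f" using psum_refine[OF L(1), of "N - L"] L(2) by simp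
  moreover have "(of_nat CARD('q) :: complex) ^ N = of_nat CARD('q) ^ (N - L) * of_nat CARD('q) ^ L"
    using L(2) by (simp flip: power_add)
  ultimately show ?thesis unfolding haar_def L_def[symmetric] by simp
qed

lemma psum_haar:
  fixes f :: "'q::prime_card padic_int \<Rightarrow> complex"
  assumes "locconst N f"
  shows "psum N f = of_nat CARD('q) ^ N * haar f"
  by (simp add: haar_eq[OF assms])

lemma haar_affine:
  fixes f :: "'q::prime_card padic_int \<Rightarrow> complex"
  assumes f: "locconst N f" and u: "u dvd 1"
  shows "haar (\<lambda>x. f (t + u * x)) = haar f"
proof -
  obtain u' where u': "1 = u * u'" using u by (elim dvdE)
  have "f (t + u * (x + \<varpi> ^ N * y)) = f (t + u * x)" for x y
    using locconstD[OF f, of "t + u * x" "u * y"] by (simp add: algebra_simps)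
  hence l: "locconst N (\<lambda>x. f (t + u * x))" by (rule locconstI)
  have "psum N (\<lambda>x. f (t + u * x)) = psum N f"
  proof (rule psum_reindex[OF f])
    fix x y assume "\<varpi> ^ N dvd t + u * x - (t + u * y)"
    hence "\<varpi> ^ N dvd u' * (t + u * x - (t + u * y))" by (rule dvd_mult)
    also have "u' * (t + u * x - (t + u * y)) = (u * u') * (x - y)" by (simp add: algebra_simps)
    finally show "\<varpi> ^ N dvd x - y" by (simp flip: u')
  qed
  thus ?thesis by (simp add: haar_eq[OF f] haar_eq[OF l])
qed

lemma shiftr_add: "\<varpi> ^ m dvd x \<Longrightarrow> shiftr m (x + \<varpi> ^ (m + k) * y) = shiftr m x + \<varpi> ^ k * y"
proof (elim dvdE)
  fix z assume x: "x = \<varpi> ^ m * z"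
  have "x + \<varpi> ^ (m + k) * y = \<varpi> ^ m * (z + \<varpi> ^ k * y)" by (simp add: x power_add algebra_simps)
  thus "shiftr m (x + \<varpi> ^ (m + k) * y) = shiftr m x + \<varpi> ^ k * y" by (simp only: shiftr_mult x)
qed

lemma dvd_add_unif_power: "\<varpi> ^ m dvd x + \<varpi> ^ (m + k) * y \<longleftrightarrow> \<varpi> ^ m dvd (x :: 'q::prime_card padic_int)"
  by (rule dvd_add_left_iff) (simp add: power_add)

text \<open>The substitution \<open>x = q\<^sup>m y\<close> in an integral over the multiples of \<open>q\<^sup>m\<close>.\<close>

lemma haar_dilate:
  fixes f :: "'q::prime_card padic_int \<Rightarrow> complex"
  assumes f: "locconst M f"
  shows "haar (\<lambda>x. if \<varpi> ^ m dvd x then f (shiftr m x) else 0) = haar f / of_nat CARD('q) ^ m"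
proof -
  let ?F = "\<lambda>x. if \<varpi> ^ m dvd x then f (shiftr m x) else 0"
  have l: "locconst (m + M) ?F"
    by (rule locconstI) (simp add: dvd_add_unif_power shiftr_add locconstD[OF f])
  have "psum (m + M) ?F = (\<Sum>k<CARD('q) ^ m. if k = 0 then psum M f else 0)"
    unfolding psum_split
  proof (subst (1) psum_def, rule sum.cong[OF refl])
    fix k assume k: "k \<in> {..<CARD('q) ^ m}"
    have d: "\<varpi> ^ m dvd of_nat k + \<varpi> ^ m * y \<longleftrightarrow> k = 0" for y :: "'q padic_int"
    proof -
      have "\<varpi> ^ m dvd of_nat k + \<varpi> ^ m * y \<longleftrightarrow> \<varpi> ^ m dvd (of_nat k :: 'q padic_int)"
        using dvd_add_unif_power[of m "of_nat k" 0 y] by simp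
      also have "\<dots> \<longleftrightarrow> k = 0" using residue_of_nat_inj[of m k 0, where 'q='q] k by auto
      finally show ?thesis .
    qed
    show "psum M (\<lambda>y. ?F (of_nat k + \<varpi> ^ m * y)) = (if k = 0 then psum M f else 0)"
      unfolding d by (simp add: psum_def)
  qed
  also have "\<dots> = psum M f" by (simp add: sum.delta)
  finally show ?thesis by (simp add: haar_eq[OF l] haar_eq[OF f] power_add)
qed

lemma psum_1_red:
  fixes g :: "'q::prime_card mod_ring \<Rightarrow> complex"
  shows "psum 1 (\<lambda>x :: 'q padic_int. g (red x)) = (\<Sum>s\<in>UNIV. g s)"
proof -
  let ?h = "\<lambda>k. of_nat k :: 'q mod_ring"
  have surj: "?h ` {..<CARD('q)} = UNIV" using red_surj[where 'q='q] by (auto simp: image_iff) (metis lessThan_iff)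
  have "card (?h ` {..<CARD('q)}) = card {..<CARD('q)}" unfolding surj by simp
  hence "bij_betw ?h {..<CARD('q)} UNIV" using surj by (simp add: bij_betw_def eq_card_imp_inj_on)
  thus ?thesis unfolding psum_def using sum.reindex_bij_betw[of ?h "{..<CARD('q)}" UNIV g] by simp
qed

lemma red_add_unif [simp]: "red (x + \<varpi> ^ Suc k * y) = red (x :: 'q::prime_card padic_int)"
  unfolding red_eq_iff by simp

lemma haar_red:
  fixes g :: "'q::prime_card mod_ring \<Rightarrow> complex"
  shows "haar (\<lambda>x :: 'q padic_int. g (red x)) = (\<Sum>s\<in>UNIV. g s) / of_nat CARD('q)"
proof -
  have "locconst 1 (\<lambda>x :: 'q padic_int. g (red x))"
    by (rule locconstI) (simp only: One_nat_def red_add_unif)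
  from haar_eq[OF this] show ?thesis unfolding psum_1_red by simp
qed

lemma haar_const [simp]: "haar (\<lambda>x :: 'q::prime_card padic_int. z) = z"
  by (subst haar_eq[of 0]) (simp_all add: locconst_def psum_def)

lemma haar_cmult:
  assumes f: "locconst N f" shows "haar (\<lambda>x. z * f x) = z * haar f"
proof -
  have "locconst N (\<lambda>x. z * f x)" using f by (simp add: locconst_def)
  from haar_eq[OF this] haar_eq[OF f] show ?thesis by (simp add: psum_def sum_distrib_left)
qed

lemma haar_sum:
  assumes f: "\<And>i. i \<in> I \<Longrightarrow> locconst N (f i)" shows "haar (\<lambda>x. \<Sum>i\<in>I. f i x) = (\<Sum>i\<in>I. haar (f i))"
proof -
  have "locconst N (\<lambda>x. \<Sum>i\<in>I. f i x)" using f by (simp add: locconst_def)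
  from haar_eq[OF this] haar_eq[OF f] show ?thesis
    by (simp add: psum_def sum_divide_distrib sum.swap[of _ I])
qed

lemma haar_swap:
  fixes f :: "'q::prime_card padic_int \<Rightarrow> 'q padic_int \<Rightarrow> complex"
  assumes f: "\<And>y. locconst N (\<lambda>x. f x y)" "\<And>x. locconst N (f x)"
  shows "haar (\<lambda>x. haar (f x)) = haar (\<lambda>y. haar (\<lambda>x. f x y))"
proof -
  let ?Q = "of_nat CARD('q) ^ N :: complex"
  have e: "f (x + \<varpi> ^ N * z) = f x" for x z by (rule ext) (rule locconstD[OF f(1)])
  have l: "locconst N (\<lambda>x. haar (f x))" "locconst N (\<lambda>y. haar (\<lambda>x. f x y))"
    using e by (simp_all add: locconst_def locconstD[OF f(2)])
  have "haar (\<lambda>x. haar (f x)) = (\<Sum>k<CARD('q) ^ N. \<Sum>l<CARD('q) ^ N. f (of_nat k) (of_nat l)) / ?Q / ?Q"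
    unfolding haar_eq[OF l(1)] psum_def by (simp only: haar_eq[OF f(2)] psum_def sum_divide_distrib)
  also have "(\<Sum>k<CARD('q) ^ N. \<Sum>l<CARD('q) ^ N. f (of_nat k) (of_nat l)) =
      (\<Sum>l<CARD('q) ^ N. \<Sum>k<CARD('q) ^ N. f (of_nat k) (of_nat l))" by (rule sum.swap)
  also have "\<dots> / ?Q / ?Q = haar (\<lambda>y. haar (\<lambda>x. f x y))"
    unfolding haar_eq[OF l(2)] psum_def by (simp only: haar_eq[OF f(1)] psum_def sum_divide_distrib)
  finally show ?thesis .
qed

subsection \<open>Digits\<close>

text \<open>The integrands below depend on a quantity \<open>x\<close> only through whether \<open>q\<^sup>m\<close> divides it, and then through
  the digit of \<open>x\<close> at \<open>q\<^sup>m\<close>.\<close>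

definition sift :: "nat \<Rightarrow> ('q::prime_card mod_ring \<Rightarrow> complex) \<Rightarrow> 'q padic_int \<Rightarrow> complex" where
  "sift m g x = (if \<varpi> ^ m dvd x then g (red (shiftr m x)) else 0)"

lemma sift_add: "m < N \<Longrightarrow> sift m g (x + \<varpi> ^ N * y) = sift m g x"
proof -
  assume "m < N"
  then obtain k where N: "N = m + Suc k" by (metis add_Suc_right less_natE)
  show ?thesis unfolding N sift_def dvd_add_unif_power
    by (cases "\<varpi> ^ m dvd x") (simp_all only: shiftr_add red_add_unif if_True if_False simp_thms)
qed

lemma sift_mult: "sift (m + k) g (\<varpi> ^ m * x) = sift k g x"
proof (cases "\<varpi> ^ k dvd x")
  case True
  then obtain y where "x = \<varpi> ^ k * y" by (elim dvdE)
  moreover have "\<varpi> ^ m * (\<varpi> ^ k * y) = \<varpi> ^ (m + k) * y" by (simp add: power_add mult.assoc)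
  ultimately show ?thesis unfolding sift_def by (simp only: shiftr_mult dvd_triv_left)
next
  case False
  thus ?thesis by (simp add: sift_def power_add)
qed

lemma sift_not_dvd: "\<not> \<varpi> ^ l dvd x \<Longrightarrow> l \<le> m \<Longrightarrow> sift m g x = 0"
  unfolding sift_def by (metis dvd_trans le_imp_power_dvd)

lemma haar_sift:
  fixes g :: "'q::prime_card mod_ring \<Rightarrow> complex"
  shows "haar (sift m g) = (\<Sum>s\<in>UNIV. g s) / of_nat CARD('q) ^ (m + 1)"
proof -
  have "locconst 1 (\<lambda>x :: 'q padic_int. g (red x))" by (rule locconstI) (simp only: One_nat_def red_add_unif)
  from haar_dilate[OF this, of m] show ?thesis unfolding sift_def[abs_def] haar_red by simp
qed

section \<open>The sums over classes as integrals\<close>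

text \<open>The value of \<open>\<Phi>\<close> at \<open>\<tau>\<close> in terms of \<open>B\<close> and \<open>C\<close>: substitute \<open>a = 3 \<tau> - q\<^sup>i B\<close> and the corresponding
  expression for \<open>b\<close>.\<close>

definition value_at :: "'q::prime_card padic_int \<Rightarrow> nat \<Rightarrow> nat \<Rightarrow> 'q padic_int \<Rightarrow> 'q padic_int \<Rightarrow> 'q padic_int \<Rightarrow> 'q padic_int" where
  "value_at c i n \<tau> B C = \<tau> ^ 3 - \<varpi> ^ i * B * \<tau>\<^sup>2 + \<varpi> ^ (2 * i + n) * C * \<tau> - c"

type_synonym 'q weight_function = "'q mod_ring \<Rightarrow> 'q mod_ring \<Rightarrow> 'q mod_ring \<Rightarrow> complex"

definition frame_weight :: "'q::prime_card padic_int \<Rightarrow> nat \<Rightarrow> nat \<Rightarrow> 'q weight_function \<Rightarrow> 'q padic_int \<Rightarrow> complex" where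
  "frame_weight c i n g \<tau> =
    haar (\<lambda>B. haar (\<lambda>C. sift (3 * i + 2 * n) (g (red B) (red C)) (value_at c i n \<tau> B C)))"

definition weight :: "'q::prime_card padic_int \<Rightarrow> nat \<Rightarrow> nat \<Rightarrow> 'q weight_function \<Rightarrow> complex" where
  "weight c i n g = psum (i + n) (frame_weight c i n g)"

lemma red_add_unif_power: "0 < M \<Longrightarrow> red (x + \<varpi> ^ M * y) = red (x :: 'q::prime_card padic_int)"
  by (metis gr0_conv_Suc red_add_unif)

lemma sift_value_B:
  assumes "3 * i + 2 * n < M"
  shows "sift (3 * i + 2 * n) (g (red (B + \<varpi> ^ M * y)) \<gamma>) (value_at c i n \<tau> (B + \<varpi> ^ M * y) C) =
    sift (3 * i + 2 * n) (g (red B) \<gamma>) (value_at c i n \<tau> B C)"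
proof -
  have "value_at c i n \<tau> (B + \<varpi> ^ M * y) C = value_at c i n \<tau> B C + \<varpi> ^ M * (- (\<varpi> ^ i * y * \<tau>\<^sup>2))"
    by (simp add: value_at_def algebra_simps)
  moreover have "0 < M" using assms by simp
  ultimately show ?thesis by (simp only: sift_add[OF assms] red_add_unif_power)
qed

lemma sift_value_C:
  assumes "3 * i + 2 * n < M"
  shows "sift (3 * i + 2 * n) (g \<beta> (red (C + \<varpi> ^ M * y))) (value_at c i n \<tau> B (C + \<varpi> ^ M * y)) =
    sift (3 * i + 2 * n) (g \<beta> (red C)) (value_at c i n \<tau> B C)"
proof -
  have "value_at c i n \<tau> B (C + \<varpi> ^ M * y) = value_at c i n \<tau> B C + \<varpi> ^ M * (\<varpi> ^ (2 * i + n) * y * \<tau>)"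
    by (simp add: value_at_def algebra_simps)
  moreover have "0 < M" using assms by simp
  ultimately show ?thesis by (simp only: sift_add[OF assms] red_add_unif_power)
qed

lemma frame_locconst:
  assumes "3 * i + 2 * n < M"
  shows "locconst M (\<lambda>B. sift (3 * i + 2 * n) (g (red B) \<gamma>) (value_at c i n \<tau> B C))"
    "locconst M (\<lambda>C. sift (3 * i + 2 * n) (g \<beta> (red C)) (value_at c i n \<tau> B C))"
    "locconst M (\<lambda>B. haar (\<lambda>C. sift (3 * i + 2 * n) (g (red B) (red C)) (value_at c i n \<tau> B C)))"
    "locconst M (\<lambda>C. haar (\<lambda>B. sift (3 * i + 2 * n) (g (red B) (red C)) (value_at c i n \<tau> B C)))"
  by (rule locconstI, simp only: sift_value_B[OF assms] sift_value_C[OF assms])+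

definition pair_weight :: "'q::prime_card padic_int \<Rightarrow> nat \<Rightarrow> nat \<Rightarrow> 'q padic_int \<Rightarrow> 'q weight_function \<Rightarrow> 'q padic_int \<Rightarrow> 'q padic_int \<Rightarrow> complex" where
  "pair_weight c i n \<tau> g a b = sift i (\<lambda>\<beta>. sift (2 * i + n) (\<lambda>\<gamma>. sift (3 * i + 2 * n) (g \<beta> \<gamma>)
     (value_part c (a, b) \<tau>)) (deriv_part (a, b) \<tau>)) (trace_part (a, b) \<tau>)"

lemma parts_add:
  "trace_part (a + M * y, b + M * z) \<tau> = trace_part (a, b) \<tau> + M * (- y)"
  "deriv_part (a + M * y, b + M * z) \<tau> = deriv_part (a, b) \<tau> + M * (z - 2 * y * \<tau>)"
  "value_part c (a + M * y, b + M * z) \<tau> = value_part c (a, b) \<tau> + M * (z * \<tau> - y * \<tau>\<^sup>2)"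
  by (simp_all add: trace_part_def deriv_part_def value_part_def algebra_simps)

lemma sift_add_const: "m \<le> N \<Longrightarrow> sift m (\<lambda>_. s) (x + \<varpi> ^ N * y) = sift m (\<lambda>_. s) x"
  unfolding sift_def by (metis dvd_add_unif_power le_add_diff_inverse)

lemma pair_weight_add:
  assumes "3 * i + 2 * n < M"
  shows "pair_weight c i n \<tau> g (a + \<varpi> ^ M * y) (b + \<varpi> ^ M * z) = pair_weight c i n \<tau> g a b"
proof -
  have M: "i < M" "2 * i + n < M" using assms by auto
  show ?thesis unfolding pair_weight_def parts_add sift_add[OF M(1)] sift_add[OF M(2)] sift_add[OF assms] ..
qed

lemma pair_weight_const_add:
  assumes "3 * i + 2 * n \<le> M"
  shows "pair_weight c i n \<tau> (\<lambda>_ _ _. s) (a + \<varpi> ^ M * y) (b + \<varpi> ^ M * z) = pair_weight c i n \<tau> (\<lambda>_ _ _. s) a b"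
proof -
  have M: "i \<le> M" "2 * i + n \<le> M" using assms by auto
  show ?thesis unfolding pair_weight_def parts_add sift_add_const[OF M(1)] sift_add_const[OF M(2)] sift_add_const[OF assms] ..
qed

lemma pair_weight_locconst:
  assumes "3 * i + 2 * n < M"
  shows "locconst M (\<lambda>b. pair_weight c i n \<tau> g a b)" "locconst M (\<lambda>a. haar (\<lambda>b. pair_weight c i n \<tau> g a b))"
  by (rule locconstI, simp only: pair_weight_add[OF assms, where y=0, simplified] pair_weight_add[OF assms, where z=0, simplified])+

lemma haar_divide:
  assumes "locconst N f" shows "haar (\<lambda>x. f x / z) = haar f / z"
  using haar_cmult[OF assms, of "1 / z"] by simp

text \<open>For fixed \<open>\<tau>\<close> the substitution \<open>a = 3 \<tau> - a'\<close>, \<open>b = b' + 2 a \<tau> - 3 \<tau>\<^sup>2\<close> preserves the measure and turns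
  the three conditions into conditions on \<open>a'\<close>, \<open>b'\<close> and \<open>\<tau>\<^sup>3 - a' \<tau>\<^sup>2 + b' \<tau> - c\<close>. The power of \<open>q\<close> is the
  measure of the set where the first two hold.\<close>

lemma haar_pair_weight:
  fixes c :: "'q::prime_card padic_int"
  shows "haar (\<lambda>a. haar (\<lambda>b. pair_weight c i n \<tau> g a b)) = frame_weight c i n g \<tau> / of_nat CARD('q) ^ (3 * i + n)"
proof -
  define m where "m = 3 * i + 2 * n"
  define G where "G B C = sift m (g (red B) (red C)) (value_at c i n \<tau> B C)" for B C
  have M: "3 * i + 2 * n < Suc m" by (simp add: m_def)
  have inner: "haar (\<lambda>b. pair_weight c i n \<tau> g (3 * \<tau> + (- 1) * a) b) =
      (if \<varpi> ^ i dvd a then haar (G (shiftr i a)) / of_nat CARD('q) ^ (2 * i + n) else 0)" for a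
  proof -
    let ?t = "2 * (3 * \<tau> - a) * \<tau> - 3 * \<tau>\<^sup>2"
    have p: "pair_weight c i n \<tau> g (3 * \<tau> + (- 1) * a) (?t + 1 * b) =
      (if \<varpi> ^ i dvd a then (if \<varpi> ^ (2 * i + n) dvd b then G (shiftr i a) (shiftr (2 * i + n) b) else 0) else 0)" for b
    proof -
      have T: "trace_part (3 * \<tau> + (- 1) * a, ?t + 1 * b) \<tau> = a"
        and D: "deriv_part (3 * \<tau> + (- 1) * a, ?t + 1 * b) \<tau> = b"
        and V: "value_part c (3 * \<tau> + (- 1) * a, ?t + 1 * b) \<tau> = \<tau> ^ 3 - a * \<tau>\<^sup>2 + b * \<tau> - c"
        by (simp_all add: trace_part_def deriv_part_def value_part_def algebra_simps power2_eq_square power3_eq_cube)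
      have "value_at c i n \<tau> (shiftr i a) (shiftr (2 * i + n) b) = \<tau> ^ 3 - a * \<tau>\<^sup>2 + b * \<tau> - c"
        if "\<varpi> ^ i dvd a" "\<varpi> ^ (2 * i + n) dvd b"
        unfolding value_at_def shiftr_dvd[OF that(1)] shiftr_dvd[OF that(2)] ..
      thus ?thesis unfolding pair_weight_def T D V G_def m_def sift_def[of i] sift_def[of "2 * i + n"] by simp
    qed
    have "haar (\<lambda>b. pair_weight c i n \<tau> g (3 * \<tau> + (- 1) * a) b) =
        haar (\<lambda>b. pair_weight c i n \<tau> g (3 * \<tau> + (- 1) * a) (?t + 1 * b))"
      by (rule haar_affine[symmetric, OF pair_weight_locconst(1)[OF M]]) simp
    also have "\<dots> = (if \<varpi> ^ i dvd a then haar (\<lambda>b. if \<varpi> ^ (2 * i + n) dvd b then G (shiftr i a) (shiftr (2 * i + n) b) else 0) else 0)"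
      unfolding p by (cases "\<varpi> ^ i dvd a") simp_all
    also have "haar (\<lambda>b. if \<varpi> ^ (2 * i + n) dvd b then G (shiftr i a) (shiftr (2 * i + n) b) else 0) =
        haar (G (shiftr i a)) / of_nat CARD('q) ^ (2 * i + n)"
      by (rule haar_dilate[where M="Suc m"]) (unfold G_def m_def, rule frame_locconst(2), simp)
    finally show ?thesis .
  qed
  have l: "locconst (Suc m) (\<lambda>B. haar (G B))"
    unfolding G_def m_def by (rule frame_locconst(3)) simp
  hence l': "locconst (Suc m) (\<lambda>B. haar (G B) / of_nat CARD('q) ^ (2 * i + n))" by (simp add: locconst_def)
  have "haar (\<lambda>a. haar (\<lambda>b. pair_weight c i n \<tau> g a b)) = haar (\<lambda>a. haar (\<lambda>b. pair_weight c i n \<tau> g (3 * \<tau> + (- 1) * a) b))"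
    by (rule haar_affine[symmetric, OF pair_weight_locconst(2)[OF M]]) simp
  also have "\<dots> = haar (\<lambda>B. haar (G B) / of_nat CARD('q) ^ (2 * i + n)) / of_nat CARD('q) ^ i"
    unfolding inner by (rule haar_dilate[OF l'])
  also have "\<dots> = haar (\<lambda>B. haar (G B)) / of_nat CARD('q) ^ (3 * i + n)"
    unfolding haar_divide[OF l] by (simp add: mult_2 power_add numeral_3_eq_3)
  finally show ?thesis unfolding G_def frame_weight_def m_def .
qed

definition euler_coeff :: "nat \<Rightarrow> nat \<Rightarrow> 'q::prime_card weight_function" where
  "euler_coeff n v \<beta> \<gamma> \<delta> = of_real (fps_nth (local_factor (if n = 0 then 1 else 0) \<beta> \<gamma> \<delta>) v)"

lemma local_factor_nth_0: "fps_nth (local_factor A B C D) 0 = 1"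
  by (simp add: local_factor_def cubic_euler_def fps_mult_nth_0 fps_nth_power_0)

lemma euler_coeff_0: "euler_coeff n 0 = (\<lambda>_ _ _. 1)"
  by (simp add: euler_coeff_def fun_eq_iff local_factor_nth_0)

lemma finite_index_pairs: "finite {(i, n). 3 * i + n = (r :: nat)}"
  by (rule finite_subset[of _ "{..r} \<times> {..r}"]) auto

lemma S_sum_pair_weight:
  fixes c :: "'q::prime_card padic_int"
  shows "of_real (S_sum c (a, b) v r) = (\<Sum>((i, n), k)\<in>(SIGMA (i, n):{(i, n). 3 * i + n = r}. {..<CARD('q) ^ (i + n)}).
    pair_weight c i n (of_nat k) (euler_coeff n v) a b)"
proof -
  have p: "of_real (if overorder_at c (a, b) i n \<tau> then order_coeff c (a, b) i n \<tau> v else 0) = pair_weight c i n \<tau> (euler_coeff n v) a b" for i n \<tau>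
  proof -
    have "red (\<varpi> ^ n :: 'q padic_int) = (if n = 0 then 1 else 0)"
      by (cases n) (simp_all add: red_eq_0_iff del: red_power red_mult)
    thus ?thesis by (simp add: pair_weight_def sift_def overorder_at_def order_coeff_def euler_coeff_def)
  qed
  have s: "(\<Sum>k | k < N \<and> P k. f k) = (\<Sum>k<N. if P k then f k else 0)" for N P and f :: "nat \<Rightarrow> real"
    using sum.inter_filter[of "{..<N}" f P] by simp
  have "complex_of_real (S_sum c (a, b) v r) = (\<Sum>(i, n) | 3 * i + n = r. \<Sum>k<CARD('q) ^ (i + n).
      pair_weight c i n (of_nat k) (euler_coeff n v) a b)"
    unfolding S_sum_eq s of_real_sum p[symmetric] by (rule sum.cong) (auto simp: of_real_sum)
  also have "\<dots> = (\<Sum>x | (case x of (i, n) \<Rightarrow> 3 * i + n = r). \<Sum>k\<in>(case x of (i, n) \<Rightarrow> {..<CARD('q) ^ (i + n)}).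
      pair_weight c (fst x) (snd x) (of_nat k) (euler_coeff (snd x) v) a b)"
    by (rule sum.cong) auto
  also have "\<dots> = (\<Sum>((i, n), k)\<in>(SIGMA (i, n):{(i, n). 3 * i + n = r}. {..<CARD('q) ^ (i + n)}).
    pair_weight c i n (of_nat k) (euler_coeff n v) a b)"
    by (subst sum.Sigma[OF finite_index_pairs]) (auto intro!: sum.cong)
  finally show ?thesis .
qed

text \<open>The value of \<open>\<Phi>\<close> matters modulo \<open>q\<close> to the power \<open>3 i + 2 n + 1\<close>, which exceeds \<open>v + 2 r\<close> only if \<open>v = i = 0\<close>. The
  case \<open>v = 0\<close> is saved by \<open>\<kappa> = 1\<close>: there the digit of the value does not enter.\<close>

lemma S_sum_add:
  fixes c :: "'q::prime_card padic_int"
  shows "S_sum c (a + \<varpi> ^ (v + 2 * r) * y, b + \<varpi> ^ (v + 2 * r) * z) v r = S_sum c (a, b) v r"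
proof -
  have "pair_weight c i n \<tau> (euler_coeff n v) (a + \<varpi> ^ (v + 2 * r) * y) (b + \<varpi> ^ (v + 2 * r) * z) = pair_weight c i n \<tau> (euler_coeff n v) a b"
    if "3 * i + n = r" for i n \<tau>
  proof (cases "v = 0")
    case True
    have "3 * i + 2 * n \<le> v + 2 * r" using that by simp
    thus ?thesis unfolding True euler_coeff_0 by (intro pair_weight_const_add) simp
  next
    case False
    thus ?thesis using that by (intro pair_weight_add) simp
  qed
  hence "complex_of_real (S_sum c (a + \<varpi> ^ (v + 2 * r) * y, b + \<varpi> ^ (v + 2 * r) * z) v r) = of_real (S_sum c (a, b) v r)"
    unfolding S_sum_pair_weight by (intro sum.cong) auto
  thus ?thesis by (simp only: of_real_eq_iff)
qed

text \<open>For given \<open>a\<close> the discriminant is a polynomial in \<open>b\<close> with leading coefficient \<open>- 4\<close>.\<close>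

lemma exists_disc_nonzero:
  fixes c :: "'q::prime_card padic_int"
  shows "\<exists>b'. \<varpi> ^ N dvd b - b' \<and> cubic_disc c (a, b') \<noteq> 0"
proof -
  define p where "p = [:- 4 * a ^ 3 * c - 27 * c\<^sup>2, 18 * a * c, a\<^sup>2, - 4:]"
  have p: "poly p b = cubic_disc c (a, b)" for b
    by (simp add: p_def cubic_disc_def algebra_simps power2_eq_square power3_eq_cube)
  have "p \<noteq> 0" by (simp add: p_def)
  hence fin: "finite {b. poly p b = 0}" by (rule poly_roots_finite)
  have "inj (\<lambda>k :: nat. b + \<varpi> ^ N * of_nat k)" by (rule injI) simp
  hence "infinite (range (\<lambda>k :: nat. b + \<varpi> ^ N * of_nat k))" using finite_imageD by blast
  hence "\<not> range (\<lambda>k :: nat. b + \<varpi> ^ N * of_nat k) \<subseteq> {b. poly p b = 0}" using fin finite_subset by blast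
  then obtain k :: nat where k: "poly p (b + \<varpi> ^ N * of_nat k) \<noteq> 0" by blast
  show ?thesis
  proof (intro exI conjI)
    show "\<varpi> ^ N dvd b - (b + \<varpi> ^ N * of_nat k)" by simp
    show "cubic_disc c (a, b + \<varpi> ^ N * of_nat k) \<noteq> 0" using k unfolding p .
  qed
qed

lemma kloosterman_K_psum:
  fixes c :: "'q::prime_card padic_int"
  shows "of_real (kloosterman_K c v r) =
    psum (v + 2 * r) (\<lambda>a. psum (v + 2 * r) (\<lambda>b. of_real (S_sum c (a, b) v r)))"
proof -
  define N where "N = v + 2 * r"
  let ?c = "\<lambda>a b. {(a', b'). \<varpi> ^ N dvd (a :: 'q padic_int) - a' \<and> \<varpi> ^ N dvd b - (b' :: 'q padic_int)}"
  have cls: "pair_cong N `` {(a, b)} = ?c a b" for a b :: "'q padic_int"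
    by (auto simp: pair_cong_def)
  define rep where "rep = (\<lambda>(k, l). ?c (of_nat k) (of_nat l))"
  have S: "S_sum c (SOME ab. ab \<in> ?c a b \<and> cubic_disc c ab \<noteq> 0) v r = S_sum c (a, b) v r" for a b
  proof -
    obtain b' where "\<varpi> ^ N dvd b - b'" "cubic_disc c (a, b') \<noteq> 0" using exists_disc_nonzero by blast
    hence "(a, b') \<in> ?c a b \<and> cubic_disc c (a, b') \<noteq> 0" by simp
    from someI[of "\<lambda>ab. ab \<in> ?c a b \<and> cubic_disc c ab \<noteq> 0", OF this]
    obtain a'' b'' where s: "(SOME ab. ab \<in> ?c a b \<and> cubic_disc c ab \<noteq> 0) = (a'', b'')" "\<varpi> ^ N dvd a - a''" "\<varpi> ^ N dvd b - b''"
      by (smt (verit) case_prodE mem_Collect_eq)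
    obtain y z where "a - a'' = \<varpi> ^ N * y" "b - b'' = \<varpi> ^ N * z" using s(2,3) by (elim dvdE)
    hence "a = a'' + \<varpi> ^ N * y" "b = b'' + \<varpi> ^ N * z" by (simp_all add: algebra_simps)
    hence "S_sum c (a, b) v r = S_sum c (a'', b'') v r" unfolding N_def by (simp only: S_sum_add)
    thus ?thesis unfolding s(1) ..
  qed
  have eq: "?c a b = ?c a' b' \<longleftrightarrow> residue N a = residue N a' \<and> residue N b = residue N b'" for a b a' b'
    unfolding unif_power_dvd_diff_iff by fastforce
  have bij: "bij_betw rep ({..<CARD('q) ^ N} \<times> {..<CARD('q) ^ N}) (UNIV // pair_cong N)"
  proof (rule bij_betw_imageI)
    show "inj_on rep ({..<CARD('q) ^ N} \<times> {..<CARD('q) ^ N})"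
    proof (rule inj_onI)
      fix p p' assume a: "p \<in> {..<CARD('q) ^ N} \<times> {..<CARD('q) ^ N}" "p' \<in> {..<CARD('q) ^ N} \<times> {..<CARD('q) ^ N}" "rep p = rep p'"
      obtain k l k' l' where p: "p = (k, l)" "p' = (k', l')" "k < CARD('q) ^ N" "l < CARD('q) ^ N" "k' < CARD('q) ^ N" "l' < CARD('q) ^ N"
        using a(1,2) by auto
      show "p = p'" using a(3) p(3-6) unfolding p(1,2) rep_def prod.case eq by (simp add: residue_of_nat)
    qed
    show "rep ` ({..<CARD('q) ^ N} \<times> {..<CARD('q) ^ N}) = UNIV // pair_cong N"
    proof (intro equalityI subsetI)
      fix C assume "C \<in> rep ` ({..<CARD('q) ^ N} \<times> {..<CARD('q) ^ N})"
      then obtain k l where "C = pair_cong N `` {(of_nat k, of_nat l)}" unfolding cls by (auto simp: rep_def)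
      thus "C \<in> UNIV // pair_cong N" by (simp add: quotientI)
    next
      fix C :: "('q padic_int \<times> 'q padic_int) set" assume "C \<in> UNIV // pair_cong N"
      then obtain ab where "C = pair_cong N `` {ab}" by (rule quotientE)
      then obtain a b where "C = ?c a b" using cls by (cases ab) auto
      also have "\<dots> = rep (residue N a, residue N b)"
        unfolding rep_def prod.case eq by (simp add: residue_of_nat residue_less)
      finally show "C \<in> rep ` ({..<CARD('q) ^ N} \<times> {..<CARD('q) ^ N})" by (simp add: residue_less)
    qed
  qed
  have "kloosterman_K c v r = (\<Sum>p\<in>{..<CARD('q) ^ N} \<times> {..<CARD('q) ^ N}. S_sum c (SOME ab. ab \<in> rep p \<and> cubic_disc c ab \<noteq> 0) v r)"
    unfolding kloosterman_K_def N_def[symmetric]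
    by (rule sum.reindex_bij_betw[OF bij, symmetric])
  also have "\<dots> = (\<Sum>(k, l)\<in>{..<CARD('q) ^ N} \<times> {..<CARD('q) ^ N}. S_sum c (of_nat k, of_nat l) v r)"
  proof (rule sum.cong[OF refl])
    fix p :: "nat \<times> nat"
    obtain k l where p: "p = (k, l)" by (cases p)
    show "S_sum c (SOME ab. ab \<in> rep p \<and> cubic_disc c ab \<noteq> 0) v r = (case p of (k, l) \<Rightarrow> S_sum c (of_nat k, of_nat l) v r)"
      unfolding p rep_def prod.case by (rule S)
  qed
  also have "\<dots> = (\<Sum>k<CARD('q) ^ N. \<Sum>l<CARD('q) ^ N. S_sum c (of_nat k, of_nat l) v r)"
    by (rule sum.cartesian_product[symmetric])
  finally show ?thesis unfolding N_def[symmetric] psum_def by simp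
qed

lemma kloosterman_K_weight:
  fixes c :: "'q::prime_card padic_int"
  shows "of_real (kloosterman_K c v r) = of_nat CARD('q) ^ (2 * v + 3 * r) *
    (\<Sum>(i, n) | 3 * i + n = r. weight c i n (euler_coeff n v))"
proof -
  define N where "N = v + 2 * r"
  define Q where "Q = (of_nat CARD('q) :: complex)"
  let ?I = "SIGMA (i, n):{(i, n). 3 * i + n = r}. {..<CARD('q) ^ (i + n)}"
  define P where "P = (\<lambda>((i, n), k). pair_weight c i n (of_nat k) (euler_coeff n v))"
  have l: "locconst N (\<lambda>b. complex_of_real (S_sum c (a, b) v r))" for a
    using S_sum_add[of c a v r 0] by (simp add: locconst_def N_def)
  have l': "locconst N (\<lambda>a. haar (\<lambda>b. complex_of_real (S_sum c (a, b) v r)))"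
    using S_sum_add[of c _ v r _ _ 0] by (simp add: locconst_def N_def)
  have lp: "locconst (Suc N) (P t a)" "locconst (Suc N) (\<lambda>a. haar (P t a))" if "t \<in> ?I" for t a
  proof -
    obtain i n k where t: "t = ((i, n), k)" "3 * i + n = r" using \<open>t \<in> ?I\<close> by auto
    have "3 * i + 2 * n < Suc N" using t(2) by (simp add: N_def)
    from pair_weight_locconst(1)[OF this] show "locconst (Suc N) (P t a)" unfolding t(1) P_def prod.case .
    from pair_weight_locconst(2)[OF \<open>3 * i + 2 * n < Suc N\<close>] show "locconst (Suc N) (\<lambda>a. haar (P t a))"
      unfolding t(1) P_def prod.case .
  qed
  have "of_real (kloosterman_K c v r) = Q ^ N * (Q ^ N * haar (\<lambda>a. haar (\<lambda>b. of_real (S_sum c (a, b) v r))))"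
    unfolding kloosterman_K_psum N_def[symmetric] psum_haar[OF l] Q_def
    using psum_haar[OF l'] by (simp add: psum_def flip: sum_distrib_left)
  also have "haar (\<lambda>a. haar (\<lambda>b. complex_of_real (S_sum c (a, b) v r))) = haar (\<lambda>a. \<Sum>t\<in>?I. haar (P t a))"
  proof -
    have "complex_of_real (S_sum c (a, b) v r) = (\<Sum>t\<in>?I. P t a b)" for a b
      unfolding S_sum_pair_weight by (simp add: P_def case_prod_beta)
    moreover have "haar (\<lambda>b. \<Sum>t\<in>?I. P t a b) = (\<Sum>t\<in>?I. haar (P t a))" for a
      by (rule haar_sum) (rule lp(1))
    ultimately show ?thesis by (simp only:)
  qed
  also have "haar (\<lambda>a. \<Sum>t\<in>?I. haar (P t a)) = (\<Sum>t\<in>?I. haar (\<lambda>a. haar (P t a)))"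
    by (rule haar_sum) (rule lp(2))
  also have "(\<Sum>t\<in>?I. haar (\<lambda>a. haar (P t a))) = (\<Sum>t\<in>?I. case t of ((i, n), k) \<Rightarrow> frame_weight c i n (euler_coeff n v) (of_nat k) / Q ^ (3 * i + n))"
    by (rule sum.cong[OF refl]) (auto simp: haar_pair_weight Q_def P_def)
  also have "(\<Sum>t\<in>?I. case t of ((i, n), k) \<Rightarrow> frame_weight c i n (euler_coeff n v) (of_nat k) / Q ^ (3 * i + n)) = (\<Sum>t\<in>?I. case t of (x, k) \<Rightarrow> frame_weight c (fst x) (snd x) (euler_coeff (snd x) v) (of_nat k)) / Q ^ r"
    unfolding sum_divide_distrib by (rule sum.cong) auto
  also have "(\<Sum>t\<in>?I. case t of (x, k) \<Rightarrow> frame_weight c (fst x) (snd x) (euler_coeff (snd x) v) (of_nat k)) = (\<Sum>(i, n) | 3 * i + n = r. weight c i n (euler_coeff n v))"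
    by (subst sum.Sigma[symmetric, OF finite_index_pairs]) (auto simp: weight_def psum_def intro!: sum.cong)
  also have "Q ^ N * (Q ^ N * (S / Q ^ r)) = Q ^ (2 * v + 3 * r) * S" for S
  proof -
    have "N + N = (2 * v + 3 * r) + r" by (simp add: N_def)
    hence e: "Q ^ N * Q ^ N = Q ^ (2 * v + 3 * r) * Q ^ r" by (simp only: power_add[symmetric])
    have "Q ^ N * (Q ^ N * (S / Q ^ r)) = (Q ^ N * Q ^ N) * S / Q ^ r" by simp
    also have "\<dots> = Q ^ (2 * v + 3 * r) * S" unfolding e by (simp add: Q_def)
    finally show ?thesis .
  qed
  finally show ?thesis unfolding Q_def .
qed

section \<open>Evaluation of the weights\<close>

lemma haar_red2:
  fixes g :: "'q::prime_card mod_ring \<Rightarrow> 'q mod_ring \<Rightarrow> complex"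
  shows "haar (\<lambda>B :: 'q padic_int. haar (\<lambda>C :: 'q padic_int. g (red B) (red C))) = (\<Sum>\<beta>\<in>UNIV. \<Sum>\<gamma>\<in>UNIV. g \<beta> \<gamma>) / of_nat CARD('q) ^ 2"
proof -
  have "haar (\<lambda>B :: 'q padic_int. haar (\<lambda>C :: 'q padic_int. g (red B) (red C))) = haar (\<lambda>B :: 'q padic_int. (\<lambda>\<beta>. (\<Sum>\<gamma>\<in>UNIV. g \<beta> \<gamma>) / of_nat CARD('q)) (red B))"
    by (rule arg_cong[where f=haar], rule ext, rule haar_red)
  also have "\<dots> = (\<Sum>\<beta>\<in>UNIV. (\<Sum>\<gamma>\<in>UNIV. g \<beta> \<gamma>) / of_nat CARD('q)) / of_nat CARD('q)" by (rule haar_red)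
  also have "\<dots> = (\<Sum>\<beta>\<in>UNIV. \<Sum>\<gamma>\<in>UNIV. g \<beta> \<gamma>) / of_nat CARD('q) ^ 2"
    by (simp add: power2_eq_square flip: sum_divide_distrib)
  finally show ?thesis .
qed

lemma frame_weight_0:
  fixes c :: "'q::prime_card padic_int"
  shows "frame_weight c i n g 0 = sift (3 * i + 2 * n) (\<lambda>\<delta>. \<Sum>\<beta>\<in>UNIV. \<Sum>\<gamma>\<in>UNIV. g \<beta> \<gamma> \<delta>) (- c) / of_nat CARD('q) ^ 2"
proof -
  have "value_at c i n 0 B C = - c" for B C by (simp add: value_at_def)
  thus ?thesis unfolding frame_weight_def sift_def
    using haar_red2[of "\<lambda>\<beta> \<gamma>. g \<beta> \<gamma> (red (shiftr (3 * i + 2 * n) (- c)))"] by simp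
qed

lemma value_at_scale: "value_at (\<varpi> ^ 3 * c) (Suc i) n (\<varpi> * \<tau>) B C = \<varpi> ^ 3 * value_at c i n \<tau> B C"
  by (simp add: value_at_def algebra_simps power2_eq_square power3_eq_cube power_add)

text \<open>For \<open>\<tau>\<close> divisible by \<open>q\<close> the value is homogeneous: multiplying \<open>\<tau>\<close> by \<open>q\<close> and \<open>c\<close> by \<open>q\<^sup>3\<close> increases \<open>i\<close> by one.\<close>

lemma frame_weight_scale: "frame_weight (\<varpi> ^ 3 * c) (Suc i) n g (\<varpi> * \<tau>) = frame_weight c i n g \<tau>"
proof -
  have e: "3 * Suc i + 2 * n = 3 + (3 * i + 2 * n)" by simp
  show ?thesis unfolding frame_weight_def value_at_scale e sift_mult ..
qed

lemma frame_weight_not_cube: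
  fixes c :: "'q::prime_card padic_int"
  assumes "\<not> \<varpi> ^ 3 dvd c" shows "frame_weight c (Suc i) n g (\<varpi> * \<tau>) = 0"
proof -
  have "sift (3 * Suc i + 2 * n) (g (red B) (red C)) (value_at c (Suc i) n (\<varpi> * \<tau>) B C) = 0" for B C
  proof (rule sift_not_dvd[where l=3])
    have "value_at c (Suc i) n (\<varpi> * \<tau>) B C = \<varpi> ^ 3 * value_at 0 i n \<tau> B C - c"
      using value_at_scale[of 0 i n \<tau> B C] by (simp add: value_at_def)
    moreover have "\<not> \<varpi> ^ 3 dvd \<varpi> ^ 3 * value_at 0 i n \<tau> B C - c" using assms
      by (simp add: dvd_diff_right_iff)
    ultimately show "\<not> \<varpi> ^ 3 dvd value_at c (Suc i) n (\<varpi> * \<tau>) B C" by simp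
  qed simp
  thus ?thesis unfolding frame_weight_def by (simp only: haar_const)
qed

lemma frame_weight_unit_zero:
  fixes c :: "'q::prime_card padic_int"
  assumes "\<not> \<varpi> dvd \<tau>" "\<varpi> dvd c" shows "frame_weight c (Suc i) n g \<tau> = 0"
proof -
  have "sift (3 * Suc i + 2 * n) (g (red B) (red C)) (value_at c (Suc i) n \<tau> B C) = 0" for B C
  proof (rule sift_not_dvd[where l=1])
    have "red (value_at c (Suc i) n \<tau> B C) = red \<tau> ^ 3" using assms(2) by (simp add: value_at_def flip: red_eq_0_iff)
    moreover have "red \<tau> \<noteq> 0" using assms(1) by (simp add: red_eq_0_iff)
    ultimately show "\<not> \<varpi> ^ 1 dvd value_at c (Suc i) n \<tau> B C" by (simp flip: red_eq_0_iff)
  qed simp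
  thus ?thesis unfolding frame_weight_def by (simp only: haar_const)
qed

lemma frame_weight_nonunit_zero:
  fixes c :: "'q::prime_card padic_int"
  assumes "\<varpi> dvd \<tau>" "\<not> \<varpi> dvd c" "0 < i + n" shows "frame_weight c i n g \<tau> = 0"
proof -
  have "sift (3 * i + 2 * n) (g (red B) (red C)) (value_at c i n \<tau> B C) = 0" for B C
  proof (rule sift_not_dvd[where l=1])
    have "red (value_at c i n \<tau> B C) = - red c" using assms(1) by (simp add: value_at_def flip: red_eq_0_iff)
    thus "\<not> \<varpi> ^ 1 dvd value_at c i n \<tau> B C" using assms(2) by (simp flip: red_eq_0_iff)
  qed (use assms(3) in linarith)
  thus ?thesis unfolding frame_weight_def by (simp only: haar_const)
qed

text \<open>Let \<open>\<tau> = q\<^sup>u \<epsilon>\<close> with a unit \<open>\<epsilon>\<close>, and \<open>k = i + 2 u\<close>, \<open>d = i + n - u\<close>. In the value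
  \<open>\<tau>\<^sup>3 - c - q\<^sup>k \<epsilon>\<^sup>2 B + q\<^sup>k\<^sup>+\<^sup>d \<epsilon> C\<close> the term with \<open>B\<close> dominates. So \<open>q\<^sup>k\<close> divides \<open>\<tau>\<^sup>3 - c\<close>, and for each \<open>C\<close> one can
  use the quotient \<open>Y\<close> of the value by \<open>q\<^sup>k\<close> as a variable in place of \<open>B\<close>: it has to be divisible by \<open>q\<^sup>2\<^sup>d\<close>,
  so \<open>B\<close> is fixed modulo \<open>q\<close>, while the digit of \<open>Y\<close> at \<open>q\<^sup>2\<^sup>d\<close>, which is \<open>D\<close>, is equidistributed.\<close>

lemma frame_weight_nonzero:
  fixes c :: "'q::prime_card padic_int"
  assumes \<epsilon>: "\<not> \<varpi> dvd \<epsilon>" and u: "u < i + n"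
  shows "frame_weight c i n g (\<varpi> ^ u * \<epsilon>) =
    sift (i + 2 * u) (\<lambda>\<rho>. \<Sum>\<gamma>\<in>UNIV. \<Sum>\<delta>\<in>UNIV. g (\<rho> / (red \<epsilon>)\<^sup>2) \<gamma> \<delta>) ((\<varpi> ^ u * \<epsilon>) ^ 3 - c) / of_nat CARD('q) ^ (2 * (i + n - u) + 2)"
proof -
  define d where "d = i + n - u"
  define k where "k = i + 2 * u"
  define \<tau> where "\<tau> = \<varpi> ^ u * \<epsilon>"
  have d: "0 < d" and m: "3 * i + 2 * n = k + 2 * d" and kd: "2 * i + n + u = k + d" using u by (simp_all add: d_def k_def)
  have val: "value_at c i n \<tau> B C = (\<tau> ^ 3 - c) + \<varpi> ^ k * (\<varpi> ^ d * \<epsilon> * C - \<epsilon>\<^sup>2 * B)" for B C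
  proof -
    have "\<varpi> ^ i * B * \<tau>\<^sup>2 = \<varpi> ^ k * (\<epsilon>\<^sup>2 * B)"
      by (simp add: \<tau>_def k_def power_mult_distrib power_add power_mult[symmetric] mult.commute mult.left_commute)
    moreover have "\<varpi> ^ (2 * i + n) * C * \<tau> = \<varpi> ^ (2 * i + n + u) * (\<epsilon> * C)"
      by (simp add: \<tau>_def power_add mult_ac)
    hence "\<varpi> ^ (2 * i + n) * C * \<tau> = \<varpi> ^ k * (\<varpi> ^ d * \<epsilon> * C)"
      unfolding kd by (simp only: power_add mult.assoc)
    ultimately show ?thesis unfolding value_at_def by (simp only: right_diff_distrib) simp
  qed
  have swap: "frame_weight c i n g \<tau> = haar (\<lambda>C. haar (\<lambda>B. sift (k + 2 * d) (g (red B) (red C)) (value_at c i n \<tau> B C)))"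
    unfolding frame_weight_def m[symmetric]
    by (rule haar_swap[where N="Suc (3 * i + 2 * n)"]) (rule frame_locconst, simp)+
  show ?thesis
  proof (cases "\<varpi> ^ k dvd \<tau> ^ 3 - c")
    case False
    have "sift (k + 2 * d) (g (red B) (red C)) (value_at c i n \<tau> B C) = 0" for B C
    proof (rule sift_not_dvd[where l=k])
      show "\<not> \<varpi> ^ k dvd value_at c i n \<tau> B C" unfolding val using False by (simp add: dvd_add_left_iff)
    qed simp
    thus ?thesis using False unfolding \<tau>_def[symmetric] swap k_def[symmetric] by (simp add: sift_def)
  next
    case True
    then obtain \<rho> where \<rho>: "\<tau> ^ 3 - c = \<varpi> ^ k * \<rho>" by (elim dvdE)
    have "\<epsilon>\<^sup>2 dvd 1" using \<epsilon> by (simp add: padic_unit_iff red_eq_0_iff[symmetric])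
    then obtain \<eta> where \<eta>: "1 = \<epsilon>\<^sup>2 * \<eta>" by (elim dvdE)
    have r\<eta>: "(red \<epsilon>)\<^sup>2 * red \<eta> = 1" using arg_cong[OF \<eta>, of red] by simp
    have \<eta>u: "- \<eta> dvd 1" using \<eta> by (metis dvd_triv_right minus_dvd_iff)
    have inner: "haar (\<lambda>B. sift (k + 2 * d) (g (red B) \<gamma>) (value_at c i n \<tau> B C)) =
      (\<Sum>\<delta>\<in>UNIV. g (red \<rho> / (red \<epsilon>)\<^sup>2) \<gamma> \<delta>) / of_nat CARD('q) ^ (2 * d + 1)" for C \<gamma>
    proof -
      \<comment> \<open>The substitution \<open>B = t - \<eta> Y\<close>, after which the value is \<open>q\<^sup>k Y\<close>.\<close>
      let ?t = "\<eta> * (\<rho> + \<varpi> ^ d * \<epsilon> * C)"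
      have "haar (\<lambda>B. sift (k + 2 * d) (g (red B) \<gamma>) (value_at c i n \<tau> B C)) =
        haar (\<lambda>Y. sift (k + 2 * d) (g (red (?t + - \<eta> * Y)) \<gamma>) (value_at c i n \<tau> (?t + - \<eta> * Y) C))"
        by (rule haar_affine[symmetric, OF _ \<eta>u, where N="Suc (k + 2 * d)"], unfold m[symmetric], rule frame_locconst(1)) simp
      also have "\<dots> = haar (sift (2 * d) (g (red \<rho> / (red \<epsilon>)\<^sup>2) \<gamma>))"
      proof (rule arg_cong[where f=haar], rule ext)
        fix Y
        have "value_at c i n \<tau> (?t + - \<eta> * Y) C = \<varpi> ^ k * ((\<rho> + \<varpi> ^ d * \<epsilon> * C) * (1 - \<epsilon>\<^sup>2 * \<eta>) + (\<epsilon>\<^sup>2 * \<eta>) * Y)"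
          unfolding val \<rho> by (simp add: algebra_simps)
        also have "\<dots> = \<varpi> ^ k * Y" by (simp flip: \<eta>)
        finally have v: "value_at c i n \<tau> (?t + - \<eta> * Y) C = \<varpi> ^ k * Y" .
        have r: "red (?t + - \<eta> * Y) = red \<rho> / (red \<epsilon>)\<^sup>2" if "\<varpi> ^ (2 * d) dvd Y"
        proof -
          have "\<varpi> dvd Y" using that d by (metis dvd_trans dvd_power mult_pos_pos zero_less_numeral)
          hence "red Y = 0" by (simp add: red_eq_0_iff)
          moreover have "red (\<varpi> ^ d :: 'q padic_int) = 0" using d by (simp add: red_eq_0_iff del: red_power)
          ultimately have "red (?t + - \<eta> * Y) = red \<eta> * red \<rho>" by (simp del: red_power)
          also have "\<dots> = red \<rho> / (red \<epsilon>)\<^sup>2" using r\<eta> \<epsilon>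
            by (simp add: eq_divide_eq red_eq_0_iff[symmetric]) (simp add: mult_ac)
          finally show ?thesis .
        qed
        show "sift (k + 2 * d) (g (red (?t + - \<eta> * Y)) \<gamma>) (value_at c i n \<tau> (?t + - \<eta> * Y) C) = sift (2 * d) (g (red \<rho> / (red \<epsilon>)\<^sup>2) \<gamma>) Y"
          unfolding v sift_mult by (cases "\<varpi> ^ (2 * d) dvd Y") (simp_all only: sift_def r if_True if_False)
      qed
      finally show ?thesis unfolding haar_sift .
    qed
    have "frame_weight c i n g \<tau> = haar (\<lambda>C. (\<lambda>\<gamma>. (\<Sum>\<delta>\<in>UNIV. g (red \<rho> / (red \<epsilon>)\<^sup>2) \<gamma> \<delta>) / of_nat CARD('q) ^ (2 * d + 1)) (red C))"
      unfolding swap inner ..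
    also have "\<dots> = (\<Sum>\<gamma>\<in>UNIV. (\<Sum>\<delta>\<in>UNIV. g (red \<rho> / (red \<epsilon>)\<^sup>2) \<gamma> \<delta>) / of_nat CARD('q) ^ (2 * d + 1)) / of_nat CARD('q)"
      by (rule haar_red)
    also have "\<dots> = (\<Sum>\<gamma>\<in>UNIV. \<Sum>\<delta>\<in>UNIV. g (red \<rho> / (red \<epsilon>)\<^sup>2) \<gamma> \<delta>) / of_nat CARD('q) ^ (2 * d + 2)"
      by (simp flip: sum_divide_distrib)
    finally show ?thesis unfolding \<tau>_def[symmetric] k_def[symmetric] d_def[symmetric] \<rho>
      by (simp add: sift_def)
  qed
qed

subsection \<open>Sums over residues of given valuation\<close>

text \<open>The part of \<open>psum\<close> that comes from the units.\<close>

definition usum :: "nat \<Rightarrow> ('q::prime_card padic_int \<Rightarrow> complex) \<Rightarrow> complex" where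
  "usum N f = psum N (\<lambda>x. if \<varpi> dvd x then 0 else f x)"

lemma psum_Suc_unif:
  fixes f :: "'q::prime_card padic_int \<Rightarrow> complex"
  shows "psum (Suc N) f = usum (Suc N) f + psum N (\<lambda>x. f (\<varpi> * x))"
proof -
  define A where "A k = psum N (\<lambda>y. f (of_nat k + \<varpi> * y))" for k
  have d: "\<varpi> dvd of_nat k + \<varpi> * y \<longleftrightarrow> k = 0" if "k < CARD('q)" for k and y :: "'q padic_int"
  proof -
    have "\<varpi> dvd of_nat k + \<varpi> * y \<longleftrightarrow> \<varpi> dvd (of_nat k :: 'q padic_int)" by (simp add: dvd_add_left_iff)
    also have "\<dots> \<longleftrightarrow> k = 0" using residue_of_nat_inj[of 1 k 0, where 'q='q] that by auto
    finally show ?thesis .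
  qed
  have "psum (1 + N) f = (\<Sum>k<CARD('q). A k)" unfolding psum_split psum_def[of 1] A_def by simp
  also have "\<dots> = A 0 + (\<Sum>k\<in>{..<CARD('q)} - {0}. A k)" by (rule sum.remove) auto
  also have "(\<Sum>k\<in>{..<CARD('q)} - {0}. A k) = (\<Sum>k<CARD('q). if k = 0 then 0 else A k)"
    by (rule sum.mono_neutral_cong_left) auto
  also have "\<dots> = usum (1 + N) f"
    unfolding usum_def psum_split psum_def[of 1] power_one_right
    by (rule sum.cong[OF refl]) (simp add: A_def d, simp add: psum_def)
  finally show ?thesis by (simp add: A_def)
qed

lemma psum_valuation:
  fixes f :: "'q::prime_card padic_int \<Rightarrow> complex"
  shows "psum N f = f 0 + (\<Sum>u<N. usum (N - u) (\<lambda>x. f (\<varpi> ^ u * x)))"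
proof (induction N arbitrary: f)
  case 0
  show ?case by (simp add: psum_def)
next
  case (Suc N)
  show ?case unfolding psum_Suc_unif Suc.IH sum.lessThan_Suc_shift by (simp add: mult_ac)
qed

lemma usum_cong: "(\<And>x. \<not> \<varpi> dvd x \<Longrightarrow> f x = g x) \<Longrightarrow> usum N f = usum N g"
  unfolding usum_def by (rule arg_cong[where f="psum N"]) auto

lemma psum_const: "psum N (\<lambda>x :: 'q::prime_card padic_int. z) = of_nat CARD('q) ^ N * z"
  by (simp add: psum_def)

lemma usum_const:
  shows "usum (Suc N) (\<lambda>x :: 'q::prime_card padic_int. z) = of_nat CARD('q) ^ Suc N * (1 - 1 / of_nat CARD('q)) * z"
proof -
  have "usum (Suc N) (\<lambda>x :: 'q padic_int. z) = of_nat CARD('q) ^ Suc N * z - of_nat CARD('q) ^ N * z"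
    using psum_Suc_unif[of N "\<lambda>x :: 'q padic_int. z"] unfolding psum_const by (simp add: algebra_simps)
  thus ?thesis by (simp add: algebra_simps)
qed

text \<open>A unit \<open>\<tau>\<close> contributes nothing for \<open>i > 0\<close>, since \<open>\<tau>\<^sup>3 - c\<close> is a unit; the others are covered by homogeneity.\<close>

lemma weight_rec:
  fixes c :: "'q::prime_card padic_int"
  assumes c: "\<varpi> dvd c"
  shows "weight c (Suc i) n g = (if \<varpi> ^ 3 dvd c then weight (shiftr 3 c) i n g else 0)"
proof -
  have "usum (Suc (i + n)) (frame_weight c (Suc i) n g) = usum (Suc (i + n)) (\<lambda>x :: 'q padic_int. 0)"
    by (rule usum_cong) (rule frame_weight_unit_zero[OF _ c])
  also have "\<dots> = 0" by (simp add: usum_def psum_def)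
  finally have w: "weight c (Suc i) n g = psum (i + n) (\<lambda>x. frame_weight c (Suc i) n g (\<varpi> * x))"
    unfolding weight_def add_Suc psum_Suc_unif by simp
  show ?thesis
  proof (cases "\<varpi> ^ 3 dvd c")
    case True
    then obtain c' where c': "c = \<varpi> ^ 3 * c'" by (elim dvdE)
    show ?thesis using True unfolding w unfolding c' frame_weight_scale shiftr_mult weight_def by simp
  next
    case False
    thus ?thesis unfolding w by (simp add: frame_weight_not_cube psum_def)
  qed
qed

lemma red_shiftr_eq_0_iff: "\<varpi> ^ m dvd x \<Longrightarrow> red (shiftr m x) = 0 \<longleftrightarrow> \<varpi> ^ Suc m dvd (x :: 'q::prime_card padic_int)"
  by (elim dvdE) (simp add: red_eq_0_iff mult.commute[of \<varpi>])

section \<open>Summation over the levels\<close>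

text \<open>The weights in the row \<open>0\<close> depend on the digit at \<open>q\<^sup>2\<^sup>u\<close> of \<open>\<tau>\<^sup>3 - c\<close>, where \<open>u\<close> is the valuation of \<open>\<tau>\<close>, with \<open>u = n\<close> for
  \<open>\<tau> = 0\<close>. They vanish for \<open>2 u > e\<close>, where \<open>e\<close> is the valuation of \<open>c\<close>; otherwise \<open>a\<close> is the value for a
  nonzero digit and \<open>b\<close> the value for the digit zero. In the exceptional case \<open>n = 0\<close> the forms are monic
  and the digit is zero, but the sum agrees with \<open>headU\<close>.\<close>

definition pick :: "nat \<Rightarrow> nat \<Rightarrow> complex \<Rightarrow> complex \<Rightarrow> complex" where
  "pick e u a b = (if e < 2 * u then 0 else if u = 0 \<or> 2 * u = e then a else b)"

definition cube_ind :: "'q::prime_card padic_int \<Rightarrow> nat \<Rightarrow> 'q padic_int \<Rightarrow> complex" where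
  "cube_ind c i \<tau> = (if \<not> \<varpi> dvd \<tau> \<and> \<varpi> ^ i dvd \<tau> ^ 3 - c then 1 else 0)"

text \<open>The measure of the units \<open>\<tau>\<close> with \<open>\<tau>\<^sup>3 = c\<close> modulo \<open>q\<^sup>i\<close>. For \<open>i > 0\<close> it depends on cubic residues, but then it drops
  out of the final sum.\<close>

definition cube_density :: "'q::prime_card padic_int \<Rightarrow> nat \<Rightarrow> complex" where
  "cube_density c i = haar (cube_ind c i)"

lemma cube_ind_locconst:
  assumes "1 \<le> M" "i \<le> M" shows "locconst M (cube_ind c i)"
proof (rule locconstI)
  fix x y
  have "(x + \<varpi> ^ M * y) ^ 3 - c = (x ^ 3 - c) + \<varpi> ^ M * (3 * x\<^sup>2 * y + 3 * x * \<varpi> ^ M * y\<^sup>2 + (\<varpi> ^ M)\<^sup>2 * y ^ 3)"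
    by (simp add: power2_eq_square power3_eq_cube algebra_simps)
  moreover have "\<varpi> ^ i dvd \<varpi> ^ M * (3 * x\<^sup>2 * y + 3 * x * \<varpi> ^ M * y\<^sup>2 + (\<varpi> ^ M)\<^sup>2 * y ^ 3)"
    using assms(2) by (intro dvd_mult2 le_imp_power_dvd)
  ultimately have 1: "\<varpi> ^ i dvd (x + \<varpi> ^ M * y) ^ 3 - c \<longleftrightarrow> \<varpi> ^ i dvd x ^ 3 - c" by (simp only: dvd_add_left_iff)
  have "\<varpi> dvd \<varpi> ^ M * y" using assms(1) by (intro dvd_mult2 dvd_power) simp
  hence "\<varpi> dvd x + \<varpi> ^ M * y \<longleftrightarrow> \<varpi> dvd x" by (rule dvd_add_left_iff)
  thus "cube_ind c i (x + \<varpi> ^ M * y) = cube_ind c i x" unfolding cube_ind_def 1 by simp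
qed

lemma psum_cube_ind:
  fixes c :: "'q::prime_card padic_int"
  shows "1 \<le> M \<Longrightarrow> i \<le> M \<Longrightarrow> psum M (cube_ind c i) = of_nat CARD('q) ^ M * cube_density c i"
  unfolding cube_density_def by (rule psum_haar[OF cube_ind_locconst])

lemma psum_linear: "psum N (\<lambda>x. (a * f x + b * g x) / z) = (a * psum N f + b * psum N g) / z"
  by (simp add: psum_def sum.distrib sum_distrib_left flip: sum_divide_distrib)

lemma cube_density_0:
  fixes c :: "'q::prime_card padic_int" shows "cube_density c 0 = 1 - 1 / of_nat CARD('q)"
proof -
  have "cube_density c 0 = haar (\<lambda>\<tau> :: 'q padic_int. (\<lambda>s. if s = 0 then 0 else 1) (red \<tau>))"
    unfolding cube_density_def by (rule arg_cong[where f=haar]) (auto simp: cube_ind_def red_eq_0_iff)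
  also have "\<dots> = (\<Sum>s\<in>(UNIV :: 'q mod_ring set). if s = 0 then 0 else 1) / of_nat CARD('q)" by (rule haar_red)
  also have "(\<Sum>s\<in>(UNIV :: 'q mod_ring set). if s = 0 then 0 else 1) = (of_nat CARD('q) - 1 :: complex)"
    by (subst sum_UNIV_0) (simp add: card_UNIV_minus_0 of_nat_diff Suc_leI)
  finally show ?thesis by (simp add: diff_divide_distrib)
qed

lemma cube_density_1:
  fixes c :: "'q::prime_card padic_int"
  assumes c: "\<not> \<varpi> dvd c"
  shows "cube_density c 1 = of_nat (card {s. s * s * s = red c}) / of_nat CARD('q)"
proof -
  have r: "red c \<noteq> 0" using c by (simp add: red_eq_0_iff)
  have p: "cube_ind c 1 \<tau> = (if red \<tau> * red \<tau> * red \<tau> = red c then 1 else 0)" for \<tau>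
  proof -
    have "\<varpi> dvd \<tau> ^ 3 - c \<longleftrightarrow> red \<tau> * red \<tau> * red \<tau> = red c" by (simp flip: red_eq_0_iff) (simp add: power3_eq_cube)
    thus ?thesis using r by (auto simp: cube_ind_def red_eq_0_iff[symmetric])
  qed
  have "cube_density c 1 = haar (\<lambda>\<tau> :: 'q padic_int. (\<lambda>s. if s * s * s = red c then 1 else 0) (red \<tau>))"
    unfolding cube_density_def p[abs_def] ..
  also have "\<dots> = (\<Sum>s\<in>UNIV. if s * s * s = red c then 1 else 0) / of_nat CARD('q)" by (rule haar_red)
  also have "(\<Sum>s\<in>UNIV. if s * s * s = red c then 1 else 0) = (of_nat (card {s. s * s * s = red c}) :: complex)"
    by (simp add: sum.If_cases)
  finally show ?thesis .
qed

lemma norm_cube_density: "norm (cube_density c i) \<le> 1" for c :: "'q::prime_card padic_int"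
proof -
  let ?M = "Suc i"
  have "norm (psum ?M (cube_ind c i)) \<le> (\<Sum>k<CARD('q) ^ ?M. 1)" unfolding psum_def
    by (rule sum_norm_le) (simp add: cube_ind_def)
  hence "norm (psum ?M (cube_ind c i)) \<le> real CARD('q) ^ ?M" by simp
  moreover have "norm (psum ?M (cube_ind c i)) = real CARD('q) ^ ?M * norm (cube_density c i)"
    by (subst psum_cube_ind) (simp_all add: norm_mult norm_power)
  ultimately show ?thesis by simp
qed

text \<open>A point of the open unit disc at which the series are evaluated. The letters \<open>Z\<close> and \<open>U\<close> in the names of
  the constants stand for a zero and a unit value of the remaining parameter: \<open>B\<close> for the means,
  \<open>D\<close> for the heads.\<close>

locale euler_point =
  fixes x :: complex and type :: "'q::prime_card itself"
  assumes norm_x: "norm x < 1"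
begin

definition Q :: complex where "Q = of_nat CARD('q)"
definition y :: complex where "y = x\<^sup>2 / Q"
definition t :: complex where "t = 1 + x + x\<^sup>2"
definition \<Delta> :: complex where "\<Delta> = (1 - x\<^sup>2) * (1 - x ^ 3)"
definition c5 :: complex where "c5 = x ^ 4 * (1 + x) / \<Delta>"
definition meanZ :: complex where "meanZ = (1 - y) / (1 - x)"
definition meanU :: complex where "meanU = (1 - y) / ((1 - x) * (1 - x\<^sup>2))"
definition headZ :: complex where "headZ = numer Q x / (1 - x)\<^sup>2 - (1 - 1 / Q) * y / (1 - x)"
definition headU :: complex where "headU = (numer Q x - (1 - 1 / Q) * y) / ((1 - x) * (1 - x\<^sup>2))"
definition lw :: "nat \<Rightarrow> 'q weight_function" where
  "lw n \<beta> \<gamma> \<delta> = lval x (if n = 0 then 1 else 0) \<beta> \<gamma> \<delta>"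

lemma norm_pow: "0 < k \<Longrightarrow> norm (x ^ k) < 1"
  using norm_x by (simp add: norm_power power_less_one_iff)

lemma pow_neq: "0 < k \<Longrightarrow> x ^ k \<noteq> 1"
  using norm_pow[of k] by auto

lemma neq: "x \<noteq> 1" "x\<^sup>2 \<noteq> 1" "x ^ 3 \<noteq> 1"
  using pow_neq[of 1] pow_neq[of 2] pow_neq[of 3] by simp_all

lemma Q0 [simp]: "Q \<noteq> 0" by (simp add: Q_def)

lemma norm_Q: "1 \<le> norm Q"
  using CARD_gt_1[where 'q='q] by (simp add: Q_def)

lemma norm_div_Q: "norm z < 1 \<Longrightarrow> norm (z / Q) < 1"
  using norm_Q by (simp add: norm_divide divide_less_eq)

lemma norm_y: "norm y < 1"
  unfolding y_def by (rule norm_div_Q) (rule norm_pow, simp)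

lemma y1: "1 - y \<noteq> 0" using norm_y by auto

lemma x3_factor: "1 - x ^ 3 = (1 - x) * t"
  by (simp add: t_def algebra_simps power2_eq_square power3_eq_cube)

lemma nz: "1 - x \<noteq> 0" "1 - x\<^sup>2 \<noteq> 0" "t \<noteq> 0" "\<Delta> \<noteq> 0"
  using neq x3_factor by (auto simp: \<Delta>_def)

lemma lw_mean: "0 < n \<Longrightarrow> (\<Sum>\<gamma>\<in>UNIV. \<Sum>\<delta>\<in>UNIV. lw n \<beta> \<gamma> \<delta>) = Q\<^sup>2 * (if \<beta> = 0 then meanZ else meanU)"
  using degenerate_mean_unit[OF neq(1,2), of \<beta>] degenerate_mean_zero[OF neq(1,2), where 'k="'q mod_ring"]
  by (simp add: lw_def meanZ_def meanU_def y_def Q_def)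

lemma lw_mean0: "(\<Sum>\<gamma>\<in>UNIV. \<Sum>\<delta>\<in>UNIV. lw 0 \<beta> \<gamma> \<delta>) = Q\<^sup>2 * ((1 - y * t) / \<Delta>) + c5 * of_nat (card {s. 3 * s + \<beta> = 0})"
  using monic_mean[OF neq, of \<beta>] by (simp add: lw_def y_def t_def \<Delta>_def c5_def Q_def)

lemma lw_head: "0 < n \<Longrightarrow> (\<Sum>\<beta>\<in>UNIV. \<Sum>\<gamma>\<in>UNIV. lw n \<beta> \<gamma> \<delta>) = Q\<^sup>2 * (if \<delta> = 0 then headZ else headU)"
  using degenerate_sum_unit'[OF neq(1,2), of \<delta>] degenerate_sum_zero'[OF neq(1,2), where 'k="'q mod_ring"]
  by (simp add: lw_def headZ_def headU_def y_def Q_def)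

lemma lw_head0: "(\<Sum>\<beta>\<in>UNIV. \<Sum>\<gamma>\<in>UNIV. lw 0 \<beta> \<gamma> 0) = Q\<^sup>2 * headU"
  using monic_sum_zero[OF neq, where 'k="'q mod_ring"] by (simp add: lw_def headU_def y_def Q_def)

lemma lw_head0_unit: "\<delta> \<noteq> 0 \<Longrightarrow> (\<Sum>\<beta>\<in>UNIV. \<Sum>\<gamma>\<in>UNIV. lw 0 \<beta> \<gamma> \<delta>) =
    Q\<^sup>2 * ((numer Q x - (1 - 1 / Q) * y * t) / \<Delta>) + c5 * of_nat (card {s. s * s * s = - \<delta>})"
  using monic_sum_unit[OF neq, of \<delta>] by (simp add: lw_def y_def t_def \<Delta>_def c5_def Q_def)

lemma row_sums: "(\<lambda>n. x ^ (2 * n) * (if n = 0 then w else z / Q ^ n)) sums (w + z * y / (1 - y))"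
proof -
  have "(\<lambda>n. (if n = 0 then w - z else 0) + z * y ^ n) sums ((w - z) + z * (1 / (1 - y)))"
    by (intro sums_add sums_mult geometric_sums norm_y) (rule sums_single)
  also have "(\<lambda>n. (if n = 0 then w - z else 0) + z * y ^ n) = (\<lambda>n. x ^ (2 * n) * (if n = 0 then w else z / Q ^ n))"
    by (rule ext) (simp add: y_def power_divide power_mult)
  also have "(w - z) + z * (1 / (1 - y)) = w + z * y / (1 - y)" using y1 by (simp add: field_simps)
  finally show ?thesis .
qed

subsection \<open>The case of non-unit c\<close>

text \<open>The first summand comes from \<open>\<tau> = 0\<close> and the others from the \<open>\<tau>\<close> of valuation \<open>u < n\<close>.\<close>

lemma weight_level0:
  fixes c :: "'q padic_int"
  assumes c: "c \<noteq> 0" "\<varpi> dvd c"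
  defines "e \<equiv> padic_val c"
  shows "weight c 0 n (lw n) = pick e n headU headZ + (\<Sum>u<n. (1 - 1 / Q) / Q ^ (n - u) * pick e u meanU meanZ)"
proof -
  have e: "\<varpi> ^ k dvd c \<longleftrightarrow> k \<le> e" for k unfolding e_def by (rule unif_power_dvd_padic_val[OF c(1)])
  have rc: "red c = 0" using c(2) by (simp add: red_eq_0_iff)
  have h: "frame_weight c 0 n (lw n) 0 = pick e n headU headZ"
  proof (cases "n = 0")
    case True
    have "shiftr 0 (- c) = - c" using shiftr_mult[of 0 "- c"] by simp
    thus ?thesis unfolding frame_weight_0 True by (simp add: sift_def rc lw_head0 pick_def Q_def[symmetric])
  next
    case False
    have "\<varpi> ^ (2 * n) dvd c \<Longrightarrow> red (shiftr (2 * n) (- c)) = 0 \<longleftrightarrow> Suc (2 * n) \<le> e"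
      using red_shiftr_eq_0_iff[of "2 * n" "- c"] e[of "Suc (2 * n)"] by (simp del: power_Suc)
    thus ?thesis unfolding frame_weight_0 lw_head[OF False[unfolded neq0_conv]] sift_def
      using False by (auto simp: pick_def e Q_def[symmetric])
  qed
  have u: "usum (n - u) (\<lambda>\<epsilon>. frame_weight c 0 n (lw n) (\<varpi> ^ u * \<epsilon>)) = (1 - 1 / Q) / Q ^ (n - u) * pick e u meanU meanZ"
    if "u < n" for u
  proof -
    have n: "0 < n" using that by simp
    have "frame_weight c 0 n (lw n) (\<varpi> ^ u * \<epsilon>) = pick e u meanU meanZ / Q ^ (2 * (n - u))" if \<epsilon>: "\<not> \<varpi> dvd \<epsilon>" for \<epsilon>
    proof -
      have r\<epsilon>: "red \<epsilon> \<noteq> 0" using \<epsilon> by (simp add: red_eq_0_iff)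
      define w where "w = (\<varpi> ^ u * \<epsilon>) ^ 3 - c"
      have cube: "\<varpi> ^ k dvd (\<varpi> ^ u * \<epsilon>) ^ 3" if "k \<le> 3 * u" for k
      proof -
        have "(\<varpi> ^ u * \<epsilon>) ^ 3 = \<varpi> ^ (3 * u) * \<epsilon> ^ 3" by (simp add: power_mult_distrib power_mult mult.commute flip: power_mult)
        thus ?thesis using that by (simp add: dvd_mult2 le_imp_power_dvd)
      qed
      have d: "\<varpi> ^ (2 * u) dvd w \<longleftrightarrow> 2 * u \<le> e" unfolding w_def using cube[of "2 * u"]
        by (simp add: dvd_diff_right_iff e)
      have d': "\<varpi> ^ Suc (2 * u) dvd w \<longleftrightarrow> u \<noteq> 0 \<and> Suc (2 * u) \<le> e"
      proof (cases "u = 0")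
        case True
        have "red w \<noteq> 0" using r\<epsilon> True by (simp add: w_def rc)
        thus ?thesis using True by (simp add: red_eq_0_iff)
      next
        case False
        hence "\<varpi> ^ Suc (2 * u) dvd (\<varpi> ^ u * \<epsilon>) ^ 3" by (intro cube) simp
        hence "\<varpi> ^ Suc (2 * u) dvd w \<longleftrightarrow> \<varpi> ^ Suc (2 * u) dvd c" unfolding w_def by (rule dvd_diff_right_iff)
        thus ?thesis unfolding e using False by simp
      qed
      have "frame_weight c 0 n (lw n) (\<varpi> ^ u * \<epsilon>) =
        sift (2 * u) (\<lambda>\<rho>. Q\<^sup>2 * (if \<rho> = 0 then meanZ else meanU)) w / Q ^ (2 * (n - u) + 2)"
        using frame_weight_nonzero[OF \<epsilon>, of u 0 n c "lw n"] \<open>u < n\<close> r\<epsilon> unfolding lw_mean[OF n] w_def[symmetric] Q_def[symmetric] by simp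
      also have "sift (2 * u) (\<lambda>\<rho>. Q\<^sup>2 * (if \<rho> = 0 then meanZ else meanU)) w = Q\<^sup>2 * pick e u meanU meanZ"
        unfolding sift_def using red_shiftr_eq_0_iff[of "2 * u" w] unfolding d d' by (auto simp: pick_def)
      also have "Q\<^sup>2 * pick e u meanU meanZ / Q ^ (2 * (n - u) + 2) = pick e u meanU meanZ / Q ^ (2 * (n - u))"
        by (simp add: power_add power2_eq_square)
      finally show ?thesis .
    qed
    hence "usum (n - u) (\<lambda>\<epsilon>. frame_weight c 0 n (lw n) (\<varpi> ^ u * \<epsilon>)) = usum (n - u) (\<lambda>_ :: 'q padic_int. pick e u meanU meanZ / Q ^ (2 * (n - u)))"
      by (rule usum_cong)
    also have "\<dots> = Q ^ (n - u) * (1 - 1 / Q) * (pick e u meanU meanZ / Q ^ (2 * (n - u)))"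
      using usum_const[of "n - u - 1" "pick e u meanU meanZ / Q ^ (2 * (n - u))", where 'q='q] that
      by (simp add: Suc_diff_Suc Q_def)
    also have "\<dots> = (1 - 1 / Q) / Q ^ (n - u) * pick e u meanU meanZ"
      by (simp add: mult_2 power_add)
    finally show ?thesis .
  qed
  show ?thesis unfolding weight_def add_0 psum_valuation h by (simp add: u)
qed

text \<open>Passing from the finite level \<open>n\<close> to the sum over all \<open>n\<close> removes the correction \<open>(1 - 1 / Q) y\<close> from the
  heads.\<close>

lemma pick_total:
  "pick e u headU headZ + (1 - 1 / Q) * pick e u meanU meanZ * y / (1 - y) =
    pick e u (numer Q x / ((1 - x) * (1 - x\<^sup>2))) (numer Q x / (1 - x)\<^sup>2)"
proof -
  have c: "(1 - 1 / Q) * ((1 - y) / z) * y / (1 - y) = (1 - 1 / Q) * y / z" for z using y1 by simp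
  consider (far) "e < 2 * u" | (unit) "\<not> e < 2 * u" "u = 0 \<or> 2 * u = e" | (zero) "\<not> e < 2 * u" "\<not> (u = 0 \<or> 2 * u = e)" by blast
  thus ?thesis
  proof cases
    case far
    thus ?thesis by (simp add: pick_def)
  next
    case unit
    show ?thesis unfolding pick_def if_not_P[OF unit(1)] if_P[OF unit(2)] meanU_def headU_def c by (simp add: diff_divide_distrib)
  next
    case zero
    show ?thesis unfolding pick_def if_not_P[OF zero(1)] if_not_P[OF zero(2)] meanZ_def headZ_def c by simp
  qed
qed

lemma level0_sums:
  fixes c :: "'q padic_int"
  assumes c: "c \<noteq> 0" "\<varpi> dvd c"
  defines "e \<equiv> padic_val c"
  shows "(\<lambda>n. x ^ (2 * n) * weight c 0 n (lw n)) sums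
    (\<Sum>u\<le>e. x ^ (2 * u) * pick e u (numer Q x / ((1 - x) * (1 - x\<^sup>2))) (numer Q x / (1 - x)\<^sup>2))"
proof -
  define T where "T u d = (if d = 0 then pick e u headU headZ else (1 - 1 / Q) * pick e u meanU meanZ / Q ^ d)" for u d
  have T0: "T u d = 0" if "e < u" for u d using that by (simp add: T_def pick_def)
  have w: "weight c 0 n (lw n) = (\<Sum>u\<le>e. if n < u then 0 else T u (n - u))" for n
  proof -
    have "weight c 0 n (lw n) = (\<Sum>u<Suc n. T u (n - u))"
      unfolding weight_level0[OF c] e_def[symmetric] sum.lessThan_Suc by (simp add: T_def mult.commute)
    also have "\<dots> = (\<Sum>u\<le>n. if n < u then 0 else T u (n - u))"
      unfolding lessThan_Suc_atMost by (rule sum.cong) auto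
    also have "\<dots> = (\<Sum>u\<le>n + e. if n < u then 0 else T u (n - u))"
      by (rule sum.mono_neutral_left) auto
    also have "\<dots> = (\<Sum>u\<le>e. if n < u then 0 else T u (n - u))"
      by (rule sum.mono_neutral_right) (auto simp: T0)
    finally show ?thesis .
  qed
  have "(\<lambda>n. x ^ (2 * n) * (if n < u then 0 else T u (n - u))) sums (x ^ (2 * u) * pick e u (numer Q x / ((1 - x) * (1 - x\<^sup>2))) (numer Q x / (1 - x)\<^sup>2))" for u
  proof (rule sums_zero_iff_shift[where n=u, THEN iffD1])
    show "(\<lambda>n. x ^ (2 * (n + u)) * (if n + u < u then 0 else T u (n + u - u))) sums (x ^ (2 * u) * pick e u (numer Q x / ((1 - x) * (1 - x\<^sup>2))) (numer Q x / (1 - x)\<^sup>2))"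
      using sums_mult[OF row_sums[of "pick e u headU headZ" "(1 - 1 / Q) * pick e u meanU meanZ"], of "x ^ (2 * u)"]
      unfolding pick_total by (simp add: T_def power_add mult_ac)
  qed simp
  hence "(\<lambda>n. \<Sum>u\<le>e. x ^ (2 * n) * (if n < u then 0 else T u (n - u))) sums
    (\<Sum>u\<le>e. x ^ (2 * u) * pick e u (numer Q x / ((1 - x) * (1 - x\<^sup>2))) (numer Q x / (1 - x)\<^sup>2))" by (intro sums_sum)
  thus ?thesis unfolding w sum_distrib_left .
qed

subsection \<open>The case of a unit c\<close>

lemma weight_unit_split:
  fixes c :: "'q padic_int"
  assumes c: "\<not> \<varpi> dvd c" and N: "0 < i + n"
  shows "weight c i n g = psum (i + n) (\<lambda>\<tau>. if \<varpi> dvd \<tau> then 0 else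
    sift i (\<lambda>\<rho>. \<Sum>\<gamma>\<in>UNIV. \<Sum>\<delta>\<in>UNIV. g (\<rho> / (red \<tau>)\<^sup>2) \<gamma> \<delta>) (\<tau> ^ 3 - c) / Q ^ (2 * (i + n) + 2))"
proof -
  obtain N where N': "i + n = Suc N" using N by (metis gr0_implies_Suc)
  have "weight c i n g = usum (Suc N) (frame_weight c i n g) + psum N (\<lambda>x. frame_weight c i n g (\<varpi> * x))"
    unfolding weight_def N' psum_Suc_unif ..
  also have "psum N (\<lambda>x. frame_weight c i n g (\<varpi> * x)) = 0"
    by (simp add: frame_weight_nonunit_zero[OF _ c N] psum_const)
  also have "usum (Suc N) (frame_weight c i n g) = usum (Suc N) (\<lambda>\<tau>.
    sift i (\<lambda>\<rho>. \<Sum>\<gamma>\<in>UNIV. \<Sum>\<delta>\<in>UNIV. g (\<rho> / (red \<tau>)\<^sup>2) \<gamma> \<delta>) (\<tau> ^ 3 - c) / Q ^ (2 * (i + n) + 2))"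
  proof (rule usum_cong)
    fix \<tau> :: "'q padic_int" assume "\<not> \<varpi> dvd \<tau>"
    from frame_weight_nonzero[OF this N, of c g] show "frame_weight c i n g \<tau> =
      sift i (\<lambda>\<rho>. \<Sum>\<gamma>\<in>UNIV. \<Sum>\<delta>\<in>UNIV. g (\<rho> / (red \<tau>)\<^sup>2) \<gamma> \<delta>) (\<tau> ^ 3 - c) / Q ^ (2 * (i + n) + 2)"
      by (simp add: Q_def)
  qed
  finally show ?thesis unfolding usum_def N' by simp
qed

lemma weight_unit_pos:
  fixes c :: "'q padic_int"
  assumes c: "\<not> \<varpi> dvd c" and n: "0 < n"
  shows "weight c i n (lw n) =
    ((cube_density c i - cube_density c (Suc i)) * meanU + cube_density c (Suc i) * meanZ) / Q ^ (i + n)"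
proof -
  have p: "(if \<varpi> dvd \<tau> then 0 else sift i (\<lambda>\<rho>. \<Sum>\<gamma>\<in>UNIV. \<Sum>\<delta>\<in>UNIV. lw n (\<rho> / (red \<tau>)\<^sup>2) \<gamma> \<delta>) (\<tau> ^ 3 - c) / Q ^ (2 * (i + n) + 2))
    = (meanU * cube_ind c i \<tau> + (meanZ - meanU) * cube_ind c (Suc i) \<tau>) / Q ^ (2 * (i + n))" for \<tau>
  proof (cases "\<varpi> dvd \<tau>")
    case False
    hence r: "red \<tau> \<noteq> 0" by (simp add: red_eq_0_iff)
    have s: "\<varpi> ^ Suc i dvd \<tau> ^ 3 - c \<Longrightarrow> \<varpi> ^ i dvd \<tau> ^ 3 - c" by (erule power_le_dvd) simp
    have "sift i (\<lambda>\<rho>. \<Sum>\<gamma>\<in>UNIV. \<Sum>\<delta>\<in>UNIV. lw n (\<rho> / (red \<tau>)\<^sup>2) \<gamma> \<delta>) (\<tau> ^ 3 - c) = Q\<^sup>2 * (meanU * cube_ind c i \<tau> + (meanZ - meanU) * cube_ind c (Suc i) \<tau>)"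
      unfolding lw_mean[OF n] sift_def cube_ind_def using red_shiftr_eq_0_iff[of i "\<tau> ^ 3 - c"] s r False by (auto simp del: power_Suc)
    thus ?thesis using False by (simp add: power_add power2_eq_square)
  qed (simp add: cube_ind_def)
  have "weight c i n (lw n) = (meanU * psum (i + n) (cube_ind c i) + (meanZ - meanU) * psum (i + n) (cube_ind c (Suc i))) / Q ^ (2 * (i + n))"
    using weight_unit_split[OF c, of i n "lw n"] n unfolding p psum_linear by simp
  also have "\<dots> = Q ^ (i + n) * (meanU * cube_density c i + (meanZ - meanU) * cube_density c (Suc i)) / Q ^ (2 * (i + n))"
    using n psum_cube_ind[of "i + n" i c] psum_cube_ind[of "i + n" "Suc i" c] by (simp add: Q_def[symmetric] algebra_simps)
  also have "\<dots> = (meanU * cube_density c i + (meanZ - meanU) * cube_density c (Suc i)) / Q ^ (i + n)"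
    by (simp add: mult_2 power_add)
  finally show ?thesis by (simp add: algebra_simps)
qed

text \<open>A linear approximation: \<open>\<tau> + q\<^sup>i y\<close> solves the congruence modulo the next power of \<open>q\<close> exactly if
  \<open>3 y\<close> is congruent to \<open>- \<rho> / \<tau>\<^sup>2\<close>, where \<open>\<rho> = (\<tau>\<^sup>3 - c) / q\<^sup>i\<close>. This identifies the triple root term
  of \<open>monic_mean\<close> with a density, uniformly in \<open>q\<close>, including \<open>q = 3\<close>.\<close>

lemma card_lifts:
  fixes c :: "'q padic_int"
  assumes \<tau>: "\<not> \<varpi> dvd \<tau>" and i: "0 < i"
  shows "sift i (\<lambda>\<rho>. of_nat (card {s. 3 * s + \<rho> / (red \<tau>)\<^sup>2 = 0})) (\<tau> ^ 3 - c) = psum 1 (\<lambda>y. cube_ind c (Suc i) (\<tau> + \<varpi> ^ i * y))"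
proof -
  have r: "red \<tau> \<noteq> 0" using \<tau> by (simp add: red_eq_0_iff)
  have ri: "red (\<varpi> ^ i :: 'q padic_int) = 0" using i by (simp add: red_eq_0_iff del: red_power)
  have u: "\<not> \<varpi> dvd \<tau> + \<varpi> ^ i * y" for y using r ri by (simp add: red_eq_0_iff[symmetric] del: red_power)
  have ex: "(\<tau> + \<varpi> ^ i * y) ^ 3 - c = (\<tau> ^ 3 - c) + \<varpi> ^ i * (3 * \<tau>\<^sup>2 * y + \<varpi> ^ i * (3 * \<tau> * y\<^sup>2 + \<varpi> ^ i * y ^ 3))" for y
    by (simp add: power2_eq_square power3_eq_cube algebra_simps)
  show ?thesis
  proof (cases "\<varpi> ^ i dvd \<tau> ^ 3 - c")
    case False
    have "\<not> \<varpi> ^ Suc i dvd (\<tau> + \<varpi> ^ i * y) ^ 3 - c" for y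
    proof
      assume "\<varpi> ^ Suc i dvd (\<tau> + \<varpi> ^ i * y) ^ 3 - c"
      hence "\<varpi> ^ i dvd (\<tau> + \<varpi> ^ i * y) ^ 3 - c" by (rule power_le_dvd) simp
      thus False using False unfolding ex by (simp add: dvd_add_left_iff)
    qed
    hence "cube_ind c (Suc i) (\<tau> + \<varpi> ^ i * y) = 0" for y unfolding cube_ind_def by (simp only: if_False simp_thms)
    thus ?thesis using False by (simp add: sift_def psum_const)
  next
    case True
    then obtain \<rho> where \<rho>: "\<tau> ^ 3 - c = \<varpi> ^ i * \<rho>" by (elim dvdE)
    have "\<varpi> ^ Suc i dvd (\<tau> + \<varpi> ^ i * y) ^ 3 - c \<longleftrightarrow> 3 * red y + red \<rho> / (red \<tau>)\<^sup>2 = 0" for y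
    proof -
      have e: "(\<tau> + \<varpi> ^ i * y) ^ 3 - c = \<varpi> ^ i * (\<rho> + (3 * \<tau>\<^sup>2 * y + \<varpi> ^ i * (3 * \<tau> * y\<^sup>2 + \<varpi> ^ i * y ^ 3)))"
        unfolding ex \<rho> by (simp only: distrib_left)
      have "\<varpi> ^ Suc i dvd (\<tau> + \<varpi> ^ i * y) ^ 3 - c \<longleftrightarrow> red (\<rho> + (3 * \<tau>\<^sup>2 * y + \<varpi> ^ i * (3 * \<tau> * y\<^sup>2 + \<varpi> ^ i * y ^ 3))) = 0"
        unfolding e red_eq_0_iff by (simp add: mult.commute[of \<varpi>])
      also have "red (\<rho> + (3 * \<tau>\<^sup>2 * y + \<varpi> ^ i * (3 * \<tau> * y\<^sup>2 + \<varpi> ^ i * y ^ 3))) = red \<rho> + 3 * (red \<tau>)\<^sup>2 * red y"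
        by (simp only: red_add red_mult red_power[of \<tau>] red_numeral ri mult_zero_left add_0_right)
      also have "\<dots> = (red \<tau>)\<^sup>2 * (3 * red y + red \<rho> / (red \<tau>)\<^sup>2)" using r by (simp add: algebra_simps)
      finally show ?thesis using r by simp
    qed
    hence "cube_ind c (Suc i) (\<tau> + \<varpi> ^ i * y) = (if 3 * red y + red \<rho> / (red \<tau>)\<^sup>2 = 0 then 1 else 0)" for y
      unfolding cube_ind_def using u by simp
    hence "psum 1 (\<lambda>y. cube_ind c (Suc i) (\<tau> + \<varpi> ^ i * y)) = psum 1 (\<lambda>y. (\<lambda>s. if 3 * s + red \<rho> / (red \<tau>)\<^sup>2 = 0 then 1 else 0) (red y))"
      by presburger
    also have "\<dots> = (\<Sum>s\<in>UNIV. if 3 * s + red \<rho> / (red \<tau>)\<^sup>2 = 0 then 1 else 0)" by (rule psum_1_red)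
    also have "\<dots> = of_nat (card {s. 3 * s + red \<rho> / (red \<tau>)\<^sup>2 = 0})" by (simp add: sum.If_cases)
    finally show ?thesis unfolding \<rho> by (simp add: sift_def)
  qed
qed

lemma weight_unit_0:
  fixes c :: "'q padic_int"
  assumes c: "\<not> \<varpi> dvd c" and i: "0 < i"
  shows "weight c i 0 (lw 0) = ((1 - y * t) / \<Delta> * cube_density c i + c5 * cube_density c (Suc i) / Q) / Q ^ i"
proof -
  define L where "L \<tau> = psum 1 (\<lambda>y. cube_ind c (Suc i) (\<tau> + \<varpi> ^ i * y))" for \<tau>
  have p: "(if \<varpi> dvd \<tau> then 0 else sift i (\<lambda>\<rho>. \<Sum>\<gamma>\<in>UNIV. \<Sum>\<delta>\<in>UNIV. lw 0 (\<rho> / (red \<tau>)\<^sup>2) \<gamma> \<delta>) (\<tau> ^ 3 - c) / Q ^ (2 * (i + 0) + 2))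
    = (Q\<^sup>2 * ((1 - y * t) / \<Delta>) * cube_ind c i \<tau> + c5 * L \<tau>) / Q ^ (2 * i + 2)" for \<tau>
  proof (cases "\<varpi> dvd \<tau>")
    case True
    have "\<varpi> dvd \<tau> + \<varpi> ^ i * z" for z using True i by (simp add: dvd_add dvd_mult2 dvd_power)
    hence "L \<tau> = 0" unfolding L_def by (simp add: cube_ind_def psum_const)
    thus ?thesis using True by (simp add: cube_ind_def)
  next
    case False
    have L: "L \<tau> = sift i (\<lambda>\<rho>. of_nat (card {s. 3 * s + \<rho> / (red \<tau>)\<^sup>2 = 0})) (\<tau> ^ 3 - c)"
      unfolding L_def by (rule card_lifts[OF False i, symmetric])
    show ?thesis unfolding L lw_mean0 sift_def cube_ind_def using False by simp
  qed
  have L: "psum i L = Q ^ Suc i * cube_density c (Suc i)"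
    using psum_split[of i 1 "cube_ind c (Suc i)"] psum_cube_ind[of "Suc i" "Suc i" c] unfolding L_def Q_def by simp
  have "weight c i 0 (lw 0) = (Q\<^sup>2 * ((1 - y * t) / \<Delta>) * psum i (cube_ind c i) + c5 * psum i L) / Q ^ (2 * i + 2)"
    using weight_unit_split[OF c, of i 0 "lw 0"] i unfolding p psum_linear by simp
  also have "psum i (cube_ind c i) = Q ^ i * cube_density c i" using psum_cube_ind[of i i c] i by (simp add: Q_def)
  also note L
  also have "(Q\<^sup>2 * ((1 - y * t) / \<Delta>) * (Q ^ i * cube_density c i) + c5 * (Q ^ Suc i * cube_density c (Suc i))) =
    (Q ^ i * Q\<^sup>2) * ((1 - y * t) / \<Delta> * cube_density c i + c5 * cube_density c (Suc i) / Q)"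
    unfolding power2_eq_square by (simp add: algebra_simps)
  also have "Q ^ (2 * i + 2) = (Q ^ i * Q\<^sup>2) * Q ^ i" unfolding mult_2 power_add by (simp add: mult_ac)
  finally show ?thesis by simp
qed

lemma weight_unit_00:
  fixes c :: "'q padic_int"
  assumes c: "\<not> \<varpi> dvd c"
  shows "weight c 0 0 (lw 0) = (numer Q x - (1 - 1 / Q) * y * t) / \<Delta> + c5 * cube_density c 1 / Q"
proof -
  have "red (- c) \<noteq> 0" using c by (simp add: red_eq_0_iff)
  moreover have "shiftr 0 (- c) = - c" using shiftr_mult[of 0 "- c"] by simp
  moreover have "weight c 0 0 (lw 0) = frame_weight c 0 0 (lw 0) 0" by (simp add: weight_def psum_def)
  ultimately have "weight c 0 0 (lw 0) = (Q\<^sup>2 * ((numer Q x - (1 - 1 / Q) * y * t) / \<Delta>) + c5 * of_nat (card {s. s * s * s = red c})) / Q\<^sup>2"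
    unfolding frame_weight_0 using lw_head0_unit[of "red (- c)"] by (simp add: sift_def Q_def)
  thus ?thesis unfolding cube_density_1[OF c] Q_def[symmetric] by (simp add: add_divide_distrib power2_eq_square)
qed

text \<open>The weights for \<open>n = 0\<close> and the geometric series over \<open>n > 0\<close> combine to a difference of consecutive terms. For
  \<open>i = 0\<close> the residue \<open>\<tau> = 0\<close>, which the general formula excludes, gives an extra term.\<close>

lemma unit_row_sums:
  fixes c :: "'q padic_int"
  assumes c: "\<not> \<varpi> dvd c"
  defines "a \<equiv> \<lambda>i. x ^ (6 * i) * cube_density c i / Q ^ i"
  shows "(\<lambda>n. x ^ (6 * i + 2 * n) * weight c i n (lw n)) sums
    ((a i - a (Suc i)) / \<Delta> + (if i = 0 then (numer Q x - (1 - 1 / Q)) / \<Delta> else 0))"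
proof -
  define E where "E = cube_density c i"
  define E' where "E' = cube_density c (Suc i)"
  define z where "z = ((E - E') * meanU + E' * meanZ) / Q ^ i"
  define w where "w = ((1 - y * t) / \<Delta> * E + c5 * E' / Q) / Q ^ i"
  define s where "s = (if i = 0 then (numer Q x - (1 - 1 / Q)) / \<Delta> else 0)"
  have \<Delta>': "\<Delta> = (1 - x) * (1 - x\<^sup>2) * t" unfolding \<Delta>_def x3_factor by (simp only: mult_ac)
  have ws: "weight c i n (lw n) = (if n = 0 then w + s else z / Q ^ n)" for n
  proof (cases "n = 0")
    case True
    show ?thesis
    proof (cases "i = 0")
      case i: True
      have E: "E = 1 - 1 / Q" unfolding E_def i cube_density_0 Q_def ..
      have "(1 - y * t) / \<Delta> * E + (numer Q x - (1 - 1 / Q)) / \<Delta> = (numer Q x - (1 - 1 / Q) * y * t) / \<Delta>"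
        unfolding E by (simp add: algebra_simps flip: add_divide_distrib diff_divide_distrib)
      thus ?thesis using weight_unit_00[OF c] True i by (simp add: w_def s_def E'_def add_ac)
    next
      case False
      thus ?thesis using weight_unit_0[OF c, of i] True by (simp add: w_def s_def E_def E'_def)
    qed
  next
    case False
    thus ?thesis using weight_unit_pos[OF c, of n i] by (simp add: z_def E_def E'_def power_add)
  qed
  have "(\<lambda>n. x ^ (6 * i) * (x ^ (2 * n) * weight c i n (lw n))) sums (x ^ (6 * i) * ((w + s) + z * y / (1 - y)))"
    unfolding ws by (intro sums_mult row_sums)
  moreover have "w + z * y / (1 - y) = (E - E' * (x ^ 6 / Q)) / (\<Delta> * Q ^ i)"
  proof -
    have u: "meanU * y / (1 - y) = y * t / \<Delta>" unfolding meanU_def \<Delta>' using y1 nz by simp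
    have v: "meanZ * y / (1 - y) = y * t * (1 - x\<^sup>2) / \<Delta>" unfolding meanZ_def \<Delta>' using y1 nz by simp
    have "z * y / (1 - y) = ((E - E') * (meanU * y / (1 - y)) + E' * (meanZ * y / (1 - y))) / Q ^ i"
      unfolding z_def by (simp add: algebra_simps flip: add_divide_distrib)
    also have "\<dots> = ((E - E') * (y * t) + E' * (y * t * (1 - x\<^sup>2))) / \<Delta> / Q ^ i"
      unfolding u v by (simp only: add_divide_distrib times_divide_eq_right)
    finally have "w + z * y / (1 - y) = ((1 - y * t) * E + x ^ 4 * (1 + x) * E' / Q + ((E - E') * (y * t) + E' * (y * t * (1 - x\<^sup>2)))) / \<Delta> / Q ^ i"
      unfolding w_def c5_def by (simp add: add_divide_distrib mult.commute)
    also have "(1 - y * t) * E + x ^ 4 * (1 + x) * E' / Q + ((E - E') * (y * t) + E' * (y * t * (1 - x\<^sup>2))) = E + E' * (x ^ 4 * (1 + x) / Q - y * t * x\<^sup>2)"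
      by (simp add: algebra_simps)
    also have "x ^ 4 * (1 + x) / Q - y * t * x\<^sup>2 = (x ^ 4 * (1 + x) - x\<^sup>2 * t * x\<^sup>2) / Q"
      unfolding y_def by (simp add: diff_divide_distrib)
    also have "x ^ 4 * (1 + x) - x\<^sup>2 * t * x\<^sup>2 = - (x ^ 6)"
      unfolding t_def by (simp add: algebra_simps flip: power_add)
    finally show ?thesis by simp
  qed
  moreover have "x ^ (6 * i) * ((E - E' * (x ^ 6 / Q)) / (\<Delta> * Q ^ i)) = (a i - a (Suc i)) / \<Delta>"
    unfolding a_def E_def[symmetric] E'_def[symmetric] by (simp add: diff_divide_distrib right_diff_distrib power_add mult_ac)
  moreover have "x ^ (6 * i) * s = s" by (simp add: s_def)
  ultimately have "(\<lambda>n. x ^ (6 * i) * (x ^ (2 * n) * weight c i n (lw n))) sums ((a i - a (Suc i)) / \<Delta> + s)"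
    by (simp only: distrib_left add.commute add.left_commute add.assoc)
  thus ?thesis unfolding s_def[symmetric] power_add mult.assoc .
qed

end

section \<open>Values of power series\<close>

text \<open>Absolute convergence is included, as products need it.\<close>

definition has_value :: "real fps \<Rightarrow> complex \<Rightarrow> complex \<Rightarrow> bool" where
  "has_value f x L \<longleftrightarrow> summable (\<lambda>n. norm (of_real (fps_nth f n) * x ^ n)) \<and> (\<lambda>n. of_real (fps_nth f n) * x ^ n) sums L"

lemma has_value_mult:
  assumes f: "has_value f x L" and g: "has_value g x M"
  shows "has_value (f * g) x (L * M)"
proof -
  let ?a = "\<lambda>n. of_real (fps_nth f n) * x ^ n" and ?b = "\<lambda>n. of_real (fps_nth g n) * x ^ n"
  have a: "summable (\<lambda>n. norm (?a n))" "?a sums L" and b: "summable (\<lambda>n. norm (?b n))" "?b sums M"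
    using f g by (simp_all add: has_value_def)
  have c: "of_real (fps_nth (f * g) n) * x ^ n = (\<Sum>i\<le>n. ?a i * ?b (n - i))" for n
  proof -
    have e: "?a i * ?b (n - i) = of_real (fps_nth f i) * of_real (fps_nth g (n - i)) * x ^ n" if "i \<le> n" for i
    proof -
      have "x ^ n = x ^ i * x ^ (n - i)" using that by (simp flip: power_add)
      thus ?thesis by simp
    qed
    show ?thesis unfolding fps_mult_nth atLeast0AtMost of_real_sum of_real_mult sum_distrib_right
      by (rule sum.cong[OF refl], rule e[symmetric]) simp
  qed
  have "summable (\<lambda>n. \<Sum>i\<le>n. norm (?a i) * norm (?b (n - i)))"
    by (rule summable_Cauchy_product) (use a b in simp_all)
  moreover have "norm (\<Sum>i\<le>n. ?a i * ?b (n - i)) \<le> (\<Sum>i\<le>n. norm (?a i) * norm (?b (n - i)))" for n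
    by (rule sum_norm_le) (simp add: norm_mult)
  ultimately have "summable (\<lambda>n. norm (\<Sum>i\<le>n. ?a i * ?b (n - i)))"
    by (rule_tac summable_comparison_test'[where N=0]) auto
  moreover have "(\<lambda>n. \<Sum>i\<le>n. ?a i * ?b (n - i)) sums (L * M)"
    using Cauchy_product_sums[OF a(1) b(1)] sums_unique[OF a(2)] sums_unique[OF b(2)] by simp
  ultimately show ?thesis unfolding has_value_def c by blast
qed

lemma has_value_unique: "has_value f x L \<Longrightarrow> has_value f x M \<Longrightarrow> L = M"
  unfolding has_value_def using sums_unique2 by blast

lemma has_value_monom: "has_value (fps_const a * fps_X ^ k) x (of_real a * x ^ k)"
proof -
  have e: "of_real (fps_nth (fps_const a * fps_X ^ k) n) * x ^ n = (if n = k then of_real a * x ^ n else 0)" for n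
    by simp
  have s: "(\<lambda>n. if n = k then of_real a * x ^ n else 0) sums (of_real a * x ^ k)" by (rule sums_single)
  have "summable (\<lambda>n. norm (if n = k then of_real a * x ^ n else 0))"
    by (rule summable_finite[of "{k}"]) auto
  thus ?thesis unfolding has_value_def e using s by blast
qed

lemma has_value_const: "has_value (fps_const a) x (of_real a)"
  using has_value_monom[of a 0 x] by simp

lemma has_value_1: "has_value 1 x 1"
  using has_value_const[of 1 x] by simp

lemma has_value_add: "has_value f x L \<Longrightarrow> has_value g x M \<Longrightarrow> has_value (f + g) x (L + M)"
  unfolding has_value_def
proof (elim conjE, intro conjI)
  assume a: "summable (\<lambda>n. norm (of_real (fps_nth f n) * x ^ n))" "summable (\<lambda>n. norm (of_real (fps_nth g n) * x ^ n))"
  show "summable (\<lambda>n. norm (of_real (fps_nth (f + g) n) * x ^ n))"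
    by (rule summable_comparison_test'[OF summable_add[OF a], where N=0]) (simp add: distrib_right norm_triangle_ineq)
qed (simp add: distrib_right sums_add)

lemma has_value_diff: "has_value f x L \<Longrightarrow> has_value g x M \<Longrightarrow> has_value (f - g) x (L - M)"
  using has_value_add[of f x L "fps_const (- 1) * g" "- M"] has_value_mult[OF has_value_const[of "- 1" x], of g M]
  by (simp add: fps_const_neg[symmetric] del: fps_const_neg)

lemma has_value_power: "has_value f x L \<Longrightarrow> has_value (f ^ k) x (L ^ k)"
  by (induction k) (simp_all add: has_value_1 has_value_mult)

lemma has_value_one_minus: "has_value (1 - fps_X ^ k) x (1 - x ^ k)"
  using has_value_diff[OF has_value_1 has_value_monom[of 1 k x]] by simp

lemma inverse_one_minus_X_power:
  assumes "0 < k"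
  shows "inverse (1 - fps_X ^ k :: real fps) = Abs_fps (\<lambda>n. if k dvd n then 1 else 0)"
proof (rule fps_inverse_unique)
  let ?g = "Abs_fps (\<lambda>n. if k dvd n then 1 else 0) :: real fps"
  have "fps_nth (?g * (1 - fps_X ^ k)) n = fps_nth 1 n" for n
  proof (cases "n < k")
    case True
    hence "k dvd n \<longleftrightarrow> n = 0" using assms by (auto dest: dvd_imp_le)
    thus ?thesis using True by (simp add: right_diff_distrib fps_X_power_mult_right_nth)
  next
    case False
    hence "k dvd n - k \<longleftrightarrow> k dvd n" by (simp add: dvd_minus_self)
    moreover have "n \<noteq> 0" using False assms by simp
    ultimately show ?thesis using False by (simp add: right_diff_distrib fps_X_power_mult_right_nth)
  qed
  hence "?g * (1 - fps_X ^ k) = 1" by (simp add: fps_eq_iff)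
  thus "(1 - fps_X ^ k) * ?g = 1" by (simp only: mult.commute)
qed

lemma has_value_inverse:
  assumes x: "norm x < 1" and k: "0 < k"
  shows "has_value (inverse (1 - fps_X ^ k)) x (1 / (1 - x ^ k))"
proof -
  let ?f = "inverse (1 - fps_X ^ k) :: real fps"
  have xk: "x ^ k \<noteq> 1" using x k by (metis norm_one norm_power power_less_one_iff norm_ge_zero less_irrefl)
  have s: "summable (\<lambda>n. norm (of_real (fps_nth ?f n) * x ^ n))"
    by (rule summable_comparison_test'[OF summable_geometric[of "norm x"], where N=0])
      (use x in \<open>simp_all add: inverse_one_minus_X_power[OF k] norm_mult norm_power\<close>)
  define L where "L = suminf (\<lambda>n. of_real (fps_nth ?f n) * x ^ n)"
  have L: "has_value ?f x L" unfolding has_value_def L_def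
    using s summable_norm_cancel[OF s] by (simp add: summable_sums)
  have "fps_nth (1 - fps_X ^ k :: real fps) 0 \<noteq> 0" using k by simp
  hence "?f * (1 - fps_X ^ k) = 1" by (rule inverse_mult_eq_1)
  hence "L * (1 - x ^ k) = 1"
    using has_value_mult[OF L has_value_one_minus[of k]] has_value_1 has_value_unique by metis
  hence "L = 1 / (1 - x ^ k)" using xk by (simp add: eq_divide_eq)
  thus ?thesis using L by simp
qed

lemma has_value_local_factor:
  fixes A B C D :: "'k::{field, finite}"
  assumes x: "norm x < 1"
  shows "has_value (local_factor A B C D) x (lval x A B C D)"
proof -
  have i: "has_value (inverse (1 - fps_X ^ 2)) x (1 / (1 - x\<^sup>2))" "has_value (inverse (1 - fps_X ^ 3)) x (1 / (1 - x ^ 3))"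
    "has_value (inverse (1 - fps_X)) x (1 / (1 - x))"
    using has_value_inverse[OF x, of 2] has_value_inverse[OF x, of 3] has_value_inverse[OF x, of 1] by simp_all
  have o: "has_value (1 - fps_X) x (1 - x)" using has_value_one_minus[of 1 x] by simp
  have h: "has_value (1 + of_nat CARD('k) * fps_X) x (1 + of_nat CARD('k) * x)"
    using has_value_add[OF has_value_1 has_value_monom[of "of_nat CARD('k)" 1 x]] by (simp add: fps_of_nat)
  have h': "has_value (if P then 1 + of_nat CARD('k) * fps_X else 1) x (if P then 1 + of_nat CARD('k) * x else 1)" for P
    using h has_value_1 by simp
  have e: "has_value (if P then inverse (1 - fps_X ^ 3) else if P' then inverse (1 - fps_X) * inverse (1 - fps_X ^ 2) else inverse (1 - fps_X) ^ m) x
    (if P then 1 / (1 - x ^ 3) else if P' then 1 / (1 - x) * (1 / (1 - x\<^sup>2)) else (1 / (1 - x)) ^ m)" for P P' m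
    using i has_value_mult[OF i(3) i(1)] has_value_power[OF i(3), of m] by presburger
  show ?thesis unfolding local_factor_def lval_def cubic_euler_def
    by (intro has_value_mult o h' e)
qed

text \<open>The identity theorem for power series.\<close>

lemma has_value_zero_imp:
  assumes "\<And>x. norm x < 1 \<Longrightarrow> has_value f x 0" shows "f = 0"
proof -
  define F where "F = Abs_fps (\<lambda>n. complex_of_real (fps_nth f n))"
  have s: "(\<lambda>n. fps_nth F n * x ^ n) sums 0" if "norm x < 1" for x
    using assms[OF that] by (simp add: has_value_def F_def)
  have "F = 0"
  proof (rule eval_fps_eqD)
    have "norm (1 / 2 :: complex) \<le> fps_conv_radius F" unfolding fps_conv_radius_def
      by (rule conv_radius_geI) (use s[of "1 / 2"] in \<open>simp add: sums_iff\<close>)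
    moreover have "(0 :: ereal) < norm (1 / 2 :: complex)" by simp
    ultimately show "fps_conv_radius F > 0" by (rule order.strict_trans2[rotated])
    show "fps_conv_radius (0 :: complex fps) > 0" by simp
    have "eventually (\<lambda>x. x \<in> ball (0 :: complex) 1) (nhds 0)" by (rule eventually_nhds_in_open) simp_all
    thus "eventually (\<lambda>x. eval_fps F x = eval_fps 0 x) (nhds 0)"
      by eventually_elim (use s in \<open>simp add: eval_fps_def sums_iff\<close>)
  qed
  thus ?thesis by (simp add: F_def fps_eq_iff)
qed

section \<open>Summability\<close>

definition mass :: "'q::prime_card weight_function \<Rightarrow> real" where
  "mass g = (\<Sum>\<beta>\<in>UNIV. \<Sum>\<gamma>\<in>UNIV. \<Sum>\<delta>\<in>UNIV. norm (g \<beta> \<gamma> \<delta>))"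

lemma mass_nonneg: "0 \<le> mass g" by (simp add: mass_def sum_nonneg)

lemma norm_sift_le: "(\<And>s. norm (g s) \<le> b) \<Longrightarrow> 0 \<le> b \<Longrightarrow> norm (sift m g x) \<le> b"
  by (simp add: sift_def)

lemma norm_sums_le_mass:
  fixes g :: "'q::prime_card weight_function"
  shows "norm (\<Sum>\<beta>\<in>UNIV. \<Sum>\<gamma>\<in>UNIV. g \<beta> \<gamma> \<delta>) \<le> mass g" "norm (\<Sum>\<gamma>\<in>UNIV. \<Sum>\<delta>\<in>UNIV. g \<beta> \<gamma> \<delta>) \<le> mass g"
proof -
  have "norm (\<Sum>\<beta>\<in>UNIV. \<Sum>\<gamma>\<in>UNIV. g \<beta> \<gamma> \<delta>) \<le> (\<Sum>\<beta>\<in>UNIV. \<Sum>\<gamma>\<in>UNIV. norm (g \<beta> \<gamma> \<delta>))"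
    by (intro sum_norm_le order_refl)
  also have "\<dots> \<le> mass g" unfolding mass_def by (intro sum_mono member_le_sum) simp_all
  finally show "norm (\<Sum>\<beta>\<in>UNIV. \<Sum>\<gamma>\<in>UNIV. g \<beta> \<gamma> \<delta>) \<le> mass g" .
  have "norm (\<Sum>\<gamma>\<in>UNIV. \<Sum>\<delta>\<in>UNIV. g \<beta> \<gamma> \<delta>) \<le> (\<Sum>\<gamma>\<in>UNIV. \<Sum>\<delta>\<in>UNIV. norm (g \<beta> \<gamma> \<delta>))"
    by (intro sum_norm_le order_refl)
  also have "\<dots> \<le> mass g" unfolding mass_def by (rule member_le_sum) (simp_all add: sum_nonneg)
  finally show "norm (\<Sum>\<gamma>\<in>UNIV. \<Sum>\<delta>\<in>UNIV. g \<beta> \<gamma> \<delta>) \<le> mass g" .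
qed

lemma norm_usum_le:
  fixes f :: "'q::prime_card padic_int \<Rightarrow> complex"
  assumes "\<And>\<epsilon>. \<not> \<varpi> dvd \<epsilon> \<Longrightarrow> norm (f \<epsilon>) \<le> b" "0 \<le> b"
  shows "norm (usum N f) \<le> real CARD('q) ^ N * b"
proof -
  have "norm (usum N f) \<le> (\<Sum>k<CARD('q) ^ N. b)" unfolding usum_def psum_def
    by (rule sum_norm_le) (simp add: assms)
  thus ?thesis by simp
qed

lemma half_powers_sum: "(\<Sum>u<N. (1 / 2 :: real) ^ (N - u)) = 1 - (1 / 2) ^ N"
proof (induction N)
  case (Suc N)
  show ?case unfolding sum.lessThan_Suc_shift using Suc by simp
qed simp

text \<open>The residue \<open>\<tau> = 0\<close> contributes at most the mass of \<open>g\<close>, and the \<open>q\<^sup>d\<close> residues of valuation \<open>i + n - d\<close>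
  contribute at most its product with \<open>q\<^sup>-\<^sup>2\<^sup>d\<close> each.\<close>

lemma norm_weight_le:
  fixes c :: "'q::prime_card padic_int"
  shows "norm (weight c i n g) \<le> 2 * mass g"
proof -
  define q where "q = real CARD('q)"
  have q2: "2 \<le> q" using CARD_gt_1[where 'q='q] by (simp add: q_def)
  have q1: "1 \<le> q ^ k" for k using q2 by (simp add: one_le_power)
  have 0: "norm (frame_weight c i n g 0) \<le> mass g"
  proof -
    have "norm (frame_weight c i n g 0) \<le> mass g / q ^ 2"
      unfolding frame_weight_0 norm_divide norm_power norm_of_nat q_def
      by (intro divide_right_mono norm_sift_le norm_sums_le_mass mass_nonneg) simp
    also have "\<dots> \<le> mass g" using q1[of 2] mass_nonneg[of g] by (simp add: divide_le_eq mult_le_cancel_left1)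
    finally show ?thesis .
  qed
  have u: "norm (usum (i + n - u) (\<lambda>\<epsilon>. frame_weight c i n g (\<varpi> ^ u * \<epsilon>))) \<le> mass g * (1 / 2) ^ (i + n - u)"
    if u: "u < i + n" for u
  proof -
    define d where "d = i + n - u"
    have "norm (usum d (\<lambda>\<epsilon>. frame_weight c i n g (\<varpi> ^ u * \<epsilon>))) \<le> q ^ d * (mass g / q ^ (2 * d))"
      unfolding q_def
    proof (rule norm_usum_le)
      fix \<epsilon> :: "'q padic_int" assume \<epsilon>: "\<not> \<varpi> dvd \<epsilon>"
      have "norm (frame_weight c i n g (\<varpi> ^ u * \<epsilon>)) \<le> mass g / q ^ (2 * d + 2)"
        unfolding frame_weight_nonzero[OF \<epsilon> u] norm_divide norm_power norm_of_nat q_def d_def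
        by (intro divide_right_mono norm_sift_le norm_sums_le_mass mass_nonneg) simp
      also have "\<dots> \<le> mass g / q ^ (2 * d)"
        using q2 by (intro divide_left_mono power_increasing mult_pos_pos zero_less_power mass_nonneg) simp_all
      finally show "norm (frame_weight c i n g (\<varpi> ^ u * \<epsilon>)) \<le> mass g / real CARD('q) ^ (2 * d)" by (simp add: q_def)
    qed (simp add: mass_nonneg)
    also have "\<dots> = mass g * (1 / q) ^ d" using q2 unfolding mult_2 power_add by (simp add: power_one_over)
    also have "\<dots> \<le> mass g * (1 / 2) ^ d"
      using q2 by (intro mult_left_mono power_mono mass_nonneg) (simp_all add: field_simps)
    finally show ?thesis unfolding d_def .
  qed
  have "norm (weight c i n g) \<le> norm (frame_weight c i n g 0) + (\<Sum>u<i + n. norm (usum (i + n - u) (\<lambda>\<epsilon>. frame_weight c i n g (\<varpi> ^ u * \<epsilon>))))"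
    unfolding weight_def psum_valuation by (rule order_trans[OF norm_triangle_ineq]) (simp add: sum_norm_le)
  also have "\<dots> \<le> mass g + (\<Sum>u<i + n. mass g * (1 / 2) ^ (i + n - u))"
    using u by (intro add_mono 0 sum_mono) simp
  also have "\<dots> = mass g + mass g * (1 - (1 / 2) ^ (i + n))" by (simp add: half_powers_sum flip: sum_distrib_left)
  also have "\<dots> \<le> 2 * mass g" using mass_nonneg[of g] by (simp add: algebra_simps)
  finally show ?thesis .
qed

lemma haar_sums:
  fixes f :: "nat \<Rightarrow> 'q::prime_card padic_int \<Rightarrow> complex"
  assumes "\<And>v. locconst N (f v)" "locconst N g" "\<And>x. (\<lambda>v. f v x) sums g x"
  shows "(\<lambda>v. haar (f v)) sums haar g"
  unfolding haar_eq[OF assms(1)] haar_eq[OF assms(2)] psum_def by (intro sums_divide sums_sum assms(3))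

lemma weight_sums:
  fixes c :: "'q::prime_card padic_int"
  assumes "\<And>\<beta> \<gamma> \<delta>. (\<lambda>v. f v \<beta> \<gamma> \<delta>) sums g \<beta> \<gamma> \<delta>"
  shows "(\<lambda>v. weight c i n (f v)) sums weight c i n g"
proof -
  have s: "(\<lambda>v. sift m (f v \<beta> \<gamma>) w) sums sift m (g \<beta> \<gamma>) w" for m \<beta> \<gamma> w
    using assms by (simp add: sift_def)
  have "(\<lambda>v. frame_weight c i n (f v) \<tau>) sums frame_weight c i n g \<tau>" for \<tau>
    unfolding frame_weight_def
    by (rule haar_sums[where N="Suc (3 * i + 2 * n)"], (rule frame_locconst(3), simp)+,
        rule haar_sums[where N="Suc (3 * i + 2 * n)"], (rule frame_locconst(2), simp)+, rule s)
  thus ?thesis unfolding weight_def psum_def by (intro sums_sum)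
qed

lemma weight_cmult:
  fixes c :: "'q::prime_card padic_int"
  shows "weight c i n (\<lambda>\<beta> \<gamma> \<delta>. z * g \<beta> \<gamma> \<delta>) = z * weight c i n g"
proof -
  have M: "3 * i + 2 * n < Suc (3 * i + 2 * n)" by simp
  have s: "sift m (\<lambda>\<delta>. z * g \<beta> \<gamma> \<delta>) w = z * sift m (g \<beta> \<gamma>) w" for m \<beta> \<gamma> w by (simp add: sift_def)
  have "frame_weight c i n (\<lambda>\<beta> \<gamma> \<delta>. z * g \<beta> \<gamma> \<delta>) \<tau> = z * frame_weight c i n g \<tau>" for \<tau>
    unfolding frame_weight_def s haar_cmult[OF frame_locconst(2)[OF M]] haar_cmult[OF frame_locconst(3)[OF M]] ..
  thus ?thesis by (simp add: weight_def psum_def sum_distrib_left)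
qed

lemma summable_on_times:
  fixes f :: "'a \<Rightarrow> real" and h :: "'b \<Rightarrow> real"
  assumes f: "f summable_on UNIV" "\<And>a. 0 \<le> f a" and h: "h summable_on UNIV" "\<And>b. 0 \<le> h b"
  shows "(\<lambda>(a, b). f a * h b) summable_on UNIV"
proof -
  have "(\<lambda>(a, b). f a * h b) summable_on (SIGMA a:UNIV. UNIV)"
  proof (rule summable_on_SigmaI)
    show "((\<lambda>b. case (a, b) of (a, b) \<Rightarrow> f a * h b) has_sum f a * infsum h UNIV) UNIV" for a
      unfolding prod.case by (intro has_sum_cmult_right has_sum_infsum h(1))
    show "(\<lambda>a. f a * infsum h UNIV) summable_on UNIV" by (intro summable_on_cmult_left f(1))
  qed (simp add: f(2) h(2))
  thus ?thesis by simp
qed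

lemma summable_on_nat:
  fixes f :: "nat \<Rightarrow> real"
  assumes "summable f" "\<And>n. 0 \<le> f n" shows "f summable_on UNIV"
  using norm_summable_imp_summable_on[of f] assms by simp

lemma has_sum_sums_unique:
  fixes f :: "nat \<Rightarrow> complex"
  assumes "f summable_on UNIV" "f sums S" shows "(f has_sum S) UNIV"
  using has_sum_imp_sums[OF has_sum_infsum[OF assms(1)]] assms sums_unique2 has_sum_infsum by metis

section \<open>The series\<close>

context euler_point
begin

text \<open>The right hand side of the theorem for valuation \<open>e\<close>.\<close>

definition limit :: "nat \<Rightarrow> complex" where
  "limit e = numer Q x * (1 - x ^ (e + 1)) * (1 - x ^ (e + 2)) / ((1 - x) * (1 - x\<^sup>2)\<^sup>2 * (1 - x ^ 3))"

text \<open>The closed form satisfies the recursion that cubes in \<open>c\<close> impose: the row \<open>0\<close> is what is left of it after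
  removing the rows that are inherited from \<open>c / q\<^sup>3\<close>.\<close>

lemma level0_total:
  assumes e: "0 < e"
  shows "(\<Sum>u\<le>e. x ^ (2 * u) * pick e u (numer Q x / ((1 - x) * (1 - x\<^sup>2))) (numer Q x / (1 - x)\<^sup>2)) =
    limit e - (if 3 \<le> e then x ^ 6 * limit (e - 3) else 0)"
proof -
  define N where "N = numer Q x"
  define d where "d = (1 - x) * (1 - x\<^sup>2)\<^sup>2 * (1 - x ^ 3)"
  define U where "U = N / ((1 - x) * (1 - x\<^sup>2))"
  define Z where "Z = N / (1 - x)\<^sup>2"
  have U: "U = N * ((1 - x\<^sup>2) * (1 - x ^ 3)) / d"
    unfolding U_def d_def using nz neq by (simp add: power2_eq_square)
  have d': "d = ((1 - x)\<^sup>2 * (1 - x\<^sup>2)) * ((1 - x\<^sup>2) * t)" unfolding d_def x3_factor by (simp only: power2_eq_square mult_ac)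
  have G: "(\<Sum>u<k. x ^ (2 * Suc u) * Z) = N * (x\<^sup>2 * (1 - x ^ (2 * k)) * (1 - x\<^sup>2) * t) / d" for k
  proof -
    have "(1 - x\<^sup>2) * (\<Sum>u<k. x ^ (2 * Suc u)) = x\<^sup>2 * (1 - x ^ (2 * k))"
    proof (induction k)
      case (Suc k)
      have "x ^ (2 * Suc k) = x\<^sup>2 * x ^ (2 * k)" by (simp add: power2_eq_square)
      thus ?case unfolding sum.lessThan_Suc distrib_left Suc.IH by (simp only:) (simp add: algebra_simps)
    qed simp
    hence S: "(\<Sum>u<k. x ^ (2 * Suc u)) = x\<^sup>2 * (1 - x ^ (2 * k)) / (1 - x\<^sup>2)" using nz(2) by (simp add: eq_divide_eq mult.commute)
    have "(\<Sum>u<k. x ^ (2 * Suc u) * Z) = N * (x\<^sup>2 * (1 - x ^ (2 * k))) / ((1 - x)\<^sup>2 * (1 - x\<^sup>2))"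
      unfolding sum_distrib_right[symmetric] S Z_def by (simp add: mult_ac)
    also have "\<dots> = N * (x\<^sup>2 * (1 - x ^ (2 * k))) * ((1 - x\<^sup>2) * t) / d"
      unfolding d' using nz by simp
    finally show ?thesis by (simp only: mult.assoc)
  qed
  have lim: "limit e = N * ((1 - x ^ (e + 1)) * (1 - x ^ (e + 2))) / d" for e
    by (simp add: limit_def N_def d_def)
  let ?f = "\<lambda>u. x ^ (2 * u) * pick e u U Z"
  have split: "N * (A - x ^ 6 * B) / d = N * A / d - x ^ 6 * (N * B / d)" for A B
    by (simp add: right_diff_distrib diff_divide_distrib mult.left_commute)
  have "e = 2 * ((e - 1) div 2) + 1 \<or> e = 2 * ((e - 1) div 2) + 2" using e by presburger
  then obtain k where "e = 2 * k + 1 \<or> e = 2 * k + 2" by blast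
  then consider (odd) "e = 2 * k + 1" | (even) "e = 2 * k + 2" by blast
  hence "(\<Sum>u\<le>e. ?f u) = limit e - (if 3 \<le> e then x ^ 6 * limit (e - 3) else 0)"
  proof cases
    case odd
    have "(\<Sum>u\<le>e. ?f u) = (\<Sum>u<Suc k. ?f u)"
      by (rule sum.mono_neutral_right) (auto simp: odd pick_def)
    also have "\<dots> = U + (\<Sum>u<k. x ^ (2 * Suc u) * Z)"
      unfolding sum.lessThan_Suc_shift by (auto simp: odd pick_def intro!: sum.cong)
    also have "\<dots> = N * ((1 - x\<^sup>2) * (1 - x ^ 3) + x\<^sup>2 * (1 - x ^ (2 * k)) * (1 - x\<^sup>2) * t) / d"
      unfolding G U by (simp add: distrib_left add_divide_distrib)
    also have "\<dots> = limit e - (if 3 \<le> e then x ^ 6 * limit (e - 3) else 0)"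
    proof (cases k)
      case 0
      show ?thesis unfolding lim odd 0 by (simp add: numeral_eq_Suc)
    next
      case (Suc j)
      define r where "r = x ^ (2 * j)"
      have p: "x ^ (2 * k) = x\<^sup>2 * r" "x ^ (e + 1) = x ^ 4 * r" "x ^ (e + 2) = x ^ 5 * r" "x ^ (e - 3 + 1) = x * r" "x ^ (e - 3 + 2) = x\<^sup>2 * r"
        by (simp_all add: r_def odd Suc power_add numeral_eq_Suc)
      have id: "(1 - x\<^sup>2) * (1 - x ^ 3) + x\<^sup>2 * (1 - x\<^sup>2 * r) * (1 - x\<^sup>2) * t =
        (1 - x ^ 4 * r) * (1 - x ^ 5 * r) - x ^ 6 * ((1 - x * r) * (1 - x\<^sup>2 * r))"
        unfolding t_def by (simp add: eval_nat_numeral algebra_simps)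
      have "3 \<le> e" using odd Suc by simp
      thus ?thesis unfolding lim p id split by simp
    qed
    finally show ?thesis .
  next
    case even
    have "(\<Sum>u\<le>e. ?f u) = (\<Sum>u<Suc (Suc k). ?f u)"
      by (rule sum.mono_neutral_right) (auto simp: even pick_def)
    also have "\<dots> = (\<Sum>u<Suc k. ?f u) + x ^ (2 * Suc k) * U"
      unfolding sum.lessThan_Suc[of _ "Suc k"] by (simp add: even pick_def)
    also have "(\<Sum>u<Suc k. ?f u) = U + (\<Sum>u<k. x ^ (2 * Suc u) * Z)"
      unfolding sum.lessThan_Suc_shift by (auto simp: even pick_def intro!: sum.cong)
    also have "U + (\<Sum>u<k. x ^ (2 * Suc u) * Z) + x ^ (2 * Suc k) * U =
      N * ((1 - x\<^sup>2) * (1 - x ^ 3) * (1 + x ^ (2 * Suc k)) + x\<^sup>2 * (1 - x ^ (2 * k)) * (1 - x\<^sup>2) * t) / d"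
      unfolding G U by (simp add: distrib_left add_divide_distrib mult_ac)
    also have "\<dots> = limit e - (if 3 \<le> e then x ^ 6 * limit (e - 3) else 0)"
    proof (cases k)
      case 0
      have id: "(1 - x\<^sup>2) * (1 - x ^ 3) * (1 + x\<^sup>2) = (1 - x ^ 3) * (1 - x ^ 4)"
        by (simp add: eval_nat_numeral algebra_simps)
      have p: "x ^ (2 * Suc k) = x\<^sup>2" "x ^ (2 * k) = 1" "x ^ (e + 1) = x ^ 3" "x ^ (e + 2) = x ^ 4"
        by (simp_all add: even 0 power3_eq_cube power4_eq_xxxx mult.assoc)
      have "\<not> 3 \<le> e" by (simp add: even 0)
      thus ?thesis unfolding lim p id by simp
    next
      case (Suc j)
      define r where "r = x ^ (2 * j)"
      have p: "x ^ (2 * k) = x\<^sup>2 * r" "x ^ (2 * Suc k) = x ^ 4 * r" "x ^ (e + 1) = x ^ 5 * r" "x ^ (e + 2) = x ^ 6 * r"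
        "x ^ (e - 3 + 1) = x\<^sup>2 * r" "x ^ (e - 3 + 2) = x ^ 3 * r"
        by (simp_all add: r_def even Suc power_add numeral_eq_Suc)
      have id: "(1 - x\<^sup>2) * (1 - x ^ 3) * (1 + x ^ 4 * r) + x\<^sup>2 * (1 - x\<^sup>2 * r) * (1 - x\<^sup>2) * t =
        (1 - x ^ 5 * r) * (1 - x ^ 6 * r) - x ^ 6 * ((1 - x\<^sup>2 * r) * (1 - x ^ 3 * r))"
        unfolding t_def by (simp add: eval_nat_numeral algebra_simps)
      have "3 \<le> e" using even Suc by simp
      thus ?thesis unfolding lim p id split by simp
    qed
    finally show ?thesis .
  qed
  thus ?thesis unfolding U_def Z_def N_def .
qed

lemma unit_total:
  fixes c :: "'q padic_int"
  assumes c: "\<not> \<varpi> dvd c"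
  defines "a \<equiv> \<lambda>i. x ^ (6 * i) * cube_density c i / Q ^ i"
  shows "(\<lambda>i. (a i - a (Suc i)) / \<Delta> + (if i = 0 then (numer Q x - (1 - 1 / Q)) / \<Delta> else 0)) sums limit 0"
proof -
  have n: "norm (x ^ 6 / Q) < 1" by (rule norm_div_Q) (rule norm_pow, simp)
  have "a \<longlonglongrightarrow> 0"
  proof (rule Lim_null_comparison)
    show "(\<lambda>i. norm (x ^ 6 / Q) ^ i) \<longlonglongrightarrow> 0" using n by (intro LIMSEQ_power_zero) simp
    have "norm (a i) \<le> norm (x ^ 6 / Q) ^ i" for i
    proof -
      have "a i = (x ^ 6 / Q) ^ i * cube_density c i" by (simp add: a_def power_mult power_divide)
      thus ?thesis using mult_left_mono[OF norm_cube_density[of c i], of "norm (x ^ 6 / Q) ^ i"]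
        by (simp add: norm_mult norm_power)
    qed
    thus "\<forall>\<^sub>F i in sequentially. norm (a i) \<le> norm (x ^ 6 / Q) ^ i" by simp
  qed
  hence "(\<lambda>i. a i - a (Suc i)) sums (a 0 - 0)" by (rule telescope_sums')
  moreover have "(\<lambda>i. if i = 0 then (numer Q x - (1 - 1 / Q)) / \<Delta> else 0) sums ((numer Q x - (1 - 1 / Q)) / \<Delta>)"
    by (rule sums_single)
  ultimately have "(\<lambda>i. (a i - a (Suc i)) / \<Delta> + (if i = 0 then (numer Q x - (1 - 1 / Q)) / \<Delta> else 0)) sums
    ((a 0 - 0) / \<Delta> + (numer Q x - (1 - 1 / Q)) / \<Delta>)" by (intro sums_add sums_divide)
  moreover have "a 0 = 1 - 1 / Q" by (simp add: a_def cube_density_0 Q_def)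
  moreover have "(1 - 1 / Q - 0) / \<Delta> + (numer Q x - (1 - 1 / Q)) / \<Delta> = numer Q x / \<Delta>"
    by (simp flip: add_divide_distrib)
  moreover have "numer Q x / \<Delta> = limit 0"
    using nz neq by (simp add: limit_def \<Delta>_def power2_eq_square)
  ultimately show ?thesis by simp
qed

text \<open>Induction on the valuation of \<open>c\<close> in steps of three, down to a valuation less than three.\<close>

lemma rows_total:
  fixes c :: "'q padic_int"
  assumes "c \<noteq> 0"
  shows "\<exists>r. (\<forall>i. (\<lambda>n. x ^ (6 * i + 2 * n) * weight c i n (lw n)) sums r i) \<and> r sums limit (padic_val c)"
  using assms
proof (induction "padic_val c" arbitrary: c rule: less_induct)
  case less
  show ?case
  proof (cases "\<varpi> dvd c")
    case False
    have "padic_val c = 0" using padic_val_eq[OF False, of 0] by simp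
    show ?thesis unfolding \<open>padic_val c = 0\<close>
      by (intro exI conjI allI, rule unit_row_sums[OF False], rule unit_total[OF False])
  next
    case True
    define e where "e = padic_val c"
    have d: "\<varpi> ^ k dvd c \<longleftrightarrow> k \<le> e" for k unfolding e_def by (rule unif_power_dvd_padic_val[OF less.prems])
    have e0: "0 < e" using d[of 1] True by simp
    define L where "L = limit e - (if 3 \<le> e then x ^ 6 * limit (e - 3) else 0)"
    have L: "(\<lambda>n. x ^ (6 * 0 + 2 * n) * weight c 0 n (lw n)) sums L"
      using level0_sums[OF less.prems True] unfolding e_def[symmetric] level0_total[OF e0] L_def by simp
    obtain r' where r': "\<And>i. (\<lambda>n. x ^ (6 * Suc i + 2 * n) * weight c (Suc i) n (lw n)) sums r' i"
        "r' sums (if 3 \<le> e then x ^ 6 * limit (e - 3) else 0)"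
    proof (cases "3 \<le> e")
      case e3: True
      hence "\<varpi> ^ 3 dvd c" unfolding d .
      then obtain c' where c': "c = \<varpi> ^ 3 * c'" by (elim dvdE)
      have c'0: "c' \<noteq> 0" using c' less.prems by auto
      then obtain u where u: "c' = \<varpi> ^ padic_val c' * u" "\<not> \<varpi> dvd u" by (rule padic_factor)
      have "c = \<varpi> ^ (3 + padic_val c') * u" unfolding c' power_add mult.assoc u(1)[symmetric] ..
      hence v: "e = 3 + padic_val c'" unfolding e_def using padic_val_eq[OF u(2)] by metis
      have "padic_val c' < padic_val c" using v e_def by simp
      from less.hyps[OF this c'0] obtain r where
        r: "\<And>i. (\<lambda>n. x ^ (6 * i + 2 * n) * weight c' i n (lw n)) sums r i" "r sums limit (padic_val c')" by blast
      have w: "weight c (Suc i) n g = weight c' i n g" for i n g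
        unfolding weight_rec[OF True] using e3 d[of 3] by (simp add: c')
      show ?thesis
      proof (rule that)
        show "(\<lambda>n. x ^ (6 * Suc i + 2 * n) * weight c (Suc i) n (lw n)) sums (x ^ 6 * r i)" for i
          unfolding w using sums_mult[OF r(1)[of i], of "x ^ 6"] by (simp add: power_add mult_ac)
        show "(\<lambda>i. x ^ 6 * r i) sums (if 3 \<le> e then x ^ 6 * limit (e - 3) else 0)"
          using sums_mult[OF r(2), of "x ^ 6"] e3 v by simp
      qed
    next
      case False
      hence "weight c (Suc i) n g = 0" for i n g using d[of 3] by (simp add: weight_rec[OF True])
      thus ?thesis using False by (intro that[of "\<lambda>_. 0"]) simp_all
    qed
    define r where "r = (\<lambda>i. case i of 0 \<Rightarrow> L | Suc i \<Rightarrow> r' i)"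
    have "(\<lambda>n. x ^ (6 * i + 2 * n) * weight c i n (lw n)) sums r i" for i
      using L r'(1) by (cases i) (simp_all only: r_def nat.case)
    moreover have "r sums limit e"
    proof -
      have "(\<lambda>i. r (Suc i)) sums (if 3 \<le> e then x ^ 6 * limit (e - 3) else 0)" using r'(2) by (simp add: r_def)
      from sums_Suc[OF this] show ?thesis by (simp add: r_def L_def)
    qed
    ultimately show ?thesis unfolding e_def by blast
  qed
qed

text \<open>The terms of the series before the sums over \<open>i\<close> and \<open>n\<close> are collected according to \<open>r = 3 i + n\<close>.\<close>

definition tm :: "'q padic_int \<Rightarrow> nat \<times> nat \<Rightarrow> nat \<Rightarrow> complex" where
  "tm c = (\<lambda>(i, n) v. x ^ (6 * i + 2 * n) * (x ^ v * weight c i n (euler_coeff n v)))"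

lemma euler_coeff_has_value:
  "has_value (local_factor (if n = 0 then 1 else 0) \<beta> \<gamma> \<delta>) x (lw n \<beta> \<gamma> \<delta>)" for \<beta> :: "'q mod_ring"
  unfolding lw_def by (rule has_value_local_factor[OF norm_x])

lemma tm_sums: "(\<lambda>v. tm c (i, n) v) sums (x ^ (6 * i + 2 * n) * weight c i n (lw n))"
proof -
  have "(\<lambda>v. weight c i n (\<lambda>\<beta> \<gamma> \<delta>. x ^ v * euler_coeff n v \<beta> \<gamma> \<delta>)) sums weight c i n (lw n)"
    by (rule weight_sums) (use euler_coeff_has_value[of n] in \<open>simp add: has_value_def euler_coeff_def mult.commute\<close>)
  thus ?thesis unfolding weight_cmult tm_def prod.case by (rule sums_mult)
qed

lemma tm_summable: "(\<lambda>(p, v). tm c p v) summable_on UNIV"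
proof -
  define b :: "nat \<Rightarrow> real" where
    "b v = mass (euler_coeff 0 v :: 'q weight_function) + mass (euler_coeff 1 v :: 'q weight_function)" for v
  have b: "mass (euler_coeff n v :: 'q weight_function) \<le> b v" for n v
  proof -
    have "euler_coeff n v = (if n = 0 then euler_coeff 0 v else euler_coeff 1 v :: 'q weight_function)"
      by (simp add: euler_coeff_def fun_eq_iff)
    thus ?thesis using mass_nonneg[of "euler_coeff 0 v :: 'q weight_function"] mass_nonneg[of "euler_coeff 1 v :: 'q weight_function"]
      by (simp add: b_def)
  qed
  have b0: "0 \<le> b v" for v by (simp add: b_def mass_nonneg)
  have m: "summable (\<lambda>v. norm x ^ v * mass (euler_coeff n v :: 'q weight_function))" for n
  proof -
    have "summable (\<lambda>v. \<Sum>\<beta>\<in>(UNIV :: 'q mod_ring set). \<Sum>\<gamma>\<in>UNIV. \<Sum>\<delta>\<in>UNIV. norm (complex_of_real (fps_nth (local_factor (if n = 0 then 1 else 0) \<beta> \<gamma> \<delta>) v) * x ^ v))"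
      by (intro summable_sum) (use euler_coeff_has_value[of n] in \<open>simp only: has_value_def\<close>)
    thus ?thesis by (simp add: mass_def euler_coeff_def norm_mult norm_power sum_distrib_left mult.commute)
  qed
  have sb: "(\<lambda>v. norm x ^ v * (2 * b v)) summable_on UNIV"
  proof (rule summable_on_nat)
    show "summable (\<lambda>v. norm x ^ v * (2 * b v))"
      using summable_mult[OF summable_add[OF m[of 0] m[of 1]], of 2] by (simp add: b_def algebra_simps)
  qed (simp add: b0)
  have sx: "(\<lambda>i. norm x ^ (k * i)) summable_on UNIV" if "0 < k" for k :: nat
  proof (rule summable_on_nat)
    have "norm (norm x ^ k) < 1" using norm_pow[OF that] by (simp add: norm_power)
    thus "summable (\<lambda>i. norm x ^ (k * i))" unfolding power_mult by (rule summable_geometric)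
  qed simp
  have s1: "(\<lambda>(i, n). norm x ^ (6 * i) * norm x ^ (2 * n)) summable_on UNIV"
    by (rule summable_on_times[OF sx _ sx]) simp_all
  have s2: "(\<lambda>(p, v). (case p of (i, n) \<Rightarrow> norm x ^ (6 * i) * norm x ^ (2 * n)) * (norm x ^ v * (2 * b v))) summable_on UNIV"
    by (rule summable_on_times[OF s1 _ sb]) (auto simp: b0)
  have "(\<lambda>p. norm (case p of (p, v) \<Rightarrow> tm c p v)) summable_on UNIV"
  proof (rule Infinite_Sum.abs_summable_on_comparison_test'[OF s2])
    fix pv :: "(nat \<times> nat) \<times> nat"
    obtain i n v where pv: "pv = ((i, n), v)" by (metis prod.exhaust)
    have "norm (weight c i n (euler_coeff n v)) \<le> 2 * b v"
      using norm_weight_le[of c i n "euler_coeff n v"] b[of n v] by linarith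
    hence "norm x ^ (6 * i + 2 * n) * (norm x ^ v * norm (weight c i n (euler_coeff n v))) \<le> norm x ^ (6 * i + 2 * n) * (norm x ^ v * (2 * b v))"
      by (intro mult_left_mono) simp_all
    thus "norm (case pv of (p, v) \<Rightarrow> tm c p v) \<le> (case pv of (p, v) \<Rightarrow> (case p of (i, n) \<Rightarrow> norm x ^ (6 * i) * norm x ^ (2 * n)) * (norm x ^ v * (2 * b v)))"
      unfolding pv tm_def prod.case norm_mult norm_power by (simp add: power_add)
  qed
  thus ?thesis by (rule abs_summable_summable)
qed

lemma tm_has_sum:
  assumes c: "c \<noteq> 0"
  shows "((\<lambda>(p, v). tm c p v) has_sum limit (padic_val c)) UNIV"
proof -
  define T where "T = infsum (\<lambda>(p, v). tm c p v) UNIV"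
  have T: "((\<lambda>(p, v). tm c p v) has_sum T) (Sigma UNIV (\<lambda>_. UNIV))"
    using has_sum_infsum[OF tm_summable, of c] by (simp add: T_def)
  define w where "w = (\<lambda>(i, n). x ^ (6 * i + 2 * n) * weight c i n (lw n))"
  have "(tm c p has_sum w p) UNIV" for p
  proof (rule has_sum_sums_unique)
    show "tm c p summable_on UNIV" using summable_on_SigmaD1[of "tm c" UNIV "\<lambda>_. UNIV" p] tm_summable[of c] by simp
    show "tm c p sums w p" using tm_sums[of c] by (cases p) (simp add: w_def)
  qed
  hence w: "(w has_sum T) (Sigma UNIV (\<lambda>_. UNIV))"
    using has_sum_Sigma'[OF T, of w] by simp
  obtain r where r: "\<And>i. (\<lambda>n. w (i, n)) sums r i" "r sums limit (padic_val c)"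
    using rows_total[OF c] by (auto simp: w_def)
  have "((\<lambda>n. w (i, n)) has_sum r i) UNIV" for i
  proof (rule has_sum_sums_unique[OF _ r(1)])
    show "(\<lambda>n. w (i, n)) summable_on UNIV"
      using summable_on_SigmaD1[of "\<lambda>i n. w (i, n)" UNIV "\<lambda>_. UNIV" i] w by (simp add: summable_on_def) blast
  qed
  hence "(r has_sum T) UNIV" using has_sum_Sigma'[OF w, of r] by simp
  hence "r sums T" by (rule has_sum_imp_sums)
  hence "T = limit (padic_val c)" using r(2) sums_unique2 by blast
  thus ?thesis using T by simp
qed

text \<open>The same absolutely convergent family, summed over the fibres of \<open>(i, n) \<mapsto> 3 i + n\<close>.\<close>

lemma kloosterman_has_sum:
  fixes c :: "'q padic_int"
  assumes c: "c \<noteq> 0"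
  shows "((\<lambda>(v, r). of_real (kloosterman_K c v r) / Q ^ (2 * v + 3 * r) * x ^ (v + 2 * r)) has_sum limit (padic_val c)) UNIV"
proof -
  let ?F = "\<lambda>vr :: nat \<times> nat. {(i, n). 3 * i + n = snd vr}"
  have "bij_betw (\<lambda>(vr, p). (p, fst vr)) (Sigma UNIV ?F) (UNIV :: ((nat \<times> nat) \<times> nat) set)"
    by (rule bij_betwI[where g="\<lambda>((i, n), v). ((v, 3 * i + n), (i, n))"]) auto
  from has_sum_reindex_bij_betw[OF this, of "\<lambda>(p, v). tm c p v"]
  have s: "((\<lambda>(vr, p). tm c p (fst vr)) has_sum limit (padic_val c)) (Sigma UNIV ?F)"
    using tm_has_sum[OF c] by (simp add: case_prod_unfold)
  show ?thesis
  proof (rule has_sum_Sigma'[OF s])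
    fix vr :: "nat \<times> nat"
    obtain v r where vr: "vr = (v, r)" by (cases vr)
    have "of_real (kloosterman_K c v r) / Q ^ (2 * v + 3 * r) * x ^ (v + 2 * r) = (\<Sum>p | (case p of (i, n) \<Rightarrow> 3 * i + n = r). tm c p v)"
    proof -
      have "of_real (kloosterman_K c v r) / Q ^ (2 * v + 3 * r) * x ^ (v + 2 * r) = x ^ (v + 2 * r) * (\<Sum>(i, n) | 3 * i + n = r. weight c i n (euler_coeff n v))"
        unfolding kloosterman_K_weight by (simp add: Q_def)
      also have "\<dots> = (\<Sum>p | (case p of (i, n) \<Rightarrow> 3 * i + n = r). tm c p v)"
        unfolding sum_distrib_left by (rule sum.cong) (auto simp: tm_def power_add algebra_simps power_mult[symmetric])
      finally show ?thesis .
    qed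
    thus "((\<lambda>p. case (vr, p) of (vr, p) \<Rightarrow> tm c p (fst vr)) has_sum (case vr of (v, r) \<Rightarrow> of_real (kloosterman_K c v r) / Q ^ (2 * v + 3 * r) * x ^ (v + 2 * r))) (?F vr)"
      unfolding vr prod.case fst_conv snd_conv using has_sum_finite[OF finite_index_pairs[of r], of "\<lambda>p. tm c p v"] by (simp only:)
  qed
qed

lemma kloosterman_D_has_value:
  fixes c :: "'q padic_int"
  assumes c: "c \<noteq> 0"
  shows "has_value (kloosterman_D c) x (limit (padic_val c))"
proof -
  define f where "f = (\<lambda>(v, r). of_real (kloosterman_K c v r) / Q ^ (2 * v + 3 * r) * x ^ (v + 2 * r))"
  have "bij_betw snd (SIGMA k:UNIV. {(v, r). v + 2 * r = k}) (UNIV :: (nat \<times> nat) set)"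
    by (rule bij_betwI[where g="\<lambda>(v, r). (v + 2 * r, (v, r))"]) auto
  from has_sum_reindex_bij_betw[OF this, of f]
  have s: "((\<lambda>z. f (snd z)) has_sum limit (padic_val c)) (SIGMA k:UNIV. {(v, r). v + 2 * r = k})"
    using kloosterman_has_sum[OF c] by (simp add: f_def)
  have "((\<lambda>k. of_real (fps_nth (kloosterman_D c) k) * x ^ k) has_sum limit (padic_val c)) UNIV"
  proof (rule has_sum_Sigma'[OF s])
    fix k :: nat
    have fin: "finite {(v, r). v + 2 * r = k}" by (rule finite_subset[of _ "{..k} \<times> {..k}"]) auto
    have "of_real (fps_nth (kloosterman_D c) k) * x ^ k = sum f {(v, r). v + 2 * r = k}"
      unfolding kloosterman_D_def fps_nth_Abs_fps of_real_sum sum_distrib_right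
      by (rule sum.cong) (auto simp: f_def Q_def)
    thus "((\<lambda>p. f (snd (k, p))) has_sum of_real (fps_nth (kloosterman_D c) k) * x ^ k) {(v, r). v + 2 * r = k}"
      using has_sum_finite[OF fin, of f] by simp
  qed
  moreover from this have "(\<lambda>k. norm (of_real (fps_nth (kloosterman_D c) k) * x ^ k)) summable_on UNIV"
    using summable_on_iff_abs_summable_on_complex has_sum_imp_summable by metis
  ultimately show ?thesis unfolding has_value_def
    using has_sum_imp_sums has_sum_infsum sums_summable by metis
qed

end

theorem theorem1p2:
  fixes c :: "'q::prime_card padic_int" and q e :: nat
  assumes "c \<noteq> 0"
    and "q = CARD('q)"
    and "e = padic_val c"
  shows "kloosterman_D c =
      (1 - fps_X ^ (e + 1)) * (1 - fps_X ^ (e + 2)) *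
      (1 - fps_const (1 / real q) * fps_X) * (1 - fps_const (1 / real q) * fps_X ^ 2) /
      ((1 - fps_X) * (1 - fps_X ^ 2) ^ 2 * (1 - fps_X ^ 3)) \<and>
    (\<forall>z :: complex. Re z > 0 \<longrightarrow>
      (kloosterman_D_term c z has_sum
        (1 - of_nat q powr (- z * (of_nat e + 1))) * (1 - of_nat q powr (- z * (of_nat e + 2))) *
        (1 - of_nat q powr (- z - 1)) * (1 - of_nat q powr (- 2 * z - 1)) /
        ((1 - of_nat q powr (- z)) * (1 - of_nat q powr (- 2 * z)) ^ 2 *
         (1 - of_nat q powr (- 3 * z)))) UNIV)"
proof (intro conjI allI impI)
  let ?num = "(1 - fps_X ^ (e + 1)) * (1 - fps_X ^ (e + 2)) *
      (1 - fps_const (1 / real q) * fps_X) * (1 - fps_const (1 / real q) * fps_X ^ 2) :: real fps"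
  let ?den = "(1 - fps_X) * (1 - fps_X ^ 2) ^ 2 * (1 - fps_X ^ 3) :: real fps"
  have "kloosterman_D c * ?den - ?num = 0"
  proof (rule has_value_zero_imp)
    fix x :: complex assume x: "norm x < 1"
    interpret euler_point x "TYPE('q)" by unfold_locales (rule x)
    have one: "has_value (1 - fps_X) x (1 - x)" using has_value_one_minus[of 1 x] by simp
    have lin: "has_value (1 - fps_const (1 / real q) * fps_X ^ k) x (1 - x ^ k / Q)" for k
      using has_value_diff[OF has_value_1 has_value_monom[of "1 / real q" k x]] by (simp add: Q_def assms(2))
    have lin1: "has_value (1 - fps_const (1 / real q) * fps_X) x (1 - x / Q)" using lin[of 1] by simp
    have "has_value (kloosterman_D c * ?den - ?num) x
      (limit e * ((1 - x) * (1 - x\<^sup>2)\<^sup>2 * (1 - x ^ 3)) - (1 - x ^ (e + 1)) * (1 - x ^ (e + 2)) * (1 - x / Q) * (1 - x\<^sup>2 / Q))"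
      unfolding assms(3)
      by (intro has_value_diff has_value_mult has_value_power has_value_one_minus one lin lin1 kloosterman_D_has_value assms(1))
    moreover have "limit e * ((1 - x) * (1 - x\<^sup>2)\<^sup>2 * (1 - x ^ 3)) = (1 - x ^ (e + 1)) * (1 - x ^ (e + 2)) * (1 - x / Q) * (1 - x\<^sup>2 / Q)"
      using neq by (simp add: limit_def numer_def)
    ultimately show "has_value (kloosterman_D c * ?den - ?num) x 0" by simp
  qed
  hence "?num = kloosterman_D c * ?den" by simp
  moreover have "?den \<noteq> 0"
  proof
    have n1: "fps_nth ?den 0 = 1" by (simp add: fps_mult_nth_0 fps_nth_power_0)
    assume "?den = 0"
    with n1 have "fps_nth 0 0 = (1 :: real)" by (simp only:)
    thus False by simp
  qed
  ultimately show "kloosterman_D c = ?num / ?den" by simp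
next
  fix z :: complex assume z: "Re z > 0"
  define l where "l = Ln (of_nat q)"
  define x where "x = exp (- z * l)"
  have q: "1 < q" using CARD_gt_1[where 'q='q] by (simp add: assms(2))
  have l: "l = of_real (ln (real q))" using q Ln_of_real[of "real q"] by (simp add: l_def)
  have pw: "of_nat q powr w = exp (w * l)" for w :: complex using q by (simp add: powr_def l_def)
  have el: "exp l = of_nat q" unfolding l_def by (rule exp_Ln) (use q in simp)
  have "0 < Re z * ln (real q)" using z q by simp
  hence x: "norm x < 1" by (simp add: x_def l norm_exp_eq_Re)
  interpret euler_point x "TYPE('q)" by unfold_locales (rule x)
  have Q: "Q = exp l" by (simp add: Q_def el assms(2))
  have xp: "x ^ k = exp (of_nat k * (- z * l))" for k unfolding x_def by (rule exp_of_nat_mult[symmetric])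
  have Qp: "Q ^ k = exp (of_nat k * l)" for k unfolding Q by (rule exp_of_nat_mult[symmetric])
  have terms: "kloosterman_D_term c z = (\<lambda>(v, r). of_real (kloosterman_K c v r) / Q ^ (2 * v + 3 * r) * x ^ (v + 2 * r))"
  proof (rule ext, clarify)
    fix v r
    have "of_nat q powr (of_nat v * (z + 2) + of_nat r * (2 * z + 3)) = Q ^ (2 * v + 3 * r) / x ^ (v + 2 * r)"
      unfolding pw xp Qp exp_diff[symmetric] by (rule arg_cong[where f=exp]) (simp add: algebra_simps)
    thus "kloosterman_D_term c z (v, r) = of_real (kloosterman_K c v r) / Q ^ (2 * v + 3 * r) * x ^ (v + 2 * r)"
      by (simp add: kloosterman_D_term_def assms(2))
  qed
  have e1: "of_nat q powr (- z * (of_nat e + 1)) = x ^ (e + 1)" "of_nat q powr (- z * (of_nat e + 2)) = x ^ (e + 2)"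
    "of_nat q powr (- z) = x" "of_nat q powr (- 2 * z) = x\<^sup>2" "of_nat q powr (- 3 * z) = x ^ 3"
    unfolding pw xp by (simp_all add: x_def algebra_simps)
  have e2: "of_nat q powr (- z - 1) = x / Q" "of_nat q powr (- 2 * z - 1) = x\<^sup>2 / Q"
    unfolding pw Q xp[of 2] by (simp_all add: x_def algebra_simps flip: exp_diff)
  show "(kloosterman_D_term c z has_sum
        (1 - of_nat q powr (- z * (of_nat e + 1))) * (1 - of_nat q powr (- z * (of_nat e + 2))) *
        (1 - of_nat q powr (- z - 1)) * (1 - of_nat q powr (- 2 * z - 1)) /
        ((1 - of_nat q powr (- z)) * (1 - of_nat q powr (- 2 * z)) ^ 2 *
         (1 - of_nat q powr (- 3 * z)))) UNIV"
    unfolding e1 e2 terms using kloosterman_has_sum[OF assms(1)]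
    by (simp add: limit_def numer_def assms(3) mult_ac)
qed

end
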